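(* Let $\{u\}_{\nu>0}$ be a sequence of stationary martingale solutions to the stochastically forced Navier–Stokes equations on $\mathbb{T}^3$, and let $$S_0(\ell)=\frac{1}{4\pi}\mathbf{E}\int_{\mathbb{S}^2}\int_{\mathbb{T}^3}|\delta_{\ell\hat n}u|^2\,\delta_{\ell\hat n}u\cdot\hat n\,dx\,dS(\hat n),\qquad S_{||}(\ell)=\frac{1}{4\pi}\mathbf{E}\int_{\mathbb{S}^2}\int_{\mathbb{T}^3}(\delta_{\ell\hat n}u\cdot\hat n)^3\,dx\,dS(\hat n)$$ be the corresponding structure functions. Then, for every fixed $\nu>0$, there holds $$-\frac83\varepsilon\le\liminf_{\ell\to0}\frac{S_0(\ell)}{\ell}\le\limsup_{\ell\to0}\frac{S_0(\ell)}{\ell}\le0 .$$ A similar statement holds also for $S_{||}$.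
   Context: Equations. On the periodic box $\mathbb{T}^3$ consider $\partial_t u+u\cdot\nabla u+\nabla p-\nu\Delta u=\partial_t W$, $\mathrm{div}\,u=0$, with $\nu>0$ and $\partial_tW(t,x)=\sum_{k\ge1}\sigma_ke_k(x)\,d\beta_k(t)$, where $\{\beta_k\}$ are independent one-dimensional Brownian motions, $\{e_k\}$ are orthonormal eigenfunctions of the Stokes operator on $\mathbb{T}^3$, and $\{\sigma_k\}$ are fixed constants (independent of $\nu$) with $\varepsilon:=\frac12\sum_k|\sigma_k|^2<\infty$. $L^2_{\mathrm{div}}$ and $H^1_{\mathrm{div}}$ are the completions of $C^\infty_{\mathrm{div}}$ (smooth divergence-free zero-average vector fields on $\mathbb{T}^3$) in the $L^2$ and $H^1$ norms; $\dot H^\alpha_x$ are homogeneous Sobolev spaces. Stationary martingale solution on $[0,\infty)$: a stochastic basis $(\Omega,(\mathcal F_t)_{t\ge0},\mathbf P,\{\beta_k\})$ with complete right-continuous filtration and an $\mathcal F_t$-progressively measurable process $u:[0,\infty)\times\Omega\to L^2_{\mathrm{div}}$ such that: for each $T\ge0$ the restriction $u|_{[0,T]}$ has sample paths in $C_t(\dot H^\alpha_x)\cap L^\infty_tL^2_{\mathrm{div}}\cap L^2_tH^1_{\mathrm{div}}$ for some $\alpha<0$; the law of the path $u(\cdot+\tau)$ is the same as that of $u(\cdot)$ for each $\tau\ge0$; and for all $t\ge0$, $\varphi\in C^\infty_{\mathrm{div}}$, $\mathbf P$-almost surely $$\int u(t)\cdot\varphi\,dx+\nu\int_0^t\!\!\int\nabla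 u:\nabla\varphi\,dx\,ds+\int_0^t\!\!\int[(u\cdot\nabla)u]\cdot\varphi\,dx\,ds=\int u_0\cdot\varphi\,dx+\sum_k\int_0^t\!\!\int\sigma_ke_k\cdot\varphi\,dx\,d\beta_k(s),$$ with $u_0=u(0)$ and space integrals over $\mathbb T^3$. Standing properties: stationary martingale solutions satisfy the energy inequality $\nu\,\mathbf E\|\nabla u\|_{L^2_x}^2\le\varepsilon$ and $\mathbf E\|u\|^r_{L^\infty(0,T;L^2_x)}<\infty$ for all $r\in[1,\infty)$, $T<\infty$. Notation: $\delta_hu(x)=u(x+h)-u(x)$ for $h\in\mathbb R^3$; $\mathbb S^2$ is the unit sphere and $dS$ its surface measure. Since $u$ is stationary, expectations of functionals of $u$ at a fixed time do not depend on the time, which is suppressed. $S_0,S_{||}$ depend on $\nu$ through $u$. *)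

theory Defs
  imports "HOL-Probability.Probability"
begin

section \<open>Fields on the torus\<close>

text \<open>The torus is \<open>(\<real> / 2\<pi>\<int>)\<^sup>3\<close>. Fields on it are periodic functions on \<^typ>\<open>real^3\<close>, and
  \<open>dx\<close> is the (unnormalised) Lebesgue measure on the fundamental cell \<open>[0, 2\<pi>]\<^sup>3\<close>.\<close>

abbreviation torus :: "(real^3) measure" where
  "torus \<equiv> lebesgue_on (cbox 0 (\<chi> i. 2 * pi))"

definition periodic :: "(real^3 \<Rightarrow> 'b) \<Rightarrow> bool" where
  "periodic f \<longleftrightarrow> (\<forall>x i. f (x + axis i (2 * pi)) = f x)"

definition pd :: "3 \<Rightarrow> (real^3 \<Rightarrow> 'b::real_normed_vector) \<Rightarrow> real^3 \<Rightarrow> 'b" where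
  "pd i f x = frechet_derivative f (at x) (axis i 1)"

text \<open>\<open>C\<^sup>\<infinity>\<close>: every iterated partial derivative exists and is (totally) differentiable everywhere.\<close>

definition smooth :: "(real^3 \<Rightarrow> 'b::real_normed_vector) \<Rightarrow> bool" where
  "smooth f \<longleftrightarrow> (\<forall>is x. foldr pd is f differentiable (at x))"

definition laplacian :: "(real^3 \<Rightarrow> 'b::real_normed_vector) \<Rightarrow> real^3 \<Rightarrow> 'b" where
  "laplacian f x = (\<Sum>i\<in>UNIV. pd i (pd i f) x)"

definition divergence :: "(real^3 \<Rightarrow> real^3) \<Rightarrow> real^3 \<Rightarrow> real" where
  "divergence f x = (\<Sum>i\<in>UNIV. pd i f x $ i)"

text \<open>\<open>(grad f x) $ i $ j = \<partial>\<^sub>j f\<^sub>i (x)\<close>; thus \<open>(f \<cdot> \<nabla>) f = grad f x *v f x\<close>, and \<open>\<nabla>f : \<nabla>g\<close> is the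
  inner product of the Euclidean space \<^typ>\<open>real^3^3\<close>.\<close>

definition grad :: "(real^3 \<Rightarrow> real^3) \<Rightarrow> real^3 \<Rightarrow> real^3^3" where
  "grad f x = jacobian f (at x)"

definition C_inf_div :: "(real^3 \<Rightarrow> real^3) set" where
  "C_inf_div = {f. smooth f \<and> periodic f \<and> (\<forall>x. divergence f x = 0) \<and> (LINT x|torus. f x) = 0}"


section \<open>Function spaces\<close>

text \<open>Elements of \<open>L\<^sup>2\<close> are represented by functions; the \<open>L\<^sup>2\<close> norm is a seminorm on representatives.\<close>

definition L2_inner :: "(real^3 \<Rightarrow> 'b::euclidean_space) \<Rightarrow> (real^3 \<Rightarrow> 'b) \<Rightarrow> real" where
  "L2_inner f g = (LINT x|torus. f x \<bullet> g x)"

definition L2_norm :: "(real^3 \<Rightarrow> 'b::euclidean_space) \<Rightarrow> real" where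
  "L2_norm f = sqrt (LINT x|torus. (norm (f x))\<^sup>2)"

definition L2 :: "(real^3 \<Rightarrow> 'b::euclidean_space) set" where
  "L2 = {f. periodic f \<and> f \<in> borel_measurable torus \<and> integrable torus (\<lambda>x. (norm (f x))\<^sup>2)}"

definition L2_div :: "(real^3 \<Rightarrow> real^3) set" where
  "L2_div = {f \<in> L2. \<exists>\<Phi>. (\<forall>n::nat. \<Phi> n \<in> C_inf_div) \<and>
      (\<lambda>n. L2_norm (\<lambda>x. \<Phi> n x - f x)) \<longlonglongrightarrow> 0}"

definition L2_div_open :: "(real^3 \<Rightarrow> real^3) set \<Rightarrow> bool" where
  "L2_div_open U \<longleftrightarrow> U \<subseteq> L2_div \<and>
    (\<forall>f\<in>U. \<exists>r>0. \<forall>g\<in>L2_div. L2_norm (\<lambda>x. g x - f x) < r \<longrightarrow> g \<in> U)"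

definition L2_div_borel :: "(real^3 \<Rightarrow> real^3) measure" where
  "L2_div_borel = sigma L2_div {U. L2_div_open U}"

text \<open>Distributional gradient in \<open>L\<^sup>2\<close>, with the index convention of \<^const>\<open>grad\<close>.\<close>

definition has_weak_grad :: "(real^3 \<Rightarrow> real^3) \<Rightarrow> (real^3 \<Rightarrow> real^3^3) \<Rightarrow> bool" where
  "has_weak_grad f G \<longleftrightarrow> G \<in> L2 \<and>
    (\<forall>\<psi> :: real^3 \<Rightarrow> real. smooth \<psi> \<and> periodic \<psi> \<longrightarrow>
      (\<forall>i j. (LINT x|torus. f x $ i * pd j \<psi> x) = - (LINT x|torus. G x $ i $ j * \<psi> x)))"

definition weak_grad :: "(real^3 \<Rightarrow> real^3) \<Rightarrow> real^3 \<Rightarrow> real^3^3" where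
  "weak_grad f = (SOME G. has_weak_grad f G)"

definition H1_div :: "(real^3 \<Rightarrow> real^3) set" where
  "H1_div = {f \<in> L2. \<exists>G. has_weak_grad f G \<and>
      (\<exists>\<Phi>. (\<forall>n::nat. \<Phi> n \<in> C_inf_div) \<and>
        (\<lambda>n. L2_norm (\<lambda>x. \<Phi> n x - f x)) \<longlonglongrightarrow> 0 \<and>
        (\<lambda>n. L2_norm (\<lambda>x. grad (\<Phi> n) x - G x)) \<longlonglongrightarrow> 0)}"

definition fourier_coeff :: "(real^3 \<Rightarrow> real^3) \<Rightarrow> real^3 \<Rightarrow> complex^3" where
  "fourier_coeff f k = (\<chi> i. (LINT x|torus. complex_of_real (f x $ i) * cis (- (k \<bullet> x))) / (2 * pi) ^ 3)"

definition Hdot_norm :: "real \<Rightarrow> (real^3 \<Rightarrow> real^3) \<Rightarrow> real" where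
  "Hdot_norm \<alpha> f = sqrt (\<Sum>\<^sub>\<infinity>k \<in> {k. (\<forall>i. k $ i \<in> \<int>) \<and> k \<noteq> 0}.
      norm k powr (2 * \<alpha>) * (norm (fourier_coeff f k))\<^sup>2)"


subsection \<open>Path spaces on \<open>[0, T]\<close>\<close>

definition in_C_Hdot :: "real \<Rightarrow> real \<Rightarrow> (real \<Rightarrow> real^3 \<Rightarrow> real^3) \<Rightarrow> bool" where
  "in_C_Hdot T \<alpha> v \<longleftrightarrow>
    (\<forall>t\<in>{0..T}. ((\<lambda>s. Hdot_norm \<alpha> (\<lambda>x. v s x - v t x)) \<longlongrightarrow> 0) (at t within {0..T}))"

definition esssup_L2 :: "real \<Rightarrow> (real \<Rightarrow> real^3 \<Rightarrow> real^3) \<Rightarrow> ereal" where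
  "esssup_L2 T v = esssup (lebesgue_on {0..T}) (\<lambda>t. ereal (L2_norm (v t)))"

definition in_Linf_L2 :: "real \<Rightarrow> (real \<Rightarrow> real^3 \<Rightarrow> real^3) \<Rightarrow> bool" where
  "in_Linf_L2 T v \<longleftrightarrow> (AE t in lebesgue_on {0..T}. v t \<in> L2_div) \<and> esssup_L2 T v < \<infinity>"

definition in_L2_H1 :: "real \<Rightarrow> (real \<Rightarrow> real^3 \<Rightarrow> real^3) \<Rightarrow> bool" where
  "in_L2_H1 T v \<longleftrightarrow> (AE t in lebesgue_on {0..T}. v t \<in> H1_div) \<and>
    (\<integral>\<^sup>+ t. ennreal ((L2_norm (v t))\<^sup>2 + (L2_norm (weak_grad (v t)))\<^sup>2) \<partial>lebesgue_on {0..T}) < \<infinity>"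


section \<open>The forcing\<close>

text \<open>Eigenfunctions of the Stokes operator \<open>-P\<Delta>\<close>, \<open>P\<close> being the Leray projection; \<open>p\<close> is the
  pressure, i.e. \<open>- \<nabla>p\<close> is the part of \<open>-\<Delta>f\<close> removed by \<open>P\<close>.\<close>

definition stokes_eigenfunction :: "(real^3 \<Rightarrow> real^3) \<Rightarrow> bool" where
  "stokes_eigenfunction f \<longleftrightarrow> f \<in> C_inf_div \<and> f \<noteq> (\<lambda>x. 0) \<and>
    (\<exists>(c::real) (p :: real^3 \<Rightarrow> real). smooth p \<and> periodic p \<and>
      (\<forall>x. - laplacian f x + (\<chi> i. pd i p x) = c *\<^sub>R f x))"

text \<open>The modes \<open>k \<ge> 1\<close> are numbered from \<open>0\<close> here.\<close>

definition stokes_forcing :: "(nat \<Rightarrow> real) \<Rightarrow> (nat \<Rightarrow> real^3 \<Rightarrow> real^3) \<Rightarrow> bool" where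
  "stokes_forcing \<sigma> e \<longleftrightarrow>
    (\<forall>k. stokes_eigenfunction (e k)) \<and>
    (\<forall>j k. L2_inner (e j) (e k) = (if j = k then 1 else 0)) \<and>
    summable (\<lambda>k. \<bar>\<sigma> k\<bar>\<^sup>2)"

definition energy_input :: "(nat \<Rightarrow> real) \<Rightarrow> real" where
  "energy_input \<sigma> = 1/2 * (\<Sum>k. \<bar>\<sigma> k\<bar>\<^sup>2)"


section \<open>Stochastic bases\<close>

text \<open>Times are nonnegative reals; values of time-indexed families at negative times are irrelevant.\<close>

locale usual_filtration = prob_space M for M :: "'w measure" +
  fixes F :: "real \<Rightarrow> 'w measure"
  assumes sub: "\<And>t. 0 \<le> t \<Longrightarrow> subalgebra M (F t)"
    and mono: "\<And>s t. 0 \<le> s \<Longrightarrow> s \<le> t \<Longrightarrow> sets (F s) \<subseteq> sets (F t)"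
    and right_continuous: "\<And>t. 0 \<le> t \<Longrightarrow> sets (F t) = (\<Inter>s\<in>{t<..}. sets (F s))"
    and complete: "\<And>A B. A \<in> null_sets M \<Longrightarrow> B \<subseteq> A \<Longrightarrow> B \<in> sets (F 0)"

locale brownian_motion = usual_filtration M F for M :: "'w measure" and F +
  fixes B :: "real \<Rightarrow> 'w \<Rightarrow> real"
  assumes adapted: "\<And>t. 0 \<le> t \<Longrightarrow> B t \<in> borel_measurable (F t)"
    and start: "AE \<omega> in M. B 0 \<omega> = 0"
    and gaussian: "\<And>s t. 0 \<le> s \<Longrightarrow> s < t \<Longrightarrow>
      distributed M lborel (\<lambda>\<omega>. B t \<omega> - B s \<omega>) (normal_density 0 (sqrt (t - s)))"
    and independent_increments: "\<And>s t. 0 \<le> s \<Longrightarrow> s < t \<Longrightarrow>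
      indep_set (sets (F s)) {(\<lambda>\<omega>. B t \<omega> - B s \<omega>) -` A \<inter> space M | A. A \<in> sets borel}"
    and continuous_paths: "AE \<omega> in M. continuous_on {0..} (\<lambda>t. B t \<omega>)"

locale stochastic_basis = usual_filtration M F for M :: "'w measure" and F +
  fixes \<beta> :: "nat \<Rightarrow> real \<Rightarrow> 'w \<Rightarrow> real"
  assumes brownian: "\<And>k. brownian_motion M F (\<beta> k)"
    and independent: "indep_vars (\<lambda>_. PiM {0..} (\<lambda>_. borel)) (\<lambda>k \<omega>. \<lambda>t\<in>{0..}. \<beta> k t \<omega>) UNIV"


section \<open>Stationary martingale solutions\<close>

text \<open>In the weak formulation the integrand \<open>\<integral> \<sigma>\<^sub>k e\<^sub>k \<cdot> \<phi> dx\<close> of the \<open>k\<close>-th stochastic integral is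
  deterministic and constant in time, so the integral over \<open>[0, t]\<close> is this constant times the
  increment of \<open>\<beta>\<^sub>k\<close>. The path law is the law on the product space \<open>(L\<^sup>2\<^sub>d\<^sub>i\<^sub>v)\<^bsup>[0,\<infinity>)\<^esup>\<close>.\<close>

locale stationary_martingale_solution = stochastic_basis M F \<beta>
  for M :: "'w measure" and F and \<beta> +
  fixes \<nu> :: real
    and \<sigma> :: "nat \<Rightarrow> real"
    and e :: "nat \<Rightarrow> real^3 \<Rightarrow> real^3"
    and u :: "real \<Rightarrow> 'w \<Rightarrow> real^3 \<Rightarrow> real^3"
  assumes progressive: "\<And>T. 0 \<le> T \<Longrightarrow>
      (\<lambda>(t, \<omega>). u t \<omega>) \<in> restrict_space borel {0..T} \<Otimes>\<^sub>M F T \<rightarrow>\<^sub>M L2_div_borel"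
    and paths: "\<And>T. 0 \<le> T \<Longrightarrow> \<exists>\<alpha><0. AE \<omega> in M.
      in_C_Hdot T \<alpha> (\<lambda>t. u t \<omega>) \<and> in_Linf_L2 T (\<lambda>t. u t \<omega>) \<and> in_L2_H1 T (\<lambda>t. u t \<omega>)"
    and stationary: "\<And>\<tau>. 0 \<le> \<tau> \<Longrightarrow>
      distr M (PiM {0..} (\<lambda>_. L2_div_borel)) (\<lambda>\<omega>. \<lambda>t\<in>{0..}. u (t + \<tau>) \<omega>) =
      distr M (PiM {0..} (\<lambda>_. L2_div_borel)) (\<lambda>\<omega>. \<lambda>t\<in>{0..}. u t \<omega>)"
    and weak_form: "\<And>t \<phi>. 0 \<le> t \<Longrightarrow> \<phi> \<in> C_inf_div \<Longrightarrow> AE \<omega> in M.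
      \<exists>N. (\<lambda>k. L2_inner (\<lambda>x. \<sigma> k *\<^sub>R e k x) \<phi> * (\<beta> k t \<omega> - \<beta> k 0 \<omega>)) sums N \<and>
        L2_inner (u t \<omega>) \<phi>
          + \<nu> * (LINT s|lebesgue_on {0..t}. L2_inner (weak_grad (u s \<omega>)) (grad \<phi>))
          + (LINT s|lebesgue_on {0..t}. L2_inner (\<lambda>x. weak_grad (u s \<omega>) x *v u s \<omega> x) \<phi>)
        = L2_inner (u 0 \<omega>) \<phi> + N"

text \<open>The energy inequality and the moment bounds are not part of the definition above, but standing
  properties of the solutions under consideration.\<close>

definition energy_inequality ::
  "'w measure \<Rightarrow> real \<Rightarrow> (nat \<Rightarrow> real) \<Rightarrow> (real \<Rightarrow> 'w \<Rightarrow> real^3 \<Rightarrow> real^3) \<Rightarrow> bool" where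
  "energy_inequality M \<nu> \<sigma> u \<longleftrightarrow> (\<forall>t\<ge>0.
    ennreal \<nu> * (\<integral>\<^sup>+ \<omega>. ennreal ((L2_norm (weak_grad (u t \<omega>)))\<^sup>2) \<partial>M) \<le> ennreal (energy_input \<sigma>))"

definition finite_moments :: "'w measure \<Rightarrow> (real \<Rightarrow> 'w \<Rightarrow> real^3 \<Rightarrow> real^3) \<Rightarrow> bool" where
  "finite_moments M u \<longleftrightarrow> (\<forall>r\<ge>1. \<forall>T>0.
    (\<integral>\<^sup>+ \<omega>. ennreal (real_of_ereal (esssup_L2 T (\<lambda>t. u t \<omega>)) powr r) \<partial>M) < \<infinity>)"


section \<open>Structure functions\<close>

text \<open>Surface measure of the unit sphere, as given by polar coordinates: \<open>dS(A)\<close> is three times the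
  volume of the cone \<open>{r n | n \<in> A, 0 < r < 1}\<close>. Note \<open>sgn x = x / |x|\<close>. The measure lives on
  \<^typ>\<open>real^3\<close> and is concentrated on \<open>sphere 0 1\<close>.\<close>

definition sphere_measure :: "(real^3) measure" where
  "sphere_measure = distr (density lborel (\<lambda>x. 3 * indicator (ball 0 1) x)) borel sgn"

lemma emeasure_sphere_measure: "emeasure sphere_measure (sphere 0 1) = ennreal (4 * pi)"
proof -
  have m: "sgn \<in> borel_measurable (borel :: (real^3) measure)"
    unfolding sgn_div_norm[abs_def] by measurable
  have eq: "sgn -` sphere (0::real^3) 1 = UNIV - {0}"
    by (auto simp: norm_sgn)
  have "emeasure sphere_measure (sphere 0 1) =
      (\<integral>\<^sup>+ x. 3 * indicator (ball 0 1) x * indicator (UNIV - {0}) x \<partial>(lborel :: (real^3) measure))"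
    unfolding sphere_measure_def
    by (subst emeasure_distr, use m in simp, simp, subst emeasure_density, measurable)
      (simp_all add: eq)
  also have "\<dots> = (\<integral>\<^sup>+ x. 3 * indicator (ball 0 1) x \<partial>(lborel :: (real^3) measure))"
    using AE_lborel_singleton[of "0::real^3"]
    by (intro nn_integral_cong_AE) (auto elim!: eventually_mono)
  also have "\<dots> = 3 * ennreal (4 / 3 * pi)"
    by (subst nn_integral_cmult_indicator) (simp_all add: emeasure_ball unit_ball_vol_3)
  also have "\<dots> = ennreal (4 * pi)"
    by (simp flip: ennreal_numeral ennreal_mult)
  finally show ?thesis .
qed

definition increment :: "real^3 \<Rightarrow> (real^3 \<Rightarrow> real^3) \<Rightarrow> real^3 \<Rightarrow> real^3" where
  "increment h v x = v (x + h) - v x"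

text \<open>Here \<open>v\<close> is a random field, to be instantiated with \<open>u t\<close>.\<close>

definition S0 :: "'w measure \<Rightarrow> ('w \<Rightarrow> real^3 \<Rightarrow> real^3) \<Rightarrow> real \<Rightarrow> real" where
  "S0 M v l = 1 / (4 * pi) * (LINT \<omega>|M. LINT n|sphere_measure. LINT x|torus.
     (norm (increment (l *\<^sub>R n) (v \<omega>) x))\<^sup>2 * (increment (l *\<^sub>R n) (v \<omega>) x \<bullet> n))"

definition S_par :: "'w measure \<Rightarrow> ('w \<Rightarrow> real^3 \<Rightarrow> real^3) \<Rightarrow> real \<Rightarrow> real" where
  "S_par M v l = 1 / (4 * pi) * (LINT \<omega>|M. LINT n|sphere_measure. LINT x|torus.
     (increment (l *\<^sub>R n) (v \<omega>) x \<bullet> n) ^ 3)"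

end

theory Submission
  imports Defs
begin

text \<open>Write \<open>B(K, f, g) = \<integral>\<integral> K (x - y) f(x) \<cdot> g(y) dx dy\<close>. Testing the equation with the real Fourier modes of
  wave vector \<open>k\<close> polarised orthogonally to \<open>k\<close>, and comparing second moments at times \<open>0\<close> and \<open>t \<rightarrow> 0\<close>, which
  agree by stationarity, gives \<open>E[\<nu> B(K, \<nabla>u, \<nabla>u) + B(K, (u \<cdot> \<nabla>)u, u)] = 1/2 \<Sum>\<^sub>j \<sigma>\<^sub>j\<^sup>2 B(K, e\<^sub>j, e\<^sub>j)\<close> for
  \<open>K(h) = cos (k \<cdot> h)\<close>, hence for all even continuous \<open>K\<close>, hence for \<open>K = 1\<^bsub>|h| < l\<^esub>\<close> and
  \<open>K = (l\<^sup>2 - |h|\<^sup>2)\<^sub>+\<close>. For these two kernels the divergence theorem in \<open>h\<close> turns the cubic term into a multiple of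
  the integral defining \<open>S\<^sub>0\<close>, respectively \<open>S\<^sub>|\<^sub>|\<close>, and with the mass \<open>m\<close> of \<open>K\<close> the identity reads
  \<open>S/l = - c (1/2 \<Sum>\<^sub>j \<sigma>\<^sub>j\<^sup>2 B(K, e\<^sub>j, e\<^sub>j) - \<nu> E B(K, \<nabla>u, \<nabla>u)) / m\<close> with \<open>c = 4/3\<close>, respectively \<open>c = 4/5\<close>.
  As \<open>l \<rightarrow> 0\<close> the first quotient tends to \<open>\<epsilon>\<close>, while the second lies in \<open>[-\<epsilon>, \<epsilon>]\<close> by the energy inequality.\<close>

text \<open>The equation is tested against one smooth mode at a time: \<open>u\<close> is merely H1
  in space, which is too rough for applying an Ito formula to |u|^2 directly. For one mode the Ito
  correction reduces to expanding a second moment over [0, t] and dividing by t. This needs a square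
  integrable drift, and the drift is quadratic in \<open>u\<close>: hence the fourth moments. No
  pressure occurs, because polarisations orthogonal to k see only the solenoidal part. The cubic
  term is controlled in L3, so the flux identities are proved for smooth fields and carried to H1
  fields by a Sobolev inequality. Both kernels are nonnegative but need not be positive definite, so
  the gradient form has no sign; the lower bound adds its worst value to that of the forcing, which
  is where 8/3 = 2 * 4/3 and 8/5 = 2 * 4/5 come from. For the upper bound the limit of the forcing
  quotient exactly cancels the largest dissipation that the energy inequality allows.\<close>

hide_fact (open)
  Henstock_Kurzweil_Integration.integrable_bound
  Henstock_Kurzweil_Integration.integral_sum
  Henstock_Kurzweil_Integration.integral_diff
  Henstock_Kurzweil_Integration.integral_cong
  Henstock_Kurzweil_Integration.integral_nonneg
  Henstock_Kurzweil_Integration.integrable_diff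
  Henstock_Kurzweil_Integration.integral_add
  Henstock_Kurzweil_Integration.integrable_add
  Henstock_Kurzweil_Integration.integrable_sum
  Henstock_Kurzweil_Integration.integrable_cong

section \<open>Smooth functions\<close>

lemma pd_eqI: "(f has_derivative f') (at x) \<Longrightarrow> pd i f x = f' (axis i 1)"
  unfolding pd_def by (metis frechet_derivative_at)

lemma smooth_differentiable: "smooth f \<Longrightarrow> f differentiable (at x)"
  unfolding smooth_def by (metis foldr_Nil id_apply)

lemma smooth_pd: "smooth f \<Longrightarrow> smooth (pd i f)"
  unfolding smooth_def
proof (intro allI)
  fix "is" x assume *: "\<forall>is x. foldr pd is f differentiable at x"
  show "foldr pd is (pd i f) differentiable at x"
    using *[rule_format, of "is @ [i]" x] by simp
qed

text \<open>Every iterated derivative stays inside a class closed under \<open>pd\<close>. Each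
  closure property below therefore only exhibits such a class, instead of an induction over lists of
  indices.\<close>

lemma smooth_coinduct:
  assumes "f \<in> C" and "\<And>g x. g \<in> C \<Longrightarrow> g differentiable (at x)"
    and "\<And>g i. g \<in> C \<Longrightarrow> pd i g \<in> C"
  shows "smooth f"
proof -
  have "foldr pd is f \<in> C" for "is"
    by (induct "is") (use assms in auto)
  then show ?thesis unfolding smooth_def using assms(2) by blast
qed

lemma smooth_has_derivative_frechet:
  "smooth f \<Longrightarrow> (f has_derivative frechet_derivative f (at x)) (at x)"
  using smooth_differentiable frechet_derivative_works by blast

lemma smooth_has_derivative:
  assumes "smooth f"
  shows "(f has_derivative (\<lambda>h. \<Sum>i\<in>UNIV. h $ i *\<^sub>R pd i f x)) (at x)"
proof -
  let ?D = "frechet_derivative f (at x)"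
  have d: "(f has_derivative ?D) (at x)" by (rule smooth_has_derivative_frechet[OF assms])
  then have l: "linear ?D" by (rule has_derivative_linear)
  have "?D h = (\<Sum>i\<in>UNIV. h $ i *\<^sub>R pd i f x)" for h
  proof -
    have "h = (\<Sum>i\<in>UNIV. h $ i *\<^sub>R axis i 1)"
      by (simp add: basis_expansion[of h, unfolded scalar_mult_eq_scaleR])
    then have "?D h = ?D (\<Sum>i\<in>UNIV. h $ i *\<^sub>R axis i 1)" by simp
    also have "\<dots> = (\<Sum>i\<in>UNIV. h $ i *\<^sub>R ?D (axis i 1))"
      by (simp add: linear_sum[OF l] linear_cmul[OF l])
    finally show ?thesis by (simp add: pd_def)
  qed
  then have "?D = (\<lambda>h. \<Sum>i\<in>UNIV. h $ i *\<^sub>R pd i f x)" by blast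
  then show ?thesis using d by simp
qed

lemma smooth_continuous: "smooth f \<Longrightarrow> continuous_on A f"
  by (intro continuous_at_imp_continuous_on ballI differentiable_imp_continuous_within smooth_differentiable)

lemma smooth_const: "smooth (\<lambda>x. c)"
proof (rule smooth_coinduct[of _ "{\<lambda>x. c | c. True}"])
  fix g :: "real^3 \<Rightarrow> 'a" and i assume "g \<in> {\<lambda>x. c | c. True}"
  then obtain c where g: "g = (\<lambda>x. c)" by blast
  have "pd i g = (\<lambda>x. 0)" unfolding g by (rule ext, rule pd_eqI[OF has_derivative_const])
  then show "pd i g \<in> {\<lambda>x. c | c. True}" by blast
next
  fix g :: "real^3 \<Rightarrow> 'a" and x assume "g \<in> {\<lambda>x. c | c. True}"
  then show "g differentiable at x" using differentiable_const by blast
qed blast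

lemma pd_add:
  assumes "f differentiable (at x)" "g differentiable (at x)"
  shows "pd i (\<lambda>x. f x + g x) x = pd i f x + pd i g x"
  using pd_eqI[OF has_derivative_add[OF assms[THEN iffD1[OF frechet_derivative_works]]], of i]
  by (simp add: pd_def)

lemma pd_bounded_linear:
  assumes "bounded_linear L" "f differentiable (at x)"
  shows "pd i (\<lambda>x. L (f x)) x = L (pd i f x)"
  using pd_eqI[OF bounded_linear.has_derivative[OF assms(1) assms(2)[THEN iffD1[OF frechet_derivative_works]]], of i]
  by (simp add: pd_def)

lemma pd_bounded_bilinear:
  assumes "bounded_bilinear B" "f differentiable (at x)" "g differentiable (at x)"
  shows "pd i (\<lambda>x. B (f x) (g x)) x = B (f x) (pd i g x) + B (pd i f x) (g x)"
  using pd_eqI[OF bounded_bilinear.FDERIV[OF assms(1) assms(2,3)[THEN iffD1[OF frechet_derivative_works]]], of i]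
  by (simp add: pd_def)

lemma smooth_add: assumes "smooth f" "smooth g" shows "smooth (\<lambda>x. f x + g x)"
proof (rule smooth_coinduct[of _ "{\<lambda>x. f x + g x | f g. smooth f \<and> smooth g}"])
  fix h :: "real^3 \<Rightarrow> 'a" and i assume "h \<in> {\<lambda>x. f x + g x | f g. smooth f \<and> smooth g}"
  then obtain f g where h: "h = (\<lambda>x. f x + g x)" "smooth f" "smooth g" by blast
  then have "pd i h = (\<lambda>x. pd i f x + pd i g x)"
    unfolding h(1) by (intro ext pd_add smooth_differentiable)
  then show "pd i h \<in> {\<lambda>x. f x + g x | f g. smooth f \<and> smooth g}" using h smooth_pd by blast
qed (use assms in \<open>auto intro: differentiable_add smooth_differentiable\<close>)

lemma smooth_bounded_linear: assumes "bounded_linear L" "smooth f" shows "smooth (\<lambda>x. L (f x))"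
proof (rule smooth_coinduct[of _ "{\<lambda>x. L (f x) | f. smooth f}"])
  fix h :: "real^3 \<Rightarrow> 'b" and i assume "h \<in> {\<lambda>x. L (f x) | f. smooth f}"
  then obtain f where h: "h = (\<lambda>x. L (f x))" "smooth f" by blast
  then have "pd i h = (\<lambda>x. L (pd i f x))"
    unfolding h(1) by (intro ext pd_bounded_linear[OF assms(1)] smooth_differentiable)
  then show "pd i h \<in> {\<lambda>x. L (f x) | f. smooth f}" using h smooth_pd by blast
next
  fix h :: "real^3 \<Rightarrow> 'b" and x assume "h \<in> {\<lambda>x. L (f x) | f. smooth f}"
  then obtain f where h: "h = (\<lambda>x. L (f x))" "smooth f" by blast
  show "h differentiable at x" unfolding h(1) differentiable_def
    by (rule exI, rule bounded_linear.has_derivative[OF assms(1) smooth_has_derivative_frechet[OF h(2)]])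
qed (use assms in auto)

text \<open>By the Leibniz rule a derivative of a product is a sum of two products, so products
  alone are not closed under \<open>pd\<close>; this is the least class that repairs it.\<close>

inductive bilinear_span :: "('a::real_normed_vector \<Rightarrow> 'b::real_normed_vector \<Rightarrow> 'c::real_normed_vector) \<Rightarrow>
    (real^3 \<Rightarrow> 'c) \<Rightarrow> bool" for B where
  prod: "smooth f \<Longrightarrow> smooth g \<Longrightarrow> bilinear_span B (\<lambda>x. B (f x) (g x))"
| add: "bilinear_span B f \<Longrightarrow> bilinear_span B g \<Longrightarrow> bilinear_span B (\<lambda>x. f x + g x)"

lemma smooth_bounded_bilinear:
  assumes B: "bounded_bilinear B" and "smooth f" "smooth g"
  shows "smooth (\<lambda>x. B (f x) (g x))"
proof (rule smooth_coinduct[of _ "{h. bilinear_span B h}"])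
  have *: "bilinear_span B h \<Longrightarrow> (\<forall>x. h differentiable at x) \<and> (\<forall>i. bilinear_span B (pd i h))" for h
  proof (induct rule: bilinear_span.induct)
    case (prod f g)
    then have "pd i (\<lambda>x. B (f x) (g x)) = (\<lambda>x. B (f x) (pd i g x) + B (pd i f x) (g x))" for i
      by (auto simp: fun_eq_iff pd_bounded_bilinear[OF B] smooth_differentiable)
    moreover have "(\<lambda>x. B (f x) (g x)) differentiable at x" for x
      unfolding differentiable_def
      by (rule exI, rule bounded_bilinear.FDERIV[OF B prod[THEN smooth_has_derivative_frechet]])
    ultimately show ?case using prod by (auto intro!: bilinear_span.intros smooth_pd)
  next
    case (add f g)
    then have "pd i (\<lambda>x. f x + g x) = (\<lambda>x. pd i f x + pd i g x)" for i
      by (auto simp: fun_eq_iff pd_add)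
    then show ?case using add by (auto intro!: bilinear_span.intros differentiable_add)
  qed
  then show "\<And>h x. h \<in> {h. bilinear_span B h} \<Longrightarrow> h differentiable at x"
    "\<And>h i. h \<in> {h. bilinear_span B h} \<Longrightarrow> pd i h \<in> {h. bilinear_span B h}" by auto
  show "(\<lambda>x. B (f x) (g x)) \<in> {h. bilinear_span B h}"
    using assms by (auto intro: bilinear_span.intros)
qed

lemmas smooth_mult = smooth_bounded_bilinear[OF bounded_bilinear_mult]
lemmas smooth_scaleR = smooth_bounded_bilinear[OF bounded_bilinear_scaleR]
lemmas smooth_inner = smooth_bounded_bilinear[OF bounded_bilinear_inner]
lemmas smooth_vec_nth = smooth_bounded_linear[OF bounded_linear_vec_nth]

lemma smooth_minus: "smooth f \<Longrightarrow> smooth (\<lambda>x. - f x)"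
  using smooth_bounded_linear[OF bounded_linear_minus[OF bounded_linear_ident]] by blast

lemma smooth_diff: "smooth f \<Longrightarrow> smooth g \<Longrightarrow> smooth (\<lambda>x. f x - g x)"
  using smooth_add[of f "\<lambda>x. - g x"] smooth_minus by auto

lemma smooth_sum: "(\<And>i. i \<in> I \<Longrightarrow> smooth (f i)) \<Longrightarrow> smooth (\<lambda>x. \<Sum>i\<in>I. f i x)"
  by (induct I rule: infinite_finite_induct) (auto intro: smooth_const smooth_add)

lemma pd_wave:
  "pd i (\<lambda>x. cos (k \<bullet> x) *\<^sub>R a + sin (k \<bullet> x) *\<^sub>R b) =
   (\<lambda>x. cos (k \<bullet> x) *\<^sub>R (k $ i *\<^sub>R b) + sin (k \<bullet> x) *\<^sub>R (- (k $ i) *\<^sub>R a))"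
proof
  fix x
  have "((\<lambda>x. cos (k \<bullet> x) *\<^sub>R a + sin (k \<bullet> x) *\<^sub>R b) has_derivative
    (\<lambda>h. (- sin (k \<bullet> x) * (k \<bullet> h)) *\<^sub>R a + (cos (k \<bullet> x) * (k \<bullet> h)) *\<^sub>R b)) (at x)"
    by (auto intro!: derivative_eq_intros simp: mult.commute)
  from pd_eqI[OF this, of i] show "pd i (\<lambda>x. cos (k \<bullet> x) *\<^sub>R a + sin (k \<bullet> x) *\<^sub>R b) x =
   cos (k \<bullet> x) *\<^sub>R (k $ i *\<^sub>R b) + sin (k \<bullet> x) *\<^sub>R (- (k $ i) *\<^sub>R a)"
    by (simp add: inner_axis algebra_simps)
qed

lemma smooth_wave: "smooth (\<lambda>x. cos (k \<bullet> x) *\<^sub>R a + sin (k \<bullet> x) *\<^sub>R b)"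
proof (rule smooth_coinduct[of _ "{\<lambda>x. cos (k \<bullet> x) *\<^sub>R a + sin (k \<bullet> x) *\<^sub>R b | a b. True}"])
  fix g :: "real^3 \<Rightarrow> 'a" and x
  assume "g \<in> {\<lambda>x. cos (k \<bullet> x) *\<^sub>R a + sin (k \<bullet> x) *\<^sub>R b | a b. True}"
  then obtain a b where g: "g = (\<lambda>x. cos (k \<bullet> x) *\<^sub>R a + sin (k \<bullet> x) *\<^sub>R b)" by blast
  show "g differentiable at x" unfolding g differentiable_def
    by (rule exI) (auto intro!: derivative_eq_intros)
next
  fix g :: "real^3 \<Rightarrow> 'a" and i
  assume "g \<in> {\<lambda>x. cos (k \<bullet> x) *\<^sub>R a + sin (k \<bullet> x) *\<^sub>R b | a b. True}"
  then obtain a b where g: "g = (\<lambda>x. cos (k \<bullet> x) *\<^sub>R a + sin (k \<bullet> x) *\<^sub>R b)" by blast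
  show "pd i g \<in> {\<lambda>x. cos (k \<bullet> x) *\<^sub>R a + sin (k \<bullet> x) *\<^sub>R b | a b. True}"
    unfolding g pd_wave by blast
qed blast

lemma has_derivative_shift:
  assumes "(f has_derivative D) (at (x + a))"
  shows "((\<lambda>x. f (x + a)) has_derivative D) (at x)"
proof -
  have "((\<lambda>x. x + a) has_derivative (\<lambda>h. h)) (at x)"
    by (intro derivative_eq_intros) auto
  from has_derivative_compose[OF this assms] show ?thesis .
qed

lemma smooth_translate: assumes "smooth f" shows "smooth (\<lambda>x. f (x + h))"
    and pd_translate: "pd i (\<lambda>x. f (x + h)) x = pd i f (x + h)"
proof -
  have *: "((\<lambda>x. g (x + h)) has_derivative frechet_derivative g (at (x + h))) (at x)" if "smooth g"
    for g :: "real^3 \<Rightarrow> 'a" and x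
    by (rule has_derivative_shift[OF smooth_has_derivative_frechet[OF that]])
  have pd: "pd i (\<lambda>x. g (x + h)) = (\<lambda>x. pd i g (x + h))" if "smooth g" for g :: "real^3 \<Rightarrow> 'a" and i
    using pd_eqI[OF *[OF that]] by (auto simp: pd_def)
  show "smooth (\<lambda>x. f (x + h))"
  proof (rule smooth_coinduct[of _ "{\<lambda>x. g (x + h) | g. smooth g}"])
    fix g :: "real^3 \<Rightarrow> 'a" and x
    assume "g \<in> {\<lambda>x. g (x + h) | g. smooth g}"
    then obtain g' where g: "g = (\<lambda>x. g' (x + h))" "smooth g'" by blast
    show "g differentiable at x" unfolding g(1) differentiable_def by (rule exI, rule *[OF g(2)])
  next
    fix g :: "real^3 \<Rightarrow> 'a" and i
    assume "g \<in> {\<lambda>x. g (x + h) | g. smooth g}"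
    then obtain g' where g: "g = (\<lambda>x. g' (x + h))" "smooth g'" by blast
    show "pd i g \<in> {\<lambda>x. g (x + h) | g. smooth g}"
      unfolding g(1) pd[OF g(2)] using smooth_pd[OF g(2), of i] by blast
  qed (use assms in auto)
  show "pd i (\<lambda>x. f (x + h)) x = pd i f (x + h)" using pd[OF assms] by (simp add: fun_eq_iff)
qed

lemma grad_eq: assumes "smooth f" shows "grad f x $ i $ j = pd j f x $ i"
proof -
  have "(f has_derivative (\<lambda>h. \<Sum>i\<in>UNIV. h $ i *\<^sub>R pd i f x)) (at x)"
    by (rule smooth_has_derivative[OF assms])
  then show ?thesis
    unfolding grad_def jacobian_def matrix_def
    by (simp add: frechet_derivative_at[symmetric] pd_def)
qed

section \<open>Periodic functions\<close>

text \<open>\<open>frechet_derivative\<close> is a choice, so for an arbitrary f it is enough that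
  exactly the same linear maps are derivatives at x and at the translated point.\<close>

lemma periodic_pd: assumes "periodic f" shows "periodic (pd i f)"
proof -
  have "pd i f (x + axis j (2 * pi)) = pd i f x" for x j
  proof -
    let ?a = "axis j (2 * pi) :: real^3"
    have e: "(\<lambda>x. f (x + ?a)) = f" using assms by (auto simp: periodic_def)
    have "(f has_derivative D) (at (x + ?a)) \<longleftrightarrow> (f has_derivative D) (at x)" for D
    proof
      assume "(f has_derivative D) (at (x + ?a))"
      then have "((\<lambda>x. f (x + ?a)) has_derivative D) (at x)"
        by (rule has_derivative_shift)
      then show "(f has_derivative D) (at x)" using e by simp
    next
      assume "(f has_derivative D) (at x)"
      then have "((\<lambda>x. f (x + - ?a)) has_derivative D) (at (x + ?a))"
        by (intro has_derivative_shift) simp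
      moreover have "(\<lambda>x. f (x + - ?a)) = f"
      proof
        fix x show "f (x + - ?a) = f x" using fun_cong[OF e, of "x + - ?a"] by simp
      qed
      ultimately show "(f has_derivative D) (at (x + ?a))" by simp
    qed
    then show ?thesis unfolding pd_def frechet_derivative_def by simp
  qed
  then show ?thesis unfolding periodic_def by blast
qed

section \<open>The torus as a measure space\<close>

abbreviation cell :: "(real^3) set" where "cell \<equiv> cbox 0 (\<chi> i. 2 * pi)"

text \<open>Half open, so that it meets every orbit of the lattice exactly once; it differs from
  \<open>cell\<close> by a null set.\<close>

definition hcell :: "(real^3) set" where "hcell = {x. \<forall>i. 0 \<le> x $ i \<and> x $ i < 2 * pi}"

definition lat :: "int^3 \<Rightarrow> real^3" where "lat m = (\<chi> i. 2 * pi * of_int (m $ i))"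

definition wrap :: "real^3 \<Rightarrow> real^3" where "wrap x = x - lat (\<chi> i. \<lfloor>x $ i / (2 * pi)\<rfloor>)"

lemma periodic_axis_nat: "periodic f \<Longrightarrow> f (x + axis i (2 * pi * real n)) = f x"
proof (induct n)
  case 0
  have e: "axis i 0 = (0::real^3)" by (simp add: axis_def vec_eq_iff)
  show ?case unfolding of_nat_0 mult_zero_right e by simp
next
  case (Suc n)
  have "x + axis i (2 * pi * real (Suc n)) = (x + axis i (2 * pi * real n)) + axis i (2 * pi)"
    by (simp add: axis_def vec_eq_iff algebra_simps)
  then show ?case using Suc unfolding periodic_def by metis
qed

lemma periodic_axis_int: assumes "periodic f" shows "f (x + axis i (2 * pi * of_int n)) = f x"
proof (cases n)
  case (nonneg m) then show ?thesis using periodic_axis_nat[OF assms] by simp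
next
  case (neg m)
  have "of_int n = - real (Suc m)" using neg by simp
  then have "x = (x + axis i (2 * pi * of_int n)) + axis i (2 * pi * real (Suc m))"
    by (simp add: axis_def vec_eq_iff del: of_nat_Suc)
  then show ?thesis using periodic_axis_nat[OF assms, of "x + axis i (2 * pi * of_int n)" i "Suc m"] by metis
qed

lemma periodic_lat: assumes "periodic f" shows "f (x + lat m) = f x"
proof -
  have "lat m = axis 1 (2 * pi * of_int (m $ 1)) + axis 2 (2 * pi * of_int (m $ 2)) + axis 3 (2 * pi * of_int (m $ 3))"
    by (simp add: lat_def vec_eq_iff forall_3 axis_def)
  then show ?thesis
    by (simp add: add.assoc[symmetric] periodic_axis_int[OF assms])
qed

lemma periodic_wrap: assumes "periodic f" shows "f (wrap x) = f x"
  using periodic_lat[OF assms, of "wrap x" "\<chi> i. \<lfloor>x $ i / (2 * pi)\<rfloor>"] by (simp add: wrap_def)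

lemma lat_axis: "lat (axis i 1) = axis i (2 * pi)"
  by (simp add: lat_def axis_def vec_eq_iff)

lemma periodicI_lat: "(\<And>x m. f (x + lat m) = f x) \<Longrightarrow> periodic f"
  unfolding periodic_def by (metis lat_axis)

lemma wrap_in: "wrap x \<in> hcell"
proof -
  have "0 \<le> x $ i - 2 * pi * of_int \<lfloor>x $ i / (2 * pi)\<rfloor>"
    "x $ i - 2 * pi * of_int \<lfloor>x $ i / (2 * pi)\<rfloor> < 2 * pi" for i
  proof -
    have "of_int \<lfloor>x $ i / (2 * pi)\<rfloor> \<le> x $ i / (2 * pi)" "x $ i / (2 * pi) < of_int \<lfloor>x $ i / (2 * pi)\<rfloor> + 1"
      by linarith+
    then have "of_int \<lfloor>x $ i / (2 * pi)\<rfloor> * (2 * pi) \<le> x $ i" "x $ i < (of_int \<lfloor>x $ i / (2 * pi)\<rfloor> + 1) * (2 * pi)"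
      by (metis pos_le_divide_eq pos_divide_less_eq mult_pos_pos pi_gt_zero zero_less_numeral)+
    then show "0 \<le> x $ i - 2 * pi * of_int \<lfloor>x $ i / (2 * pi)\<rfloor>"
      "x $ i - 2 * pi * of_int \<lfloor>x $ i / (2 * pi)\<rfloor> < 2 * pi"
      by (simp_all add: algebra_simps)
  qed
  then show ?thesis by (simp add: hcell_def wrap_def lat_def)
qed

lemma in_hcell_lat_unique:
  "x + lat m \<in> hcell \<longleftrightarrow> m = - (\<chi> i. \<lfloor>x $ i / (2 * pi)\<rfloor>)"
proof
  assume "x + lat m \<in> hcell"
  then have "0 \<le> x $ i + 2 * pi * of_int (m $ i)" "x $ i + 2 * pi * of_int (m $ i) < 2 * pi" for i
    by (auto simp: hcell_def lat_def)
  then have "of_int (- m $ i) * (2 * pi) \<le> x $ i" "x $ i < (of_int (- m $ i) + 1) * (2 * pi)" for i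
    using spec[of _ i] by (simp_all add: algebra_simps) (smt (verit))+
  then have "of_int (- m $ i) \<le> x $ i / (2 * pi)" "x $ i / (2 * pi) < of_int (- m $ i) + 1" for i
    by (metis pos_le_divide_eq pos_divide_less_eq mult_pos_pos pi_gt_zero zero_less_numeral)+
  then have "\<lfloor>x $ i / (2 * pi)\<rfloor> = - m $ i" for i by (intro floor_unique) auto
  then show "m = - (\<chi> i. \<lfloor>x $ i / (2 * pi)\<rfloor>)" by (simp add: vec_eq_iff)
next
  assume "m = - (\<chi> i. \<lfloor>x $ i / (2 * pi)\<rfloor>)"
  then have "x + lat m = wrap x" by (simp add: wrap_def lat_def vec_eq_iff)
  then show "x + lat m \<in> hcell" using wrap_in by simp
qed

lemma wrap_lat: "wrap (x + lat m) = wrap x"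
  by (simp add: wrap_def lat_def vec_eq_iff add_divide_distrib algebra_simps)

lemma periodic_wrap_compose: "periodic (\<lambda>x. g (wrap x))"
  by (rule periodicI_lat) (simp add: wrap_lat)

lemma borel_hcell[measurable]: "hcell \<in> sets borel"
proof -
  have "{x::real^3. (0 \<le> x $ 1 \<and> x $ 1 < 2 * pi) \<and> (0 \<le> x $ 2 \<and> x $ 2 < 2 * pi) \<and> (0 \<le> x $ 3 \<and> x $ 3 < 2 * pi)} \<in> sets borel"
    by measurable
  then show ?thesis by (simp add: hcell_def forall_3)
qed

lemma wrap_measurable[measurable]: "wrap \<in> borel_measurable borel"
proof (rule borel_measurable_euclidean_space[THEN iffD2], safe)
  fix b :: "real^3" assume "b \<in> Basis"
  then obtain i where b: "b = axis i 1" by (auto simp: Basis_vec_def)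
  have "(\<lambda>x::real^3. x $ i - 2 * pi * of_int \<lfloor>x $ i / (2 * pi)\<rfloor>) \<in> borel_measurable borel"
    by measurable
  then show "(\<lambda>x. wrap x \<bullet> b) \<in> borel_measurable borel"
    by (simp add: b wrap_def lat_def inner_axis)
qed

lemma hcell_sub_cell: "hcell \<subseteq> cell"
  by (auto simp: hcell_def mem_box_cart less_imp_le)

lemma AE_hcell_cell: "AE x in lborel. x \<in> hcell \<longleftrightarrow> x \<in> cell"
proof (rule AE_I')
  show "cell - box 0 (\<chi> i. 2 * pi) \<in> null_sets lborel" by (rule null_sets_cbox_Diff_box)
  show "{x \<in> space lborel. (x \<in> hcell) \<noteq> (x \<in> cell)} \<subseteq> cell - box 0 (\<chi> i. 2 * pi)"
    using hcell_sub_cell by (auto simp: hcell_def mem_box_cart less_imp_le)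
qed

lemma space_torus[simp]: "space torus = cell" by simp

lemma cell_lebesgue[simp]: "cell \<in> sets lebesgue" "cell \<inter> space lebesgue \<in> sets lebesgue" by auto

lemma nn_integral_torus: "(\<integral>\<^sup>+x. f x \<partial>torus) = (\<integral>\<^sup>+x. f x * indicator hcell x \<partial>lborel)"
proof -
  have "(\<integral>\<^sup>+x. f x \<partial>torus) = (\<integral>\<^sup>+x. f x * indicator cell x \<partial>lborel)"
    by (subst nn_integral_restrict_space) (simp_all add: nn_integral_completion)
  also have "\<dots> = (\<integral>\<^sup>+x. f x * indicator hcell x \<partial>lborel)"
    by (rule nn_integral_cong_AE) (use AE_hcell_cell in eventually_elim, simp add: indicator_def)
  finally show ?thesis .
qed

section \<open>Translation invariance of the torus measure\<close>

lemma nn_integral_lborel_shift: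
  fixes f :: "real^3 \<Rightarrow> ennreal"
  assumes [measurable]: "f \<in> borel_measurable borel"
  shows "(\<integral>\<^sup>+x. f (x + h) \<partial>lborel) = (\<integral>\<^sup>+x. f x \<partial>lborel)"
proof -
  have "(\<integral>\<^sup>+x. f x \<partial>lborel) = (\<integral>\<^sup>+x. f x \<partial>distr lborel borel ((+) h))"
    by (simp add: lborel_distr_plus)
  also have "\<dots> = (\<integral>\<^sup>+x. f (x + h) \<partial>lborel)"
    by (subst nn_integral_distr) (simp_all add: add.commute)
  finally show ?thesis by simp
qed

text \<open>Exactly one point of the orbit of x lies in \<open>hcell\<close>. Multiplying an
  integrand by this 1 introduces a sum over the lattice.\<close>

lemma tile: "(\<integral>\<^sup>+m. indicator hcell (x + lat m) \<partial>count_space UNIV) = 1"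
proof -
  have "(\<lambda>m. indicator hcell (x + lat m) :: ennreal) = indicator {- (\<chi> i. \<lfloor>x $ i / (2 * pi)\<rfloor>)}"
    by (auto simp: fun_eq_iff indicator_def in_hcell_lat_unique)
  then show ?thesis by simp
qed

lemma lat_minus: "lat (- m) = - lat m" by (simp add: lat_def vec_eq_iff)

lemma tile_minus: "(\<integral>\<^sup>+m. indicator hcell (x - lat m) \<partial>count_space UNIV) = 1"
proof -
  have "(\<lambda>m. indicator hcell (x - lat m) :: ennreal) = indicator {(\<chi> i. \<lfloor>x $ i / (2 * pi)\<rfloor>)}"
  proof
    fix m
    have "x - lat m \<in> hcell \<longleftrightarrow> m = (\<chi> i. \<lfloor>x $ i / (2 * pi)\<rfloor>)"
      using in_hcell_lat_unique[of x "- m"] by (simp add: lat_minus)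
    then show "(indicator hcell (x - lat m) :: ennreal) = indicator {(\<chi> i. \<lfloor>x $ i / (2 * pi)\<rfloor>)} m"
      by (simp add: indicator_def)
  qed
  then show ?thesis by simp
qed

text \<open>Unfold and refold: the tiling cuts the shifted cell into pieces, a lattice vector moves
  each piece back into \<open>hcell\<close> without changing the periodic f, and the indicators of
  the moved pieces again sum to 1.\<close>

lemma nn_integral_torus_shift_borel:
  fixes f :: "real^3 \<Rightarrow> ennreal"
  assumes [measurable]: "f \<in> borel_measurable borel" and p: "periodic f"
  shows "(\<integral>\<^sup>+x. f (x + h) \<partial>torus) = (\<integral>\<^sup>+x. f x \<partial>torus)"
proof -
  let ?I = "indicator hcell :: real^3 \<Rightarrow> ennreal"
  have "(\<integral>\<^sup>+x. f (x + h) \<partial>torus) = (\<integral>\<^sup>+x. f (x + h) * ?I ((x + h) - h) \<partial>lborel)"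
    by (simp add: nn_integral_torus)
  also have "\<dots> = (\<integral>\<^sup>+x. f x * ?I (x - h) \<partial>lborel)"
    by (rule nn_integral_lborel_shift[where f="\<lambda>x. f x * ?I (x - h)"]) measurable
  also have "\<dots> = (\<integral>\<^sup>+x. \<integral>\<^sup>+m. f x * ?I (x - h) * ?I (x - lat m) \<partial>count_space UNIV \<partial>lborel)"
    by (simp add: nn_integral_cmult tile_minus)
  also have "\<dots> = (\<integral>\<^sup>+m. \<integral>\<^sup>+x. f x * ?I (x - h) * ?I (x - lat m) \<partial>lborel \<partial>count_space UNIV)"
    by (rule nn_integral_count_space_nn_integral) auto
  also have "\<dots> = (\<integral>\<^sup>+m. \<integral>\<^sup>+x. f x * ?I (x - h + lat m) * ?I x \<partial>lborel \<partial>count_space UNIV)"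
  proof (rule nn_integral_cong)
    fix m
    have "(\<integral>\<^sup>+x. f x * ?I (x - h) * ?I (x - lat m) \<partial>lborel)
        = (\<integral>\<^sup>+x. f (x + lat m) * ?I (x + lat m - h) * ?I (x + lat m - lat m) \<partial>lborel)"
      by (rule nn_integral_lborel_shift[where f="\<lambda>x. f x * ?I (x - h) * ?I (x - lat m)", symmetric]) measurable
    then show "(\<integral>\<^sup>+x. f x * ?I (x - h) * ?I (x - lat m) \<partial>lborel) = (\<integral>\<^sup>+x. f x * ?I (x - h + lat m) * ?I x \<partial>lborel)"
      by (simp add: periodic_lat[OF p] algebra_simps)
  qed
  also have "\<dots> = (\<integral>\<^sup>+x. \<integral>\<^sup>+m. f x * ?I (x - h + lat m) * ?I x \<partial>count_space UNIV \<partial>lborel)"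
    by (rule nn_integral_count_space_nn_integral[symmetric]) auto
  also have "\<dots> = (\<integral>\<^sup>+x. f x * ?I x \<partial>lborel)"
    by (simp add: nn_integral_cmult nn_integral_multc tile)
  finally show ?thesis by (simp add: nn_integral_torus)
qed

lemma finite_torus: "finite_measure torus"
  by (rule finite_measure_lebesgue_on) simp

interpretation torus: finite_measure torus by (rule finite_torus)
interpretation torus2: pair_sigma_finite torus torus ..

lemma complete_lebesgue_on: assumes S: "S \<in> sets lebesgue" shows "complete_measure (lebesgue_on S)"
proof
  fix A B assume *: "B \<subseteq> A" "A \<in> null_sets (lebesgue_on S)"
  then have "A \<in> null_sets lebesgue" "A \<subseteq> S" using S by (auto simp: null_sets_restrict_space)
  then have "B \<in> null_sets lebesgue" "B \<subseteq> S" using * completion.complete2 by blast+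
  then show "B \<in> sets (lebesgue_on S)" using S by (auto simp: sets_restrict_space_iff)
qed

text \<open>Translation made into a self-map of the cell, so that invariance becomes the equation
  \<open>distr torus torus (tshift h) = torus\<close> and integrals can be transported along
  it.\<close>

definition tshift :: "real^3 \<Rightarrow> real^3 \<Rightarrow> real^3" where "tshift h x = wrap (x + h)"

lemma borel_imp_torus: "f \<in> borel_measurable borel \<Longrightarrow> f \<in> borel_measurable torus"
  by (simp add: measurable_completion measurable_restrict_space1)

lemma sets_torusI: "A \<in> sets borel \<Longrightarrow> A \<inter> cell \<in> sets torus"
  by (rule sets_restrict_space_iff[THEN iffD2]) (auto intro: sets.Int)

lemma tshift_emeasure_borel:
  assumes [measurable]: "A \<in> sets borel"
  shows "emeasure torus {x \<in> cell. tshift h x \<in> A} = emeasure torus (A \<inter> cell)"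
proof -
  let ?f = "\<lambda>x. indicator A (wrap x) :: ennreal"
  have e: "(\<integral>\<^sup>+x. ?f (x + h) \<partial>torus) = (\<integral>\<^sup>+x. ?f x \<partial>torus)"
    by (rule nn_integral_torus_shift_borel[OF _ periodic_wrap_compose]) measurable
  have m: "{x. tshift h x \<in> A} \<in> sets borel"
    unfolding tshift_def by measurable
  have "(\<integral>\<^sup>+x. ?f (x + h) \<partial>torus) = (\<integral>\<^sup>+x. indicator {x \<in> cell. tshift h x \<in> A} x \<partial>torus)"
    by (intro nn_integral_cong) (auto simp: tshift_def indicator_def)
  also have "\<dots> = emeasure torus {x \<in> cell. tshift h x \<in> A}"
  proof (rule nn_integral_indicator)
    have "{x \<in> cell. tshift h x \<in> A} = {x. tshift h x \<in> A} \<inter> cell" by auto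
    then show "{x \<in> cell. tshift h x \<in> A} \<in> sets torus" using sets_torusI[OF m] by simp
  qed
  finally have 1: "(\<integral>\<^sup>+x. ?f (x + h) \<partial>torus) = emeasure torus {x \<in> cell. tshift h x \<in> A}" .
  have "(\<integral>\<^sup>+x. ?f x \<partial>torus) = (\<integral>\<^sup>+x. indicator A x \<partial>torus)"
    unfolding nn_integral_torus
  proof (rule nn_integral_cong)
    fix x :: "real^3"
    have "wrap x = x" if "x \<in> hcell"
      using in_hcell_lat_unique[of x 0] that by (simp add: lat_def wrap_def vec_eq_iff zero_vec_def[symmetric])
    then show "?f x * indicator hcell x = indicator A x * indicator hcell x" by (auto simp: indicator_def)
  qed
  also have "\<dots> = (\<integral>\<^sup>+x. indicator (A \<inter> cell) x \<partial>torus)"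
    by (intro nn_integral_cong) (auto simp: indicator_def)
  also have "\<dots> = emeasure torus (A \<inter> cell)"
    by (rule nn_integral_indicator) (rule sets_torusI, measurable)
  finally show ?thesis using 1 e by simp
qed

lemma emeasure_torus: "A \<in> sets lebesgue \<Longrightarrow> emeasure torus (A \<inter> cell) = emeasure lebesgue (A \<inter> cell)"
  by (subst emeasure_restrict_space) auto

text \<open>Preimages of Lebesgue sets ask for more than Borel measurability: by
  \<open>tshift_emeasure_borel\<close> preimages of null sets are null, and completeness of the
  torus measure does the rest.\<close>

lemma tshift_measurable: "tshift h \<in> torus \<rightarrow>\<^sub>M torus"
proof -
  have b: "tshift h \<in> borel_measurable torus"
    unfolding tshift_def by (intro borel_imp_torus) measurable
  interpret complete_measure torus by (rule complete_lebesgue_on) simp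
  have "tshift h \<in> torus \<rightarrow>\<^sub>M lebesgue"
  proof (rule measurable_completion2)
    show "tshift h \<in> torus \<rightarrow>\<^sub>M lborel" using b by simp
    show "null_sets lborel \<subseteq> null_sets (distr torus lborel (tshift h))"
    proof
      fix A assume A: "A \<in> null_sets (lborel :: (real^3) measure)"
      then have [measurable]: "A \<in> sets borel" by auto
      have "emeasure torus (A \<inter> cell) = emeasure lebesgue (A \<inter> cell)" by (rule emeasure_torus) auto
      also have "\<dots> \<le> emeasure lebesgue A" by (rule emeasure_mono) auto
      also have "\<dots> = 0" using A by auto
      finally have "emeasure torus (A \<inter> cell) = 0" by simp
      then have "emeasure torus {x \<in> cell. tshift h x \<in> A} = 0" by (simp add: tshift_emeasure_borel)
      moreover have "tshift h -` A \<inter> space torus = {x \<in> cell. tshift h x \<in> A}" by auto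
      ultimately show "A \<in> null_sets (distr torus lborel (tshift h))"
        using b by (auto simp: null_sets_def emeasure_distr)
    qed
  qed
  then show ?thesis
    by (rule measurable_restrict_space2[rotated]) (use hcell_sub_cell wrap_in in \<open>auto simp: tshift_def\<close>)
qed

text \<open>A Lebesgue set is a Borel set up to a subset of a null set, which reduces the claim to
  \<open>tshift_emeasure_borel\<close>.\<close>

lemma distr_tshift: "distr torus torus (tshift h) = torus"
proof (rule measure_eqI)
  fix A assume "A \<in> sets (distr torus torus (tshift h))"
  then have A: "A \<in> sets torus" by simp
  then have "A \<in> sets lebesgue" "A \<subseteq> cell" by (auto simp: sets_restrict_space_iff)
  then obtain S N N' where SN: "A = S \<union> N" "N' \<in> null_sets lborel" "S \<in> sets lborel" "N \<subseteq> N'"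
    by (elim sets_completionE) auto
  have [measurable]: "S \<in> sets borel" "N' \<in> sets borel" using SN by auto
  have pre: "tshift h -` A \<inter> space torus \<in> sets torus"
    by (rule measurable_sets[OF tshift_measurable A])
  have preS: "{x \<in> cell. tshift h x \<in> B} \<in> sets torus" if [measurable]: "B \<in> sets borel" for B
  proof -
    have "{x. tshift h x \<in> B} \<in> sets borel" unfolding tshift_def by measurable
    moreover have "{x \<in> cell. tshift h x \<in> B} = {x. tshift h x \<in> B} \<inter> cell" by auto
    ultimately show ?thesis using sets_torusI by simp
  qed
  have N0: "emeasure torus (N' \<inter> cell) = 0"
  proof -
    have "emeasure torus (N' \<inter> cell) = emeasure lebesgue (N' \<inter> cell)" by (rule emeasure_torus) auto
    also have "\<dots> \<le> emeasure lebesgue N'" by (rule emeasure_mono) auto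
    also have "\<dots> = 0" using SN by auto
    finally show ?thesis by simp
  qed
  have "emeasure torus (tshift h -` A \<inter> space torus) = emeasure torus {x \<in> cell. tshift h x \<in> S}"
  proof (rule emeasure_eq_AE)
    show "AE x in torus. x \<in> tshift h -` A \<inter> space torus \<longleftrightarrow> x \<in> {x \<in> cell. tshift h x \<in> S}"
    proof (rule AE_I')
      show "{x \<in> cell. tshift h x \<in> N'} \<in> null_sets torus"
        using preS N0 by (auto simp: null_sets_def tshift_emeasure_borel)
    qed (use SN in auto)
  qed (use pre preS in auto)
  also have "\<dots> = emeasure torus (S \<inter> cell)" by (rule tshift_emeasure_borel) measurable
  also have "\<dots> = emeasure torus A"
  proof (rule emeasure_eq_AE)
    show "AE x in torus. x \<in> S \<inter> cell \<longleftrightarrow> x \<in> A"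
    proof (rule AE_I')
      show "N' \<inter> cell \<in> null_sets torus"
        using N0 sets_torusI[of N'] by (simp add: null_sets_def)
    qed (use SN \<open>A \<subseteq> cell\<close> in auto)
  qed (use A sets_torusI[of S] in simp_all)
  finally show "emeasure (distr torus torus (tshift h)) A = emeasure torus A"
    using A by (simp add: emeasure_distr tshift_measurable)
qed simp

lemma periodic_tshift: "periodic f \<Longrightarrow> f (tshift h x) = f (x + h)"
  by (simp add: tshift_def periodic_wrap)

lemma torus_measurable_shift:
  assumes "periodic f" "f \<in> torus \<rightarrow>\<^sub>M N" shows "(\<lambda>x. f (x + h)) \<in> torus \<rightarrow>\<^sub>M N"
  using measurable_compose[OF tshift_measurable assms(2), of h] by (simp add: periodic_tshift[OF assms(1)])

lemma torus_integral_shift: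
  fixes f :: "real^3 \<Rightarrow> 'b::{banach, second_countable_topology}"
  assumes "periodic f" "f \<in> borel_measurable torus"
  shows "(LINT x|torus. f (x + h)) = (LINT x|torus. f x)"
    and "integrable torus (\<lambda>x. f (x + h)) \<longleftrightarrow> integrable torus f"
proof -
  have "(LINT x|torus. f x) = (LINT x|distr torus torus (tshift h). f x)" by (simp add: distr_tshift)
  also have "\<dots> = (LINT x|torus. f (x + h))"
    by (subst integral_distr[OF tshift_measurable]) (use assms in \<open>auto simp: periodic_tshift\<close>)
  finally show "(LINT x|torus. f (x + h)) = (LINT x|torus. f x)" by simp
  have "integrable (distr torus torus (tshift h)) f \<longleftrightarrow> integrable torus (\<lambda>x. f (tshift h x))"
    by (rule integrable_distr_eq[OF tshift_measurable assms(2)])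
  then show "integrable torus (\<lambda>x. f (x + h)) \<longleftrightarrow> integrable torus f"
    by (simp add: distr_tshift periodic_tshift[OF assms(1)])
qed

section \<open>Square integrable fields\<close>

lemma LIMSEQ_inverse_Suc: "(\<lambda>n. 1 / real (Suc n)) \<longlonglongrightarrow> 0"
  using LIMSEQ_inverse_real_of_nat by (simp add: inverse_eq_divide)

lemma LIMSEQ_0_le:
  fixes f g :: "nat \<Rightarrow> real"
  assumes "g \<longlonglongrightarrow> 0" "\<And>n. 0 \<le> f n" "\<And>n. f n \<le> g n" shows "f \<longlonglongrightarrow> 0"
  by (rule tendsto_sandwich[OF _ _ tendsto_const assms(1)]) (use assms in auto)

text \<open>Fatou's lemma in the form in which L2 completeness, L3 convergence and the noise use it:
  a bound on the approximants survives the limit.\<close>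

lemma nn_integral_limit_le:
  fixes h :: "nat \<Rightarrow> 'a \<Rightarrow> real"
  assumes [measurable]: "\<And>k. h k \<in> borel_measurable M" and lim: "AE x in M. (\<lambda>k. h k x) \<longlonglongrightarrow> H x"
    and le: "\<forall>\<^sub>F k in sequentially. (\<integral>\<^sup>+x. h k x \<partial>M) \<le> c"
  shows "(\<integral>\<^sup>+x. H x \<partial>M) \<le> c"
proof -
  have "(\<integral>\<^sup>+x. H x \<partial>M) = (\<integral>\<^sup>+x. liminf (\<lambda>k. ennreal (h k x)) \<partial>M)"
    by (rule nn_integral_cong_AE, use lim in eventually_elim)
      (metis lim_imp_Liminf sequentially_bot tendsto_ennrealI)
  also have "\<dots> \<le> liminf (\<lambda>k. \<integral>\<^sup>+x. h k x \<partial>M)" by (rule nn_integral_liminf) measurable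
  also have "\<dots> \<le> liminf (\<lambda>k. c)" by (rule Liminf_mono[OF le])
  also have "\<dots> = c" by (simp add: Liminf_const)
  finally show ?thesis .
qed

lemma cauchy_schwarz_integral:
  fixes f g :: "'a \<Rightarrow> real"
  assumes [measurable]: "f \<in> borel_measurable M" "g \<in> borel_measurable M"
    and f: "integrable M (\<lambda>x. (f x)^2)" and g: "integrable M (\<lambda>x. (g x)^2)"
  shows "integrable M (\<lambda>x. f x * g x)"
    and "(LINT x|M. \<bar>f x * g x\<bar>) \<le> sqrt (LINT x|M. (f x)^2) * sqrt (LINT x|M. (g x)^2)"
    and "\<bar>LINT x|M. f x * g x\<bar> \<le> sqrt (LINT x|M. (f x)^2) * sqrt (LINT x|M. (g x)^2)"
proof -
  have b: "\<bar>f x * g x\<bar> \<le> (f x)^2 + (g x)^2" for x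
  proof -
    have "2 * (\<bar>f x\<bar> * \<bar>g x\<bar>) \<le> (f x)^2 + (g x)^2" "0 \<le> \<bar>f x\<bar> * \<bar>g x\<bar>"
      using sum_squares_bound[of "\<bar>f x\<bar>" "\<bar>g x\<bar>"] by (simp_all add: mult.assoc)
    then show ?thesis unfolding abs_mult by linarith
  qed
  show I: "integrable M (\<lambda>x. f x * g x)"
    by (rule integrable_bound[OF integrable_add[OF f g]])
      (use b in auto)
  let ?I = "LINT x|M. \<bar>f x * g x\<bar>" let ?A = "LINT x|M. (f x)^2" let ?B = "LINT x|M. (g x)^2"
  have "(\<integral>\<^sup>+x. ennreal \<bar>f x\<bar> * ennreal \<bar>g x\<bar> \<partial>M)^2 \<le> (\<integral>\<^sup>+x. (ennreal \<bar>f x\<bar>)^2 \<partial>M) * (\<integral>\<^sup>+x. (ennreal \<bar>g x\<bar>)^2 \<partial>M)"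
    by (rule Cauchy_Schwarz_nn_integral) measurable
  moreover have "(\<integral>\<^sup>+x. ennreal \<bar>f x\<bar> * ennreal \<bar>g x\<bar> \<partial>M) = ennreal ?I"
    by (subst nn_integral_eq_integral[symmetric])
       (use integrable_abs[OF I] in \<open>simp_all add: ennreal_mult abs_mult\<close>)
  moreover have "(\<integral>\<^sup>+x. (ennreal \<bar>f x\<bar>)^2 \<partial>M) = ennreal ?A"
    by (subst nn_integral_eq_integral[symmetric]) (use f in \<open>auto simp: ennreal_power\<close>)
  moreover have "(\<integral>\<^sup>+x. (ennreal \<bar>g x\<bar>)^2 \<partial>M) = ennreal ?B"
    by (subst nn_integral_eq_integral[symmetric]) (use g in \<open>auto simp: ennreal_power\<close>)
  ultimately have "ennreal (?I^2) \<le> ennreal (?A * ?B)"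
    by (simp add: ennreal_power ennreal_mult)
  then have "?I^2 \<le> ?A * ?B" by (simp add: ennreal_le_iff)
  then have "?I \<le> sqrt (?A * ?B)" by (rule real_le_rsqrt)
  then show "?I \<le> sqrt ?A * sqrt ?B" by (simp add: real_sqrt_mult)
  moreover have "\<bar>LINT x|M. f x * g x\<bar> \<le> ?I" by (rule integral_abs_bound)
  ultimately show "\<bar>LINT x|M. f x * g x\<bar> \<le> sqrt ?A * sqrt ?B" by linarith
qed

lemma torus_id_measurable: "(\<lambda>x. x) \<in> borel_measurable torus"
  by (rule borel_imp_torus) simp

lemma continuous_borel: "continuous_on UNIV f \<Longrightarrow> f \<in> borel_measurable borel"
  by (rule borel_measurable_continuous_onI)

lemma compact_bound:
  assumes "compact S" "continuous_on S (g :: 'a::topological_space \<Rightarrow> 'b::real_normed_vector)"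
  obtains B where "\<And>x. x \<in> S \<Longrightarrow> norm (g x) \<le> B"
  using compact_imp_bounded[OF compact_continuous_image[OF assms(2,1)]] unfolding bounded_iff by blast

lemma integrable_torus_continuous:
  fixes f :: "real^3 \<Rightarrow> 'b::{banach, second_countable_topology}"
  assumes "continuous_on UNIV f" shows "integrable torus f"
proof -
  obtain B where "\<And>x. x \<in> cell \<Longrightarrow> norm (f x) \<le> B"
    using compact_bound[OF compact_cbox continuous_on_subset[OF assms subset_UNIV]] by blast
  then show ?thesis
    by (intro torus.integrable_const_bound[of _ B] borel_imp_torus continuous_borel assms AE_I2) auto
qed

lemma periodic_continuous_bounded:
  fixes f :: "real^3 \<Rightarrow> 'b::real_normed_vector"
  assumes "continuous_on UNIV f" "periodic f"
  obtains B where "B > 0" "\<And>x. norm (f x) \<le> B"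
proof -
  obtain B where "\<And>x. x \<in> cell \<Longrightarrow> norm (f x) \<le> B"
    using compact_bound[OF compact_cbox continuous_on_subset[OF assms(1) subset_UNIV]] by blast
  then have "norm (f x) \<le> B" for x
    using periodic_wrap[OF assms(2), of x] wrap_in[of x] hcell_sub_cell by (metis subsetD)
  then have "norm (f x) \<le> \<bar>B\<bar> + 1" for x by (smt (verit))
  then show thesis by (rule that[rotated]) simp
qed

lemma periodic_const: "periodic (\<lambda>x. c)" by (simp add: periodic_def)
lemma periodic_compose: "periodic f \<Longrightarrow> periodic (\<lambda>x. F (f x))" by (simp add: periodic_def)
lemma periodic_compose2: "periodic f \<Longrightarrow> periodic g \<Longrightarrow> periodic (\<lambda>x. F (f x) (g x))" by (simp add: periodic_def)
lemma periodic_sum: "(\<And>i. i \<in> I \<Longrightarrow> periodic (f i)) \<Longrightarrow> periodic (\<lambda>x. \<Sum>i\<in>I. f i x)"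
  by (simp add: periodic_def)
lemma periodic_shift: "periodic f \<Longrightarrow> periodic (\<lambda>x. f (x + h))"
  by (simp add: periodic_def) (metis add.assoc add.commute)

lemma L2D: assumes "f \<in> L2"
  shows "periodic f" "f \<in> borel_measurable torus" "integrable torus (\<lambda>x. (norm (f x))^2)"
  using assms by (auto simp: L2_def)

lemma L2_continuous: "continuous_on UNIV f \<Longrightarrow> periodic f \<Longrightarrow> f \<in> L2"
  unfolding L2_def
  by (auto intro!: borel_imp_torus continuous_borel integrable_torus_continuous continuous_intros)

lemma L2_smooth: "smooth f \<Longrightarrow> periodic f \<Longrightarrow> f \<in> L2"
  by (intro L2_continuous smooth_continuous)

lemma L2_norm_nonneg[simp]: "0 \<le> L2_norm f" by (simp add: L2_norm_def)

lemma L2_norm_sq: "(L2_norm f)^2 = (LINT x|torus. (norm (f x))^2)"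
  by (simp add: L2_norm_def)

lemma L2_add: assumes "f \<in> L2" "g \<in> L2" shows "(\<lambda>x. f x + g x) \<in> L2"
proof -
  note [measurable] = L2D(2)[OF assms(1)] L2D(2)[OF assms(2)]
  have b: "(norm (f x + g x))^2 \<le> 2 * (norm (f x))^2 + 2 * (norm (g x))^2" for x
  proof -
    have "(norm (f x + g x))^2 \<le> (norm (f x) + norm (g x))^2"
      by (intro power_mono norm_triangle_ineq) auto
    also have "\<dots> \<le> 2 * (norm (f x))^2 + 2 * (norm (g x))^2"
      using sum_squares_bound[of "norm (f x)" "norm (g x)"] by (simp add: power2_sum)
    finally show ?thesis .
  qed
  have "integrable torus (\<lambda>x. (norm (f x + g x))^2)"
    by (rule integrable_bound[of _ "\<lambda>x. 2 * (norm (f x))^2 + 2 * (norm (g x))^2"])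
       (use L2D(3)[OF assms(1)] L2D(3)[OF assms(2)] b in auto)
  then show ?thesis using L2D[OF assms(1)] L2D[OF assms(2)] by (auto simp: L2_def intro: periodic_compose2)
qed

lemma L2_scaleR: assumes "f \<in> L2" shows "(\<lambda>x. c *\<^sub>R f x) \<in> L2"
  using L2D[OF assms] by (auto simp: L2_def power_mult_distrib intro: periodic_compose)

lemma L2_diff: assumes "f \<in> L2" "g \<in> L2" shows "(\<lambda>x. f x - g x) \<in> L2"
  using L2_add[OF assms(1) L2_scaleR[OF assms(2), of "-1"]] by simp

lemma L2_nth: fixes f :: "real^3 \<Rightarrow> ('b::euclidean_space)^3" assumes "f \<in> L2" shows "(\<lambda>x. f x $ i) \<in> L2"
proof -
  have m: "(\<lambda>x. f x $ i) \<in> borel_measurable torus"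
    using L2D(2)[OF assms] by (rule borel_measurable_continuous_on[rotated]) (intro continuous_intros)
  have "integrable torus (\<lambda>x. (norm (f x $ i))^2)"
    by (rule integrable_bound[OF L2D(3)[OF assms]])
       (use m in \<open>auto intro!: AE_I2 power_mono Finite_Cartesian_Product.norm_nth_le\<close>)
  then show ?thesis using m L2D[OF assms] by (auto simp: L2_def intro: periodic_compose)
qed

lemma le_one_add_sq: "(a::real) \<le> 1 + a^2"
proof -
  have "0 \<le> (a - 1/2)^2" by simp
  then show ?thesis by (simp add: power2_diff field_simps)
qed

lemma L2_integrable: assumes "f \<in> L2" shows "integrable torus f"
  by (rule integrable_bound[of _ "\<lambda>x. 1 + (norm (f x))^2"])
     (use L2D[OF assms] le_one_add_sq in auto)

lemma L2_cs_norm: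
  assumes "f \<in> L2" "g \<in> L2"
  shows "integrable torus (\<lambda>x. norm (f x) * norm (g x))"
    and "(LINT x|torus. norm (f x) * norm (g x)) \<le> L2_norm f * L2_norm g"
proof -
  note [measurable] = L2D(2)[OF assms(1)] L2D(2)[OF assms(2)]
  note cs = cauchy_schwarz_integral[of "\<lambda>x. norm (f x)" torus "\<lambda>x. norm (g x)", OF _ _ L2D(3)[OF assms(1)] L2D(3)[OF assms(2)]]
  show "integrable torus (\<lambda>x. norm (f x) * norm (g x))" using cs(1) by simp
  show "(LINT x|torus. norm (f x) * norm (g x)) \<le> L2_norm f * L2_norm g"
    using cs(2) by (simp add: L2_norm_def)
qed

lemma L2_cs:
  assumes "f \<in> L2" "g \<in> L2"
  shows "integrable torus (\<lambda>x. f x \<bullet> g x)"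
    and "\<bar>L2_inner f g\<bar> \<le> L2_norm f * L2_norm g"
proof -
  note [measurable] = L2D(2)[OF assms(1)] L2D(2)[OF assms(2)]
  note i = L2_cs_norm(1)[OF assms] and le = L2_cs_norm(2)[OF assms]
  show i2: "integrable torus (\<lambda>x. f x \<bullet> g x)"
    by (rule integrable_bound[OF i]) (auto simp: abs_mult intro: Cauchy_Schwarz_ineq2)
  have "\<bar>L2_inner f g\<bar> \<le> (LINT x|torus. \<bar>f x \<bullet> g x\<bar>)" unfolding L2_inner_def by (rule integral_abs_bound)
  also have "\<dots> \<le> (LINT x|torus. norm (f x) * norm (g x))"
    by (rule integral_mono) (use i i2 Cauchy_Schwarz_ineq2 in auto)
  finally show "\<bar>L2_inner f g\<bar> \<le> L2_norm f * L2_norm g" using le by simp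
qed

lemma L2_norm_triangle:
  assumes "f \<in> L2" "g \<in> L2" shows "L2_norm (\<lambda>x. f x + g x) \<le> L2_norm f + L2_norm g"
proof -
  have "(L2_norm (\<lambda>x. f x + g x))^2 = (LINT x|torus. (norm (f x + g x))^2)" by (rule L2_norm_sq)
  also have "\<dots> \<le> (LINT x|torus. (norm (f x))^2 + 2 * (norm (f x) * norm (g x)) + (norm (g x))^2)"
  proof (rule integral_mono)
    show "integrable torus (\<lambda>x. (norm (f x + g x))^2)" using L2D(3)[OF L2_add[OF assms]] .
    show "integrable torus (\<lambda>x. (norm (f x))^2 + 2 * (norm (f x) * norm (g x)) + (norm (g x))^2)"
      using L2D(3)[OF assms(1)] L2D(3)[OF assms(2)] L2_cs_norm(1)[OF assms] by auto
    show "(norm (f x + g x))^2 \<le> (norm (f x))^2 + 2 * (norm (f x) * norm (g x)) + (norm (g x))^2" for x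
      using power_mono[OF norm_triangle_ineq[of "f x" "g x"], of 2] by (simp add: power2_sum)
  qed
  also have "\<dots> = (L2_norm f)^2 + 2 * (LINT x|torus. norm (f x) * norm (g x)) + (L2_norm g)^2"
    using L2D(3)[OF assms(1)] L2D(3)[OF assms(2)] L2_cs_norm(1)[OF assms] by (simp add: L2_norm_sq)
  also have "\<dots> \<le> (L2_norm f + L2_norm g)^2"
    using L2_cs_norm(2)[OF assms] by (simp add: power2_sum)
  finally show ?thesis by (rule power2_le_imp_le) simp
qed

lemma L2_norm_commute: "L2_norm (\<lambda>x. f x - g x) = L2_norm (\<lambda>x. g x - f x)"
  by (simp add: L2_norm_def norm_minus_commute)

lemma L2_norm_triangle_diff:
  assumes "f \<in> L2" "g \<in> L2" "h \<in> L2"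
  shows "L2_norm (\<lambda>x. f x - h x) \<le> L2_norm (\<lambda>x. f x - g x) + L2_norm (\<lambda>x. g x - h x)"
  using L2_norm_triangle[OF L2_diff[OF assms(1,2)] L2_diff[OF assms(2,3)]] by simp

lemma L2_norm_diff_abs:
  assumes "f \<in> L2" "g \<in> L2"
  shows "\<bar>L2_norm f - L2_norm g\<bar> \<le> L2_norm (\<lambda>x. f x - g x)"
  using L2_norm_triangle[OF L2_diff[OF assms] assms(2)] L2_norm_triangle[OF L2_diff[OF assms(2,1)] assms(1)]
    L2_norm_commute[of f g] by simp

definition tvol :: real where "tvol = measure torus cell"

lemma tvol_nonneg[simp]: "0 \<le> tvol" by (simp add: tvol_def)

lemma measure_torus_cell[simp]: "measure torus cell = tvol"
  by (simp add: tvol_def)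

lemma L1_le_L2: assumes "f \<in> L2" shows "(LINT x|torus. norm (f x)) \<le> sqrt tvol * L2_norm f"
proof -
  have "(\<lambda>x. 1::real) \<in> L2" by (rule L2_continuous) (auto intro: periodic_const)
  from L2_cs_norm(2)[OF this assms] have "(LINT x|torus. norm (f x)) \<le> L2_norm (\<lambda>x. 1::real) * L2_norm f" by simp
  moreover have "L2_norm (\<lambda>x. 1::real) = sqrt tvol" by (simp add: L2_norm_def)
  ultimately show ?thesis by simp
qed

lemma L1_tendsto_L2:
  assumes "\<And>n. F n \<in> L2" "f \<in> L2" "(\<lambda>n. L2_norm (\<lambda>x. F n x - f x)) \<longlonglongrightarrow> 0"
  shows "(\<lambda>n. LINT x|torus. norm (F n x - f x)) \<longlonglongrightarrow> 0"
  by (rule LIMSEQ_0_le[OF _ _ L1_le_L2[OF L2_diff[OF assms(1,2)]]])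
    (use tendsto_mult_left[OF assms(3), of "sqrt tvol"] in auto)

section \<open>Integration by parts on the torus\<close>

lemma smooth_Lipschitz_on:
  fixes f :: "real^3 \<Rightarrow> 'b::real_normed_vector"
  assumes f: "smooth f" and S: "convex S" and b: "\<And>i. \<exists>B. \<forall>x\<in>S. norm (pd i f x) \<le> B"
  obtains L where "L > 0" "\<And>x y. x \<in> S \<Longrightarrow> y \<in> S \<Longrightarrow> norm (f x - f y) \<le> L * norm (x - y)"
proof -
  obtain B where "\<And>i x. x \<in> S \<Longrightarrow> norm (pd i f x) \<le> B i" using b by metis
  then have B: "norm (pd i f x) \<le> \<bar>B i\<bar>" if "x \<in> S" for i x using that by (meson abs_ge_self order_trans)
  define L where "L = 1 + (\<Sum>i\<in>UNIV. \<bar>B i\<bar>)"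
  have "norm (f x - f y) \<le> L * norm (x - y)" if "x \<in> S" "y \<in> S" for x y
  proof (rule differentiable_bound[OF S, of f "\<lambda>x h. \<Sum>i\<in>UNIV. h $ i *\<^sub>R pd i f x"])
    fix x assume x: "x \<in> S"
    show "(f has_derivative (\<lambda>h. \<Sum>i\<in>UNIV. h $ i *\<^sub>R pd i f x)) (at x within S)"
      using smooth_has_derivative[OF f] by (rule has_derivative_at_withinI)
    show "onorm (\<lambda>h. \<Sum>i\<in>UNIV. h $ i *\<^sub>R pd i f x) \<le> L"
    proof (rule onorm_le)
      fix h :: "real^3"
      have "norm (\<Sum>i\<in>UNIV. h $ i *\<^sub>R pd i f x) \<le> (\<Sum>i\<in>UNIV. norm h * \<bar>B i\<bar>)"
        by (intro sum_norm_le) (auto intro!: mult_mono component_le_norm_cart B x)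
      also have "\<dots> \<le> L * norm h" unfolding L_def sum_distrib_left[symmetric] by (simp add: algebra_simps)
      finally show "norm (\<Sum>i\<in>UNIV. h $ i *\<^sub>R pd i f x) \<le> L * norm h" .
    qed
  qed (use that in auto)
  moreover have "L > 0" unfolding L_def by (simp add: add_pos_nonneg sum_nonneg)
  ultimately show thesis using that by blast
qed

lemma smooth_Lipschitz:
  fixes f :: "real^3 \<Rightarrow> 'b::real_normed_vector"
  assumes "smooth f" "periodic f"
  obtains L where "L > 0" "\<And>x y. norm (f x - f y) \<le> L * norm (x - y)"
proof (rule smooth_Lipschitz_on[OF assms(1) convex_UNIV])
  show "\<exists>B. \<forall>x\<in>UNIV. norm (pd i f x) \<le> B" for i
    using periodic_continuous_bounded[OF smooth_continuous[OF smooth_pd[OF assms(1)]] periodic_pd[OF assms(2)], of i] by metis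
qed (use that in auto)

lemma smooth_Lipschitz_compact:
  fixes f :: "real^3 \<Rightarrow> 'b::real_normed_vector"
  assumes "smooth f" "convex S" "compact S"
  obtains L where "L > 0" "\<And>x y. x \<in> S \<Longrightarrow> y \<in> S \<Longrightarrow> norm (f x - f y) \<le> L * norm (x - y)"
proof (rule smooth_Lipschitz_on[OF assms(1,2)])
  show "\<exists>B. \<forall>x\<in>S. norm (pd i f x) \<le> B" for i
    using compact_bound[OF assms(3) smooth_continuous[OF smooth_pd[OF assms(1)]]] by metis
qed (use that in auto)

lemma difference_quotient_LIMSEQ:
  fixes f :: "real^3 \<Rightarrow> real"
  assumes "(f has_derivative D) (at x)"
  shows "(\<lambda>n. (f (x + (1 / real (Suc n)) *\<^sub>R a) - f x) * real (Suc n)) \<longlonglongrightarrow> D a"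
proof -
  have l: "linear D" using assms by (rule has_derivative_linear)
  have "((\<lambda>t. x + t *\<^sub>R a) has_derivative (\<lambda>t. t *\<^sub>R a)) (at 0)"
    by (auto intro!: derivative_eq_intros)
  then have "((\<lambda>t. f (x + t *\<^sub>R a)) has_derivative (\<lambda>t. D (t *\<^sub>R a))) (at 0)"
    by (rule has_derivative_compose) (use assms in simp)
  then have "((\<lambda>t. f (x + t *\<^sub>R a)) has_field_derivative (D a)) (at 0)"
    unfolding has_field_derivative_def by (simp add: linear_cmul[OF l] mult_commute_abs)
  then have "((\<lambda>t. (f (x + t *\<^sub>R a) - f x) / t) \<longlongrightarrow> D a) (at 0)"
    unfolding DERIV_def by simp
  moreover have "filterlim (\<lambda>n. 1 / real (Suc n)) (at 0) sequentially"
    unfolding filterlim_at using LIMSEQ_inverse_real_of_nat by (simp add: inverse_eq_divide)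
  ultimately have "(\<lambda>n. (f (x + (1 / real (Suc n)) *\<^sub>R a) - f x) / (1 / real (Suc n))) \<longlonglongrightarrow> D a"
    by (rule filterlim_compose)
  then show ?thesis by simp
qed

text \<open>Difference quotients of f integrate to zero by translation invariance; they converge to
  the derivative and are dominated by the Lipschitz constant. No boundary of the cell
  enters.\<close>

lemma integral_pd_eq_0:
  fixes f :: "real^3 \<Rightarrow> real"
  assumes "smooth f" "periodic f"
  shows "(LINT x|torus. pd i f x) = 0"
proof -
  obtain L where L: "L > 0" "\<And>x y. norm (f x - f y) \<le> L * norm (x - y)" using smooth_Lipschitz[OF assms] by metis
  let ?a = "axis i 1 :: real^3"
  let ?s = "\<lambda>n x. (f (x + (1 / real (Suc n)) *\<^sub>R ?a) - f x) * real (Suc n)"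
  have [measurable]: "f \<in> borel_measurable torus" using assms smooth_continuous borel_imp_torus continuous_borel by blast
  have i: "integrable torus f" by (intro integrable_torus_continuous smooth_continuous assms)
  have "(\<lambda>n. LINT x|torus. ?s n x) \<longlonglongrightarrow> (LINT x|torus. pd i f x)"
  proof (rule integral_dominated_convergence[where w="\<lambda>x. L"])
    show "pd i f \<in> borel_measurable torus"
      by (intro borel_imp_torus continuous_borel smooth_continuous smooth_pd assms)
    show "?s n \<in> borel_measurable torus" for n
    proof -
      have [measurable]: "(\<lambda>x. f (x + (1 / real (Suc n)) *\<^sub>R ?a)) \<in> borel_measurable torus"
        by (rule torus_measurable_shift[OF assms(2)]) measurable
      show ?thesis by measurable
    qed
    show "integrable torus (\<lambda>x. L)" by simp
    show "AE x in torus. (\<lambda>n. ?s n x) \<longlonglongrightarrow> pd i f x"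
    proof (rule AE_I2)
      fix x
      from difference_quotient_LIMSEQ[OF smooth_has_derivative_frechet[OF assms(1)], of x ?a]
      show "(\<lambda>n. ?s n x) \<longlonglongrightarrow> pd i f x" by (simp add: pd_def)
    qed
    show "AE x in torus. norm (?s n x) \<le> L" for n
    proof (rule AE_I2)
      fix x
      have "norm (?s n x) \<le> (L * (1 / real (Suc n))) * real (Suc n)"
        using L(2)[of "x + (1 / real (Suc n)) *\<^sub>R ?a" x] unfolding norm_mult
        by (intro mult_mono) (auto simp del: of_nat_Suc)
      then show "norm (?s n x) \<le> L" by simp
    qed
  qed
  moreover have "(LINT x|torus. ?s n x) = 0" for n
  proof -
    have "(LINT x|torus. ?s n x) = (LINT x|torus. f (x + (1 / real (Suc n)) *\<^sub>R ?a) - f x) * real (Suc n)"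
      by (rule integral_mult_left_zero)
    also have "(LINT x|torus. f (x + (1 / real (Suc n)) *\<^sub>R ?a) - f x) = 0"
      using torus_integral_shift[OF assms(2), of "(1 / real (Suc n)) *\<^sub>R ?a"] i
      by (subst integral_diff) auto
    finally show ?thesis by simp
  qed
  ultimately show ?thesis by (simp add: tendsto_const_iff)
qed

lemma integration_by_parts:
  fixes f g :: "real^3 \<Rightarrow> real"
  assumes "smooth f" "periodic f" "smooth g" "periodic g"
  shows "(LINT x|torus. f x * pd i g x) = - (LINT x|torus. pd i f x * g x)"
proof -
  have "pd i (\<lambda>x. f x * g x) x = f x * pd i g x + pd i f x * g x" for x
    by (rule pd_bounded_bilinear[OF bounded_bilinear_mult]) (auto intro: smooth_differentiable assms)
  then have "0 = (LINT x|torus. f x * pd i g x + pd i f x * g x)"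
    using integral_pd_eq_0[OF smooth_mult[OF assms(1,3)] periodic_compose2[OF assms(2,4)], of i] by simp
  also have "\<dots> = (LINT x|torus. f x * pd i g x) + (LINT x|torus. pd i f x * g x)"
    by (intro integral_add integrable_torus_continuous smooth_continuous smooth_mult smooth_pd assms)
  finally show ?thesis by simp
qed

section \<open>Convolution forms\<close>

definition conv_form :: "(real^3 \<Rightarrow> real) \<Rightarrow> (real^3 \<Rightarrow> 'b::euclidean_space) \<Rightarrow> (real^3 \<Rightarrow> 'b) \<Rightarrow> real" where
  "conv_form K f g = (LINT x|torus. LINT y|torus. K (x - y) * (f x \<bullet> g y))"

definition bounded_kernel :: "(real^3 \<Rightarrow> real) \<Rightarrow> bool" where
  "bounded_kernel K \<longleftrightarrow> K \<in> borel_measurable borel \<and> (\<exists>C. \<forall>x. \<bar>K x\<bar> \<le> C)"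

lemma bounded_kernelI: "K \<in> borel_measurable borel \<Longrightarrow> (\<And>x. \<bar>K x\<bar> \<le> C) \<Longrightarrow> bounded_kernel K"
  unfolding bounded_kernel_def by blast

lemma torus_diff_measurable[measurable]:
  "(\<lambda>z. fst z - snd z) \<in> borel_measurable (torus \<Otimes>\<^sub>M torus)"
proof -
  have "fst \<in> borel_measurable (torus \<Otimes>\<^sub>M torus)" "snd \<in> borel_measurable (torus \<Otimes>\<^sub>M torus)"
    using measurable_compose[OF measurable_fst torus_id_measurable] measurable_compose[OF measurable_snd torus_id_measurable]
    by auto
  then show ?thesis by (rule borel_measurable_diff)
qed

lemma integrable_tensor:
  fixes f g :: "real^3 \<Rightarrow> real"
  assumes "integrable torus f" "integrable torus g"
  shows "integrable (torus \<Otimes>\<^sub>M torus) (\<lambda>z. f (fst z) * g (snd z))"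
    and "(LINT z|(torus \<Otimes>\<^sub>M torus). f (fst z) * g (snd z)) = (LINT x|torus. f x) * (LINT x|torus. g x)"
proof -
  note [measurable] = borel_measurable_integrable[OF assms(1)] borel_measurable_integrable[OF assms(2)]
  show i: "integrable (torus \<Otimes>\<^sub>M torus) (\<lambda>z. f (fst z) * g (snd z))"
  proof (rule torus2.Fubini_integrable)
    show "(\<lambda>z. f (fst z) * g (snd z)) \<in> borel_measurable (torus \<Otimes>\<^sub>M torus)" by measurable
    show "integrable torus (\<lambda>x. LINT y|torus. norm (f (fst (x, y)) * g (snd (x, y))))"
      using assms by (simp add: abs_mult)
    show "AE x in torus. integrable torus (\<lambda>y. f (fst (x, y)) * g (snd (x, y)))"
      using assms by simp
  qed
  show "(LINT z|(torus \<Otimes>\<^sub>M torus). f (fst z) * g (snd z)) = (LINT x|torus. f x) * (LINT x|torus. g x)"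
    using torus2.integral_fst'[OF i] by simp
qed

lemma inner_tensor_measurable:
  fixes f g :: "real^3 \<Rightarrow> 'b::euclidean_space"
  assumes "f \<in> borel_measurable torus" "g \<in> borel_measurable torus"
  shows "(\<lambda>z. f (fst z) \<bullet> g (snd z)) \<in> borel_measurable (torus \<Otimes>\<^sub>M torus)"
  using measurable_compose[OF measurable_fst assms(1)] measurable_compose[OF measurable_snd assms(2)]
  by (rule borel_measurable_inner)

lemma conv_form_integrable:
  fixes f g :: "real^3 \<Rightarrow> 'b::euclidean_space"
  assumes "bounded_kernel K" "integrable torus f" "integrable torus g"
  shows "integrable (torus \<Otimes>\<^sub>M torus) (\<lambda>z. K (fst z - snd z) * (f (fst z) \<bullet> g (snd z)))"
proof -
  obtain C where C: "\<And>x. \<bar>K x\<bar> \<le> C" and K[measurable]: "K \<in> borel_measurable borel"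
    using assms(1) unfolding bounded_kernel_def by blast
  have m: "(\<lambda>z. f (fst z) \<bullet> g (snd z)) \<in> borel_measurable (torus \<Otimes>\<^sub>M torus)"
    by (rule inner_tensor_measurable) (use assms in auto)
  have i: "integrable (torus \<Otimes>\<^sub>M torus) (\<lambda>z. C * (norm (f (fst z)) * norm (g (snd z))))"
    using integrable_tensor(1)[of "\<lambda>x. norm (f x)" "\<lambda>x. norm (g x)"] assms by simp
  show ?thesis
  proof (rule integrable_bound[OF i])
    show "(\<lambda>z. K (fst z - snd z) * (f (fst z) \<bullet> g (snd z))) \<in> borel_measurable (torus \<Otimes>\<^sub>M torus)"
      by (rule borel_measurable_times[OF measurable_compose[OF torus_diff_measurable K] m])
    show "AE z in torus \<Otimes>\<^sub>M torus. norm (K (fst z - snd z) * (f (fst z) \<bullet> g (snd z)))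
        \<le> norm (C * (norm (f (fst z)) * norm (g (snd z))))"
    proof (rule AE_I2)
      fix z :: "(real^3) \<times> (real^3)"
      have "\<bar>K (fst z - snd z)\<bar> * \<bar>f (fst z) \<bullet> g (snd z)\<bar> \<le> C * (norm (f (fst z)) * norm (g (snd z)))"
        using C[of "fst z - snd z"] by (intro mult_mono C Cauchy_Schwarz_ineq2) auto
      then show "norm (K (fst z - snd z) * (f (fst z) \<bullet> g (snd z))) \<le> norm (C * (norm (f (fst z)) * norm (g (snd z))))"
        using order_trans[OF abs_ge_zero C] by (simp add: abs_mult)
    qed
  qed
qed

lemma conv_form_pair:
  fixes f g :: "real^3 \<Rightarrow> 'b::euclidean_space"
  assumes "bounded_kernel K" "integrable torus f" "integrable torus g"
  shows "conv_form K f g = (LINT z|(torus \<Otimes>\<^sub>M torus). K (fst z - snd z) * (f (fst z) \<bullet> g (snd z)))"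
  using torus2.integral_fst'[OF conv_form_integrable[OF assms]] by (simp add: conv_form_def)

lemma conv_form_bound:
  fixes f g :: "real^3 \<Rightarrow> 'b::euclidean_space"
  assumes "bounded_kernel K" "\<And>x. \<bar>K x\<bar> \<le> C" "integrable torus f" "integrable torus g"
  shows "\<bar>conv_form K f g\<bar> \<le> C * ((LINT x|torus. norm (f x)) * (LINT x|torus. norm (g x)))"
proof -
  note i = conv_form_integrable[OF assms(1,3,4)]
  have i': "integrable (torus \<Otimes>\<^sub>M torus) (\<lambda>z. norm (f (fst z)) * norm (g (snd z)))"
    using integrable_tensor(1)[of "\<lambda>x. norm (f x)" "\<lambda>x. norm (g x)"] assms by simp
  have "\<bar>conv_form K f g\<bar> \<le> (LINT z|(torus \<Otimes>\<^sub>M torus). \<bar>K (fst z - snd z) * (f (fst z) \<bullet> g (snd z))\<bar>)"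
    unfolding conv_form_pair[OF assms(1,3,4)] by (rule integral_abs_bound)
  also have "\<dots> \<le> (LINT z|(torus \<Otimes>\<^sub>M torus). C * (norm (f (fst z)) * norm (g (snd z))))"
  proof (rule integral_mono)
    fix z :: "(real^3) \<times> (real^3)"
    show "\<bar>K (fst z - snd z) * (f (fst z) \<bullet> g (snd z))\<bar> \<le> C * (norm (f (fst z)) * norm (g (snd z)))"
      unfolding abs_mult using order_trans[OF abs_ge_zero assms(2)]
      by (intro mult_mono assms(2) Cauchy_Schwarz_ineq2) auto
  qed (use i i' integrable_abs in auto)
  also have "\<dots> = C * ((LINT x|torus. norm (f x)) * (LINT x|torus. norm (g x)))"
    using integrable_tensor(2)[of "\<lambda>x. norm (f x)" "\<lambda>x. norm (g x)"] assms by simp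
  finally show ?thesis .
qed

lemma conv_form_limit:
  fixes f g :: "real^3 \<Rightarrow> 'b::euclidean_space"
  assumes "\<And>n. bounded_kernel (K n)" "\<And>n x. \<bar>K n x\<bar> \<le> C" "\<And>x. (\<lambda>n. K n x) \<longlonglongrightarrow> L x"
    and "integrable torus f" "integrable torus g"
  shows "(\<lambda>n. conv_form (K n) f g) \<longlonglongrightarrow> conv_form L f g"
proof -
  have [measurable]: "L \<in> borel_measurable borel"
    by (rule borel_measurable_LIMSEQ_real[OF assms(3)]) (use assms(1) in \<open>auto simp: bounded_kernel_def\<close>)
  have "\<bar>L x\<bar> \<le> C" for x
    by (rule tendsto_upperbound[OF tendsto_rabs[OF assms(3)]]) (auto intro!: always_eventually assms(2))
  then have L: "bounded_kernel L" by (intro bounded_kernelI) auto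
  show ?thesis
    unfolding conv_form_pair[OF assms(1,4,5)] conv_form_pair[OF L assms(4,5)]
  proof (rule integral_dominated_convergence[where w="\<lambda>z. C * (norm (f (fst z)) * norm (g (snd z)))"])
    show "integrable (torus \<Otimes>\<^sub>M torus) (\<lambda>z. C * (norm (f (fst z)) * norm (g (snd z))))"
      using integrable_tensor(1)[of "\<lambda>x. norm (f x)" "\<lambda>x. norm (g x)"] assms by simp
    show "(\<lambda>z. L (fst z - snd z) * (f (fst z) \<bullet> g (snd z))) \<in> borel_measurable (torus \<Otimes>\<^sub>M torus)"
      using conv_form_integrable[OF L assms(4,5)] by simp
    show "(\<lambda>z. K n (fst z - snd z) * (f (fst z) \<bullet> g (snd z))) \<in> borel_measurable (torus \<Otimes>\<^sub>M torus)" for n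
      using conv_form_integrable[OF assms(1,4,5)] by simp
    show "AE z in torus \<Otimes>\<^sub>M torus. (\<lambda>n. K n (fst z - snd z) * (f (fst z) \<bullet> g (snd z)))
        \<longlonglongrightarrow> L (fst z - snd z) * (f (fst z) \<bullet> g (snd z))"
      by (intro AE_I2 tendsto_mult assms(3) tendsto_const)
    show "AE z in torus \<Otimes>\<^sub>M torus. norm (K n (fst z - snd z) * (f (fst z) \<bullet> g (snd z)))
        \<le> C * (norm (f (fst z)) * norm (g (snd z)))" for n
    proof (rule AE_I2)
      fix z :: "(real^3) \<times> (real^3)"
      show "norm (K n (fst z - snd z) * (f (fst z) \<bullet> g (snd z))) \<le> C * (norm (f (fst z)) * norm (g (snd z)))"
        unfolding real_norm_def abs_mult using order_trans[OF abs_ge_zero assms(2)]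
        by (intro mult_mono assms(2) Cauchy_Schwarz_ineq2) auto
    qed
  qed
qed

lemma bounded_kernel_add: "bounded_kernel K \<Longrightarrow> bounded_kernel L \<Longrightarrow> bounded_kernel (\<lambda>x. K x + L x)"
  unfolding bounded_kernel_def
proof safe
  fix C D assume "\<forall>x. \<bar>K x\<bar> \<le> C" "\<forall>x. \<bar>L x\<bar> \<le> D"
  then have "\<bar>K x + L x\<bar> \<le> C + D" for x using abs_triangle_ineq[of "K x" "L x"] by (smt (verit))
  then show "\<exists>C. \<forall>x. \<bar>K x + L x\<bar> \<le> C" by blast
qed auto

lemma conv_form_add:
  fixes f g :: "real^3 \<Rightarrow> 'b::euclidean_space"
  assumes "bounded_kernel K" "bounded_kernel L" "integrable torus f" "integrable torus g"
  shows "conv_form (\<lambda>x. K x + L x) f g = conv_form K f g + conv_form L f g"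
  unfolding conv_form_pair[OF assms(1,3,4)] conv_form_pair[OF assms(2,3,4)]
    conv_form_pair[OF bounded_kernel_add[OF assms(1,2)] assms(3,4)]
  using conv_form_integrable[OF assms(1,3,4)] conv_form_integrable[OF assms(2,3,4)]
  by (simp add: distrib_right)

lemma conv_form_cmult: "conv_form (\<lambda>x. a * K x) f g = a * conv_form K f g"
  by (simp add: conv_form_def mult.assoc)

lemma conv_form_diff_left:
  fixes f g :: "real^3 \<Rightarrow> 'b::euclidean_space"
  assumes "bounded_kernel K" "integrable torus f" "integrable torus f'" "integrable torus g"
  shows "conv_form K (\<lambda>x. f x - f' x) g = conv_form K f g - conv_form K f' g"
  unfolding conv_form_pair[OF assms(1,2,4)] conv_form_pair[OF assms(1,3,4)]
    conv_form_pair[OF assms(1) integrable_diff[OF assms(2,3)] assms(4)]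
  using conv_form_integrable[OF assms(1,2,4)] conv_form_integrable[OF assms(1,3,4)]
  by (simp add: inner_diff_left right_diff_distrib)

lemma conv_form_diff_right:
  fixes f g :: "real^3 \<Rightarrow> 'b::euclidean_space"
  assumes "bounded_kernel K" "integrable torus f" "integrable torus g" "integrable torus g'"
  shows "conv_form K f (\<lambda>x. g x - g' x) = conv_form K f g - conv_form K f g'"
  unfolding conv_form_pair[OF assms(1,2,3)] conv_form_pair[OF assms(1,2,4)]
    conv_form_pair[OF assms(1,2) integrable_diff[OF assms(3,4)]]
  using conv_form_integrable[OF assms(1,2,3)] conv_form_integrable[OF assms(1,2,4)]
  by (simp add: inner_diff_right right_diff_distrib)

text \<open>A bounded kernel makes \<open>conv_form\<close> continuous on L1 x L1. L1 is the space
  in which the advection term of an H1 field is controlled below.\<close>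

lemma conv_form_convergence:
  fixes f g :: "real^3 \<Rightarrow> 'b::euclidean_space"
  assumes K: "bounded_kernel K" and f: "\<And>n. integrable torus (f' n)" "integrable torus f"
    and g: "\<And>n. integrable torus (g' n)" "integrable torus g"
    and lf: "(\<lambda>n. LINT x|torus. norm (f' n x - f x)) \<longlonglongrightarrow> 0"
    and lg: "(\<lambda>n. LINT x|torus. norm (g' n x - g x)) \<longlonglongrightarrow> 0"
  shows "(\<lambda>n. conv_form K (f' n) (g' n)) \<longlonglongrightarrow> conv_form K f g"
proof -
  obtain C where C: "\<And>x. \<bar>K x\<bar> \<le> C" using K unfolding bounded_kernel_def by blast
  have C0: "0 \<le> C" using order_trans[OF abs_ge_zero C] .
  let ?a = "\<lambda>n. LINT x|torus. norm (f' n x - f x)" and ?b = "\<lambda>n. LINT x|torus. norm (g' n x - g x)"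
  have G: "(LINT x|torus. norm (g' n x)) \<le> ?b n + (LINT x|torus. norm (g x))" for n
  proof -
    have "(LINT x|torus. norm (g' n x)) \<le> (LINT x|torus. norm (g' n x - g x) + norm (g x))"
      by (rule integral_mono) (use g norm_triangle_sub[of "g' n _" "g _"] in \<open>auto simp: add.commute\<close>)
    then show ?thesis using g by simp
  qed
  have le: "norm (conv_form K (f' n) (g' n) - conv_form K f g)
      \<le> C * (?a n * (?b n + (LINT x|torus. norm (g x)))) + C * ((LINT x|torus. norm (f x)) * ?b n)" for n
  proof -
    have "conv_form K (f' n) (g' n) - conv_form K f g =
        conv_form K (\<lambda>x. f' n x - f x) (g' n) + conv_form K f (\<lambda>x. g' n x - g x)"
      using conv_form_diff_left[OF K f(1)[of n] f(2) g(1)[of n]] conv_form_diff_right[OF K f(2) g(1)[of n] g(2)] by simp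
    moreover have "\<bar>conv_form K (\<lambda>x. f' n x - f x) (g' n)\<bar> \<le> C * (?a n * (?b n + (LINT x|torus. norm (g x))))"
    proof -
      have "\<bar>conv_form K (\<lambda>x. f' n x - f x) (g' n)\<bar> \<le> C * (?a n * (LINT x|torus. norm (g' n x)))"
        by (rule conv_form_bound[OF K C]) (use f g in auto)
      also have "\<dots> \<le> C * (?a n * (?b n + (LINT x|torus. norm (g x))))"
        by (intro mult_left_mono G C0) simp
      finally show ?thesis .
    qed
    moreover have "\<bar>conv_form K f (\<lambda>x. g' n x - g x)\<bar> \<le> C * ((LINT x|torus. norm (f x)) * ?b n)"
      by (rule conv_form_bound[OF K C]) (use f g in auto)
    ultimately show ?thesis by simp
  qed
  have lim: "(\<lambda>n. C * (?a n * (?b n + (LINT x|torus. norm (g x)))) + C * ((LINT x|torus. norm (f x)) * ?b n)) \<longlonglongrightarrow>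
      C * (0 * (0 + (LINT x|torus. norm (g x)))) + C * ((LINT x|torus. norm (f x)) * 0)"
    by (intro tendsto_intros lf lg)
  have "(\<lambda>n. conv_form K (f' n) (g' n) - conv_form K f g) \<longlonglongrightarrow> 0"
  proof (rule Lim_null_comparison)
    show "\<forall>\<^sub>F n in sequentially. norm (conv_form K (f' n) (g' n) - conv_form K f g)
        \<le> C * (?a n * (?b n + (LINT x|torus. norm (g x)))) + C * ((LINT x|torus. norm (f x)) * ?b n)"
      by (rule always_eventually, rule allI, rule le)
  qed (use lim in simp)
  then show ?thesis by (rule LIM_zero_cancel)
qed

lemma integral_kernel_reflect:
  assumes "bounded_kernel K" "periodic K" "\<And>x. K (- x) = K x"
  shows "(LINT y|torus. K (x - y)) = (LINT y|torus. K y)"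
proof -
  have "(LINT y|torus. K (x - y)) = (LINT y|torus. K (y + - x))"
    using assms(3)[of "x - _"] by simp
  also have "\<dots> = (LINT y|torus. K y)"
    by (rule torus_integral_shift[OF assms(2)]) (use assms(1) in \<open>auto simp: bounded_kernel_def intro: borel_imp_torus\<close>)
  finally show ?thesis .
qed

text \<open>Schur's test: |f(x) . f(y)| is at most the mean of |f(x)|^2 and |f(y)|^2, and K
  integrates to its mass in either variable. The constant is exactly the mass of K; the sharp
  multiples of \<epsilon> in the final bounds depend on that.\<close>

lemma conv_form_schur:
  fixes f :: "real^3 \<Rightarrow> 'b::euclidean_space"
  assumes K: "bounded_kernel K" "periodic K" "\<And>x. K (- x) = K x" "\<And>x. 0 \<le> K x" and f: "f \<in> L2"
  shows "\<bar>conv_form K f f\<bar> \<le> (LINT y|torus. K y) * (L2_norm f)^2"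
proof -
  let ?P = "torus \<Otimes>\<^sub>M torus"
  let ?m = "LINT y|torus. K y"
  note fi = L2_integrable[OF f]
  note i = conv_form_integrable[OF K(1) fi fi]
  obtain C where C: "\<And>x. \<bar>K x\<bar> \<le> C" and [measurable]: "K \<in> borel_measurable borel"
    using K(1) unfolding bounded_kernel_def by blast
  have i2: "integrable torus (\<lambda>x. (norm (f x))^2)" by (rule L2D(3)[OF f])
  have i1: "integrable torus (\<lambda>x. 1::real)" by simp
  have ia: "integrable ?P (\<lambda>z. K (fst z - snd z) * (norm (f (fst z)))^2)"
    using conv_form_integrable[OF K(1) i2 i1] by simp
  have ib: "integrable ?P (\<lambda>z. K (fst z - snd z) * (norm (f (snd z)))^2)"
    using conv_form_integrable[OF K(1) i1 i2] by simp
  have ea: "(LINT z|?P. K (fst z - snd z) * (norm (f (fst z)))^2) = ?m * (L2_norm f)^2"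
    using torus2.integral_fst'[OF ia] integral_kernel_reflect[OF K(1,2,3)] by (simp add: L2_norm_sq)
  have eb: "(LINT z|?P. K (fst z - snd z) * (norm (f (snd z)))^2) = ?m * (L2_norm f)^2"
  proof -
    have sh: "(LINT x|torus. K (x - y)) = ?m" for y
      using integral_kernel_reflect[OF K(1,2,3), of y] K(3)[of "_ - y"] by simp
    have "(LINT z|?P. K (fst z - snd z) * (norm (f (snd z)))^2) = (LINT y|torus. LINT x|torus. K (x - y) * (norm (f y))^2)"
      using torus2.integral_snd[of "\<lambda>x y. K (x - y) * (norm (f y))^2"] ib by (simp add: split_beta')
    then show ?thesis by (simp add: sh L2_norm_sq)
  qed
  have "\<bar>conv_form K f f\<bar> \<le> (LINT z|?P. \<bar>K (fst z - snd z) * (f (fst z) \<bullet> f (snd z))\<bar>)"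
    unfolding conv_form_pair[OF K(1) fi fi] by (rule integral_abs_bound)
  also have "\<dots> \<le> (LINT z|?P. (K (fst z - snd z) * (norm (f (fst z)))^2 + K (fst z - snd z) * (norm (f (snd z)))^2) / 2)"
  proof (rule integral_mono)
    fix z :: "(real^3) \<times> (real^3)"
    have "\<bar>f (fst z) \<bullet> f (snd z)\<bar> \<le> norm (f (fst z)) * norm (f (snd z))" by (rule Cauchy_Schwarz_ineq2)
    also have "\<dots> \<le> ((norm (f (fst z)))^2 + (norm (f (snd z)))^2) / 2"
      using sum_squares_bound[of "norm (f (fst z))" "norm (f (snd z))"] by simp
    finally have "K (fst z - snd z) * \<bar>f (fst z) \<bullet> f (snd z)\<bar> \<le> K (fst z - snd z) * (((norm (f (fst z)))^2 + (norm (f (snd z)))^2) / 2)"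
      by (rule mult_left_mono) (rule K(4))
    then show "\<bar>K (fst z - snd z) * (f (fst z) \<bullet> f (snd z))\<bar>
        \<le> (K (fst z - snd z) * (norm (f (fst z)))^2 + K (fst z - snd z) * (norm (f (snd z)))^2) / 2"
      using K(4)[of "fst z - snd z"] by (simp add: abs_mult distrib_left)
  qed (use i ia ib integrable_abs in auto)
  also have "\<dots> = ?m * (L2_norm f)^2" using ia ib ea eb by simp
  finally show ?thesis .
qed

section \<open>Cosine kernels and Fourier coefficients\<close>

lemma integrable_wave:
  fixes f :: "real^3 \<Rightarrow> 'b::euclidean_space"
  assumes "integrable torus f"
  shows "integrable torus (\<lambda>x. cos (k \<bullet> x) *\<^sub>R f x)" "integrable torus (\<lambda>x. sin (k \<bullet> x) *\<^sub>R f x)"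
proof -
  have [measurable]: "(\<lambda>x. cos (k \<bullet> x)) \<in> borel_measurable torus" "(\<lambda>x. sin (k \<bullet> x)) \<in> borel_measurable torus"
    by (intro borel_imp_torus continuous_borel continuous_intros)+
  note [measurable] = borel_measurable_integrable[OF assms]
  show "integrable torus (\<lambda>x. cos (k \<bullet> x) *\<^sub>R f x)"
    by (rule integrable_bound[OF assms])
       (auto simp: intro!: mult_left_le_one_le)
  show "integrable torus (\<lambda>x. sin (k \<bullet> x) *\<^sub>R f x)"
    by (rule integrable_bound[OF assms])
       (auto simp: intro!: mult_left_le_one_le)
qed

definition cosc :: "(real^3 \<Rightarrow> 'b::euclidean_space) \<Rightarrow> real^3 \<Rightarrow> 'b" where
  "cosc f k = (LINT x|torus. cos (k \<bullet> x) *\<^sub>R f x)"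

text \<open>The sine coefficient, unnormalised like \<open>cosc\<close>; unrelated to the cardinal
  sine.\<close>

definition sinc' :: "(real^3 \<Rightarrow> 'b::euclidean_space) \<Rightarrow> real^3 \<Rightarrow> 'b" where
  "sinc' f k = (LINT x|torus. sin (k \<bullet> x) *\<^sub>R f x)"

text \<open>The addition formula for cos (k . x - k . y) separates the variables, so this kernel
  only sees the Fourier coefficients at k.\<close>

lemma conv_form_cos:
  fixes f g :: "real^3 \<Rightarrow> 'b::euclidean_space"
  assumes "integrable torus f" "integrable torus g"
  shows "conv_form (\<lambda>h. cos (k \<bullet> h)) f g = cosc f k \<bullet> cosc g k + sinc' f k \<bullet> sinc' g k"
proof -
  have "(LINT y|torus. cos (k \<bullet> (x - y)) * (f x \<bullet> g y)) =
      (cos (k \<bullet> x) *\<^sub>R f x) \<bullet> cosc g k + (sin (k \<bullet> x) *\<^sub>R f x) \<bullet> sinc' g k" for x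
  proof -
    have "(LINT y|torus. cos (k \<bullet> (x - y)) * (f x \<bullet> g y)) =
        (LINT y|torus. (cos (k \<bullet> x) *\<^sub>R f x) \<bullet> (cos (k \<bullet> y) *\<^sub>R g y) + (sin (k \<bullet> x) *\<^sub>R f x) \<bullet> (sin (k \<bullet> y) *\<^sub>R g y))"
      by (intro integral_cong) (auto simp: inner_diff_right cos_diff algebra_simps)
    also have "\<dots> = (LINT y|torus. (cos (k \<bullet> x) *\<^sub>R f x) \<bullet> (cos (k \<bullet> y) *\<^sub>R g y))
        + (LINT y|torus. (sin (k \<bullet> x) *\<^sub>R f x) \<bullet> (sin (k \<bullet> y) *\<^sub>R g y))"
      by (intro integral_add integrable_inner_right integrable_wave assms)
    also have "\<dots> = (cos (k \<bullet> x) *\<^sub>R f x) \<bullet> cosc g k + (sin (k \<bullet> x) *\<^sub>R f x) \<bullet> sinc' g k"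
      unfolding cosc_def sinc'_def by (intro arg_cong2[where f="(+)"] integral_inner_right integrable_wave assms)
    finally show ?thesis .
  qed
  then have "conv_form (\<lambda>h. cos (k \<bullet> h)) f g =
      (LINT x|torus. (cos (k \<bullet> x) *\<^sub>R f x) \<bullet> cosc g k + (sin (k \<bullet> x) *\<^sub>R f x) \<bullet> sinc' g k)"
    unfolding conv_form_def by simp
  also have "\<dots> = (LINT x|torus. (cos (k \<bullet> x) *\<^sub>R f x) \<bullet> cosc g k) + (LINT x|torus. (sin (k \<bullet> x) *\<^sub>R f x) \<bullet> sinc' g k)"
    by (intro integral_add integrable_inner_left integrable_wave assms)
  also have "\<dots> = cosc f k \<bullet> cosc g k + sinc' f k \<bullet> sinc' g k"
    unfolding cosc_def[of f] sinc'_def[of f]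
    by (intro arg_cong2[where f="(+)"] integral_inner_left integrable_wave assms)
  finally show ?thesis .
qed

section \<open>Trigonometric polynomials\<close>

definition int_vec :: "real^3 \<Rightarrow> bool" where "int_vec k \<longleftrightarrow> (\<forall>i. k $ i \<in> \<int>)"

inductive trig_poly :: "(real^3 \<Rightarrow> real) \<Rightarrow> bool" where
  cos: "int_vec k \<Longrightarrow> trig_poly (\<lambda>x. a * cos (k \<bullet> x))"
| sin: "int_vec k \<Longrightarrow> trig_poly (\<lambda>x. a * sin (k \<bullet> x))"
| add: "trig_poly p \<Longrightarrow> trig_poly q \<Longrightarrow> trig_poly (\<lambda>x. p x + q x)"

text \<open>The kernels that the balance for single wave vectors reaches by linearity.\<close>

inductive cos_poly :: "(real^3 \<Rightarrow> real) \<Rightarrow> bool" where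
  cos: "int_vec k \<Longrightarrow> cos_poly (\<lambda>x. a * cos (k \<bullet> x))"
| add: "cos_poly p \<Longrightarrow> cos_poly q \<Longrightarrow> cos_poly (\<lambda>x. p x + q x)"

lemma int_vec_simps: "int_vec 0" "int_vec k \<Longrightarrow> int_vec l \<Longrightarrow> int_vec (k + l)"
  "int_vec k \<Longrightarrow> int_vec l \<Longrightarrow> int_vec (k - l)"
  by (auto simp: int_vec_def)

lemma trig_poly_const: "trig_poly (\<lambda>x. c)"
  using trig_poly.cos[OF int_vec_simps(1), of c] by simp

lemma trig_poly_cmult: "trig_poly p \<Longrightarrow> trig_poly (\<lambda>x. c * p x)"
proof (induct rule: trig_poly.induct)
  case (cos k a) then show ?case using trig_poly.cos[of k "c * a"] by (simp add: mult.assoc)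
next
  case (sin k a) then show ?case using trig_poly.sin[of k "c * a"] by (simp add: mult.assoc)
next
  case (add p q) then show ?case using trig_poly.add by (fastforce simp: distrib_left)
qed

lemma trig_poly_mult_cos: "trig_poly p \<Longrightarrow> int_vec l \<Longrightarrow> trig_poly (\<lambda>x. p x * cos (l \<bullet> x))"
proof (induct rule: trig_poly.induct)
  case (cos k a)
  have "(\<lambda>x. a * cos (k \<bullet> x) * cos (l \<bullet> x)) = (\<lambda>x. (a/2) * cos ((k - l) \<bullet> x) + (a/2) * cos ((k + l) \<bullet> x))"
    by (auto simp: fun_eq_iff cos_times_cos inner_add_left inner_diff_left field_simps)
  moreover have "trig_poly (\<lambda>x. (a/2) * cos ((k - l) \<bullet> x) + (a/2) * cos ((k + l) \<bullet> x))"
    using cos by (intro trig_poly.intros int_vec_simps)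
  ultimately show ?case by metis
next
  case (sin k a)
  have "(\<lambda>x. a * sin (k \<bullet> x) * cos (l \<bullet> x)) = (\<lambda>x. (a/2) * sin ((k + l) \<bullet> x) + (a/2) * sin ((k - l) \<bullet> x))"
    unfolding mult.assoc sin_times_cos by (simp add: fun_eq_iff inner_add_left inner_diff_left field_simps)
  moreover have "trig_poly (\<lambda>x. (a/2) * sin ((k + l) \<bullet> x) + (a/2) * sin ((k - l) \<bullet> x))"
    using sin by (intro trig_poly.intros int_vec_simps)
  ultimately show ?case by metis
next
  case (add p q) then show ?case using trig_poly.add by (fastforce simp: distrib_right)
qed

lemma trig_poly_mult_sin: "trig_poly p \<Longrightarrow> int_vec l \<Longrightarrow> trig_poly (\<lambda>x. p x * sin (l \<bullet> x))"
proof (induct rule: trig_poly.induct)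
  case (cos k a)
  have "(\<lambda>x. a * cos (k \<bullet> x) * sin (l \<bullet> x)) = (\<lambda>x. (a/2) * sin ((k + l) \<bullet> x) + (- a/2) * sin ((k - l) \<bullet> x))"
    by (auto simp: fun_eq_iff cos_times_sin inner_add_left inner_diff_left field_simps)
  moreover have "trig_poly (\<lambda>x. (a/2) * sin ((k + l) \<bullet> x) + (- a/2) * sin ((k - l) \<bullet> x))"
    using cos by (intro trig_poly.intros int_vec_simps)
  ultimately show ?case by metis
next
  case (sin k a)
  have "(\<lambda>x. a * sin (k \<bullet> x) * sin (l \<bullet> x)) = (\<lambda>x. (a/2) * cos ((k - l) \<bullet> x) + (- a/2) * cos ((k + l) \<bullet> x))"
    by (auto simp: fun_eq_iff sin_times_sin inner_add_left inner_diff_left field_simps)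
  moreover have "trig_poly (\<lambda>x. (a/2) * cos ((k - l) \<bullet> x) + (- a/2) * cos ((k + l) \<bullet> x))"
    using sin by (intro trig_poly.intros int_vec_simps)
  ultimately show ?case by metis
next
  case (add p q) then show ?case using trig_poly.add by (fastforce simp: distrib_right)
qed

lemma trig_poly_mult:
  assumes "trig_poly p" "trig_poly q" shows "trig_poly (\<lambda>x. p x * q x)"
  using assms(2)
proof (induct rule: trig_poly.induct)
  case (cos k a)
  have "trig_poly (\<lambda>x. a * (p x * cos (k \<bullet> x)))" by (intro trig_poly_cmult trig_poly_mult_cos assms cos)
  then show ?case by (simp add: mult.left_commute)
next
  case (sin k a)
  have "trig_poly (\<lambda>x. a * (p x * sin (k \<bullet> x)))" by (intro trig_poly_cmult trig_poly_mult_sin assms sin)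
  then show ?case by (simp add: mult.left_commute)
next
  case (add q r) then show ?case using trig_poly.add by (fastforce simp: distrib_left)
qed

text \<open>Symmetrisation keeps the cosines and annihilates the sines.\<close>

lemma trig_poly_even_part: "trig_poly p \<Longrightarrow> cos_poly (\<lambda>x. (p x + p (- x)) / 2)"
proof (induct rule: trig_poly.induct)
  case (cos k a) then show ?case using cos_poly.cos[of k a] by simp
next
  case (sin k a) then show ?case using cos_poly.cos[of k 0] by simp
next
  case (add p q)
  have "(\<lambda>x. (p x + q x + (p (- x) + q (- x))) / 2) = (\<lambda>x. (p x + p (- x)) / 2 + (q x + q (- x)) / 2)"
    by (auto simp: fun_eq_iff field_simps)
  then show ?case using cos_poly.add[OF add(2,4)] by simp
qed

text \<open>A periodic function is a function on the image of this map, a compact set on which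
  the Stone--Weierstrass theorem applies.\<close>

definition expmap :: "real^3 \<Rightarrow> (real^3) \<times> (real^3)" where
  "expmap x = (\<chi> i. cos (x $ i), \<chi> i. sin (x $ i))"

lemma continuous_expmap: "continuous_on A expmap"
  unfolding expmap_def by (intro continuous_intros)

lemma expmap_eq_imp:
  assumes "expmap x = expmap y" "periodic f" shows "f x = f y"
proof -
  have cs: "sin (x $ i) = sin (y $ i) \<and> cos (x $ i) = cos (y $ i)" for i
    using assms(1) by (simp add: expmap_def vec_eq_iff)
  have "\<exists>n::int. x $ i = y $ i + 2 * pi * n" for i
    using cs[of i] unfolding sin_cos_eq_iff by (auto simp: algebra_simps)
  then obtain n :: "3 \<Rightarrow> int" where n: "\<And>i. x $ i = y $ i + 2 * pi * n i" by metis
  have "x = y + lat (\<chi> i. n i)" by (simp add: vec_eq_iff lat_def n)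
  then show ?thesis using periodic_lat[OF assms(2)] by simp
qed

text \<open>The coordinates of \<open>expmap\<close> are cos x_i and sin x_i, and the product-to-sum
  formulas close the trigonometric polynomials under multiplication.\<close>

lemma trig_poly_polynomial:
  assumes "real_polynomial_function p" shows "trig_poly (\<lambda>x. p (expmap x))"
  using assms
proof (induct rule: real_polynomial_function.induct)
  case (linear f)
  have l: "linear f" using linear bounded_linear.linear by blast
  have "f (expmap x) = (\<Sum>i\<in>UNIV. f (axis i 1, 0) * cos (axis i 1 \<bullet> x) + f (0, axis i 1) * sin (axis i 1 \<bullet> x))" for x
  proof -
    have "expmap x = (\<Sum>i\<in>UNIV. cos (x $ i) *\<^sub>R (axis i 1, 0) + sin (x $ i) *\<^sub>R (0, axis i 1))"
      by (simp add: expmap_def vec_eq_iff sum.distrib[symmetric] fst_sum snd_sum prod_eq_iff axis_def if_distrib[where f="\<lambda>x. _ * x"] cong: if_cong)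
    then have "f (expmap x) = (\<Sum>i\<in>UNIV. cos (x $ i) *\<^sub>R f (axis i 1, 0) + sin (x $ i) *\<^sub>R f (0, axis i 1))"
      by (simp only: linear_sum[OF l] linear_add[OF l] linear_cmul[OF l])
    then show ?thesis by (simp add: inner_axis' mult.commute)
  qed
  moreover have "trig_poly (\<lambda>x. \<Sum>i\<in>I. f (axis i 1, 0) * cos (axis i 1 \<bullet> x) + f (0, axis i 1) * sin (axis i 1 \<bullet> x))"
    if "finite I" for I :: "3 set"
    using that
  proof induct
    case empty show ?case using trig_poly_const[of 0] by simp
  next
    case (insert i I)
    have "int_vec (axis i 1)" by (auto simp: int_vec_def axis_def)
    then have "trig_poly (\<lambda>x. (f (axis i 1, 0) * cos (axis i 1 \<bullet> x) + f (0, axis i 1) * sin (axis i 1 \<bullet> x)) +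
       (\<Sum>i\<in>I. f (axis i 1, 0) * cos (axis i 1 \<bullet> x) + f (0, axis i 1) * sin (axis i 1 \<bullet> x)))"
      by (intro trig_poly.add[OF trig_poly.add[OF trig_poly.cos trig_poly.sin] insert(3)])
    then show ?case using insert by simp
  qed
  ultimately show ?case by simp
next
  case (const c) show ?case by (rule trig_poly_const)
next
  case (add f g) then show ?case using trig_poly.add by blast
next
  case (mult f g) then show ?case using trig_poly_mult by blast
qed

theorem trig_poly_dense:
  fixes f :: "real^3 \<Rightarrow> real"
  assumes f: "continuous_on UNIV f" "periodic f" and e: "e > 0"
  obtains p where "trig_poly p" "\<And>x. \<bar>f x - p x\<bar> < e"
proof -
  let ?S = "expmap ` cell"
  have S: "compact ?S" by (rule compact_continuous_image[OF continuous_expmap]) simp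
  \<comment> \<open>The factorisation of f through \<open>expmap\<close>. Any preimage in the cell
    may be chosen, because points with the same image differ by a lattice vector.\<close>
  define g where "g z = f (SOME x. x \<in> cell \<and> expmap x = z)" for z
  have g: "g (expmap x) = f x" if "x \<in> cell" for x
  proof -
    have "(SOME y. y \<in> cell \<and> expmap y = expmap x) \<in> cell \<and> expmap (SOME y. y \<in> cell \<and> expmap y = expmap x) = expmap x"
      by (rule someI[of _ x]) (use that in simp)
    then show ?thesis unfolding g_def using expmap_eq_imp[OF _ f(2)] by blast
  qed
  \<comment> \<open>On the compact cell \<open>expmap\<close> is a closed map, so images of the
    closed sets f^-1(B) are closed. This is why continuity is tested on closed sets.\<close>
  have "continuous_on ?S g"
    unfolding continuous_on_closed_invariant
  proof (intro allI impI)
    fix B :: "real set" assume B: "closed B"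
    let ?A = "expmap ` (cell \<inter> f -` B)"
    have "closed (cell \<inter> f -` B)"
      by (rule continuous_closed_preimage[OF continuous_on_subset[OF f(1)]]) (use B closed_cbox in auto)
    then have "compact (cell \<inter> f -` B)" by (metis compact_Int_closed compact_cbox inf_left_idem)
    then have "closed ?A" by (intro compact_imp_closed compact_continuous_image[OF continuous_expmap])
    moreover have "?A \<inter> ?S = g -` B \<inter> ?S" using g by auto
    ultimately show "\<exists>A. closed A \<and> A \<inter> ?S = g -` B \<inter> ?S" by blast
  qed
  then obtain p where p: "real_polynomial_function p" "\<And>z. z \<in> ?S \<Longrightarrow> \<bar>g z - p z\<bar> < e"
    using Stone_Weierstrass_real_polynomial_function[OF S _ e] by blast
  have "\<bar>f x - p (expmap x)\<bar> < e" for x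
  proof -
    have "wrap x \<in> cell" using wrap_in hcell_sub_cell by blast
    moreover have "expmap (wrap x) = expmap x"
      by (rule periodic_wrap[of expmap]) (auto simp: periodic_def expmap_def axis_def vec_eq_iff)
    ultimately show ?thesis using p(2)[OF imageI[of "wrap x"]] g[of "wrap x"] periodic_wrap[OF f(2), of x] by simp
  qed
  then show thesis using that trig_poly_polynomial[OF p(1)] by blast
qed

lemma cos_poly_kernel: "cos_poly p \<Longrightarrow> bounded_kernel p \<and> continuous_on UNIV p \<and> periodic p \<and> (\<forall>x. p (- x) = p x)"
proof (induct rule: cos_poly.induct)
  case (cos k a)
  have "periodic (\<lambda>x. a * cos (k \<bullet> x))"
  proof -
    have "cos (k \<bullet> x + k $ i * (2 * pi)) = cos (k \<bullet> x)" for x i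
    proof -
      obtain n :: int where "k $ i = n" using cos unfolding int_vec_def by (metis Ints_cases)
      then show ?thesis
        using cos_int_2pin[of n] sin_int_2pin[of n] by (simp add: cos_add mult.commute mult.left_commute)
    qed
    then show ?thesis by (simp add: periodic_def inner_add_right inner_axis)
  qed
  moreover have "bounded_kernel (\<lambda>x. a * cos (k \<bullet> x))"
    by (rule bounded_kernelI[where C="\<bar>a\<bar>"])
      (auto intro!: continuous_borel continuous_intros simp: abs_mult mult_left_le)
  ultimately show ?case by (auto intro!: continuous_intros)
next
  case (add p q)
  then show ?case by (auto intro: bounded_kernel_add continuous_on_add periodic_compose2)
qed

theorem kernel_approximation:
  fixes K :: "real^3 \<Rightarrow> real"
  assumes "continuous_on UNIV K" "periodic K" "\<And>x. K (- x) = K x"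
  obtains P where "\<And>n. cos_poly (P n)" "\<And>n x. \<bar>P n x - K x\<bar> < 1 / real (Suc n)"
proof -
  have "\<exists>p. cos_poly p \<and> (\<forall>x. \<bar>p x - K x\<bar> < 1 / real (Suc n))" for n
  proof -
    obtain p where p: "trig_poly p" "\<And>x. \<bar>K x - p x\<bar> < 1 / real (Suc n)"
      using trig_poly_dense[OF assms(1,2), of "1 / real (Suc n)"] by auto
    \<comment> \<open>K is even, so the values of p at x and at -x both approximate K x and so does
      their mean.\<close>
    have "\<bar>(p x + p (- x)) / 2 - K x\<bar> < 1 / real (Suc n)" for x
      using p(2)[of x] p(2)[of "- x"] assms(3)[of x] by (simp add: field_simps abs_less_iff)
    then show ?thesis using trig_poly_even_part[OF p(1)] by blast
  qed
  then show thesis using that by metis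
qed

section \<open>The sphere and the divergence theorem on balls\<close>

lemma ball_measurable[measurable]: "ball (x::real^3) r \<in> sets borel" by simp

lemma indicator_ball_measurable[measurable]:
  "(indicator (ball (x::real^3) r) :: _ \<Rightarrow> real) \<in> borel_measurable borel"
  "(indicator (ball (x::real^3) r) :: _ \<Rightarrow> ennreal) \<in> borel_measurable borel"
  by (rule borel_measurable_indicator, simp)+

lemma sgn_measurable[measurable]: "(sgn :: real^3 \<Rightarrow> real^3) \<in> borel_measurable borel"
  unfolding sgn_div_norm[abs_def] by measurable

lemma sets_sphere_measure[simp, measurable_cong]: "sets sphere_measure = sets borel"
  by (simp add: sphere_measure_def)

lemma space_sphere_measure[simp]: "space sphere_measure = UNIV"
  by (simp add: sphere_measure_def)

lemma sphere_density_eq: "(\<lambda>x::real^3. 3 * indicator (ball 0 1) x :: ennreal) = (\<lambda>x. ennreal (3 * indicator (ball 0 1) x))"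
  by (auto simp: fun_eq_iff indicator_def)

lemma integral_sphere_measure:
  fixes F :: "real^3 \<Rightarrow> real"
  assumes [measurable]: "F \<in> borel_measurable borel"
  shows "(LINT n|sphere_measure. F n) = 3 * (LINT y|lborel. indicator (ball 0 1) y * F (sgn y))"
proof -
  have "(LINT n|sphere_measure. F n) = (LINT y|density lborel (\<lambda>x. ennreal (3 * indicator (ball 0 1) x)). F (sgn y))"
    unfolding sphere_measure_def sphere_density_eq by (rule integral_distr) measurable
  also have "\<dots> = (LINT y|lborel. (3 * indicator (ball 0 1) y) *\<^sub>R F (sgn y))"
    by (rule integral_density) auto
  finally show ?thesis by (simp add: mult.assoc)
qed

lemma AE_sphere_measure: "AE n in sphere_measure. norm n = 1"
proof -
  have "AE x in lborel. (x::real^3) \<noteq> 0" by (rule AE_lborel_singleton)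
  then have "AE x in lborel. indicator (ball 0 1) x > (0::ennreal) \<longrightarrow> norm (sgn (x::real^3)) = 1"
    by (rule eventually_mono) (simp add: norm_sgn)
  then have "AE x in density lborel (\<lambda>x. 3 * indicator (ball 0 1) x). norm (sgn (x::real^3)) = 1"
    by (subst AE_density) (auto simp: ennreal_zero_less_mult_iff)
  then show ?thesis
    unfolding sphere_measure_def by (subst AE_distr_iff) auto
qed

lemma finite_sphere_measure: "finite_measure sphere_measure"
proof (rule finite_measureI)
  have "emeasure sphere_measure (space sphere_measure) = emeasure sphere_measure (sphere 0 1)"
    by (rule emeasure_eq_AE) (use AE_sphere_measure in \<open>auto simp: eventually_mono\<close>)
  then show "emeasure sphere_measure (space sphere_measure) \<noteq> \<infinity>"
    by (simp add: emeasure_sphere_measure)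
qed

interpretation sphere: finite_measure sphere_measure by (rule finite_sphere_measure)

lemma lborel_integral_scale:
  fixes f :: "real^3 \<Rightarrow> real"
  assumes [measurable]: "f \<in> borel_measurable borel" and c: "c \<noteq> 0"
  shows "(LINT x|lborel. f x) = \<bar>c\<bar> ^ 3 * (LINT x|lborel. f (c *\<^sub>R x))"
proof -
  have "(LINT x|lborel. f x) = (LINT x|density (distr lborel borel (\<lambda>x::real^3. 0 + c *\<^sub>R x)) (\<lambda>_. ennreal (\<bar>c\<bar> ^ DIM(real^3))). f x)"
    using lborel_affine[OF c, of "0::real^3"] by simp
  also have "\<dots> = (LINT x|distr lborel borel (\<lambda>x::real^3. 0 + c *\<^sub>R x). (\<bar>c\<bar> ^ DIM(real^3)) *\<^sub>R f x)"
    by (rule integral_density) auto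
  also have "\<dots> = (LINT x|lborel. (\<bar>c\<bar> ^ DIM(real^3)) *\<^sub>R f (0 + c *\<^sub>R x))"
    by (rule integral_distr) measurable
  finally show ?thesis by simp
qed

lemma lborel_integral_shift:
  fixes f :: "real^3 \<Rightarrow> real"
  assumes [measurable]: "f \<in> borel_measurable borel"
  shows "(LINT x|lborel. f (x + h)) = (LINT x|lborel. f x)"
proof -
  have "(LINT x|lborel. f x) = (LINT x|distr lborel borel ((+) h). f x)"
    by (simp add: lborel_distr_plus)
  also have "\<dots> = (LINT x|lborel. f (x + h))"
    by (subst integral_distr) (simp_all add: add.commute)
  finally show ?thesis by simp
qed

lemma lborel_integrable_shift:
  fixes f :: "real^3 \<Rightarrow> real"
  assumes [measurable]: "f \<in> borel_measurable borel" and "integrable lborel f"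
  shows "integrable lborel (\<lambda>x. f (x + h))"
proof -
  have "integrable (distr lborel borel ((+) h)) f" using assms by (simp add: lborel_distr_plus)
  then have "integrable lborel (\<lambda>x. f (h + x))" by (subst (asm) integrable_distr_eq) auto
  then show ?thesis by (simp add: add.commute)
qed

lemma sphere_integral_reflect:
  fixes F :: "real^3 \<Rightarrow> real"
  assumes [measurable]: "F \<in> borel_measurable borel"
  shows "(LINT n|sphere_measure. F (- n)) = (LINT n|sphere_measure. F n)"
proof -
  have "(LINT y|lborel. indicator (ball 0 1) y * F (sgn y)) = \<bar>-1\<bar>^3 * (LINT y|lborel. indicator (ball 0 1) ((-1) *\<^sub>R y) * F (sgn ((-1) *\<^sub>R y)))"
    by (rule lborel_integral_scale) auto
  then show ?thesis
    by (simp add: integral_sphere_measure sgn_minus indicator_def)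
qed

lemma emeasure_ball_less_top: "emeasure lborel (ball (x::real^3) R) < \<top>"
  using emeasure_lborel_ball_finite[of x R] by simp

lemma integrable_ball:
  fixes f :: "real^3 \<Rightarrow> real"
  assumes [measurable]: "f \<in> borel_measurable borel" and b: "\<And>x. norm x < R \<Longrightarrow> \<bar>f x\<bar> \<le> B"
  shows "integrable lborel (\<lambda>x. indicator (ball 0 R) x * f x)"
proof (rule integrable_bound[of _ "\<lambda>x. B * indicator (ball 0 R) x"])
  show "integrable lborel (\<lambda>x::real^3. B * indicator (ball 0 R) x :: real)"
    by (intro integrable_mult_right integrable_real_indicator) (auto simp: emeasure_ball_less_top)
  have "norm (indicator (ball 0 R) x * f x) \<le> norm (B * indicator (ball 0 R) x :: real)" for x :: "real^3"
    using b[of x] by (auto simp: indicator_def)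
  then show "AE x::real^3 in lborel. norm (indicator (ball 0 R) x * f x) \<le> norm (B * indicator (ball 0 R) x :: real)"
    by simp
qed auto

lemma indicator_ball_scale: "R > 0 \<Longrightarrow> indicator (ball 0 R) (R *\<^sub>R y :: real^3) = (indicator (ball 0 1) y :: real)"
  by (auto simp: indicator_def dist_norm mult_less_cancel_left2)

text \<open>Polar coordinates for integrands that are constant along rays: the defining property of
  \<open>sphere_measure\<close>, rescaled from the unit ball.\<close>

lemma ball_radial_integral:
  fixes F :: "real^3 \<Rightarrow> real"
  assumes [measurable]: "F \<in> borel_measurable borel" and R: "R > 0"
  shows "(LINT y|lborel. indicator (ball 0 R) y * F (sgn y)) = R ^ 3 / 3 * (LINT n|sphere_measure. F n)"
proof -
  have "(LINT y|lborel. indicator (ball 0 R) y * F (sgn y)) =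
    \<bar>R\<bar>^3 * (LINT y|lborel. indicator (ball 0 R) (R *\<^sub>R y) * F (sgn (R *\<^sub>R y)))"
    by (rule lborel_integral_scale) (use R in auto)
  also have "\<dots> = R^3 * (LINT y|lborel. indicator (ball 0 1) y * F (sgn y))"
    using R by (simp add: indicator_ball_scale sgn_scaleR)
  finally show ?thesis by (simp add: integral_sphere_measure)
qed

lemma measure_ball3: "R \<ge> 0 \<Longrightarrow> measure lborel (ball (0::real^3) R) = 4 / 3 * pi * R ^ 3"
  by (simp add: content_ball unit_ball_vol_3)

section \<open>Surface integrals as limits over thin shells\<close>

definition shell :: "real \<Rightarrow> real \<Rightarrow> real^3 \<Rightarrow> real" where
  "shell R d x = indicator (ball 0 (R + d)) x - indicator (ball 0 R) x"

lemma shell_eq: "d \<ge> 0 \<Longrightarrow> shell R d x = (if R \<le> norm x \<and> norm x < R + d then 1 else 0)"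
  by (auto simp: shell_def indicator_def)

lemma shell_measurable[measurable]: "shell R d \<in> borel_measurable borel"
  unfolding shell_def by measurable

lemma integrable_shell:
  fixes f :: "real^3 \<Rightarrow> real"
  assumes [measurable]: "f \<in> borel_measurable borel" and d: "d \<ge> 0"
    and b: "\<And>x. R \<le> norm x \<Longrightarrow> norm x < R + d \<Longrightarrow> \<bar>f x\<bar> \<le> B"
  shows "integrable lborel (\<lambda>x. shell R d x * f x)"
proof (rule integrable_bound[of _ "\<lambda>x. \<bar>B\<bar> * indicator (ball 0 (R + d)) x"])
  show "integrable lborel (\<lambda>x::real^3. \<bar>B\<bar> * indicator (ball 0 (R + d)) x :: real)"
    by (intro integrable_mult_right integrable_real_indicator) (auto simp: emeasure_ball_less_top)
  have "norm (shell R d x * f x) \<le> norm (\<bar>B\<bar> * indicator (ball 0 (R + d)) x :: real)" for x :: "real^3"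
    using b[of x] d by (auto simp: shell_eq indicator_def)
  then show "AE x::real^3 in lborel. norm (shell R d x * f x) \<le> norm (\<bar>B\<bar> * indicator (ball 0 (R + d)) x :: real)"
    by simp
qed auto

text \<open>On a shell of thickness d the function is within L d of its value at radius R on the
  same ray. Freezing it there leaves an integrand constant along rays, with exact integral ((R +
  d)^3 - R^3) / 3 times the sphere integral; dividing by d gives the factor R^2. Only radial
  regularity of g is involved.\<close>

lemma shell_average:
  fixes g :: "real^3 \<Rightarrow> real"
  assumes [measurable]: "g \<in> borel_measurable borel" and R: "R > 0"
    and L: "0 \<le> L" "\<And>x. R \<le> norm x \<Longrightarrow> norm x \<le> R + 1 \<Longrightarrow> \<bar>g x - g (R *\<^sub>R sgn x)\<bar> \<le> L * (norm x - R)"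
    and B: "\<And>x. norm x \<le> R + 1 \<Longrightarrow> \<bar>g x\<bar> \<le> B"
  shows "(\<lambda>n. real (Suc n) * (LINT x|lborel. shell R (1 / real (Suc n)) x * g x))
    \<longlonglongrightarrow> R^2 * (LINT n|sphere_measure. g (R *\<^sub>R n))"
proof -
  let ?d = "\<lambda>n. 1 / real (Suc n)"
  define F where "F = (\<lambda>n. g (R *\<^sub>R n))"
  have [measurable]: "F \<in> borel_measurable borel" unfolding F_def by measurable
  define V where "V = (LINT n|sphere_measure. F n)"
  have d01: "0 \<le> ?d n" "?d n \<le> 1" for n by auto
  have FB: "\<bar>F (sgn x)\<bar> \<le> B" for x unfolding F_def using R by (intro B) (simp add: norm_sgn)
  have le1: "norm x \<le> R + 1" if "norm x < R + ?d n" for x :: "real^3" and n using that d01(2)[of n] by linarith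
  have if1: "integrable lborel (\<lambda>x. shell R (?d n) x * g x)" for n
    by (rule integrable_shell[of _ _ _ B]) (use d01[of n] in \<open>auto intro!: B le1 simp del: of_nat_Suc\<close>)
  have if2: "integrable lborel (\<lambda>x. shell R (?d n) x * F (sgn x))" for n
    by (rule integrable_shell[of _ _ _ B]) (use FB d01 in auto)
  have if3: "integrable lborel (\<lambda>x. shell R (?d n) x)" for n
    using integrable_shell[of "\<lambda>x. 1" "?d n" R 1] d01 by simp
  have vol: "(LINT x|lborel. shell R (?d n) x) = 4 / 3 * pi * ((R + ?d n)^3 - R^3)" for n
    unfolding shell_def
    by (subst integral_diff)
       (use R d01[of n] in \<open>auto simp: emeasure_ball_less_top measure_ball3 field_simps simp del: of_nat_Suc\<close>)
  have rad: "(LINT x|lborel. shell R (?d n) x * F (sgn x)) = ((R + ?d n)^3 - R^3) / 3 * V" for n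
  proof -
    have ib: "integrable lborel (\<lambda>x. indicator (ball 0 Q) x * F (sgn x))" for Q
      by (rule integrable_ball[of _ _ B]) (use FB in auto)
    have "(LINT x|lborel. shell R (?d n) x * F (sgn x)) =
      (LINT x|lborel. indicator (ball 0 (R + ?d n)) x * F (sgn x)) - (LINT x|lborel. indicator (ball 0 R) x * F (sgn x))"
      unfolding shell_def left_diff_distrib by (rule integral_diff[OF ib ib])
    also have "\<dots> = (R + ?d n)^3 / 3 * V - R^3 / 3 * V"
      unfolding V_def using ball_radial_integral[of F R] ball_radial_integral[of F "R + ?d n"] R d01[of n]
      by (simp del: of_nat_Suc)
    finally show ?thesis by (simp only: left_diff_distrib diff_divide_distrib)
  qed
  have cube: "real (Suc n) * ((R + ?d n)^3 - R^3) = 3 * R^2 + 3 * R * ?d n + (?d n)^2" for n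
  proof -
    have "(R + d)^3 - R^3 = d * (3 * R^2 + 3 * R * d + d^2)" for d :: real
      by (simp add: power2_eq_square power3_eq_cube algebra_simps)
    then show ?thesis by (simp del: of_nat_Suc)
  qed
  have "(\<lambda>n. (3 * R^2 + 3 * R * ?d n + (?d n)^2) / 3 * V) \<longlonglongrightarrow> (3 * R^2 + 3 * R * 0 + 0^2) / 3 * V"
    by (intro tendsto_intros LIMSEQ_inverse_Suc) auto
  then have lim1: "(\<lambda>n. real (Suc n) * (LINT x|lborel. shell R (?d n) x * F (sgn x))) \<longlonglongrightarrow> R^2 * V"
    unfolding rad cube[symmetric] by (simp add: mult.assoc)
  have le: "norm (real (Suc n) * (LINT x|lborel. shell R (?d n) x * g x) - real (Suc n) * (LINT x|lborel. shell R (?d n) x * F (sgn x)))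
      \<le> L * (4 / 3 * pi * ((R + ?d n)^3 - R^3))" for n
  proof -
    have pt: "\<bar>shell R (?d n) x * g x - shell R (?d n) x * F (sgn x)\<bar> \<le> L * ?d n * shell R (?d n) x" for x
    proof (cases "R \<le> norm x \<and> norm x < R + ?d n")
      case True
      then have "\<bar>g x - F (sgn x)\<bar> \<le> L * (norm x - R)" unfolding F_def using le1[of x n] by (intro L) auto
      also have "\<dots> \<le> L * ?d n" using True L(1) by (intro mult_left_mono) auto
      finally show ?thesis using True by (simp add: shell_eq)
    next
      case False
      then have "shell R (?d n) x = 0" using d01(1)[of n] by (simp only: shell_eq if_False)
      then show ?thesis by simp
    qed
    have "norm ((LINT x|lborel. shell R (?d n) x * g x) - (LINT x|lborel. shell R (?d n) x * F (sgn x)))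
        = norm (LINT x|lborel. shell R (?d n) x * g x - shell R (?d n) x * F (sgn x))"
      by (subst integral_diff[OF if1 if2]) simp
    also have "\<dots> \<le> (LINT x|lborel. L * ?d n * shell R (?d n) x)"
      unfolding real_norm_def by (intro integral_abs_bound_integral integrable_diff if1 if2 integrable_mult_right if3 pt)
    also have "\<dots> = ?d n * (L * (4 / 3 * pi * ((R + ?d n)^3 - R^3)))"
      by (simp only: integral_mult_right_zero vol mult_ac)
    finally have "real (Suc n) * norm ((LINT x|lborel. shell R (?d n) x * g x) - (LINT x|lborel. shell R (?d n) x * F (sgn x)))
        \<le> real (Suc n) * (?d n * (L * (4 / 3 * pi * ((R + ?d n)^3 - R^3))))"
      by (rule mult_left_mono) simp
    then show ?thesis by (simp add: right_diff_distrib[symmetric] abs_mult del: of_nat_Suc)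
  qed
  have "(\<lambda>n. L * (4 / 3 * pi * ((R + ?d n)^3 - R^3))) \<longlonglongrightarrow> L * (4 / 3 * pi * ((R + 0)^3 - R^3))"
    by (intro tendsto_intros LIMSEQ_inverse_Suc)
  then have "(\<lambda>n. L * (4 / 3 * pi * ((R + ?d n)^3 - R^3))) \<longlonglongrightarrow> 0" by simp
  from tendsto_add[OF Lim_null_comparison[OF always_eventually[OF allI[OF le]] this] lim1]
  show ?thesis by (simp add: V_def F_def)
qed

lemma norm_axis_real: "norm (axis i c :: real^'n) = \<bar>c\<bar>"
proof -
  have "axis i c = c *\<^sub>R (axis i 1 :: real^'n)" by (simp add: axis_def vec_eq_iff)
  then show ?thesis by simp
qed

text \<open>The difference quotient argument of \<open>integral_pd_eq_0\<close> on the whole space.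
  Derivatives almost everywhere are enough, as the Lipschitz bound dominates; the products with a
  cutoff to which it is applied have kinks on two spheres.\<close>

lemma integral_derivative_compact_support:
  fixes F :: "real^3 \<Rightarrow> real"
  assumes L: "\<And>x y. \<bar>F x - F y\<bar> \<le> L * norm (x - y)" and z: "\<And>x. R \<le> norm x \<Longrightarrow> F x = 0"
    and D: "AE x in lborel. (F has_derivative D x) (at x)" and m: "(\<lambda>x. D x (axis i 1)) \<in> borel_measurable borel"
  shows "(LINT x|lborel. D x (axis i 1)) = 0"
proof -
  let ?a = "axis i 1 :: real^3"
  let ?t = "\<lambda>n. 1 / real (Suc n)"
  let ?s = "\<lambda>n x. (F (x + ?t n *\<^sub>R ?a) - F x) * real (Suc n)"
  have L0: "L \<ge> 0" using L[of "axis 1 1" 0] by (simp add: norm_axis_real)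
  have "continuous_on UNIV F"
  proof (rule continuous_onI)
    fix x e assume "e > (0::real)"
    have "dist (F x') (F x) \<le> e" if "dist x' x < e / (L + 1)" for x'
    proof -
      have "(L + 1) * norm (x' - x) < e" using that L0 by (simp add: pos_less_divide_eq dist_norm mult.commute)
      then have "L * norm (x' - x) \<le> e" using norm_ge_zero[of "x' - x"] unfolding distrib_right by linarith
      then show ?thesis using L[of x' x] by (simp add: dist_real_def)
    qed
    moreover have "e / (L + 1) > 0" using \<open>e > 0\<close> L0 by simp
    ultimately show "\<exists>d>0. \<forall>x'\<in>UNIV. dist x' x < d \<longrightarrow> dist (F x') (F x) \<le> e" by blast
  qed
  then have [measurable]: "F \<in> borel_measurable borel" by (rule continuous_borel)
  have Fb: "\<bar>F x\<bar> \<le> L * (2 * \<bar>R\<bar>)" if "norm x < R" for x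
  proof -
    \<comment> \<open>The point R e_1 is not inside the open ball of radius R, so F vanishes there,
      and its distance to x controls F x.\<close>
    have "\<bar>F x - F (R *\<^sub>R axis 1 1)\<bar> \<le> L * norm (x - R *\<^sub>R axis 1 1)" by (rule L)
    also have "\<dots> \<le> L * (2 * \<bar>R\<bar>)"
      using norm_triangle_ineq4[of x "R *\<^sub>R axis 1 1"] that L0 by (intro mult_left_mono) (auto simp: norm_axis_real)
    moreover have "F (R *\<^sub>R axis 1 1) = 0" by (rule z) (simp add: norm_axis_real)
    ultimately show ?thesis by simp
  qed
  have Fi: "integrable lborel F"
  proof -
    have "integrable lborel (\<lambda>x. indicator (ball 0 R) x * F x)"
      by (rule integrable_ball) (use Fb in auto)
    moreover have "(\<lambda>x. indicator (ball 0 R) x * F x) = F" using z by (auto simp: fun_eq_iff indicator_def)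
    ultimately show ?thesis by simp
  qed
  have "(\<lambda>n. LINT x|lborel. ?s n x) \<longlonglongrightarrow> (LINT x|lborel. D x ?a)"
  proof (rule integral_dominated_convergence[where w="\<lambda>x. indicator (ball 0 (R + 1)) x * L"])
    show "(\<lambda>x. D x ?a) \<in> borel_measurable lborel" using m by simp
    show "?s n \<in> borel_measurable lborel" for n by measurable
    show "integrable lborel (\<lambda>x::real^3. indicator (ball 0 (R + 1)) x * L :: real)"
      by (intro integrable_mult_left integrable_real_indicator) (auto simp: emeasure_ball_less_top)
    show "AE x in lborel. (\<lambda>n. ?s n x) \<longlonglongrightarrow> D x ?a"
      using D by (rule eventually_mono) (rule difference_quotient_LIMSEQ)
    show "AE x in lborel. norm (?s n x) \<le> indicator (ball 0 (R + 1)) x * L" for n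
    proof (rule AE_I2)
      fix x :: "real^3"
      have na: "norm (?t n *\<^sub>R ?a) = ?t n" by (simp add: norm_axis_real)
      show "norm (?s n x) \<le> indicator (ball 0 (R + 1)) x * L"
      proof (cases "norm x < R + 1")
        case True
        have "norm (?s n x) \<le> (L * ?t n) * real (Suc n)"
          using L[of "x + ?t n *\<^sub>R ?a" x] na unfolding norm_mult by (intro mult_mono) (auto simp del: of_nat_Suc)
        then show ?thesis using True by simp
      next
        case False
        have "norm x \<le> norm (x + ?t n *\<^sub>R ?a) + norm (?t n *\<^sub>R ?a)"
          using norm_triangle_ineq4[of "x + ?t n *\<^sub>R ?a" "?t n *\<^sub>R ?a"] by simp
        then have "R \<le> norm (x + ?t n *\<^sub>R ?a)" using False na by (smt (verit) divide_le_eq_1 of_nat_0_le_iff of_nat_Suc)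
        then have "F (x + ?t n *\<^sub>R ?a) = 0" by (rule z)
        moreover have "F x = 0" using z False by auto
        ultimately show ?thesis using L0 by simp
      qed
    qed
  qed
  moreover have "(LINT x|lborel. ?s n x) = 0" for n
  proof -
    have "(LINT x|lborel. ?s n x) = (LINT x|lborel. F (x + ?t n *\<^sub>R ?a) - F x) * real (Suc n)"
      by (rule integral_mult_left_zero)
    also have "(LINT x|lborel. F (x + ?t n *\<^sub>R ?a) - F x) = 0"
      using lborel_integrable_shift[OF _ Fi] Fi lborel_integral_shift[of F]
      by (subst integral_diff) auto
    finally show ?thesis by simp
  qed
  ultimately show ?thesis by (simp add: tendsto_const_iff)
qed

section \<open>Radial cutoffs and the divergence theorem on a ball\<close>

lemma sgn_nth_measurable[measurable]: "(\<lambda>x::real^3. sgn x $ i) \<in> borel_measurable borel"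
proof -
  have "(\<lambda>x::real^3. sgn x \<bullet> axis i 1) \<in> borel_measurable borel" by measurable
  then show ?thesis by (simp add: inner_axis)
qed

text \<open>Equal to 1 on the ball of radius R, to 0 beyond R + 1/N, and affine in the radius
  between. Its gradient is -N \<open>sgn x\<close> on the shell, so it turns volume integrals of
  derivatives into shell averages of the normal component.\<close>

definition cutoff :: "real \<Rightarrow> real \<Rightarrow> real^3 \<Rightarrow> real" where
  "cutoff R N x = max 0 (min 1 (1 - (norm x - R) * N))"

lemma cutoff_bounds: "0 \<le> cutoff R N x" "cutoff R N x \<le> 1" by (auto simp: cutoff_def)

lemma cutoff_Lipschitz: assumes "N > 0" shows "\<bar>cutoff R N x - cutoff R N y\<bar> \<le> N * norm (x - y)"
proof -
  have "\<bar>max 0 (min 1 a) - max 0 (min 1 b)\<bar> \<le> \<bar>a - b\<bar>" for a b :: real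
    by (auto simp: max_def min_def abs_real_def)
  then have "\<bar>cutoff R N x - cutoff R N y\<bar> \<le> \<bar>(1 - (norm x - R) * N) - (1 - (norm y - R) * N)\<bar>"
    unfolding cutoff_def .
  also have "(1 - (norm x - R) * N) - (1 - (norm y - R) * N) = N * (norm y - norm x)"
    by (simp add: algebra_simps)
  also have "\<bar>N * (norm y - norm x)\<bar> = N * \<bar>norm x - norm y\<bar>"
    using assms by (simp add: abs_mult abs_minus_commute)
  also have "\<dots> \<le> N * norm (x - y)" using assms by (intro mult_left_mono norm_triangle_ineq3) auto
  finally show ?thesis .
qed

lemma cutoff_inside: "N > 0 \<Longrightarrow> norm x \<le> R \<Longrightarrow> cutoff R N x = 1"
  by (simp add: cutoff_def mult_nonpos_nonneg)

lemma cutoff_outside: "N > 0 \<Longrightarrow> R + 1 / N \<le> norm x \<Longrightarrow> cutoff R N x = 0"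
proof -
  assume N: "N > 0" "R + 1 / N \<le> norm x"
  then have "1 / N * N \<le> (norm x - R) * N" by (intro mult_right_mono) auto
  then show ?thesis using N by (simp add: cutoff_def)
qed

lemma cutoff_middle: "N > 0 \<Longrightarrow> R \<le> norm x \<Longrightarrow> norm x \<le> R + 1 / N \<Longrightarrow> cutoff R N x = 1 - (norm x - R) * N"
proof -
  assume N: "N > 0" "R \<le> norm x" "norm x \<le> R + 1 / N"
  then have "(norm x - R) * N \<le> 1 / N * N" by (intro mult_right_mono) auto
  then show ?thesis using N by (simp add: cutoff_def)
qed

lemma null_sphere: "sphere (0::real^3) r \<in> null_sets lborel"
  using negligible_sphere[of "0::real^3" r] by (simp add: negligible_iff_null_sets null_sets_completion_iff)

lemma AE_not_sphere: "AE x in lborel. norm (x::real^3) \<noteq> r"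
  using AE_not_in[OF null_sphere[of r]] by (auto elim: eventually_mono)

lemma cutoff_derivative:
  assumes N: "N > 0" and R: "R > 0"
  shows "AE x in lborel. (cutoff R N has_derivative (\<lambda>h. - N * shell R (1 / N) x * (sgn x \<bullet> h))) (at x)"
  using AE_not_sphere[of R] AE_not_sphere[of "R + 1 / N"]
proof eventually_elim
  fix x :: "real^3" assume x: "norm x \<noteq> R" "norm x \<noteq> R + 1 / N"
  have d: "1 / N > 0" using N by simp
  consider "norm x < R" | "R < norm x" "norm x < R + 1 / N" | "R + 1 / N < norm x" using x by linarith
  then show "(cutoff R N has_derivative (\<lambda>h. - N * shell R (1 / N) x * (sgn x \<bullet> h))) (at x)"
  proof cases
    case 1
    have "(cutoff R N has_derivative (\<lambda>h. 0)) (at x)"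
      by (rule has_derivative_transform_within_open[OF has_derivative_const[of 1], where s="ball 0 R"])
         (use 1 N cutoff_inside in auto)
    then show ?thesis using 1 d by (simp add: shell_eq)
  next
    case 3
    have "(cutoff R N has_derivative (\<lambda>h. 0)) (at x)"
      by (rule has_derivative_transform_within_open[OF has_derivative_const[of 0], where s="- cball 0 (R + 1 / N)"])
         (use 3 N cutoff_outside in auto)
    then show ?thesis using 3 d by (simp add: shell_eq)
  next
    case 2
    have "x \<noteq> 0" using 2 R by auto
    then have "((\<lambda>y. 1 - (norm y - R) * N) has_derivative (\<lambda>h. - ((sgn x \<bullet> h) * N))) (at x)"
      using GDERIV_norm unfolding gderiv_def
      by (auto intro!: derivative_eq_intros simp: inner_commute)
    then have "(cutoff R N has_derivative (\<lambda>h. - ((sgn x \<bullet> h) * N))) (at x)"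
      by (rule has_derivative_transform_within_open[where s="ball 0 (R + 1 / N) - cball 0 R"])
         (use 2 N cutoff_middle in \<open>auto intro!: open_Diff\<close>)
    then show ?thesis using 2 d by (simp add: shell_eq mult.commute)
  qed
qed

lemma cutoff_measurable[measurable]: "cutoff R N \<in> borel_measurable borel"
  unfolding cutoff_def by measurable

text \<open>The derivative of the product of cutoff and f integrates to zero; its two Leibniz terms
  are the two sides of the third claim.\<close>

lemma cutoff_by_parts:
  fixes f :: "real^3 \<Rightarrow> real"
  assumes f: "smooth f" and N: "N \<ge> 1" and R: "R > 0"
  shows "integrable lborel (\<lambda>x. cutoff R N x * pd i f x)"
    and "integrable lborel (\<lambda>x. shell R (1 / N) x * (f x * sgn x $ i))"
    and "(LINT x|lborel. cutoff R N x * pd i f x) = N * (LINT x|lborel. shell R (1 / N) x * (f x * sgn x $ i))"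
proof -
  let ?B = "cball 0 (R + 1) :: (real^3) set"
  have N0: "N > 0" and dN: "1 / N \<le> 1" "0 \<le> 1 / N" using N by auto
  have [measurable]: "f \<in> borel_measurable borel" "pd i f \<in> borel_measurable borel"
    using f by (auto intro: continuous_borel smooth_continuous smooth_pd)
  obtain L where L: "L > 0" "\<And>x y. x \<in> ?B \<Longrightarrow> y \<in> ?B \<Longrightarrow> norm (f x - f y) \<le> L * norm (x - y)"
    using smooth_Lipschitz_compact[OF f convex_cball compact_cball] by metis
  have bd: "\<exists>M. \<forall>x\<in>?B. \<bar>h x\<bar> \<le> M" if "smooth h" for h :: "real^3 \<Rightarrow> real"
    using compact_bound[OF compact_cball smooth_continuous[OF that]] by (metis real_norm_def)
  obtain M where M: "\<And>x. x \<in> ?B \<Longrightarrow> \<bar>f x\<bar> \<le> M" using bd[OF f] by blast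
  obtain M' where M': "\<And>x. x \<in> ?B \<Longrightarrow> \<bar>pd i f x\<bar> \<le> M'" using bd[OF smooth_pd[OF f]] by blast
  have M0: "M \<ge> 0" using M[of 0] R by simp
  have out: "cutoff R N x = 0" if "R + 1 \<le> norm x" for x
    by (rule cutoff_outside[OF N0]) (use that dN in linarith)
  have cA: "(\<lambda>x. cutoff R N x * pd i f x) = (\<lambda>x. indicator (ball 0 (R + 1)) x * (cutoff R N x * pd i f x))"
    using out by (auto simp: fun_eq_iff indicator_def)
  show i1: "integrable lborel (\<lambda>x. cutoff R N x * pd i f x)"
    unfolding cA
  proof (rule integrable_ball[of _ _ "1 * M'"])
    fix x :: "real^3" assume "norm x < R + 1"
    then show "\<bar>cutoff R N x * pd i f x\<bar> \<le> 1 * M'"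
      unfolding abs_mult using cutoff_bounds[of R N x] M' by (intro mult_mono) auto
  qed measurable
  show i2: "integrable lborel (\<lambda>x. shell R (1 / N) x * (f x * sgn x $ i))"
  proof (rule integrable_shell[of _ _ _ "M * 1"])
    fix x :: "real^3" assume "R \<le> norm x" "norm x < R + 1 / N"
    moreover have "\<bar>sgn x $ i\<bar> \<le> 1" using component_le_norm_cart[of "sgn x" i] norm_sgn[of x] by (auto split: if_splits)
    ultimately show "\<bar>f x * sgn x $ i\<bar> \<le> M * 1"
      unfolding abs_mult using M M0 dN by (intro mult_mono) auto
  qed (use dN in auto)
  have "(LINT x|lborel. (\<lambda>h. cutoff R N x * frechet_derivative f (at x) h + (- N * shell R (1 / N) x * (sgn x \<bullet> h)) * f x) (axis i 1)) = 0"
  \<comment> \<open>The Lipschitz constant \<open>N * M + L\<close>: the cutoff is N-Lipschitz and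
    at most 1, and f is bounded by M and L-Lipschitz on the ball of radius R + 1, outside which the
    cutoff vanishes because N is at least 1.\<close>
  proof (rule integral_derivative_compact_support[where F="\<lambda>x. cutoff R N x * f x" and R="R + 1" and L="N * M + L"])
    show "\<bar>cutoff R N x * f x - cutoff R N y * f y\<bar> \<le> (N * M + L) * norm (x - y)" for x y
    proof -
      have inner: "\<bar>cutoff R N x * f x - cutoff R N y * f y\<bar> \<le> (N * M + L) * norm (x - y)" if "x \<in> ?B" for x y
      proof (cases "y \<in> ?B")
        case True
        have "\<bar>cutoff R N x * f x - cutoff R N y * f y\<bar> = \<bar>(cutoff R N x - cutoff R N y) * f x + cutoff R N y * (f x - f y)\<bar>"
          by (simp add: algebra_simps)
        also have "\<dots> \<le> \<bar>cutoff R N x - cutoff R N y\<bar> * \<bar>f x\<bar> + \<bar>cutoff R N y\<bar> * \<bar>f x - f y\<bar>"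
          using abs_triangle_ineq by (metis abs_mult)
        also have "\<dots> \<le> (N * norm (x - y)) * M + 1 * (L * norm (x - y))"
          using L(2)[OF that True] L(1) M[OF that] N0 cutoff_bounds[of R N y] cutoff_Lipschitz[OF N0]
          by (intro add_mono mult_mono) auto
        finally show ?thesis by (simp add: algebra_simps)
      next
        case False
        then have z: "cutoff R N y = 0" using out[of y] by auto
        then have "\<bar>cutoff R N x * f x - cutoff R N y * f y\<bar> = \<bar>cutoff R N x - cutoff R N y\<bar> * \<bar>f x\<bar>" by (simp add: abs_mult)
        also have "\<dots> \<le> (N * norm (x - y)) * M"
          using M[OF that] N0 cutoff_Lipschitz[OF N0] by (intro mult_mono) auto
        also have "\<dots> \<le> (N * M + L) * norm (x - y)" using L(1) by (simp add: algebra_simps)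
        finally show ?thesis .
      qed
      consider "x \<in> ?B" | "y \<in> ?B" | "x \<notin> ?B" "y \<notin> ?B" by blast
      then show ?thesis
      proof cases
        case 1 then show ?thesis by (rule inner)
      next
        case 2 then show ?thesis using inner[OF 2, of x] by (simp add: abs_minus_commute norm_minus_commute)
      next
        case 3
        then have "cutoff R N x = 0" "cutoff R N y = 0" using out[of x] out[of y] by auto
        then show ?thesis using N0 M0 L(1) by simp
      qed
    qed
    show "cutoff R N x * f x = 0" if "R + 1 \<le> norm x" for x using out[OF that] by simp
    show "AE x in lborel. ((\<lambda>x. cutoff R N x * f x) has_derivative
      (\<lambda>h. cutoff R N x * frechet_derivative f (at x) h + (- N * shell R (1 / N) x * (sgn x \<bullet> h)) * f x)) (at x)"
      using cutoff_derivative[OF N0 R]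
    proof eventually_elim
      fix x :: "real^3"
      assume "(cutoff R N has_derivative (\<lambda>h. - N * shell R (1 / N) x * (sgn x \<bullet> h))) (at x)"
      from has_derivative_mult[OF this smooth_has_derivative_frechet[OF f, of x]]
      show "((\<lambda>x. cutoff R N x * f x) has_derivative
        (\<lambda>h. cutoff R N x * frechet_derivative f (at x) h + (- N * shell R (1 / N) x * (sgn x \<bullet> h)) * f x)) (at x)" .
    qed
    have "(\<lambda>x. cutoff R N x * pd i f x + - N * shell R (1 / N) x * (sgn x \<bullet> axis i 1) * f x) \<in> borel_measurable borel"
      by measurable
    then show "(\<lambda>x. cutoff R N x * frechet_derivative f (at x) (axis i 1) + - N * shell R (1 / N) x * (sgn x \<bullet> axis i 1) * f x)
        \<in> borel_measurable borel" by (simp add: pd_def)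
  qed
  then have "(LINT x|lborel. cutoff R N x * pd i f x - N * (shell R (1 / N) x * (f x * sgn x $ i))) = 0"
    by (simp add: pd_def[symmetric] inner_axis algebra_simps)
  then show "(LINT x|lborel. cutoff R N x * pd i f x) = N * (LINT x|lborel. shell R (1 / N) x * (f x * sgn x $ i))"
    using i1 i2 by simp
qed

text \<open>Summing \<open>cutoff_by_parts\<close> over the components gives the theorem with the
  ball replaced by a cutoff. As N grows, dominated convergence treats the volume side and
  \<open>shell_average\<close> the surface side.\<close>

theorem gauss_ball:
  fixes W :: "real^3 \<Rightarrow> real^3"
  assumes W: "smooth W" and R: "R > 0"
  shows "(LINT x|lborel. indicator (ball 0 R) x * divergence W x) = R^2 * (LINT n|sphere_measure. W (R *\<^sub>R n) \<bullet> n)"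
proof -
  let ?N = "\<lambda>n. real (Suc n)"
  have cW: "continuous_on UNIV W" by (rule smooth_continuous[OF W])
  have [measurable]: "W \<in> borel_measurable borel" by (rule continuous_borel[OF cW])
  have Wi: "smooth (\<lambda>x. W x $ i)" for i by (rule smooth_vec_nth[OF W])
  have pdi: "pd i (\<lambda>x. W x $ i) x = pd i W x $ i" for i x
    by (rule pd_bounded_linear[OF bounded_linear_vec_nth smooth_differentiable[OF W]])
  have div: "divergence W = (\<lambda>x. \<Sum>i\<in>UNIV. pd i (\<lambda>x. W x $ i) x)" by (auto simp: fun_eq_iff divergence_def pdi)
  have sdiv: "smooth (divergence W)" unfolding div by (intro smooth_sum smooth_pd Wi)
  note [measurable] = continuous_borel[OF smooth_continuous[OF sdiv]]
  have id: "(LINT x|lborel. cutoff R (?N n) x * divergence W x) = ?N n * (LINT x|lborel. shell R (1 / ?N n) x * (W x \<bullet> sgn x))" for n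
  proof -
    have N: "?N n \<ge> 1" by simp
    note * = cutoff_by_parts[OF Wi N R]
    have "(LINT x|lborel. cutoff R (?N n) x * divergence W x) = (\<Sum>i\<in>UNIV. (LINT x|lborel. cutoff R (?N n) x * pd i (\<lambda>x. W x $ i) x))"
      unfolding div sum_distrib_left by (rule integral_sum) (rule *(1))
    also have "\<dots> = ?N n * (\<Sum>i\<in>UNIV. (LINT x|lborel. shell R (1 / ?N n) x * (W x $ i * sgn x $ i)))"
      by (simp only: *(3) sum_distrib_left)
    also have "(\<Sum>i\<in>UNIV. (LINT x|lborel. shell R (1 / ?N n) x * (W x $ i * sgn x $ i))) = (LINT x|lborel. (\<Sum>i\<in>UNIV. shell R (1 / ?N n) x * (W x $ i * sgn x $ i)))"
      by (rule integral_sum[symmetric]) (rule *(2))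
    also have "\<dots> = (LINT x|lborel. shell R (1 / ?N n) x * (W x \<bullet> sgn x))"
      by (simp only: inner_vec_def inner_real_def sum_distrib_left)
    finally show ?thesis .
  qed
  obtain L where L: "L > 0" "\<And>x y. x \<in> cball 0 (R + 1) \<Longrightarrow> y \<in> cball 0 (R + 1) \<Longrightarrow> norm (W x - W y) \<le> L * norm (x - y)"
    using smooth_Lipschitz_compact[OF W convex_cball compact_cball] by metis
  obtain B where B: "\<And>x. x \<in> cball 0 (R + 1) \<Longrightarrow> norm (W x) \<le> B"
    using compact_bound[OF compact_cball smooth_continuous[OF W]] by blast
  have "(\<lambda>n. ?N n * (LINT x|lborel. shell R (1 / ?N n) x * (W x \<bullet> sgn x))) \<longlonglongrightarrow> R^2 * (LINT n|sphere_measure. W (R *\<^sub>R n) \<bullet> sgn (R *\<^sub>R n))"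
  proof (rule shell_average[OF _ R, where L=L and B=B])
    show "0 \<le> L" using L(1) by simp
    show "\<bar>W x \<bullet> sgn x\<bar> \<le> B" if "norm x \<le> R + 1" for x
      using order_trans[OF Cauchy_Schwarz_ineq2 mult_mono[OF B _ order_trans[OF norm_ge_zero B]], of x "sgn x" 1 x] that by (simp add: norm_sgn)
    fix x :: "real^3" assume x: "R \<le> norm x" "norm x \<le> R + 1"
    have x0: "x \<noteq> 0" using x R by auto
    have "x = norm x *\<^sub>R sgn x" using x0 by (simp add: sgn_div_norm)
    then have "x - R *\<^sub>R sgn x = (norm x - R) *\<^sub>R sgn x" by (metis scaleR_left_diff_distrib)
    then have d: "norm (x - R *\<^sub>R sgn x) = norm x - R" using x x0 by (simp add: norm_sgn)
    have "W x \<bullet> sgn x - W (R *\<^sub>R sgn x) \<bullet> sgn (R *\<^sub>R sgn x) = (W x - W (R *\<^sub>R sgn x)) \<bullet> sgn x"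
    proof -
      have "sgn (R *\<^sub>R sgn x) = sgn x" using R x0 by (simp add: sgn_scaleR sgn_div_norm[of "sgn x"] norm_sgn)
      then show ?thesis by (simp only: inner_diff_left)
    qed
    also have "\<bar>\<dots>\<bar> \<le> norm (W x - W (R *\<^sub>R sgn x))"
      using Cauchy_Schwarz_ineq2[of "W x - W (R *\<^sub>R sgn x)" "sgn x"] x0 by (simp add: norm_sgn)
    also have "\<dots> \<le> L * (norm x - R)" using L(2)[of x "R *\<^sub>R sgn x"] x R d by (simp add: norm_sgn)
    finally show "\<bar>W x \<bullet> sgn x - W (R *\<^sub>R sgn x) \<bullet> sgn (R *\<^sub>R sgn x)\<bar> \<le> L * (norm x - R)" .
  qed measurable
  \<comment> \<open>\<open>shell_average\<close> returns the normal as \<open>sgn (R n)\<close>,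
    which is n only on the unit sphere, that is, almost everywhere for
    \<open>sphere_measure\<close>.\<close>
  also have "(LINT n|sphere_measure. W (R *\<^sub>R n) \<bullet> sgn (R *\<^sub>R n)) = (LINT n|sphere_measure. W (R *\<^sub>R n) \<bullet> n)"
  proof (rule integral_cong_AE)
    show "AE n in sphere_measure. W (R *\<^sub>R n) \<bullet> sgn (R *\<^sub>R n) = W (R *\<^sub>R n) \<bullet> n"
      using AE_sphere_measure by (rule eventually_mono) (use R in \<open>simp add: sgn_div_norm\<close>)
  qed measurable
  finally have lim1: "(\<lambda>n. LINT x|lborel. cutoff R (?N n) x * divergence W x) \<longlonglongrightarrow> R^2 * (LINT n|sphere_measure. W (R *\<^sub>R n) \<bullet> n)"
    by (simp only: id)
  obtain B where B: "\<And>x. x \<in> cball 0 (R + 1) \<Longrightarrow> \<bar>divergence W x\<bar> \<le> B"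
    using compact_bound[OF compact_cball smooth_continuous[OF sdiv]] by (metis real_norm_def)
  have "(\<lambda>n. LINT x|lborel. cutoff R (?N n) x * divergence W x) \<longlonglongrightarrow> (LINT x|lborel. indicator (ball 0 R) x * divergence W x)"
  proof (rule integral_dominated_convergence[where w="\<lambda>x. indicator (ball 0 (R + 1)) x * B"])
    show "integrable lborel (\<lambda>x::real^3. indicator (ball 0 (R + 1)) x * B :: real)"
      by (intro integrable_mult_left integrable_real_indicator) (auto simp: emeasure_ball_less_top)
    show "AE x in lborel. (\<lambda>n. cutoff R (?N n) x * divergence W x) \<longlonglongrightarrow> indicator (ball 0 R) x * divergence W x"
      using AE_not_sphere[of R]
    proof eventually_elim
      fix x :: "real^3" assume x: "norm x \<noteq> R"
      have "(\<lambda>n. cutoff R (?N n) x) \<longlonglongrightarrow> indicator (ball 0 R) x"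
      proof (cases "norm x < R")
        case True
        then have "cutoff R (?N n) x = 1" for n by (intro cutoff_inside) auto
        then show ?thesis using True by simp
      next
        case False
        then have "norm x - R > 0" using x by simp
        from order_tendstoD(2)[OF LIMSEQ_inverse_Suc this]
        have "\<forall>\<^sub>F n in sequentially. cutoff R (?N n) x = 0"
          by (rule eventually_mono) (intro cutoff_outside, auto simp del: of_nat_Suc)
        then have "(\<lambda>n. cutoff R (?N n) x) \<longlonglongrightarrow> 0" by (rule tendsto_eventually)
        then show ?thesis using False by simp
      qed
      then show "(\<lambda>n. cutoff R (?N n) x * divergence W x) \<longlonglongrightarrow> indicator (ball 0 R) x * divergence W x"
        by (intro tendsto_intros)
    qed
    show "AE x in lborel. norm (cutoff R (?N n) x * divergence W x) \<le> indicator (ball 0 (R + 1)) x * B" for n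
    proof (rule AE_I2)
      fix x :: "real^3"
      show "norm (cutoff R (?N n) x * divergence W x) \<le> indicator (ball 0 (R + 1)) x * B"
      proof (cases "norm x < R + 1")
        case True
        have "\<bar>cutoff R (?N n) x\<bar> * \<bar>divergence W x\<bar> \<le> 1 * B"
          using True B cutoff_bounds[of R "?N n" x] by (intro mult_mono) auto
        then show ?thesis using True by (simp add: abs_mult)
      next
        case False
        have "1 / ?N n \<le> 1" by simp
        then have "R + 1 / ?N n \<le> norm x" using False by linarith
        then have "cutoff R (?N n) x = 0" by (intro cutoff_outside) auto
        then show ?thesis using False by simp
      qed
    qed
  qed measurable
  from LIMSEQ_unique[OF this lim1] show ?thesis .
qed

section \<open>Radial kernels on the torus\<close>

text \<open>The distance of \<open>h\<close> to the lattice \<open>2\<pi>\<int>\<^sup>3\<close>: \<open>arccos (cos t)\<close> is the distance of \<open>t\<close> to \<open>2\<pi>\<int>\<close>.\<close>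

definition tnorm :: "real^3 \<Rightarrow> real" where "tnorm h = norm (\<chi> i. arccos (cos (h $ i)) :: real^3)"

lemma continuous_tnorm: "continuous_on A tnorm"
proof -
  have c: "continuous_on A (\<lambda>h::real^3. arccos (cos (h $ i)))" for i
    by (rule continuous_on_arccos) (auto intro!: continuous_intros)
  show ?thesis unfolding tnorm_def by (intro continuous_on_norm continuous_on_vec_lambda c)
qed

lemma tnorm_measurable[measurable]: "tnorm \<in> borel_measurable borel"
  by (rule continuous_borel[OF continuous_tnorm])

lemma periodic_tnorm: "periodic tnorm"
proof -
  have "cos ((x + axis i (2 * pi)) $ j) = cos (x $ j)" for x :: "real^3" and i j
    by (cases "i = j") (auto simp: axis_def)
  then show ?thesis by (simp add: periodic_def tnorm_def)
qed

lemma tnorm_minus: "tnorm (- h) = tnorm h" by (simp add: tnorm_def)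

lemma tnorm_eq_norm:
  assumes "\<And>i. \<bar>h $ i\<bar> \<le> pi" shows "tnorm h = norm h"
proof -
  have "arccos (cos (h $ i)) = \<bar>h $ i\<bar>" for i
    using arccos_cos[of "\<bar>h $ i\<bar>"] assms[of i] by (simp add: abs_if split: if_splits)
  then show ?thesis by (simp add: tnorm_def norm_vec_def)
qed

lemma integral_torus_lborel:
  fixes f :: "real^3 \<Rightarrow> real"
  assumes [measurable]: "f \<in> borel_measurable borel"
  shows "(LINT x|torus. f x) = (LINT x|lborel. indicator cell x * f x)"
proof -
  have "(LINT x|torus. f x) = (LINT x|lebesgue. indicator cell x *\<^sub>R f x)"
    by (subst integral_restrict_space) auto
  also have "\<dots> = (LINT x|lborel. indicator cell x *\<^sub>R f x)"
    by (rule integral_completion) measurable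
  finally show ?thesis by simp
qed

text \<open>Centre the cell at x: it becomes the cube of half side pi about x, which contains the
  ball of radius l and on which \<open>tnorm\<close> is the Euclidean norm. This is the origin of
  the restriction l \<le> pi.\<close>

lemma torus_radial_convolution:
  fixes f :: "real^3 \<Rightarrow> real" and k :: "real \<Rightarrow> real"
  assumes f[measurable]: "f \<in> borel_measurable borel" and p: "periodic f"
    and k[measurable]: "k \<in> borel_measurable borel" and k0: "\<And>r. l \<le> r \<Longrightarrow> k r = 0" and l: "l \<le> pi"
  shows "(LINT y|torus. k (tnorm (x - y)) * f y) = (LINT h|lborel. indicator (ball 0 l) h * (k (norm h) * f (x + h)))"
proof -
  let ?p = "(\<chi> i. pi) :: real^3"
  have comm: "tnorm (x - y) = tnorm (y - x)" for y using tnorm_minus[of "x - y"] by simp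
  have per: "periodic (\<lambda>y. k (tnorm (y - x)) * f y)"
    using periodic_shift[OF periodic_tnorm, of "- x"] p by (simp add: periodic_def)
  have m: "(\<lambda>y. k (tnorm (y - x)) * f y) \<in> borel_measurable borel" by measurable
  have "(LINT y|torus. k (tnorm (x - y)) * f y) = (LINT y|torus. k (tnorm (y - x)) * f y)"
    by (simp add: comm)
  also have "\<dots> = (LINT z|torus. k (tnorm (z + (x - ?p) - x)) * f (z + (x - ?p)))"
    using torus_integral_shift(1)[OF per borel_imp_torus[OF m], of "x - ?p"] by simp
  also have "\<dots> = (LINT z|torus. k (tnorm (z - ?p)) * f (x + (z - ?p)))"
    by (simp add: algebra_simps)
  also have "\<dots> = (LINT z|lborel. indicator cell z * (k (tnorm (z - ?p)) * f (x + (z - ?p))))"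
    by (rule integral_torus_lborel) measurable
  also have "\<dots> = (LINT h|lborel. indicator cell (h + ?p) * (k (tnorm (h + ?p - ?p)) * f (x + (h + ?p - ?p))))"
    by (rule lborel_integral_shift[symmetric]) measurable
  also have "\<dots> = (LINT h|lborel. indicator (ball 0 l) h * (k (norm h) * f (x + h)))"
  proof (rule integral_cong[OF refl])
    fix h :: "real^3"
    show "indicator cell (h + ?p) * (k (tnorm (h + ?p - ?p)) * f (x + (h + ?p - ?p))) = indicator (ball 0 l) h * (k (norm h) * f (x + h))"
    proof (cases "\<forall>i. \<bar>h $ i\<bar> \<le> pi")
      case True
      then have "h + ?p \<in> cell" by (simp add: mem_box_cart) (metis abs_le_D1 abs_le_D2 add.commute add_le_cancel_left diff_ge_0_iff_ge diff_minus_eq_add mult_2 uminus_add_conv_diff)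
      moreover have "tnorm h = norm h" by (rule tnorm_eq_norm) (use True in auto)
      ultimately show ?thesis using k0[of "norm h"] by (auto simp: indicator_def)
    next
      case False
      then obtain i where i: "\<bar>h $ i\<bar> > pi" by (auto simp: not_le)
      then have "norm h > pi" using component_le_norm_cart[of h i] by linarith
      then have 1: "h \<notin> ball 0 l" using l by auto
      have "\<not> (0 \<le> h $ i + pi \<and> h $ i + pi \<le> 2 * pi)" using i by linarith
      then have "h + ?p \<notin> cell" by (auto simp: mem_box_cart)
      with 1 show ?thesis by simp
    qed
  qed
  finally show ?thesis .
qed

section \<open>The divergence theorem with a parabolic weight\<close>

lemma smooth_ident: "smooth (\<lambda>x::real^3. x)"
proof (rule smooth_coinduct[of _ "insert (\<lambda>x. x) {\<lambda>x. c | c. True}"])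
  have pc: "pd i (\<lambda>x. c) = (\<lambda>x. 0)" for i and c :: "real^3" by (rule ext, rule pd_eqI[OF has_derivative_const])
  have pid: "pd i (\<lambda>x. x) = (\<lambda>x. axis i 1)" for i by (rule ext, rule pd_eqI[OF has_derivative_ident])
  fix g :: "real^3 \<Rightarrow> real^3" and i x
  assume "g \<in> insert (\<lambda>x. x) {\<lambda>x. c | c. True}"
  then consider "g = (\<lambda>x. x)" | c where "g = (\<lambda>x. c)" by blast
  then show "pd i g \<in> insert (\<lambda>x. x) {\<lambda>x. c | c. True}"
    by cases (simp_all add: pid pc, blast+)
  from \<open>g \<in> insert (\<lambda>x. x) {\<lambda>x. c | c. True}\<close> consider "g = (\<lambda>x. x)" | c where "g = (\<lambda>x. c)" by blast
  then show "g differentiable at x" by cases simp_all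
qed simp

lemma pd_ident: "pd i (\<lambda>x::real^3. x) x = axis i 1" by (rule pd_eqI[OF has_derivative_ident])
lemma divergence_scaleR:
  assumes "smooth c" "smooth W"
  shows "divergence (\<lambda>h. c h *\<^sub>R W h) x = c x * divergence W x + (\<Sum>j\<in>UNIV. pd j c x * W x $ j)"
proof -
  have "pd j (\<lambda>h. c h *\<^sub>R W h) x = c x *\<^sub>R pd j W x + pd j c x *\<^sub>R W x" for j
    by (rule pd_bounded_bilinear[OF bounded_bilinear_scaleR]) (auto intro: smooth_differentiable assms)
  then show ?thesis by (simp add: divergence_def sum.distrib sum_distrib_left)
qed

lemma smooth_parabola: "smooth (\<lambda>h::real^3. l^2 - h \<bullet> h)"
  by (intro smooth_diff smooth_const smooth_inner smooth_ident)

lemma pd_parabola: "pd j (\<lambda>h::real^3. l^2 - h \<bullet> h) x = - 2 * x $ j"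
proof -
  have "((\<lambda>h::real^3. l^2 - h \<bullet> h) has_derivative (\<lambda>h. - (x \<bullet> h + h \<bullet> x))) (at x)"
    by (auto intro!: derivative_eq_intros)
  from pd_eqI[OF this, of j] show ?thesis by (simp add: inner_axis inner_axis')
qed

text \<open>The divergence theorem for (l^2 - |h|^2) W: the weight vanishes on the sphere, so there
  is no surface term, and its gradient -2 h produces the right side.\<close>

lemma gauss_parabola:
  assumes W: "smooth W" and l: "l > 0"
  shows "(LINT h|lborel. indicator (ball 0 l) h * ((l^2 - (norm h)^2) * divergence W h)) =
    (LINT h|lborel. indicator (ball 0 l) h * (2 * (h \<bullet> W h)))"
proof -
  have s: "smooth (\<lambda>h. (l^2 - h \<bullet> h) *\<^sub>R W h)" by (intro smooth_scaleR smooth_parabola W)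
  have d: "divergence (\<lambda>h. (l^2 - h \<bullet> h) *\<^sub>R W h) x = (l^2 - (norm x)^2) * divergence W x - 2 * (x \<bullet> W x)" for x
    unfolding divergence_scaleR[OF smooth_parabola W] pd_parabola
    by (simp add: inner_vec_def[of x "W x"] sum_distrib_left power2_norm_eq_inner mult.assoc sum_negf)
  have Wi: "smooth (\<lambda>x. W x $ i)" for i by (rule smooth_vec_nth[OF W])
  have sd: "continuous_on A (divergence W)" for A
    unfolding divergence_def[abs_def] by (intro continuous_intros smooth_continuous smooth_pd W)
  have cW: "continuous_on A W" for A by (rule smooth_continuous[OF W])
  have ib: "integrable lborel (\<lambda>h. indicator (ball 0 l) h * g h)" if g: "continuous_on UNIV g" for g :: "real^3 \<Rightarrow> real"
  proof -
    obtain B where "\<And>x. x \<in> cball 0 l \<Longrightarrow> norm (g x) \<le> B"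
      using compact_bound[OF compact_cball continuous_on_subset[OF g]] by blast
    then have B: "\<And>x. x \<in> cball 0 l \<Longrightarrow> \<bar>g x\<bar> \<le> B" by simp
    show ?thesis by (rule integrable_ball[OF continuous_borel[OF g], of _ B]) (use B in auto)
  qed
  have "(LINT h|lborel. indicator (ball 0 l) h * divergence (\<lambda>h. (l^2 - h \<bullet> h) *\<^sub>R W h) h)
      = l^2 * (LINT n|sphere_measure. ((l^2 - (l *\<^sub>R n) \<bullet> (l *\<^sub>R n)) *\<^sub>R W (l *\<^sub>R n)) \<bullet> n)"
    by (rule gauss_ball[OF s l])
  also have "(LINT n|sphere_measure. ((l^2 - (l *\<^sub>R n) \<bullet> (l *\<^sub>R n)) *\<^sub>R W (l *\<^sub>R n)) \<bullet> n) = (LINT n|sphere_measure. 0)"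
  proof (rule integral_cong_AE)
    note [measurable] = continuous_borel[OF cW]
    show "(\<lambda>n. ((l^2 - (l *\<^sub>R n) \<bullet> (l *\<^sub>R n)) *\<^sub>R W (l *\<^sub>R n)) \<bullet> n) \<in> borel_measurable sphere_measure" by measurable
    show "AE n in sphere_measure. ((l^2 - (l *\<^sub>R n) \<bullet> (l *\<^sub>R n)) *\<^sub>R W (l *\<^sub>R n)) \<bullet> n = 0"
      using AE_sphere_measure by (rule eventually_mono) (simp add: power2_norm_eq_inner[symmetric] power2_eq_square[symmetric])
  qed simp
  finally have "0 = (LINT h|lborel. indicator (ball 0 l) h * ((l^2 - (norm h)^2) * divergence W h - 2 * (h \<bullet> W h)))"
    by (simp add: d)
  also have "\<dots> = (LINT h|lborel. indicator (ball 0 l) h * ((l^2 - (norm h)^2) * divergence W h)) - (LINT h|lborel. indicator (ball 0 l) h * (2 * (h \<bullet> W h)))"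
    unfolding right_diff_distrib
    by (rule integral_diff; rule ib) (intro continuous_intros sd cW)+
  finally show ?thesis by simp
qed

text \<open>\<open>gauss_parabola\<close> for W(h) = h reads 3 I = 2 (l^2 vol - I), where I is the
  integral sought, so 5 I = 2 l^2 vol.\<close>

lemma integral_ball_parabola:
  assumes "l > 0"
  shows "(LINT h|lborel. indicator (ball (0::real^3) l) h * (l^2 - (norm h)^2)) = 8 / 15 * pi * l ^ 5"
proof -
  let ?I = "\<lambda>g. LINT h|lborel. indicator (ball (0::real^3) l) h * g h :: real"
  have d: "divergence (\<lambda>x. x) h = 3" for h by (simp add: divergence_def pd_ident axis_def)
  have ib: "integrable lborel (\<lambda>h::real^3. indicator (ball 0 l) h * (norm h)^2 :: real)"
    by (rule integrable_ball[of _ _ "l^2"]) (auto intro: power_mono)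
  have i1: "integrable lborel (\<lambda>h::real^3. indicator (ball 0 l) h :: real)"
    by (intro integrable_real_indicator) (auto simp: emeasure_ball_less_top)
  have v: "(LINT h|lborel. indicator (ball (0::real^3) l) h) = 4 / 3 * pi * l ^ 3"
    using assms by (simp add: measure_ball3)
  have "?I (\<lambda>h. (l^2 - (norm h)^2) * 3) = ?I (\<lambda>h. 2 * (h \<bullet> h))"
    using gauss_parabola[OF smooth_ident assms] by (simp add: d)
  moreover have "?I (\<lambda>h. 2 * (h \<bullet> h)) = 2 * ?I (\<lambda>h. (norm h)^2)"
    by (simp add: power2_norm_eq_inner mult.left_commute)
  moreover have "?I (\<lambda>h. (l^2 - (norm h)^2) * 3) = 3 * ?I (\<lambda>h. l^2 - (norm h)^2)"
  proof -
    have "?I (\<lambda>h. (l^2 - (norm h)^2) * 3) = (LINT h|lborel. (indicator (ball (0::real^3) l) h * (l^2 - (norm h)^2)) * 3)"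
      by (simp only: mult.assoc)
    also have "\<dots> = ?I (\<lambda>h. l^2 - (norm h)^2) * 3" by (rule integral_mult_left_zero)
    finally show ?thesis by simp
  qed
  moreover have "?I (\<lambda>h. l^2 - (norm h)^2) = l^2 * (4 / 3 * pi * l ^ 3) - ?I (\<lambda>h. (norm h)^2)"
  proof -
    have "?I (\<lambda>h. l^2 - (norm h)^2) = (LINT h|lborel. l^2 * indicator (ball (0::real^3) l) h - indicator (ball (0::real^3) l) h * (norm h)^2)"
      by (simp add: algebra_simps)
    also have "\<dots> = (LINT h|lborel. l^2 * indicator (ball (0::real^3) l) h) - ?I (\<lambda>h. (norm h)^2)"
      by (rule integral_diff) (use i1 ib in auto)
    finally show ?thesis unfolding integral_mult_right_zero v .
  qed
  ultimately have "5 * ?I (\<lambda>h. l^2 - (norm h)^2) = 2 * (l^2 * (4 / 3 * pi * l ^ 3))" by linarith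
  also have "\<dots> = 8 / 3 * (pi * (l^2 * l ^ 3))" by simp
  also have "l^2 * l ^ 3 = l ^ 5" by (simp flip: power_add)
  finally show ?thesis by linarith
qed

section \<open>Fubini for continuous integrands\<close>

text \<open>The bound on G is required only where \<phi> is nonzero: in the applications \<phi>
  carries the indicator of a bounded set, which cuts an unbounded parameter space down to
  size.\<close>

lemma fubini_torus_bounded:
  fixes G :: "real^3 \<Rightarrow> 'c::euclidean_space \<Rightarrow> real"
  assumes \<mu>: "sigma_finite_measure \<mu>" "sets \<mu> = sets borel"
    and g: "(\<lambda>z. G (fst z) (snd z)) \<in> borel_measurable (borel \<Otimes>\<^sub>M borel)"
    and \<phi>: "integrable \<mu> \<phi>" and C: "\<And>x h. x \<in> cell \<Longrightarrow> \<phi> h \<noteq> (0::real) \<Longrightarrow> \<bar>G x h\<bar> \<le> C"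
  shows "(LINT x|torus. LINT h|\<mu>. \<phi> h * G x h) = (LINT h|\<mu>. \<phi> h * (LINT x|torus. G x h))"
    and "integrable \<mu> (\<lambda>h. \<phi> h * (LINT x|torus. G x h))"
    and "integrable torus (\<lambda>x. LINT h|\<mu>. \<phi> h * G x h)"
proof -
  interpret sigma_finite_measure \<mu> by (rule \<mu>(1))
  interpret P: pair_sigma_finite torus \<mu> ..
  have mG: "(\<lambda>z. G (fst z) (snd z)) \<in> borel_measurable (torus \<Otimes>\<^sub>M \<mu>)"
  proof -
    have "(\<lambda>z. (fst z, snd z)) \<in> torus \<Otimes>\<^sub>M \<mu> \<rightarrow>\<^sub>M borel \<Otimes>\<^sub>M borel"
    proof (rule measurable_Pair)
      show "fst \<in> borel_measurable (torus \<Otimes>\<^sub>M \<mu>)" using measurable_compose[OF measurable_fst torus_id_measurable] .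
      have "snd \<in> torus \<Otimes>\<^sub>M \<mu> \<rightarrow>\<^sub>M \<mu>" by (rule measurable_snd)
      then show "snd \<in> borel_measurable (torus \<Otimes>\<^sub>M \<mu>)" using measurable_cong_sets[OF refl \<mu>(2)] by blast
    qed
    from measurable_compose[OF this g] show ?thesis by simp
  qed
  have [measurable]: "\<phi> \<in> borel_measurable \<mu>" using \<phi>(1) by simp
  have m: "(\<lambda>z. \<phi> (snd z) * G (fst z) (snd z)) \<in> borel_measurable (torus \<Otimes>\<^sub>M \<mu>)"
    by (rule borel_measurable_times[OF _ mG]) measurable
  have ip: "integrable (torus \<Otimes>\<^sub>M \<mu>) (\<lambda>z. C * \<phi> (snd z))"
  proof (rule integrable_mult_right, rule P.Fubini_integrable)
    show "integrable torus (\<lambda>x. LINT y|\<mu>. norm (\<phi> (snd (x, y))))" by simp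
  qed (use \<phi>(1) in auto)
  have i: "integrable (torus \<Otimes>\<^sub>M \<mu>) (\<lambda>z. \<phi> (snd z) * G (fst z) (snd z))"
  proof (rule integrable_bound[OF ip m])
    show "AE z in torus \<Otimes>\<^sub>M \<mu>. norm (\<phi> (snd z) * G (fst z) (snd z)) \<le> norm (C * \<phi> (snd z))"
    proof (rule AE_I2)
      fix z assume "z \<in> space (torus \<Otimes>\<^sub>M \<mu>)"
      then have z: "fst z \<in> cell" by (auto simp: space_pair_measure)
      show "norm (\<phi> (snd z) * G (fst z) (snd z)) \<le> norm (C * \<phi> (snd z))"
      proof (cases "\<phi> (snd z) = 0")
        case False
        have "\<bar>G (fst z) (snd z)\<bar> \<le> C" by (rule C[OF z False])
        then have "\<bar>\<phi> (snd z)\<bar> * \<bar>G (fst z) (snd z)\<bar> \<le> \<bar>\<phi> (snd z)\<bar> * \<bar>C\<bar>" by (intro mult_left_mono) auto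
        then show ?thesis by (simp add: abs_mult mult.commute)
      qed simp
    qed
  qed
  have i': "integrable (torus \<Otimes>\<^sub>M \<mu>) (\<lambda>(x, h). \<phi> h * G x h)" using i by (simp add: split_beta')
  show "(LINT x|torus. LINT h|\<mu>. \<phi> h * G x h) = (LINT h|\<mu>. \<phi> h * (LINT x|torus. G x h))"
    using P.Fubini_integral[OF i'] by simp
  show "integrable \<mu> (\<lambda>h. \<phi> h * (LINT x|torus. G x h))"
    using P.integrable_snd[OF i'] by simp
  show "integrable torus (\<lambda>x. LINT h|\<mu>. \<phi> h * G x h)"
    using P.integrable_fst'[OF i] by simp
qed

lemma fubini_torus:
  fixes G :: "real^3 \<Rightarrow> 'c::euclidean_space \<Rightarrow> real"
  assumes \<mu>: "sigma_finite_measure \<mu>" "sets \<mu> = sets borel"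
    and G: "continuous_on UNIV (\<lambda>z. G (fst z) (snd z))"
    and \<phi>: "integrable \<mu> \<phi>" "\<And>h. \<phi> h \<noteq> (0::real) \<Longrightarrow> norm h \<le> Q"
  shows "(LINT x|torus. LINT h|\<mu>. \<phi> h * G x h) = (LINT h|\<mu>. \<phi> h * (LINT x|torus. G x h))"
    and "integrable \<mu> (\<lambda>h. \<phi> h * (LINT x|torus. G x h))"
    and "integrable torus (\<lambda>x. LINT h|\<mu>. \<phi> h * G x h)"
proof -
  have Gc: "continuous_on A (\<lambda>z. G (fst z) (snd z))" for A by (rule continuous_on_subset[OF G]) simp
  obtain C where C': "\<And>z. z \<in> cell \<times> cball 0 Q \<Longrightarrow> norm (G (fst z) (snd z)) \<le> C"
    using compact_bound[OF compact_Times[OF compact_cbox compact_cball] Gc] by blast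
  have C: "\<bar>G x h\<bar> \<le> C" if "x \<in> cell" "\<phi> h \<noteq> 0" for x h
    using C'[of "(x, h)"] that(1) \<phi>(2)[OF that(2)] by simp
  have g: "(\<lambda>z. G (fst z) (snd z)) \<in> borel_measurable (borel \<Otimes>\<^sub>M borel)"
    unfolding borel_prod by (rule borel_measurable_continuous_onI[OF G])
  note F = fubini_torus_bounded[OF \<mu> g \<phi>(1) C]
  show "(LINT x|torus. LINT h|\<mu>. \<phi> h * G x h) = (LINT h|\<mu>. \<phi> h * (LINT x|torus. G x h))"
    by (rule F(1))
  show "integrable \<mu> (\<lambda>h. \<phi> h * (LINT x|torus. G x h))" by (rule F(2))
  show "integrable torus (\<lambda>x. LINT h|\<mu>. \<phi> h * G x h)" by (rule F(3))
qed

text \<open>\<open>sphere_measure\<close> is a measure on all of \<open>real^3\<close>. The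
  indicator of the closed unit ball, which is 1 almost everywhere, supplies the bounded parameter
  range of \<open>fubini_torus\<close>.\<close>

lemma fubini_sphere:
  fixes G :: "real^3 \<Rightarrow> real^3 \<Rightarrow> real"
  assumes G: "continuous_on UNIV (\<lambda>z. G (fst z) (snd z))"
  shows "(LINT x|torus. LINT n|sphere_measure. G x n) = (LINT n|sphere_measure. LINT x|torus. G x n)"
    and "integrable sphere_measure (\<lambda>n. LINT x|torus. G x n)"
    and "(\<lambda>n. LINT x|torus. G x n) \<in> borel_measurable borel"
proof -
  let ?i = "indicator (cball 0 1) :: real^3 \<Rightarrow> real"
  have mG: "(\<lambda>z. G (fst z) (snd z)) \<in> borel_measurable (borel \<Otimes>\<^sub>M borel)"
    unfolding borel_prod by (rule borel_measurable_continuous_onI[OF G])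
  have swap: "(\<lambda>z. G (snd z) (fst z)) \<in> borel_measurable (borel \<Otimes>\<^sub>M torus)"
  proof -
    have "(\<lambda>z. (snd z, fst z)) \<in> borel \<Otimes>\<^sub>M torus \<rightarrow>\<^sub>M borel \<Otimes>\<^sub>M (borel :: (real^3) measure)"
    proof (rule measurable_Pair)
      show "snd \<in> borel_measurable (borel \<Otimes>\<^sub>M torus)" using measurable_compose[OF measurable_snd torus_id_measurable] .
    qed (rule measurable_fst)
    from measurable_compose[OF this mG] show ?thesis by simp
  qed
  show m: "(\<lambda>n. LINT x|torus. G x n) \<in> borel_measurable borel"
    by (rule torus.borel_measurable_lebesgue_integral) (use swap in \<open>simp add: split_beta'\<close>)
  have ae: "AE n in sphere_measure. ?i n = 1" using AE_sphere_measure by (rule eventually_mono) simp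
  have Gx: "G x \<in> borel_measurable borel" for x
    by (rule continuous_borel) (rule continuous_on_compose2[OF G, of _ "\<lambda>n. (x, n)", simplified], intro continuous_intros)
  have im: "?i \<in> borel_measurable borel" by (rule borel_measurable_indicator) simp
  have 1: "(LINT n|sphere_measure. ?i n * G x n) = (LINT n|sphere_measure. G x n)" for x
    by (rule integral_cong_AE) (use Gx im ae in \<open>auto elim: eventually_mono\<close>)
  have 2: "(LINT n|sphere_measure. ?i n * (LINT x|torus. G x n)) = (LINT n|sphere_measure. LINT x|torus. G x n)"
    by (rule integral_cong_AE) (use m im ae in \<open>auto elim: eventually_mono\<close>)
  note F = fubini_torus[OF sphere.sigma_finite_measure_axioms sets_sphere_measure G, of ?i 1]
  have ii: "integrable sphere_measure ?i" by (intro integrable_real_indicator) (auto simp: sphere.emeasure_finite less_top[symmetric])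
  have iq: "?i h \<noteq> 0 \<Longrightarrow> norm h \<le> 1" for h by (auto simp: indicator_def split: if_splits)
  show "(LINT x|torus. LINT n|sphere_measure. G x n) = (LINT n|sphere_measure. LINT x|torus. G x n)"
    using F(1)[OF ii iq] by (simp add: 1 2)
  show "integrable sphere_measure (\<lambda>n. LINT x|torus. G x n)"
    by (rule integrable_cong_AE_imp[OF F(2)[OF ii iq]]) (use m ae in \<open>auto elim: eventually_mono\<close>)
qed

section \<open>The energy flux of a smooth solenoidal field\<close>

lemma continuous_compose: "continuous_on UNIV f \<Longrightarrow> continuous_on A g \<Longrightarrow> continuous_on A (\<lambda>x. f (g x))"
  by (rule continuous_on_compose2) auto

lemma advect_nth: assumes "smooth v" shows "(grad v x *v v x) $ i = (\<Sum>j\<in>UNIV. v x $ j * pd j v x $ i)"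
  by (simp add: matrix_vector_mult_def grad_eq[OF assms] mult.commute)

lemma smooth_nth_pd: assumes "smooth v" shows "pd j (\<lambda>x. v x $ i) x = pd j v x $ i"
  by (rule pd_bounded_linear[OF bounded_linear_vec_nth smooth_differentiable[OF assms]])

lemma continuous_grad: assumes "smooth v" shows "continuous_on A (grad v)"
proof -
  have "grad v = (\<lambda>x. \<chi> i j. pd j v x $ i)" by (simp add: fun_eq_iff vec_eq_iff grad_eq[OF assms])
  moreover have "continuous_on A (\<lambda>x. pd j v x $ i)" for i j
    by (rule continuous_on_component[OF smooth_continuous[OF smooth_pd[OF assms]]])
  ultimately show ?thesis by (simp add: continuous_on_vec_lambda)
qed

lemma periodic_grad: assumes "smooth v" "periodic v" shows "periodic (grad v)"
  using periodic_pd[OF assms(2)] by (simp add: periodic_def vec_eq_iff grad_eq[OF assms(1)])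

lemma continuous_matrix_vector:
  assumes "continuous_on A G" "continuous_on A v" shows "continuous_on A (\<lambda>x. G x *v (v x :: real^3) :: real^3)"
  unfolding matrix_vector_mult_def by (intro continuous_intros assms)

text \<open>Integration by parts moves the derivative to v(x + h). Where it falls on the advecting
  factor instead, the sum over j is div v = 0.\<close>

lemma advect_by_parts:
  assumes v: "smooth v" "periodic v" "\<And>x. divergence v x = 0"
  shows "(LINT x|torus. (grad v x *v v x) \<bullet> v (x + h)) = - (LINT x|torus. v x \<bullet> (\<Sum>j\<in>UNIV. v x $ j *\<^sub>R pd j v (x + h)))"
proof -
  let ?f = "\<lambda>i j x. v x $ j * v (x + h) $ i" and ?g = "\<lambda>i x. v x $ i"
  note sh = smooth_translate(1)[OF v(1), of h] and ph = periodic_shift[OF v(2), of h]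
  have sf: "smooth (?f i j)" and pf: "periodic (?f i j)" for i j
    by (intro smooth_mult smooth_vec_nth v sh periodic_compose2[OF v(2) ph])+
  have sg: "smooth (?g i)" and pg: "periodic (?g i)" for i
    by (rule smooth_vec_nth[OF v(1)], rule periodic_compose[OF v(2)])
  have pdf: "pd j (?f i j) x = v x $ j * pd j v (x + h) $ i + pd j v x $ j * v (x + h) $ i" for i j x
  proof -
    have "pd j (?f i j) x = v x $ j * pd j (\<lambda>x. v (x + h) $ i) x + pd j (\<lambda>x. v x $ j) x * v (x + h) $ i"
      by (rule pd_bounded_bilinear[OF bounded_bilinear_mult])
        (intro smooth_differentiable smooth_vec_nth v sh)+
    then show ?thesis by (simp only: smooth_nth_pd[OF sh] smooth_nth_pd[OF v(1)] pd_translate[OF v(1)])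
  qed
  have i1: "integrable torus (\<lambda>x. ?f i j x * pd j (?g i) x)" and i2: "integrable torus (\<lambda>x. pd j (?f i j) x * ?g i x)" for i j
    by (intro integrable_torus_continuous smooth_continuous smooth_mult sf sg smooth_pd)+
  have "(LINT x|torus. (grad v x *v v x) \<bullet> v (x + h)) = (LINT x|torus. (\<Sum>i\<in>UNIV. \<Sum>j\<in>UNIV. ?f i j x * pd j (?g i) x))"
    by (simp add: inner_vec_def advect_nth[OF v(1)] smooth_nth_pd[OF v(1)] sum_distrib_right sum_distrib_left ac_simps)
  also have "\<dots> = (\<Sum>i\<in>UNIV. \<Sum>j\<in>UNIV. (LINT x|torus. ?f i j x * pd j (?g i) x))"
    using i1 by (simp add: integral_sum)
  also have "\<dots> = (\<Sum>i\<in>UNIV. \<Sum>j\<in>UNIV. - (LINT x|torus. pd j (?f i j) x * ?g i x))"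
    by (intro sum.cong refl integration_by_parts sf sg pf pg)
  also have "\<dots> = - (LINT x|torus. (\<Sum>i\<in>UNIV. \<Sum>j\<in>UNIV. pd j (?f i j) x * ?g i x))"
    using i2 by (simp add: integral_sum sum_negf)
  also have "(\<lambda>x. (\<Sum>i\<in>UNIV. \<Sum>j\<in>UNIV. pd j (?f i j) x * ?g i x)) = (\<lambda>x. v x \<bullet> (\<Sum>j\<in>UNIV. v x $ j *\<^sub>R pd j v (x + h)))"
  proof
    fix x
    have "(\<Sum>i\<in>UNIV. \<Sum>j\<in>UNIV. pd j (?f i j) x * ?g i x)
      = (\<Sum>i\<in>UNIV. \<Sum>j\<in>UNIV. v x $ j * pd j v (x + h) $ i * v x $ i) + (\<Sum>i\<in>UNIV. (\<Sum>j\<in>UNIV. pd j v x $ j) * (v (x + h) $ i * v x $ i))"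
      by (simp only: pdf distrib_right sum.distrib sum_distrib_right mult.assoc)
    also have "(\<Sum>j\<in>UNIV. pd j v x $ j) = 0" using v(3)[of x] by (simp add: divergence_def)
    finally show "(\<Sum>i\<in>UNIV. \<Sum>j\<in>UNIV. pd j (?f i j) x * ?g i x) = v x \<bullet> (\<Sum>j\<in>UNIV. v x $ j *\<^sub>R pd j v (x + h))"
      by (simp add: inner_vec_def sum_distrib_left ac_simps)
  qed
  finally show ?thesis .
qed

text \<open>For fixed x this field in h has as divergence precisely the integrand left over by
  \<open>advect_by_parts\<close>, which opens the way to the divergence theorem in h.\<close>

lemma
  assumes v: "smooth v"
  shows smooth_two_point: "smooth (\<lambda>h. (a \<bullet> v (h + x)) *\<^sub>R a)"
    and divergence_two_point: "divergence (\<lambda>h. (a \<bullet> v (h + x)) *\<^sub>R a) h = a \<bullet> (\<Sum>j\<in>UNIV. a $ j *\<^sub>R pd j v (h + x))"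
proof -
  have L: "bounded_linear (\<lambda>y. (a \<bullet> y) *\<^sub>R a)"
    by (intro bounded_linear_scaleR_const bounded_linear_inner_right)
  show "smooth (\<lambda>h. (a \<bullet> v (h + x)) *\<^sub>R a)"
    by (rule smooth_bounded_linear[OF L smooth_translate(1)[OF v]])
  have "pd j (\<lambda>h. (a \<bullet> v (h + x)) *\<^sub>R a) h = (a \<bullet> pd j v (h + x)) *\<^sub>R a" for j
    using pd_bounded_linear[OF L smooth_differentiable[OF smooth_translate(1)[OF v]], of j x h]
    by (simp only: pd_translate[OF v])
  then show "divergence (\<lambda>h. (a \<bullet> v (h + x)) *\<^sub>R a) h = a \<bullet> (\<Sum>j\<in>UNIV. a $ j *\<^sub>R pd j v (h + x))"
    by (simp add: divergence_def inner_sum_right mult.commute)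
qed

text \<open>The integration by parts takes place in x at fixed h, the later use of the divergence
  theorem in h at fixed x. Hence the interchange of integrals before and after the integration by
  parts.\<close>

lemma flux_divergence:
  fixes k :: "real \<Rightarrow> real"
  assumes v: "smooth v" "periodic v" "\<And>x. divergence v x = 0"
    and k[measurable]: "k \<in> borel_measurable borel" and kb: "\<And>r. \<bar>k r\<bar> \<le> C"
    and k0: "\<And>r. l \<le> r \<Longrightarrow> k r = 0" and l: "l \<le> pi"
  shows "conv_form (\<lambda>h. k (tnorm h)) (\<lambda>x. grad v x *v v x) v =
    - (LINT x|torus. LINT h|lborel. indicator (ball 0 l) h * (k (norm h) * divergence (\<lambda>h. (v x \<bullet> v (h + x)) *\<^sub>R v x) h))"
proof -
  have cv: "continuous_on A v" for A by (rule smooth_continuous[OF v(1)])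
  let ?w = "\<lambda>x. grad v x *v v x"
  have cw: "continuous_on A ?w" for A by (intro continuous_matrix_vector continuous_grad v cv)
  let ?\<phi> = "\<lambda>h::real^3. indicator (ball 0 l) h * k (norm h)"
  have \<phi>i: "integrable lborel ?\<phi>" by (rule integrable_ball) (use kb in auto)
  have \<phi>q: "?\<phi> h \<noteq> 0 \<Longrightarrow> norm h \<le> l" for h by (auto simp: indicator_def split: if_splits)
  have G1: "continuous_on UNIV (\<lambda>z. ?w (fst z) \<bullet> v (fst z + snd z))"
    by (intro continuous_intros continuous_compose[OF cw] continuous_compose[OF cv])
  have G2: "continuous_on UNIV (\<lambda>z. v (fst z) \<bullet> (\<Sum>j\<in>UNIV. v (fst z) $ j *\<^sub>R pd j v (fst z + snd z)))"
    by (intro continuous_intros continuous_compose[OF cv] continuous_compose[OF smooth_continuous[OF smooth_pd[OF v(1)]]])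
  note F1 = fubini_torus(1)[OF sigma_finite_lborel sets_lborel G1 \<phi>i \<phi>q]
  note F2 = fubini_torus(1)[OF sigma_finite_lborel sets_lborel G2 \<phi>i \<phi>q]
  have "conv_form (\<lambda>h. k (tnorm h)) ?w v = (LINT x|torus. LINT h|lborel. ?\<phi> h * (?w x \<bullet> v (x + h)))"
    unfolding conv_form_def
  proof (rule integral_cong[OF refl])
    fix x
    have "(LINT y|torus. k (tnorm (x - y)) * (?w x \<bullet> v y)) = (LINT h|lborel. indicator (ball 0 l) h * (k (norm h) * (?w x \<bullet> v (x + h))))"
      by (rule torus_radial_convolution[OF continuous_borel _ k k0 l])
        (use continuous_on_inner[OF continuous_on_const cv] periodic_compose[OF v(2)] in auto)
    then show "(LINT y|torus. k (tnorm (x - y)) * (?w x \<bullet> v y)) = (LINT h|lborel. ?\<phi> h * (?w x \<bullet> v (x + h)))"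
      by (simp only: mult.assoc)
  qed
  also have "\<dots> = (LINT h|lborel. ?\<phi> h * (LINT x|torus. ?w x \<bullet> v (x + h)))" by (rule F1)
  also have "\<dots> = - (LINT h|lborel. ?\<phi> h * (LINT x|torus. v x \<bullet> (\<Sum>j\<in>UNIV. v x $ j *\<^sub>R pd j v (x + h))))"
    by (simp only: advect_by_parts[OF v] mult_minus_right integral_minus)
  also have "\<dots> = - (LINT x|torus. LINT h|lborel. ?\<phi> h * (v x \<bullet> (\<Sum>j\<in>UNIV. v x $ j *\<^sub>R pd j v (x + h))))"
    by (rule arg_cong[where f=uminus], rule F2[symmetric])
  also have "\<dots> = - (LINT x|torus. LINT h|lborel. indicator (ball 0 l) h * (k (norm h) * divergence (\<lambda>h. (v x \<bullet> v (h + x)) *\<^sub>R v x) h))"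
  proof -
    have "divergence (\<lambda>h. (v x \<bullet> v (h + x)) *\<^sub>R v x) h = v x \<bullet> (\<Sum>j\<in>UNIV. v x $ j *\<^sub>R pd j v (x + h))" for x h
      unfolding divergence_two_point[OF v(1)] add.commute[of h x] ..
    then show ?thesis by (simp only: mult.assoc)
  qed
  finally show ?thesis .
qed

text \<open>The substitution of x - h for x. Applied with h = l n it exchanges the roles of the two
  points, so that the mixed terms of an expanded increment can be written with n or with -n.\<close>

lemma two_point_shift:
  fixes F :: "'a::real_normed_vector \<Rightarrow> 'a \<Rightarrow> real"
  assumes v: "continuous_on UNIV v" "periodic v" and F: "continuous_on UNIV (\<lambda>z. F (fst z) (snd z))"
  shows "(LINT x|torus. F (v (x + h)) (v x)) = (LINT x|torus. F (v x) (v (x - h)))"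
proof -
  have "continuous_on UNIV (\<lambda>x. (v x, v (x - h)))"
    by (intro continuous_on_Pair v continuous_compose[OF v(1)] continuous_intros)
  from continuous_on_compose2[OF F this] show ?thesis
    using torus_integral_shift(1)[of "\<lambda>x. F (v x) (v (x - h))" h]
      periodic_compose2[OF v(2) periodic_shift[OF v(2), of "- h"], of F]
    by (simp add: borel_imp_torus continuous_borel)
qed

definition kball :: "real \<Rightarrow> real^3 \<Rightarrow> real" where "kball l h = (if tnorm h < l then 1 else 0)"
definition kpar :: "real \<Rightarrow> real^3 \<Rightarrow> real" where "kpar l h = max 0 (l^2 - (tnorm h)^2)"

abbreviation flux_ball :: "real \<Rightarrow> (real^3 \<Rightarrow> real^3) \<Rightarrow> real" where
  "flux_ball l v \<equiv> LINT n|sphere_measure. LINT x|torus. (norm (increment (l *\<^sub>R n) v x))^2 * (increment (l *\<^sub>R n) v x \<bullet> n)"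

abbreviation flux_par :: "real \<Rightarrow> (real^3 \<Rightarrow> real^3) \<Rightarrow> real" where
  "flux_par l v \<equiv> LINT n|sphere_measure. LINT x|torus. (increment (l *\<^sub>R n) v x \<bullet> n) ^ 3"

text \<open>The divergence theorem turns the left side into -l^2 times the sphere integral of T.
  Expanding the cubic increment gives T four times after reflection of n, besides one-point terms
  that cancel and R-terms whose sphere integral is zero: this is the 4 in l^2 / 4.\<close>

lemma smooth_flux_ball:
  assumes v: "smooth v" "periodic v" "\<And>x. divergence v x = 0" and l: "0 < l" "l \<le> pi"
  shows "conv_form (kball l) (\<lambda>x. grad v x *v v x) v = - (l^2 / 4) * flux_ball l v"
proof -
  let ?u = "\<lambda>x h. divergence (\<lambda>h. (v x \<bullet> v (h + x)) *\<^sub>R v x) h"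
  note cv = continuous_compose[OF smooth_continuous[OF v(1)]]
  note shift = two_point_shift[OF smooth_continuous[OF v(1)] v(2)]
  define T where "T n = (LINT x|torus. (v x \<bullet> v (x + l *\<^sub>R n)) * (v x \<bullet> n))" for n
  define R where "R n = (LINT x|torus. (v x \<bullet> v x) * (v (x + l *\<^sub>R n) \<bullet> n))" for n
  have GT: "continuous_on UNIV (\<lambda>z. (v (fst z) \<bullet> v (fst z + l *\<^sub>R snd z)) * (v (fst z) \<bullet> snd z))"
    and GR: "continuous_on UNIV (\<lambda>z. (v (fst z) \<bullet> v (fst z)) * (v (fst z + l *\<^sub>R snd z) \<bullet> snd z))"
    by (intro continuous_intros cv)+
  have Ti: "integrable sphere_measure T" and Tm: "T \<in> borel_measurable borel" and
    Ri: "integrable sphere_measure R" and Rm: "R \<in> borel_measurable borel"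
    using fubini_sphere(2,3)[OF GT] fubini_sphere(2,3)[OF GR] by (simp_all add: T_def[abs_def] R_def[abs_def])
  have FT: "(LINT x|torus. LINT n|sphere_measure. (v x \<bullet> v (x + l *\<^sub>R n)) * (v x \<bullet> n)) = (LINT n|sphere_measure. T n)"
    using fubini_sphere(1)[OF GT] by (simp add: T_def)
  have FR: "(LINT x|torus. LINT n|sphere_measure. (v x \<bullet> v x) * (v (x + l *\<^sub>R n) \<bullet> n)) = (LINT n|sphere_measure. R n)"
    using fubini_sphere(1)[OF GR] by (simp add: R_def)
  \<comment> \<open>The flux of the solenoidal v through the sphere of radius l about x is
    zero.\<close>
  have z: "(LINT n|sphere_measure. (v x \<bullet> v x) * (v (x + l *\<^sub>R n) \<bullet> n)) = 0" for x
  proof -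
    have "l^2 * (LINT n|sphere_measure. v (l *\<^sub>R n + x) \<bullet> n) = 0"
      using gauss_ball[OF smooth_translate(1)[OF v(1), of x] l(1)] v(3)
      by (simp add: divergence_def pd_translate[OF v(1)])
    then have "(LINT n|sphere_measure. v (x + l *\<^sub>R n) \<bullet> n) = 0" using l by (simp add: add.commute)
    then show ?thesis by simp
  qed
  have R0: "(LINT n|sphere_measure. R n) = 0" unfolding FR[symmetric] z by simp
  define k :: "real \<Rightarrow> real" where "k r = (if r < l then 1 else 0)" for r
  have km: "k \<in> borel_measurable borel" unfolding k_def by measurable
  have kb: "kball l = (\<lambda>h. k (tnorm h))" by (simp add: fun_eq_iff kball_def k_def)
  have "conv_form (kball l) (\<lambda>x. grad v x *v v x) v =
    - (LINT x|torus. LINT h|lborel. indicator (ball 0 l) h * (k (norm h) * ?u x h))"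
    unfolding kb by (rule flux_divergence[OF v km _ _ l(2), of 1]) (auto simp: k_def)
  also have "(\<lambda>x. LINT h|lborel. indicator (ball 0 l) h * (k (norm h) * ?u x h))
      = (\<lambda>x. l^2 * (LINT n|sphere_measure. (v x \<bullet> v (x + l *\<^sub>R n)) * (v x \<bullet> n)))"
  proof
    fix x
    have "(LINT h|lborel. indicator (ball 0 l) h * (k (norm h) * ?u x h))
      = (LINT h|lborel. indicator (ball 0 l) h * ?u x h)"
      by (intro integral_cong refl) (auto simp: indicator_def k_def)
    also have "\<dots> = l^2 * (LINT n|sphere_measure. ((v x \<bullet> v (l *\<^sub>R n + x)) *\<^sub>R v x) \<bullet> n)"
      by (rule gauss_ball[OF smooth_two_point[OF v(1)] l(1)])
    finally show "(LINT h|lborel. indicator (ball 0 l) h * (k (norm h) * ?u x h))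
      = l^2 * (LINT n|sphere_measure. (v x \<bullet> v (x + l *\<^sub>R n)) * (v x \<bullet> n))" by (simp add: add.commute)
  qed
  finally have main: "conv_form (kball l) (\<lambda>x. grad v x *v v x) v = - (l^2 * (LINT n|sphere_measure. T n))"
    by (simp add: FT)
  \<comment> \<open>The pure terms in v(x + h) and in v(x) cancel by translation invariance; a mixed
    term that is quadratic in v(x + h) is shifted back to x and becomes a value of R or T at -n,
    with a sign from the factor n.\<close>
  have c: "(LINT x|torus. (norm (increment (l *\<^sub>R n) v x))^2 * (increment (l *\<^sub>R n) v x \<bullet> n)) = R (- n) + 2 * T (- n) + 2 * T n + R n" for n
  proof -
    let ?h = "l *\<^sub>R n" let ?v' = "\<lambda>x. v (x + ?h)"
    let ?a = "\<lambda>x. (?v' x \<bullet> ?v' x) * (?v' x \<bullet> n) - (v x \<bullet> v x) * (v x \<bullet> n)"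
    let ?b = "\<lambda>x. (v x \<bullet> v x) * (?v' x \<bullet> n)" let ?c = "\<lambda>x. (?v' x \<bullet> ?v' x) * (v x \<bullet> n)"
    let ?d = "\<lambda>x. (v x \<bullet> ?v' x) * (?v' x \<bullet> n)" let ?e = "\<lambda>x. (v x \<bullet> ?v' x) * (v x \<bullet> n)"
    have int: "integrable torus (\<lambda>x. (?v' x \<bullet> ?v' x) * (?v' x \<bullet> n))" "integrable torus (\<lambda>x. (v x \<bullet> v x) * (v x \<bullet> n))"
      "integrable torus ?b" "integrable torus ?c" "integrable torus ?d" "integrable torus ?e"
      by (intro integrable_torus_continuous continuous_intros cv)+
    have "(norm (increment ?h v x))^2 * (increment ?h v x \<bullet> n) = ?a x + ?b x - ?c x - 2 * ?d x + 2 * ?e x" for x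
      unfolding increment_def power2_norm_eq_inner by (simp add: inner_diff_left inner_diff_right inner_commute algebra_simps)
    then have "(LINT x|torus. (norm (increment ?h v x))^2 * (increment ?h v x \<bullet> n)) = (LINT x|torus. ?a x + ?b x - ?c x - 2 * ?d x + 2 * ?e x)"
      by simp
    also have "\<dots> = (LINT x|torus. ?a x) + (LINT x|torus. ?b x) - (LINT x|torus. ?c x) - 2 * (LINT x|torus. ?d x) + 2 * (LINT x|torus. ?e x)"
      using int by simp
    also have "(LINT x|torus. ?a x) = 0"
      using shift[of "\<lambda>a b. (a \<bullet> a) * (a \<bullet> n)" ?h] int by (simp add: continuous_intros)
    also have "(LINT x|torus. ?c x) = - R (- n)"
      using shift[of "\<lambda>a b. (a \<bullet> a) * (b \<bullet> n)" ?h] by (simp add: R_def continuous_intros)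
    also have "(LINT x|torus. ?d x) = - T (- n)"
      using shift[of "\<lambda>a b. (b \<bullet> a) * (a \<bullet> n)" ?h] by (simp add: T_def inner_commute continuous_intros)
    finally show ?thesis by (simp add: R_def T_def)
  qed
  have i': "integrable sphere_measure (\<lambda>n. T (- n))" "integrable sphere_measure (\<lambda>n. R (- n))"
  proof -
    have "continuous_on UNIV (\<lambda>z. (v (fst z) \<bullet> v (fst z - l *\<^sub>R snd z)) * (v (fst z) \<bullet> - snd z))"
      "continuous_on UNIV (\<lambda>z. (v (fst z) \<bullet> v (fst z)) * (v (fst z - l *\<^sub>R snd z) \<bullet> - snd z))"
      by (intro continuous_intros cv)+
    from fubini_sphere(2)[OF this(1)] fubini_sphere(2)[OF this(2)]
    show "integrable sphere_measure (\<lambda>n. T (- n))" "integrable sphere_measure (\<lambda>n. R (- n))"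
      by (simp_all add: T_def R_def)
  qed
  have "flux_ball l v
    = (LINT n|sphere_measure. R (- n)) + 2 * (LINT n|sphere_measure. T (- n)) + 2 * (LINT n|sphere_measure. T n) + (LINT n|sphere_measure. R n)"
    unfolding c using Ti Ri i' by simp
  also have "\<dots> = 4 * (LINT n|sphere_measure. T n)"
    unfolding sphere_integral_reflect[OF Tm] sphere_integral_reflect[OF Rm] R0 by simp
  finally show ?thesis using main by simp
qed

text \<open>The divergence theorem is used twice. \<open>gauss_parabola\<close> first leaves 2 (v(x)
  . h) (v(x) . v(x + h)), which for solenoidal v is itself the divergence in h of (v(x) . h)^2 v(x +
  h). The second use gives l^4 times the sphere integral of Q, and the expanded cube contains Q six
  times after reflection.\<close>

lemma smooth_flux_par:
  assumes v: "smooth v" "periodic v" "\<And>x. divergence v x = 0" and l: "0 < l" "l \<le> pi"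
  shows "conv_form (kpar l) (\<lambda>x. grad v x *v v x) v = - (l ^ 4 / 6) * flux_par l v"
proof -
  let ?u = "\<lambda>x h. divergence (\<lambda>h. (v x \<bullet> v (h + x)) *\<^sub>R v x) h"
  note cv = continuous_compose[OF smooth_continuous[OF v(1)]]
  note shift = two_point_shift[OF smooth_continuous[OF v(1)] v(2)]
  define Q where "Q n = (LINT x|torus. (v x \<bullet> n)^2 * (v (x + l *\<^sub>R n) \<bullet> n))" for n
  have GQ: "continuous_on UNIV (\<lambda>z. (v (fst z) \<bullet> snd z)^2 * (v (fst z + l *\<^sub>R snd z) \<bullet> snd z))"
    by (intro continuous_intros cv)+
  have Qi: "integrable sphere_measure Q" and Qm: "Q \<in> borel_measurable borel"
    using fubini_sphere(2,3)[OF GQ] by (simp_all add: Q_def[abs_def])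
  have FQ: "(LINT x|torus. LINT n|sphere_measure. (v x \<bullet> n)^2 * (v (x + l *\<^sub>R n) \<bullet> n)) = (LINT n|sphere_measure. Q n)"
    using fubini_sphere(1)[OF GQ] by (simp add: Q_def)
  define k :: "real \<Rightarrow> real" where "k r = max 0 (l^2 - r^2)" for r
  have km: "k \<in> borel_measurable borel" unfolding k_def by measurable
  have kb: "kpar l = (\<lambda>h. k (tnorm h))" by (simp add: fun_eq_iff kpar_def k_def)
  have k0: "k r = 0" if "l \<le> r" for r using power_mono[OF that, of 2] l by (simp add: k_def)
  have kC: "\<bar>k r\<bar> \<le> l^2" for r by (auto simp: k_def)
  have "conv_form (kpar l) (\<lambda>x. grad v x *v v x) v =
    - (LINT x|torus. LINT h|lborel. indicator (ball 0 l) h * (k (norm h) * ?u x h))"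
    unfolding kb by (rule flux_divergence[OF v km kC k0 l(2)])
  also have "(\<lambda>x. LINT h|lborel. indicator (ball 0 l) h * (k (norm h) * ?u x h))
      = (\<lambda>x. l ^ 4 * (LINT n|sphere_measure. (v x \<bullet> n)^2 * (v (x + l *\<^sub>R n) \<bullet> n)))"
  proof
    fix x
    let ?c = "\<lambda>h. (v x \<bullet> h)^2"
    have sl: "smooth (\<lambda>h. v x \<bullet> h)" by (rule smooth_bounded_linear[OF bounded_linear_inner_right smooth_ident])
    have sc: "smooth ?c" unfolding power2_eq_square by (intro smooth_mult sl)
    have pc: "pd j ?c h = 2 * (v x \<bullet> h) * v x $ j" for j h
    proof -
      have "(?c has_derivative (\<lambda>y. 2 * (v x \<bullet> h) * (v x \<bullet> y))) (at h)"
        by (auto intro!: derivative_eq_intros)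
      from pd_eqI[OF this, of j] show ?thesis by (simp add: inner_axis)
    qed
    \<comment> \<open>The divergence falls only on the scalar factor, whose gradient is 2 (v(x) . h)
      v(x), because v is solenoidal.\<close>
    have dU: "divergence (\<lambda>h. ?c h *\<^sub>R v (h + x)) h = 2 * (h \<bullet> ((v x \<bullet> v (h + x)) *\<^sub>R v x))" for h
    proof -
      have "divergence (\<lambda>h. v (h + x)) h = 0"
        using v(3)[of "h + x"] by (simp add: divergence_def pd_translate[OF v(1)])
      then have "divergence (\<lambda>h. ?c h *\<^sub>R v (h + x)) h = (\<Sum>j\<in>UNIV. 2 * (v x \<bullet> h) * v x $ j * v (h + x) $ j)"
        unfolding divergence_scaleR[OF sc smooth_translate(1)[OF v(1)]] pc by simp
      also have "\<dots> = 2 * (v x \<bullet> h) * (v x \<bullet> v (h + x))"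
        by (simp add: inner_vec_def[of "v x" "v (h + x)"] sum_distrib_left mult.assoc)
      finally show ?thesis by (simp add: inner_commute)
    qed
    have "(LINT h|lborel. indicator (ball 0 l) h * (k (norm h) * ?u x h))
      = (LINT h|lborel. indicator (ball 0 l) h * ((l^2 - (norm h)^2) * ?u x h))"
    proof (intro integral_cong refl)
      fix h :: "real^3"
      have "k (norm h) = l^2 - (norm h)^2" if "norm h < l" using power_mono[of "norm h" l 2] that by (simp add: k_def)
      then show "indicator (ball 0 l) h * (k (norm h) * ?u x h)
        = indicator (ball 0 l) h * ((l^2 - (norm h)^2) * ?u x h)"
        by (auto simp: indicator_def)
    qed
    also have "\<dots> = (LINT h|lborel. indicator (ball 0 l) h * (2 * (h \<bullet> ((v x \<bullet> v (h + x)) *\<^sub>R v x))))"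
      by (rule gauss_parabola[OF smooth_two_point[OF v(1)] l(1)])
    also have "\<dots> = (LINT h|lborel. indicator (ball 0 l) h * divergence (\<lambda>h. ?c h *\<^sub>R v (h + x)) h)"
      by (simp only: dU)
    also have "\<dots> = l^2 * (LINT n|sphere_measure. (?c (l *\<^sub>R n) *\<^sub>R v (l *\<^sub>R n + x)) \<bullet> n)"
      by (rule gauss_ball[OF smooth_scaleR[OF sc smooth_translate(1)[OF v(1)]] l(1)])
    also have "\<dots> = l^2 * (LINT n|sphere_measure. l^2 * ((v x \<bullet> n)^2 * (v (x + l *\<^sub>R n) \<bullet> n)))"
      by (simp add: power_mult_distrib add.commute mult.assoc)
    also have "\<dots> = l ^ 4 * (LINT n|sphere_measure. (v x \<bullet> n)^2 * (v (x + l *\<^sub>R n) \<bullet> n))"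
      unfolding integral_mult_right_zero by (simp add: mult.assoc[symmetric] flip: power_add)
    finally show "(LINT h|lborel. indicator (ball 0 l) h * (k (norm h) * ?u x h))
      = l ^ 4 * (LINT n|sphere_measure. (v x \<bullet> n)^2 * (v (x + l *\<^sub>R n) \<bullet> n))" .
  qed
  finally have main: "conv_form (kpar l) (\<lambda>x. grad v x *v v x) v = - (l ^ 4 * (LINT n|sphere_measure. Q n))"
    by (simp add: FQ)
  have c: "(LINT x|torus. (increment (l *\<^sub>R n) v x \<bullet> n) ^ 3) = 3 * Q n + 3 * Q (- n)" for n
  proof -
    let ?h = "l *\<^sub>R n" let ?a' = "\<lambda>x. v (x + ?h) \<bullet> n" let ?a = "\<lambda>x. v x \<bullet> n"
    have int: "integrable torus (\<lambda>x. ?a' x ^ 3)" "integrable torus (\<lambda>x. ?a x ^ 3)"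
      "integrable torus (\<lambda>x. (?a x)^2 * ?a' x)" "integrable torus (\<lambda>x. (?a' x)^2 * ?a x)"
      by (intro integrable_torus_continuous continuous_intros cv)+
    have "(increment ?h v x \<bullet> n) ^ 3 = ?a' x ^ 3 - ?a x ^ 3 + 3 * ((?a x)^2 * ?a' x) - 3 * ((?a' x)^2 * ?a x)" for x
      unfolding increment_def by (simp add: inner_diff_left power2_eq_square power3_eq_cube algebra_simps)
    then have "(LINT x|torus. (increment ?h v x \<bullet> n) ^ 3) = (LINT x|torus. ?a' x ^ 3 - ?a x ^ 3 + 3 * ((?a x)^2 * ?a' x) - 3 * ((?a' x)^2 * ?a x))"
      by simp
    also have "\<dots> = (LINT x|torus. ?a' x ^ 3) - (LINT x|torus. ?a x ^ 3) + 3 * (LINT x|torus. (?a x)^2 * ?a' x) - 3 * (LINT x|torus. (?a' x)^2 * ?a x)"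
      using int by simp
    also have "(LINT x|torus. ?a' x ^ 3) = (LINT x|torus. ?a x ^ 3)"
      using shift[of "\<lambda>a b. (a \<bullet> n) ^ 3" ?h] by (simp add: continuous_intros)
    also have "(LINT x|torus. (?a' x)^2 * ?a x) = - Q (- n)"
      using shift[of "\<lambda>a b. (a \<bullet> n)^2 * (b \<bullet> n)" ?h] by (simp add: Q_def continuous_intros)
    finally show ?thesis by (simp add: Q_def)
  qed
  have i': "integrable sphere_measure (\<lambda>n. Q (- n))"
  proof -
    have "continuous_on UNIV (\<lambda>z. (v (fst z) \<bullet> - snd z)^2 * (v (fst z - l *\<^sub>R snd z) \<bullet> - snd z))"
      by (intro continuous_intros cv)+
    from fubini_sphere(2)[OF this] show "integrable sphere_measure (\<lambda>n. Q (- n))" by (simp add: Q_def)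
  qed
  have "flux_par l v
    = 3 * (LINT n|sphere_measure. Q n) + 3 * (LINT n|sphere_measure. Q (- n))"
    unfolding c using Qi i' by simp
  also have "\<dots> = 6 * (LINT n|sphere_measure. Q n)"
    unfolding sphere_integral_reflect[OF Qm] by simp
  finally show ?thesis using main by simp
qed

section \<open>A Sobolev inequality\<close>

lemma norm_matrix_vector_le: "norm ((A :: real^3^3) *v x) \<le> norm A * norm x"
proof -
  have "(norm (A *v x))^2 = (\<Sum>i\<in>UNIV. (A $ i \<bullet> x)^2)"
    unfolding power2_norm_eq_inner by (simp add: inner_vec_def matrix_vector_mult_def power2_eq_square)
  also have "\<dots> \<le> (\<Sum>i\<in>UNIV. (norm (A $ i))^2 * (norm x)^2)"
  proof (rule sum_mono)
    fix i
    have "\<bar>A $ i \<bullet> x\<bar>^2 \<le> (norm (A $ i) * norm x)^2" by (intro power_mono Cauchy_Schwarz_ineq2) auto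
    then show "(A $ i \<bullet> x)^2 \<le> (norm (A $ i))^2 * (norm x)^2" by (simp add: power_mult_distrib)
  qed
  also have "\<dots> = (norm A * norm x)^2"
    by (simp add: power_mult_distrib sum_distrib_right[symmetric] power2_norm_eq_inner[of A] inner_vec_def[of A] power2_norm_eq_inner)
  finally show ?thesis by (rule power2_le_imp_le) simp
qed

lemma grad_has_derivative: assumes "smooth f" shows "(f has_derivative (\<lambda>h. grad f x *v h)) (at x)"
proof -
  have "(\<Sum>i\<in>UNIV. h $ i *\<^sub>R pd i f x) = grad f x *v h" for h
    by (simp add: vec_eq_iff matrix_vector_mult_def grad_eq[OF assms] mult.commute)
  then show ?thesis using smooth_has_derivative[OF assms, of x] by simp
qed

lemma unit_interval_indicator: "integrable lborel (indicator {0..1::real} :: _ \<Rightarrow> real)"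
  by simp

lemma integral_unit_interval:
  fixes q :: "real \<Rightarrow> real"
  assumes "continuous_on UNIV q"
  shows "integral {0..1} q = (LINT t|lborel. indicator {0..1} t * q t)"
    and "integrable lborel (\<lambda>t. indicator {0..1} t * q t)"
    and "q integrable_on {0..1}"
proof -
  have c: "continuous_on {0..1} q" using assms continuous_on_subset by blast
  have s: "set_integrable lborel {0..1} q" by (rule borel_integrable_atLeastAtMost') (rule c)
  show "integral {0..1} q = (LINT t|lborel. indicator {0..1} t * q t)"
    using set_borel_integral_eq_integral(2)[OF s] by (simp add: set_lebesgue_integral_def)
  show "integrable lborel (\<lambda>t. indicator {0..1} t * q t)"
    using s by (simp add: set_integrable_def)
  show "q integrable_on {0..1}" by (rule integrable_continuous_real[OF c])
qed

text \<open>Along the segment from \<open>x\<close> to \<open>x + h\<close> the parameter is \<open>\<tau>^2\<close>: the weight \<open>2\<tau>\<close> makes the estimate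
  of \<open>sobolev_L3\<close> integrable at \<open>\<tau> = 0\<close>.\<close>

lemma increment_bound:
  assumes f: "smooth (f :: real^3 \<Rightarrow> real^3)"
  shows "norm (f (x + h) - f x) \<le> norm h * (LINT t|lborel. indicator {0..1} t * (2 * t * norm (grad f (x + t^2 *\<^sub>R h))))"
proof -
  let ?q = "\<lambda>t. norm h * (2 * t * norm (grad f (x + t^2 *\<^sub>R h)))"
  have cg: "continuous_on UNIV (\<lambda>t. grad f (x + t^2 *\<^sub>R h))"
    by (intro continuous_intros continuous_compose[OF continuous_grad[OF f]])
  have cq: "continuous_on UNIV ?q" by (intro continuous_intros cg)
  let ?d = "\<lambda>t. grad f (x + t^2 *\<^sub>R h) *v ((2 * t) *\<^sub>R h)"
  have "((\<lambda>t. f (x + t^2 *\<^sub>R h)) has_vector_derivative ?d t) (at t within {0..1})" for t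
  proof -
    have "((\<lambda>t. x + t^2 *\<^sub>R h) has_derivative (\<lambda>s. (2 * t * s) *\<^sub>R h)) (at t within {0..1})"
      by (auto intro!: derivative_eq_intros simp: mult.commute mult.left_commute)
    from has_derivative_compose[OF this grad_has_derivative[OF f]]
    have "((\<lambda>t. f (x + t^2 *\<^sub>R h)) has_derivative (\<lambda>s. grad f (x + t^2 *\<^sub>R h) *v ((2 * t * s) *\<^sub>R h))) (at t within {0..1})" .
    moreover have "(\<lambda>s. grad f (x + t^2 *\<^sub>R h) *v ((2 * t * s) *\<^sub>R h)) = (\<lambda>s. s *\<^sub>R ?d t)"
      by (simp add: matrix_vector_mult_scaleR fun_eq_iff mult.commute)
    ultimately show ?thesis by (simp add: has_vector_derivative_def)
  qed
  then have "(?d has_integral (f (x + 1^2 *\<^sub>R h) - f (x + 0^2 *\<^sub>R h))) {0..1}"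
    by (intro fundamental_theorem_of_calculus) auto
  then have di: "?d integrable_on {0..1}" and de: "f (x + h) - f x = integral {0..1} ?d"
    by (auto simp: has_integral_integrable_integral)
  have "norm (integral {0..1} ?d) \<le> integral {0..1} ?q"
  proof (rule integral_norm_bound_integral[OF di integral_unit_interval(3)[OF cq]])
    fix t :: real assume t: "t \<in> {0..1}"
    have "norm (?d t) \<le> norm (grad f (x + t^2 *\<^sub>R h)) * norm ((2 * t) *\<^sub>R h)" by (rule norm_matrix_vector_le)
    then show "norm (?d t) \<le> ?q t" using t by (simp add: ac_simps)
  qed
  also have "\<dots> = norm h * (LINT t|lborel. indicator {0..1} t * (2 * t * norm (grad f (x + t^2 *\<^sub>R h))))"
    unfolding integral_unit_interval(1)[OF cq] by (subst integral_mult_right_zero[symmetric]) (simp add: ac_simps)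
  finally show ?thesis using de by simp
qed

lemma cubic_jensen:
  fixes a :: "real \<Rightarrow> real"
  assumes a: "a \<in> borel_measurable borel" "\<And>t. 0 \<le> t \<Longrightarrow> t \<le> 1 \<Longrightarrow> 0 \<le> a t \<and> a t \<le> B"
  shows "(LINT t|lborel. indicator {0..1} t * a t) ^ 3 \<le> (LINT t|lborel. indicator {0..1} t * (a t) ^ 3)"
proof -
  note [measurable] = a(1)
  let ?I = "\<lambda>q. LINT t|lborel. indicator {0..1::real} t * q t :: real"
  have B: "0 \<le> B" using a(2)[of 0] by auto
  have int: "integrable lborel (\<lambda>t. indicator {0..1} t * q t)"
    if "q \<in> borel_measurable borel" "\<And>t. 0 \<le> t \<Longrightarrow> t \<le> 1 \<Longrightarrow> \<bar>q t\<bar> \<le> C" for q :: "real \<Rightarrow> real" and C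
  proof (rule integrable_bound[of _ "\<lambda>t. C * indicator {0..1} t"])
    note [measurable] = that(1)
    show "integrable lborel (\<lambda>t. C * indicator {0..1::real} t :: real)" by simp
    show "(\<lambda>t. indicator {0..1} t * q t) \<in> borel_measurable lborel" by measurable
    have "norm (indicator {0..1} t * q t) \<le> norm (C * indicator {0..1} t :: real)" for t
      using that(2)[of t] by (auto simp: indicator_def)
    then show "AE t in lborel. norm (indicator {0..1} t * q t) \<le> norm (C * indicator {0..1::real} t :: real)" by simp
  qed
  have i1: "integrable lborel (\<lambda>t. indicator {0..1} t * a t)" by (rule int[of _ B]) (use a in auto)
  have i3: "integrable lborel (\<lambda>t. indicator {0..1} t * (a t) ^ 3)"
    by (rule int[of _ "B ^ 3"]) (use a in \<open>auto intro: power_mono\<close>)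
  have i0: "integrable lborel (\<lambda>t::real. indicator {0..1} t * c :: real)" for c by (rule int[of "\<lambda>t. c" "\<bar>c\<bar>"]) auto
  define m where "m = ?I a"
  have m0: "0 \<le> m" unfolding m_def by (rule integral_nonneg) (use a in \<open>auto simp: indicator_def\<close>)
  \<comment> \<open>tangent line of the cube at \<open>m\<close>\<close>
  have pt: "indicator {0..1} t * (a t)^3 \<ge> 3 * m^2 * (indicator {0..1} t * a t) - indicator {0..1} t * (2 * m ^ 3)" for t :: real
  proof (cases "0 \<le> t \<and> t \<le> 1")
    case True
    have "0 \<le> (a t - m)^2 * (a t + 2 * m)" using a(2)[of t] True m0 by auto
    also have "\<dots> = (a t) ^ 3 - 3 * m^2 * a t + 2 * m ^ 3" by (simp add: power2_eq_square power3_eq_cube algebra_simps)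
    finally show ?thesis using True by simp
  qed auto
  have c: "?I (\<lambda>t. c) = c" for c :: real by simp
  have "m ^ 3 = 3 * m^2 * m - 2 * m ^ 3" by (simp add: power2_eq_square power3_eq_cube)
  also have "\<dots> = (LINT t|lborel. 3 * m^2 * (indicator {0..1} t * a t) - indicator {0..1} t * (2 * m ^ 3))"
    unfolding integral_diff[OF integrable_mult_right[OF i1] i0] integral_mult_right_zero c m_def[symmetric] ..
  also have "\<dots> \<le> ?I (\<lambda>t. (a t) ^ 3)"
    by (rule integral_mono[OF integrable_diff[OF integrable_mult_right[OF i1] i0] i3 pt])
  finally show ?thesis by (simp add: m_def)
qed

lemma integrable_indicator_cell: "integrable lborel (indicator cell :: real^3 \<Rightarrow> real)"
proof (rule integrable_real_indicator)
  show "emeasure lborel cell < \<infinity>" by (rule emeasure_lborel_cbox_finite)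
qed simp

lemma tvol_eq: "tvol = measure lborel cell"
proof -
  have "tvol = measure lebesgue cell"
    unfolding tvol_def by (rule measure_restrict_space) simp_all
  also have "\<dots> = measure lborel cell" by (rule measure_completion) simp
  finally show ?thesis .
qed

lemma tvol_pos: "tvol > 0"
proof -
  have "cell \<noteq> {}" using wrap_in hcell_sub_cell by blast
  then have "measure lborel cell = (\<Prod>i\<in>(UNIV::3 set). 2 * pi)"
    by (subst content_cbox_cart) auto
  then show ?thesis unfolding tvol_eq by simp
qed

text \<open>The cell scaled by s \<le> 1 lies inside the cell, so for nonnegative q it may be
  enlarged to the full cell; s^3 is the Jacobian.\<close>

lemma integral_torus_dilate:
  fixes q :: "real^3 \<Rightarrow> real"
  assumes q: "continuous_on UNIV q" "periodic q" "\<And>x. 0 \<le> q x" and s: "0 < s" "s \<le> 1"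
  shows "s ^ 3 * (LINT h|torus. q (x + s *\<^sub>R h)) \<le> (LINT y|torus. q y)"
proof -
  note [measurable] = continuous_borel[OF q(1)]
  obtain B where B: "\<And>x. norm (q x) \<le> B" using periodic_continuous_bounded[OF q(1,2)] by metis
  let ?c = "indicator cell :: real^3 \<Rightarrow> real"
  have ci: "integrable lborel (\<lambda>y. indicator (A \<inter> cell) y * q (x + y))" if [measurable]: "A \<in> sets borel" for A
  proof (rule integrable_bound[of _ "\<lambda>y. B * ?c y"])
    show "integrable lborel (\<lambda>y. B * ?c y)" by (rule integrable_mult_right[OF integrable_indicator_cell])
    have "norm (indicator (A \<inter> cell) y * q (x + y)) \<le> norm (B * ?c y)" for y
      using B[of "x + y"] by (auto simp: indicator_def)
    then show "AE y in lborel. norm (indicator (A \<inter> cell) y * q (x + y)) \<le> norm (B * ?c y)" by simp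
  qed measurable
  have "(LINT y|lborel. ?c ((1 / s) *\<^sub>R y) * q (x + y)) = \<bar>s\<bar> ^ 3 * (LINT h|lborel. ?c ((1 / s) *\<^sub>R s *\<^sub>R h) * q (x + s *\<^sub>R h))"
    by (rule lborel_integral_scale) (use s in auto)
  then have "s ^ 3 * (LINT h|torus. q (x + s *\<^sub>R h)) = (LINT y|lborel. ?c ((1 / s) *\<^sub>R y) * q (x + y))"
    using s by (subst integral_torus_lborel) auto
  also have "\<dots> \<le> (LINT y|lborel. ?c y * q (x + y))"
  proof (rule integral_mono)
    have sub: "y \<in> cell" if "(1 / s) *\<^sub>R y \<in> cell" for y
    proof -
      have *: "0 \<le> y $ i / s" "y $ i / s \<le> 2 * pi" for i using that by (simp_all add: mem_box_cart)
      have "0 \<le> y $ i" "y $ i \<le> 2 * pi" for i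
      proof -
        show "0 \<le> y $ i" using *(1)[of i] s by (simp add: zero_le_divide_iff)
        have "y $ i \<le> 2 * pi * s" using *(2)[of i] s by (simp add: divide_le_eq)
        also have "\<dots> \<le> 2 * pi * 1" using s by (intro mult_left_mono) auto
        finally show "y $ i \<le> 2 * pi" by simp
      qed
      then show ?thesis by (simp add: mem_box_cart)
    qed
    have e: "(\<lambda>y. ?c ((1 / s) *\<^sub>R y) * q (x + y)) = (\<lambda>y. indicator ({y. (1 / s) *\<^sub>R y \<in> cell} \<inter> cell) y * q (x + y))"
      using sub by (auto simp: fun_eq_iff indicator_def)
    show "integrable lborel (\<lambda>y. ?c ((1 / s) *\<^sub>R y) * q (x + y))"
      unfolding e by (rule ci) measurable
    show "integrable lborel (\<lambda>y. ?c y * q (x + y))" using ci[of UNIV] by simp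
    show "?c ((1 / s) *\<^sub>R y) * q (x + y) \<le> ?c y * q (x + y)" for y
      using sub[of y] q(3)[of "x + y"] by (auto simp: indicator_def)
  qed
  also have "\<dots> = (LINT y|torus. q (x + y))"
    by (rule integral_torus_lborel[symmetric]) measurable
  also have "\<dots> = (LINT y|torus. q y)"
    using torus_integral_shift(1)[OF q(2) borel_imp_torus, of x] by (simp add: add.commute)
  finally show ?thesis .
qed

text \<open>Since the mean is zero, f is minus the average of its own increments, and these are
  controlled by averages P of the gradient over dilated cells. The third moment of P is at most its
  supremum, of order t^(-3), times its second moment, which is bounded in t; the weight (2 t)^3
  cancels the singularity and leaves the factor 8. The remaining constants are D, the diameter of
  the cell, and powers of the volume.\<close>

theorem sobolev_L3:
  fixes f :: "real^3 \<Rightarrow> real^3"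
  assumes f: "smooth f" "periodic f" and mean: "(LINT x|torus. f x) = 0"
  shows "(LINT x|torus. norm (f x) ^ 3) \<le> (norm (\<chi> i. 2 * pi :: real^3)) ^ 3 * (8 * sqrt tvol / tvol) * (L2_norm (grad f)) ^ 3"
proof -
  define D where "D = norm (\<chi> i. 2 * pi :: real^3)"
  define g where "g x = norm (grad f x)" for x
  define \<Gamma> where "\<Gamma> = L2_norm (grad f)"
  let ?G = "\<lambda>t x h. g (x + t^2 *\<^sub>R h)"
  have cg: "continuous_on A g" for A unfolding g_def by (intro continuous_intros continuous_grad f)
  have pg: "periodic g" unfolding g_def by (rule periodic_compose[OF periodic_grad[OF f]])
  have g0: "0 \<le> g x" for x by (simp add: g_def)
  obtain B where B: "\<And>x. norm (g x) \<le> B" using periodic_continuous_bounded[OF cg pg] by metis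
  then have gB: "g x \<le> B" for x using abs_le_D1 by fastforce
  have B0: "0 \<le> B" using gB g0 order_trans by blast
  have \<Gamma>: "(LINT x|torus. (g x)^2) = \<Gamma>^2" by (simp add: \<Gamma>_def L2_norm_sq g_def)
  have \<Gamma>0: "0 \<le> \<Gamma>" by (simp add: \<Gamma>_def)
  note V0 = tvol_pos
  have cf: "continuous_on A f" for A by (rule smooth_continuous[OF f(1)])
  \<comment> \<open>The gradient norm integrated over the cell dilated by t^2 about x.\<close>
  define P where "P t x = (LINT h|torus. ?G t x h)" for t x
  have cgc: "continuous_on UNIV (\<lambda>z::(real^3)\<times>(real^3). g (fst z + s *\<^sub>R snd z))" for s
    by (intro continuous_intros continuous_compose[OF cg])
  have cgh: "continuous_on UNIV (\<lambda>h. g (x + s *\<^sub>R h))" for s x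
    by (intro continuous_intros continuous_compose[OF cg])
  have P0: "0 \<le> P t x" for t x unfolding P_def by (rule integral_nonneg) (rule g0)
  have PB: "P t x \<le> B * tvol" for t x
  proof -
    have "P t x \<le> (LINT h|torus. B)" unfolding P_def
      by (rule integral_mono[OF integrable_torus_continuous[OF cgh] _ gB]) simp
    then show ?thesis by (simp add: mult.commute[of B tvol])
  qed
  have PM: "(\<lambda>z. P (snd z) (fst z)) \<in> borel_measurable (borel \<Otimes>\<^sub>M borel)"
  proof -
    have c: "continuous_on UNIV (\<lambda>z::((real^3)\<times>real)\<times>(real^3). g (fst (fst z) + (snd (fst z))^2 *\<^sub>R snd z))"
      by (intro continuous_intros continuous_compose[OF cg])
    have m: "(\<lambda>z. g (fst (fst z) + (snd (fst z))^2 *\<^sub>R snd z)) \<in> borel_measurable ((borel \<Otimes>\<^sub>M borel) \<Otimes>\<^sub>M torus)"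
    proof -
      have b: "(\<lambda>z::((real^3)\<times>real)\<times>(real^3). g (fst (fst z) + (snd (fst z))^2 *\<^sub>R snd z)) \<in> borel_measurable ((borel \<Otimes>\<^sub>M borel) \<Otimes>\<^sub>M borel)"
        unfolding borel_prod by (rule borel_measurable_continuous_onI[OF c])
      have "(\<lambda>z. (fst z, snd z)) \<in> (borel \<Otimes>\<^sub>M borel) \<Otimes>\<^sub>M torus \<rightarrow>\<^sub>M ((borel :: (real^3) measure) \<Otimes>\<^sub>M (borel :: real measure)) \<Otimes>\<^sub>M borel"
      proof (rule measurable_Pair)
        show "snd \<in> borel_measurable (((borel :: (real^3) measure) \<Otimes>\<^sub>M (borel :: real measure)) \<Otimes>\<^sub>M torus)"
          using measurable_compose[OF measurable_snd torus_id_measurable] .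
      qed (rule measurable_fst)
      from measurable_compose[OF this b] show ?thesis by simp
    qed
    show ?thesis unfolding P_def
      by (rule torus.borel_measurable_lebesgue_integral) (use m in \<open>simp add: split_beta'\<close>)
  qed
  have Pt: "(\<lambda>t. P t x) \<in> borel_measurable borel" for x
    using measurable_compose[OF measurable_Pair1' PM, of x] by simp
  have nh: "norm h \<le> D" if "h \<in> cell" for h
  proof -
    have "norm (h $ i) \<le> norm ((\<chi> i. 2 * pi :: real^3) $ i)" for i using that by (simp add: mem_box_cart)
    then show ?thesis unfolding D_def by (rule norm_le_componentwise_cart)
  qed
  \<comment> \<open>Integrating f(x + h) - f(x) over h leaves only the term with f(x), as f has mean
    zero; then \<open>increment_bound\<close> and Fubini in h and t.\<close>
  have pointwise: "tvol * norm (f x) \<le> D * (LINT t|lborel. indicator {0..1} t * (2 * t * P t x))" for x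
  proof -
    have ci: "continuous_on UNIV (\<lambda>h. f (x + h))"
      by (intro continuous_intros continuous_compose[OF cf])
    have c2: "continuous_on UNIV (\<lambda>z. 2 * snd z * g (x + (snd z)^2 *\<^sub>R fst z))"
    proof -
      have "continuous_on UNIV (\<lambda>z::(real^3)\<times>real. g (x + (snd z)^2 *\<^sub>R fst z))"
        by (intro continuous_intros continuous_compose[OF cg])
      then show ?thesis by (intro continuous_intros)
    qed
    have qi: "indicator {0..1} t \<noteq> (0::real) \<Longrightarrow> norm t \<le> 1" for t :: real by (auto simp: indicator_def split: if_splits)
    note F = fubini_torus[OF sigma_finite_lborel sets_lborel, of "\<lambda>h t. 2 * t * ?G t x h" "indicator {0..1::real}" 1, OF c2 unit_interval_indicator qi]
    have "(LINT h|torus. f (x + h)) = 0"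
      using torus_integral_shift(1)[OF f(2) borel_imp_torus[OF continuous_borel[OF cf]], of x] mean by (simp add: add.commute)
    then have "- (tvol *\<^sub>R f x) = (LINT h|torus. f (x + h) - f x)"
      using integrable_torus_continuous[OF ci] by (simp add: integral_diff)
    then have "tvol * norm (f x) = norm (LINT h|torus. f (x + h) - f x)"
      by (metis norm_minus_cancel norm_scaleR abs_of_nonneg tvol_nonneg)
    also have "\<dots> \<le> (LINT h|torus. norm (f (x + h) - f x))" by (rule integral_norm_bound)
    also have "\<dots> \<le> (LINT h|torus. D * (LINT t|lborel. indicator {0..1} t * (2 * t * ?G t x h)))"
    proof (rule integral_mono)
      show "integrable torus (\<lambda>h. norm (f (x + h) - f x))"
        by (intro integrable_torus_continuous continuous_intros ci)
      show "integrable torus (\<lambda>h. D * (LINT t|lborel. indicator {0..1} t * (2 * t * ?G t x h)))"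
        by (rule integrable_mult_right[OF F(3)])
      fix h assume "h \<in> space torus"
      then have "norm h \<le> D" using nh by simp
      moreover have "0 \<le> (LINT t|lborel. indicator {0..1} t * (2 * t * ?G t x h))"
        by (rule integral_nonneg) (auto simp: indicator_def g0)
      ultimately show "norm (f (x + h) - f x) \<le> D * (LINT t|lborel. indicator {0..1} t * (2 * t * ?G t x h))"
        using increment_bound[OF f(1), of x h] unfolding g_def[symmetric] by (meson mult_right_mono order_trans)
    qed
    also have "\<dots> = D * (LINT h|torus. LINT t|lborel. indicator {0..1} t * (2 * t * ?G t x h))"
      by (rule integral_mult_right_zero)
    also have "\<dots> = D * (LINT t|lborel. indicator {0..1} t * (2 * t * P t x))"
    proof -
      have "(LINT h|torus. 2 * t * ?G t x h) = 2 * t * P t x" for t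
        unfolding P_def by (rule integral_mult_right_zero)
      moreover have "(LINT h|torus. LINT t|lborel. indicator {0..1} t * (2 * t * ?G t x h)) =
          (LINT t|lborel. indicator {0..1} t * (LINT h|torus. 2 * t * ?G t x h))"
        by (rule F(1))
      ultimately show ?thesis by (simp only:)
    qed
    finally show ?thesis .
  qed
  define J where "J x = (LINT t|lborel. indicator {0..1} t * (2 * t * P t x) ^ 3)" for x
  have cubed: "tvol ^ 3 * norm (f x) ^ 3 \<le> D ^ 3 * J x" for x
  proof -
    have "(tvol * norm (f x)) ^ 3 \<le> (D * (LINT t|lborel. indicator {0..1} t * (2 * t * P t x))) ^ 3"
      by (rule power_mono[OF pointwise]) simp
    also have "\<dots> = D ^ 3 * (LINT t|lborel. indicator {0..1} t * (2 * t * P t x)) ^ 3"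
      by (rule power_mult_distrib)
    also have "\<dots> \<le> D ^ 3 * J x"
      unfolding J_def
    proof (rule mult_left_mono[OF cubic_jensen[where B="2 * (B * tvol)"]])
      note [measurable] = Pt[of x]
      show "(\<lambda>t. 2 * t * P t x) \<in> borel_measurable borel" by measurable
      fix t :: real assume t: "0 \<le> t" "t \<le> 1"
      have "2 * t * P t x \<le> 2 * 1 * (B * tvol)" using t PB[of t x] P0[of t x] by (intro mult_mono) auto
      then show "0 \<le> 2 * t * P t x \<and> 2 * t * P t x \<le> 2 * (B * tvol)" using t P0[of t x] by simp
    qed (simp add: D_def)
    finally show ?thesis by (simp add: power_mult_distrib)
  qed
  have Pt2: "(LINT x|torus. (P t x) ^ 3) * t ^ 3 \<le> sqrt tvol * tvol^2 * \<Gamma> ^ 3" and Pi3: "integrable torus (\<lambda>x. (P t x) ^ 3)"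
    if t: "0 < t" "t \<le> 1" for t
  proof -
    have P2: "(P t x)^2 \<le> tvol * (LINT h|torus. (?G t x h)^2)" for x
    proof -
      have m: "(\<lambda>h. ?G t x h) \<in> borel_measurable torus" by (intro borel_imp_torus continuous_borel cgh)
      have i: "integrable torus (\<lambda>h. (?G t x h)^2)" by (intro integrable_torus_continuous continuous_intros cgh)
      have "\<bar>LINT h|torus. ?G t x h * 1\<bar> \<le> sqrt (LINT h|torus. (?G t x h)^2) * sqrt (LINT h|torus. 1^2)"
        by (rule cauchy_schwarz_integral(3)) (use m i in auto)
      then have "P t x \<le> sqrt (tvol * (LINT h|torus. (?G t x h)^2))"
        by (simp add: P_def real_sqrt_mult mult.commute[of "sqrt tvol"])
      then have "(P t x)^2 \<le> (sqrt (tvol * (LINT h|torus. (?G t x h)^2)))^2"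
        by (rule power_mono) (rule P0)
      then show ?thesis by (simp add: integral_nonneg)
    qed
    have t2: "0 < t^2" "t^2 \<le> 1" using t by (auto simp: power_le_one)
    \<comment> \<open>Cauchy-Schwarz in h, then \<open>integral_torus_dilate\<close> with s = t^2:
      the square of P may grow like t^(-6), which gives t^(-3) for P.\<close>
    have Psup: "P t x * t ^ 3 \<le> sqrt tvol * \<Gamma>" for x
    proof -
      have "(t^2) ^ 3 * (LINT h|torus. (?G t x h)^2) \<le> \<Gamma>^2"
        unfolding \<Gamma>[symmetric]
        by (rule integral_torus_dilate[OF continuous_on_power[OF cg] periodic_compose[OF pg]]) (use t2 in auto)
      then have "tvol * ((t^2) ^ 3 * (LINT h|torus. (?G t x h)^2)) \<le> tvol * \<Gamma>^2"
        by (rule mult_left_mono) simp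
      moreover have "(t^2) ^ 3 * (P t x)^2 \<le> (t^2) ^ 3 * (tvol * (LINT h|torus. (?G t x h)^2))"
        using P2[of x] by (rule mult_left_mono) simp
      ultimately have "(t^2) ^ 3 * (P t x)^2 \<le> tvol * \<Gamma>^2" by (simp add: mult.left_commute)
      moreover have "(P t x * t ^ 3)^2 = (t^2) ^ 3 * (P t x)^2" by (simp add: power_mult_distrib mult.commute flip: power_mult)
      moreover have "(sqrt tvol * \<Gamma>)^2 = tvol * \<Gamma>^2" by (simp add: power_mult_distrib)
      ultimately have "(P t x * t ^ 3)^2 \<le> (sqrt tvol * \<Gamma>)^2" by simp
      then show ?thesis by (rule power2_le_imp_le) (use \<Gamma>0 in auto)
    qed
    have Px: "(\<lambda>x. P t x) \<in> borel_measurable borel"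
      using measurable_compose[OF measurable_Pair2' PM, of t] by simp
    have bi: "integrable torus (\<lambda>x. (P t x) ^ n)" for n
    proof (rule torus.integrable_const_bound[of _ "(B * tvol) ^ n"])
      show "AE x in torus. norm ((P t x) ^ n) \<le> (B * tvol) ^ n"
        using P0[of t] PB[of t] by (intro AE_I2) (auto simp: norm_power intro!: power_mono)
      show "(\<lambda>x. (P t x) ^ n) \<in> borel_measurable torus" using Px by (intro borel_imp_torus borel_measurable_power)
    qed
    show "integrable torus (\<lambda>x. (P t x) ^ 3)" by (rule bi)
    have qi: "indicator cell h \<noteq> (0::real) \<Longrightarrow> norm h \<le> D" for h :: "real^3" using nh by (auto simp: indicator_def split: if_splits)
    have c2: "continuous_on UNIV (\<lambda>z::(real^3)\<times>(real^3). (g (fst z + t^2 *\<^sub>R snd z))^2)" by (intro continuous_intros cgc)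
    have F1: "(LINT x|torus. LINT h|lborel. indicator cell h * (?G t x h)^2)
        = (LINT h|lborel. indicator cell h * (LINT x|torus. (?G t x h)^2))"
      by (rule fubini_torus(1)[OF sigma_finite_lborel sets_lborel c2 integrable_indicator_cell qi])
    have F3: "integrable torus (\<lambda>x. LINT h|lborel. indicator cell h * (?G t x h)^2)"
      by (rule fubini_torus(3)[OF sigma_finite_lborel sets_lborel c2 integrable_indicator_cell qi])
    have cell_eq: "(LINT h|torus. (?G t x h)^2) = (LINT h|lborel. indicator cell h * (?G t x h)^2)" for x
      by (rule integral_torus_lborel) (intro continuous_borel continuous_intros cgh)
    have inner: "(LINT x|torus. (?G t x h)^2) = \<Gamma>^2" for h
      unfolding \<Gamma>[symmetric]
      by (rule torus_integral_shift(1)[OF periodic_compose[OF pg] borel_imp_torus[OF continuous_borel[OF continuous_on_power[OF cg]]]])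
    have tc: "(LINT h|lborel. indicator cell h :: real) = tvol"
      by (simp add: tvol_eq)
    \<comment> \<open>Integrating over x first makes the dilation harmless: for each h the translate
      of the squared gradient has the same integral.\<close>
    have P2i: "(LINT x|torus. (P t x)^2) \<le> tvol^2 * \<Gamma>^2"
    proof -
      have P2': "(P t x)^2 \<le> tvol * (LINT h|lborel. indicator cell h * (?G t x h)^2)" for x
        using P2[of x] unfolding cell_eq .
      have "(LINT x|torus. (P t x)^2) \<le> (LINT x|torus. tvol * (LINT h|lborel. indicator cell h * (?G t x h)^2))"
        by (rule integral_mono[OF bi integrable_mult_right[OF F3]]) (rule P2')
      also have "\<dots> = tvol * (LINT h|lborel. indicator cell h * \<Gamma>^2)"
        unfolding integral_mult_right_zero F1 inner ..
      also have "\<dots> = tvol^2 * \<Gamma>^2" unfolding integral_mult_left_zero tc by (simp add: power2_eq_square)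
      finally show ?thesis .
    qed
    \<comment> \<open>One factor P is estimated by its supremum, the other two by the second
      moment.\<close>
    have "(LINT x|torus. (P t x) ^ 3) * t ^ 3 = (LINT x|torus. (P t x * t ^ 3) * (P t x)^2)"
      by (subst integral_mult_left_zero[symmetric]) (simp add: power2_eq_square power3_eq_cube ac_simps)
    also have "\<dots> \<le> (LINT x|torus. (sqrt tvol * \<Gamma>) * (P t x)^2)"
    proof (rule integral_mono)
      have "(\<lambda>x. (P t x * t ^ 3) * (P t x)^2) = (\<lambda>x. t ^ 3 * (P t x) ^ 3)" by (simp add: fun_eq_iff power2_eq_square power3_eq_cube)
      then show "integrable torus (\<lambda>x. (P t x * t ^ 3) * (P t x)^2)" using bi[of 3] by simp
      show "integrable torus (\<lambda>x. (sqrt tvol * \<Gamma>) * (P t x)^2)" using bi[of 2] by simp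
      show "(P t x * t ^ 3) * (P t x)^2 \<le> (sqrt tvol * \<Gamma>) * (P t x)^2" for x by (rule mult_right_mono[OF Psup]) simp
    qed
    also have "\<dots> \<le> (sqrt tvol * \<Gamma>) * (tvol^2 * \<Gamma>^2)"
      unfolding integral_mult_right_zero by (rule mult_left_mono[OF P2i]) (use \<Gamma>0 in auto)
    finally show "(LINT x|torus. (P t x) ^ 3) * t ^ 3 \<le> sqrt tvol * tvol^2 * \<Gamma> ^ 3"
      by (simp add: power2_eq_square power3_eq_cube ac_simps)
  qed
  have mJ: "(\<lambda>z. (2 * snd z * P (snd z) (fst z)) ^ 3) \<in> borel_measurable (borel \<Otimes>\<^sub>M borel)"
    using PM by (intro borel_measurable_power borel_measurable_times) auto
  have bJ: "\<bar>(2 * t * P t x) ^ 3\<bar> \<le> (2 * (B * tvol)) ^ 3" if "x \<in> cell" "indicator {0..1} t \<noteq> (0::real)" for x and t :: real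
  proof -
    have t: "0 \<le> t" "t \<le> 1" using that(2) by (auto simp: indicator_def split: if_splits)
    have "2 * t * P t x \<le> 2 * 1 * (B * tvol)" using t PB[of t x] P0[of t x] by (intro mult_mono) auto
    moreover have n: "0 \<le> 2 * t * P t x" using t P0[of t x] by simp
    ultimately show ?thesis unfolding power_abs abs_of_nonneg[OF n] by (intro power_mono) simp_all
  qed
  have FJ1: "(LINT x|torus. J x) = (LINT t|lborel. indicator {0..1} t * (LINT x|torus. (2 * t * P t x) ^ 3))"
    unfolding J_def by (rule fubini_torus_bounded(1)[OF sigma_finite_lborel sets_lborel mJ unit_interval_indicator bJ])
  have FJ2: "integrable lborel (\<lambda>t. indicator {0..1} t * (LINT x|torus. (2 * t * P t x) ^ 3))"
    by (rule fubini_torus_bounded(2)[OF sigma_finite_lborel sets_lborel mJ unit_interval_indicator bJ])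
  have FJ3: "integrable torus (\<lambda>x. J x)"
    unfolding J_def by (rule fubini_torus_bounded(3)[OF sigma_finite_lborel sets_lborel mJ unit_interval_indicator bJ])
  have "tvol ^ 3 * (LINT x|torus. norm (f x) ^ 3) = (LINT x|torus. tvol ^ 3 * norm (f x) ^ 3)" by simp
  also have "\<dots> \<le> (LINT x|torus. D ^ 3 * J x)"
  proof (rule integral_mono)
    show "integrable torus (\<lambda>x. tvol ^ 3 * norm (f x) ^ 3)"
      by (intro integrable_mult_right integrable_torus_continuous continuous_intros cf)
    show "integrable torus (\<lambda>x. D ^ 3 * J x)" by (rule integrable_mult_right[OF FJ3])
  qed (rule cubed)
  also have "\<dots> = D ^ 3 * (LINT t|lborel. indicator {0..1} t * (LINT x|torus. (2 * t * P t x) ^ 3))"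
    unfolding FJ1[symmetric] by (rule integral_mult_right_zero)
  also have "\<dots> \<le> D ^ 3 * (LINT t|lborel. indicator {0..1::real} t * (8 * (sqrt tvol * tvol^2 * \<Gamma> ^ 3)))"
  proof (rule mult_left_mono, rule integral_mono)
    show "integrable lborel (\<lambda>t. indicator {0..1} t * (LINT x|torus. (2 * t * P t x) ^ 3))" by (rule FJ2)
    show "integrable lborel (\<lambda>t. indicator {0..1::real} t * (8 * (sqrt tvol * tvol^2 * \<Gamma> ^ 3)))" by simp
    fix t :: real
    show "indicator {0..1} t * (LINT x|torus. (2 * t * P t x) ^ 3) \<le> indicator {0..1} t * (8 * (sqrt tvol * tvol^2 * \<Gamma> ^ 3))"
    proof (cases "0 \<le> t \<and> t \<le> 1")
      case True
      have e: "(LINT x|torus. (2 * t * P t x) ^ 3) = 8 * ((LINT x|torus. (P t x) ^ 3) * t ^ 3)"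
        by (simp add: power_mult_distrib)
      have "(LINT x|torus. (P t x) ^ 3) * t ^ 3 \<le> sqrt tvol * tvol^2 * \<Gamma> ^ 3"
      proof (cases "t = 0")
        case False then show ?thesis using True by (intro Pt2) auto
      qed (use \<Gamma>0 in simp)
      then show ?thesis using True unfolding e by simp
    qed simp
  qed (simp add: D_def)
  also have "\<dots> = D ^ 3 * (8 * (sqrt tvol * tvol^2 * \<Gamma> ^ 3))" by simp
  finally have "tvol ^ 3 * (LINT x|torus. norm (f x) ^ 3) \<le> D ^ 3 * (8 * (sqrt tvol * tvol^2 * \<Gamma> ^ 3))" .
  moreover have "tvol ^ 3 * (D ^ 3 * (8 * sqrt tvol / tvol) * \<Gamma> ^ 3) = D ^ 3 * (8 * (sqrt tvol * tvol^2 * \<Gamma> ^ 3))"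
    using V0 by (simp add: power2_eq_square power3_eq_cube field_simps)
  ultimately have "tvol ^ 3 * (LINT x|torus. norm (f x) ^ 3) \<le> tvol ^ 3 * (D ^ 3 * (8 * sqrt tvol / tvol) * \<Gamma> ^ 3)" by simp
  then have "(LINT x|torus. norm (f x) ^ 3) \<le> D ^ 3 * (8 * sqrt tvol / tvol) * \<Gamma> ^ 3"
    by (rule mult_left_le_imp_le) (use V0 in simp)
  then show ?thesis unfolding D_def \<Gamma>_def .
qed

section \<open>The energy flux of a solenoidal \<open>H\<^sup>1\<close> field\<close>

lemma C_inf_divD:
  assumes "f \<in> C_inf_div"
  shows "smooth f" "periodic f" "\<And>x. divergence f x = 0" "(LINT x|torus. f x) = 0" "f \<in> L2" "grad f \<in> L2"
  using assms L2_smooth[of f] L2_continuous[OF continuous_grad periodic_grad, of f] by (auto simp: C_inf_div_def)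

lemma grad_diff: assumes "smooth f" "smooth g" shows "grad (\<lambda>x. f x - g x) = (\<lambda>x. grad f x - grad g x)"
proof -
  have "pd j (\<lambda>x. f x - g x) x = pd j f x - pd j g x" for j x
    using pd_eqI[OF has_derivative_diff[OF assms[THEN smooth_has_derivative_frechet]], of j] by (simp add: pd_def)
  then show ?thesis by (simp add: fun_eq_iff vec_eq_iff grad_eq assms smooth_diff)
qed

text \<open>Keeps the gradient and the approximating sequence explicit; \<open>H1_div\<close> hides
  both behind quantifiers, and every passage from smooth to H1 fields needs them.\<close>

definition H1_approx :: "(real^3 \<Rightarrow> real^3) \<Rightarrow> (real^3 \<Rightarrow> real^3^3) \<Rightarrow> (nat \<Rightarrow> real^3 \<Rightarrow> real^3) \<Rightarrow> bool" where
  "H1_approx v G \<Phi> \<longleftrightarrow> v \<in> L2 \<and> G \<in> L2 \<and> (\<forall>n. \<Phi> n \<in> C_inf_div) \<and>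
    (\<lambda>n. L2_norm (\<lambda>x. \<Phi> n x - v x)) \<longlonglongrightarrow> 0 \<and> (\<lambda>n. L2_norm (\<lambda>x. grad (\<Phi> n) x - G x)) \<longlonglongrightarrow> 0"

lemma H1_approxD:
  assumes "H1_approx v G \<Phi>"
  shows "v \<in> L2" "G \<in> L2" "\<And>n. \<Phi> n \<in> C_inf_div" "(\<lambda>n. L2_norm (\<lambda>x. \<Phi> n x - v x)) \<longlonglongrightarrow> 0"
    "(\<lambda>n. L2_norm (\<lambda>x. grad (\<Phi> n) x - G x)) \<longlonglongrightarrow> 0" "v \<in> L2_div"
  using assms by (auto simp: H1_approx_def L2_div_def)

lemma cube_add_le: "0 \<le> a \<Longrightarrow> 0 \<le> b \<Longrightarrow> (a + b) ^ 3 \<le> 4 * (a ^ 3 + b ^ 3)" for a b :: real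
proof -
  assume "0 \<le> a" "0 \<le> b"
  then have "0 \<le> 3 * (a + b) * (a - b)^2" by simp
  also have "\<dots> = 4 * (a ^ 3 + b ^ 3) - (a + b) ^ 3" by (simp add: power2_eq_square power3_eq_cube algebra_simps)
  finally show ?thesis by simp
qed

lemma norm_cube_diff_le: "norm (a - b) ^ 3 \<le> 4 * (norm a ^ 3 + norm b ^ 3)"
  by (rule order_trans[OF power_mono[OF norm_triangle_ineq4] cube_add_le]) auto

text \<open>Differences of the approximants have mean zero, so \<open>sobolev_L3\<close> makes the
  sequence Cauchy in L3. L2 convergence yields a subsequence converging almost everywhere, and
  Fatou's lemma identifies the L3 limit with v.\<close>

lemma L3_convergence:
  assumes A: "H1_approx v G \<Phi>"
  shows "integrable torus (\<lambda>x. norm (v x) ^ 3)"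
    and "\<And>n. integrable torus (\<lambda>x. norm (\<Phi> n x - v x) ^ 3)"
    and "(\<lambda>n. LINT x|torus. norm (\<Phi> n x - v x) ^ 3) \<longlonglongrightarrow> 0"
proof -
  note H = H1_approxD[OF A]
  note v = H(1) and G = H(2) and lv = H(4) and lG = H(5) and D = C_inf_divD[OF H(3)]
  note [measurable] = L2D(2)[OF v] L2D(2)[OF D(5)]
  define c where "c = (norm (\<chi> i. 2 * pi :: real^3)) ^ 3 * (8 * sqrt tvol / tvol)"
  have c0: "0 \<le> c" by (simp add: c_def)
  define a where "a n = L2_norm (\<lambda>x. grad (\<Phi> n) x - G x)" for n
  have a0: "0 \<le> a n" for n by (simp add: a_def)
  have sob: "(LINT x|torus. norm (\<Phi> n x - \<Phi> m x) ^ 3) \<le> c * (a n + a m) ^ 3" for n m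
  proof -
    have "(LINT x|torus. norm (\<Phi> n x - \<Phi> m x) ^ 3) \<le> c * (L2_norm (grad (\<lambda>x. \<Phi> n x - \<Phi> m x))) ^ 3"
      unfolding c_def
      by (rule sobolev_L3[OF smooth_diff[OF D(1)[of n] D(1)[of m]] periodic_compose2[OF D(2)[of n] D(2)[of m], of minus]])
         (use D(4) L2_integrable[OF D(5)] in simp)
    also have "\<dots> \<le> c * (a n + a m) ^ 3"
      using L2_norm_triangle_diff[OF D(6) G D(6), of n m] L2_norm_commute[of G]
      by (intro mult_left_mono power_mono c0) (simp_all add: grad_diff[OF D(1) D(1)] a_def)
    finally show ?thesis .
  qed
  have i3: "integrable torus (\<lambda>x. norm (\<Phi> n x - \<Phi> m x) ^ 3)" for n m
    by (intro integrable_torus_continuous continuous_intros smooth_continuous D)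
  obtain r where r: "strict_mono r" "AE x in torus. (\<lambda>k. \<Phi> (r k) x - v x) \<longlonglongrightarrow> 0"
    using tendsto_L1_AE_subseq[OF L2_integrable[OF L2_diff[OF D(5) v]] L1_tendsto_L2[OF D(5) v lv]] by blast
  have a_lim: "a \<longlonglongrightarrow> 0" using lG by (simp add: a_def[abs_def])
  \<comment> \<open>The Sobolev bound contains a(n) + a(r k) with a(r k) \<longlongrightarrow> 0;
    the summand 1/(n + 1) is room for a(r k), which falls below it for all large k.\<close>
  have bound: "(\<integral>\<^sup>+x. ennreal (norm (\<Phi> n x - v x) ^ 3) \<partial>torus) \<le> ennreal (c * (a n + 1 / real (Suc n)) ^ 3)" for n
  proof (rule nn_integral_limit_le[where h="\<lambda>k x. norm (\<Phi> n x - \<Phi> (r k) x) ^ 3"])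
    show "AE x in torus. (\<lambda>k. norm (\<Phi> n x - \<Phi> (r k) x) ^ 3) \<longlonglongrightarrow> norm (\<Phi> n x - v x) ^ 3"
        using r(2) by eventually_elim (rule tendsto_power[OF tendsto_norm[OF tendsto_diff[OF tendsto_const LIM_zero_cancel]]])
      have "(\<lambda>k. a (r k)) \<longlonglongrightarrow> 0" using LIMSEQ_subseq_LIMSEQ[OF a_lim r(1)] by (simp add: o_def)
      then have "\<forall>\<^sub>F k in sequentially. a (r k) < 1 / real (Suc n)"
        by (rule order_tendstoD(2)) simp
      then show "\<forall>\<^sub>F k in sequentially. (\<integral>\<^sup>+x. ennreal (norm (\<Phi> n x - \<Phi> (r k) x) ^ 3) \<partial>torus) \<le> ennreal (c * (a n + 1 / real (Suc n)) ^ 3)"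
      proof eventually_elim
        fix k assume k: "a (r k) < 1 / real (Suc n)"
        have "(\<integral>\<^sup>+x. ennreal (norm (\<Phi> n x - \<Phi> (r k) x) ^ 3) \<partial>torus) = ennreal (LINT x|torus. norm (\<Phi> n x - \<Phi> (r k) x) ^ 3)"
          by (rule nn_integral_eq_integral[OF i3]) simp
        also have "\<dots> \<le> ennreal (c * (a n + a (r k)) ^ 3)" by (rule ennreal_leI[OF sob])
        also have "\<dots> \<le> ennreal (c * (a n + 1 / real (Suc n)) ^ 3)"
          using k a0 by (intro ennreal_leI mult_left_mono power_mono c0) auto
        finally show "(\<integral>\<^sup>+x. ennreal (norm (\<Phi> n x - \<Phi> (r k) x) ^ 3) \<partial>torus) \<le> ennreal (c * (a n + 1 / real (Suc n)) ^ 3)" .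
      qed
  qed measurable
  show i: "integrable torus (\<lambda>x. norm (\<Phi> n x - v x) ^ 3)" for n
    by (rule integrableI_bounded) (use le_less_trans[OF bound ennreal_less_top, of n] in auto)
  have le: "(LINT x|torus. norm (\<Phi> n x - v x) ^ 3) \<le> c * (a n + 1 / real (Suc n)) ^ 3" for n
  proof -
    have "ennreal (LINT x|torus. norm (\<Phi> n x - v x) ^ 3) \<le> ennreal (c * (a n + 1 / real (Suc n)) ^ 3)"
      using bound[of n] nn_integral_eq_integral[OF i, of n] by simp
    then show ?thesis using c0 a0[of n] by (simp add: ennreal_le_iff)
  qed
  show "(\<lambda>n. LINT x|torus. norm (\<Phi> n x - v x) ^ 3) \<longlonglongrightarrow> 0"
  proof (rule LIMSEQ_0_le[OF _ _ le])
    have "(\<lambda>n. c * (a n + 1 / real (Suc n)) ^ 3) \<longlonglongrightarrow> c * (0 + 0) ^ 3" by (intro tendsto_intros a_lim LIMSEQ_inverse_Suc)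
    then show "(\<lambda>n. c * (a n + 1 / real (Suc n)) ^ 3) \<longlonglongrightarrow> 0" by simp
  qed simp
  show "integrable torus (\<lambda>x. norm (v x) ^ 3)"
  proof (rule integrable_bound)
    show "integrable torus (\<lambda>x. 4 * (norm (\<Phi> 0 x) ^ 3 + norm (\<Phi> 0 x - v x) ^ 3))"
      by (intro integrable_mult_right integrable_add i integrable_torus_continuous continuous_intros smooth_continuous D)
    have "norm (v x) ^ 3 \<le> 4 * (norm (\<Phi> 0 x) ^ 3 + norm (\<Phi> 0 x - v x) ^ 3)" for x
      using norm_cube_diff_le[of "\<Phi> 0 x" "\<Phi> 0 x - v x"] by simp
    then show "AE x in torus. norm (norm (v x) ^ 3) \<le> norm (4 * (norm (\<Phi> 0 x) ^ 3 + norm (\<Phi> 0 x - v x) ^ 3))"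
      by (intro AE_I2) auto
  qed measurable
qed

text \<open>The common property of the integrands |a|^2 (a . n) and (a . n)^3, so that both fluxes
  pass to H1 limits by one argument.\<close>

definition cubic_Lipschitz :: "real \<Rightarrow> ('b::real_normed_vector \<Rightarrow> real) \<Rightarrow> bool" where
  "cubic_Lipschitz L C \<longleftrightarrow> C 0 = 0 \<and> (\<forall>a b. \<bar>C a - C b\<bar> \<le> L * ((norm a + norm b)^2 * norm (a - b)))"

lemma cubic_Lipschitz_ball: "cubic_Lipschitz (norm n) (\<lambda>a::real^3. (norm a)^2 * (a \<bullet> n))"
  unfolding cubic_Lipschitz_def
proof (intro conjI allI)
  fix a b :: "real^3"
  let ?a = "norm a" and ?b = "norm b" and ?d = "norm (a - b)"
  have "(norm a)^2 * (a \<bullet> n) - (norm b)^2 * (b \<bullet> n) = ?a^2 * ((a - b) \<bullet> n) + (?a - ?b) * (?a + ?b) * (b \<bullet> n)"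
    by (simp add: inner_diff_left power2_eq_square algebra_simps)
  also have "\<bar>\<dots>\<bar> \<le> \<bar>?a^2 * ((a - b) \<bullet> n)\<bar> + \<bar>(?a - ?b) * (?a + ?b) * (b \<bullet> n)\<bar>" by (rule abs_triangle_ineq)
  also have "\<dots> \<le> ?a^2 * (?d * norm n) + ?d * (?a + ?b) * (?b * norm n)"
    unfolding abs_mult
    by (intro add_mono mult_mono Cauchy_Schwarz_ineq2 norm_triangle_ineq3) auto
  also have "\<dots> = norm n * ((?a^2 + ?a * ?b + ?b^2) * ?d)" by (simp add: power2_eq_square algebra_simps)
  also have "\<dots> \<le> norm n * ((?a + ?b)^2 * ?d)"
    by (intro mult_left_mono mult_right_mono) (auto simp: power2_sum)
  finally show "\<bar>(norm a)^2 * (a \<bullet> n) - (norm b)^2 * (b \<bullet> n)\<bar> \<le> norm n * ((?a + ?b)^2 * ?d)" .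
qed simp

lemma cubic_Lipschitz_par: "cubic_Lipschitz (norm n ^ 3) (\<lambda>a::real^3. (a \<bullet> n) ^ 3)"
  unfolding cubic_Lipschitz_def
proof (intro conjI allI)
  fix a b :: "real^3"
  let ?p = "a \<bullet> n" and ?q = "b \<bullet> n"
  have pq: "\<bar>?p\<bar> \<le> norm n * norm a" "\<bar>?q\<bar> \<le> norm n * norm b" "\<bar>?p - ?q\<bar> \<le> norm n * norm (a - b)"
    using Cauchy_Schwarz_ineq2[of a n] Cauchy_Schwarz_ineq2[of b n] Cauchy_Schwarz_ineq2[of "a - b" n]
    by (simp_all add: inner_diff_left mult.commute)
  have "?p ^ 3 - ?q ^ 3 = (?p^2 + ?p * ?q + ?q^2) * (?p - ?q)" by (simp add: power2_eq_square power3_eq_cube algebra_simps)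
  then have "\<bar>?p ^ 3 - ?q ^ 3\<bar> = \<bar>?p^2 + ?p * ?q + ?q^2\<bar> * \<bar>?p - ?q\<bar>" by (simp only: abs_mult)
  also have "\<dots> \<le> (norm n * norm a + norm n * norm b)^2 * (norm n * norm (a - b))"
  proof (intro mult_mono pq(3))
    have "\<bar>?p^2 + ?p * ?q + ?q^2\<bar> \<le> \<bar>?p^2\<bar> + \<bar>?p * ?q\<bar> + \<bar>?q^2\<bar>" by linarith
    also have "\<dots> \<le> (\<bar>?p\<bar> + \<bar>?q\<bar>)^2" by (simp add: power2_sum abs_mult)
    also have "\<dots> \<le> (norm n * norm a + norm n * norm b)^2" by (intro power_mono add_mono pq) auto
    finally show "\<bar>?p^2 + ?p * ?q + ?q^2\<bar> \<le> (norm n * norm a + norm n * norm b)^2" .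
  qed auto
  also have "\<dots> = norm n ^ 3 * ((norm a + norm b)^2 * norm (a - b))"
    by (simp add: power2_eq_square power3_eq_cube algebra_simps)
  finally show "\<bar>?p ^ 3 - ?q ^ 3\<bar> \<le> norm n ^ 3 * ((norm a + norm b)^2 * norm (a - b))" .
qed simp

text \<open>A Young inequality obtained by comparing |a - b| with \<eta> |b|. Here b will be fixed
  in L3 and a - b small in L3: first \<eta> is chosen, then the large factor meets the small
  term.\<close>

lemma cubic_young:
  fixes a b :: "'b::real_normed_vector"
  assumes \<eta>: "\<eta> > 0"
  shows "(norm a + norm b)^2 * norm (a - b) \<le> 8 * \<eta> * norm b ^ 3 + (8 / \<eta>^2 + 2) * norm (a - b) ^ 3"
proof -
  let ?b = "norm b" and ?d = "norm (a - b)"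
  have "norm a \<le> ?b + ?d" using norm_triangle_sub[of a b] by simp
  then have "(norm a + ?b)^2 \<le> (2 * ?b + ?d)^2" by (intro power_mono) auto
  also have "\<dots> \<le> 8 * ?b^2 + 2 * ?d^2"
  proof -
    have "0 \<le> (2 * ?b - ?d)^2" by simp
    then show ?thesis by (simp add: power2_sum power2_diff power_mult_distrib)
  qed
  finally have "(norm a + ?b)^2 * ?d \<le> (8 * ?b^2 + 2 * ?d^2) * ?d" by (rule mult_right_mono) simp
  also have "\<dots> = 8 * (?b^2 * ?d) + 2 * ?d ^ 3" by (simp add: power2_eq_square power3_eq_cube algebra_simps)
  also have "?b^2 * ?d \<le> \<eta> * ?b ^ 3 + 1 / \<eta>^2 * ?d ^ 3"
  proof (cases "?d \<le> \<eta> * ?b")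
    case True
    then have "?b^2 * ?d \<le> ?b^2 * (\<eta> * ?b)" by (intro mult_left_mono) auto
    also have "\<dots> = \<eta> * ?b ^ 3" by (simp add: power2_eq_square power3_eq_cube)
    also have "\<dots> \<le> \<eta> * ?b ^ 3 + 1 / \<eta>^2 * ?d ^ 3" using \<eta> by simp
    finally show ?thesis .
  next
    case False
    then have "?b \<le> ?d / \<eta>" using \<eta> by (simp add: pos_le_divide_eq mult.commute)
    then have "?b^2 * ?d \<le> (?d / \<eta>)^2 * ?d" by (intro mult_right_mono power_mono) auto
    also have "\<dots> = 1 / \<eta>^2 * ?d ^ 3" by (simp add: power2_eq_square power3_eq_cube)
    also have "\<dots> \<le> \<eta> * ?b ^ 3 + 1 / \<eta>^2 * ?d ^ 3" using \<eta> by simp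
    finally show ?thesis .
  qed
  finally show ?thesis by (simp add: algebra_simps)
qed

lemma increment_L3:
  assumes p: "periodic w" and m: "w \<in> borel_measurable torus" and i: "integrable torus (\<lambda>x. norm (w x :: real^3) ^ 3)"
  shows "integrable torus (\<lambda>x. norm (increment h w x) ^ 3)"
    and "(LINT x|torus. norm (increment h w x) ^ 3) \<le> 8 * (LINT x|torus. norm (w x) ^ 3)"
proof -
  note [measurable] = m torus_measurable_shift[OF p m]
  have pw: "periodic (\<lambda>x. norm (w x) ^ 3)" by (rule periodic_compose[OF p])
  have sh: "integrable torus (\<lambda>x. norm (w (x + h)) ^ 3)" "(LINT x|torus. norm (w (x + h)) ^ 3) = (LINT x|torus. norm (w x) ^ 3)"
    using torus_integral_shift[OF pw borel_measurable_integrable[OF i]] i by auto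
  have b: "norm (increment h w x) ^ 3 \<le> 4 * (norm (w (x + h)) ^ 3 + norm (w x) ^ 3)" for x
    unfolding increment_def by (rule norm_cube_diff_le)
  have ib: "integrable torus (\<lambda>x. 4 * (norm (w (x + h)) ^ 3 + norm (w x) ^ 3))" using sh i by simp
  have mi: "(\<lambda>x. norm (increment h w x) ^ 3) \<in> borel_measurable torus" unfolding increment_def by measurable
  show ii: "integrable torus (\<lambda>x. norm (increment h w x) ^ 3)"
    by (rule integrable_bound[OF ib mi]) (use b in auto)
  have "(LINT x|torus. norm (increment h w x) ^ 3) \<le> (LINT x|torus. 4 * (norm (w (x + h)) ^ 3 + norm (w x) ^ 3))"
    by (rule integral_mono[OF ii ib b])
  also have "\<dots> = 8 * (LINT x|torus. norm (w x) ^ 3)" using sh i by simp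
  finally show "(LINT x|torus. norm (increment h w x) ^ 3) \<le> 8 * (LINT x|torus. norm (w x) ^ 3)" .
qed

text \<open>By translation invariance the L3 norm of an increment is at most a constant times that
  of the field, whatever h is. So N is uniform in h and in the integrand, with the error scaled by
  L; the integration over the sphere needs this uniformity.\<close>

lemma cubic_convergence:
  assumes A: "H1_approx v G \<Phi>" and e: "e > 0"
  shows "\<exists>N. \<forall>k\<ge>N. \<forall>L C h. 0 \<le> L \<longrightarrow> cubic_Lipschitz L C \<longrightarrow> C \<in> borel_measurable borel \<longrightarrow>
    \<bar>(LINT x|torus. C (increment h (\<Phi> k) x)) - (LINT x|torus. C (increment h v x))\<bar> \<le> L * e"
proof -
  note v = H1_approxD(1)[OF A] and D = C_inf_divD[OF H1_approxD(3)[OF A]]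
  note conv = L3_convergence[OF A]
  define M where "M = (LINT x|torus. norm (v x) ^ 3)"
  have M0: "0 \<le> M" unfolding M_def by (rule integral_nonneg) simp
  define d where "d k = (LINT x|torus. norm (\<Phi> k x - v x) ^ 3)" for k
  \<comment> \<open>The constants halve the error: 8 \<eta> times 8 M is at most \<eta> Q = e/2, and
    K d(k) < e/2 for large k. Each factor 8 beside M or d(k) is the constant of
    \<open>increment_L3\<close>; the summand 1 keeps Q positive when v = 0.\<close>
  define Q where "Q = 64 * M + 1"
  have Q: "Q > 0" using M0 by (simp add: Q_def)
  define \<eta> where "\<eta> = e / (2 * Q)"
  have \<eta>: "\<eta> > 0" using e Q by (simp add: \<eta>_def)
  define K where "K = 8 * (8 / \<eta>^2 + 2)"
  have K: "K > 0" using \<eta> by (simp add: K_def add_pos_pos)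
  have "d \<longlonglongrightarrow> 0" using conv(3) by (simp add: d_def[abs_def])
  then have "\<forall>\<^sub>F k in sequentially. d k < e / (2 * K)" by (rule order_tendstoD(2)) (use e K in simp)
  then obtain N where N: "\<And>k. k \<ge> N \<Longrightarrow> d k < e / (2 * K)" unfolding eventually_sequentially by blast
  have "\<bar>(LINT x|torus. C (increment h (\<Phi> k) x)) - (LINT x|torus. C (increment h v x))\<bar> \<le> L * e"
    if k: "k \<ge> N" and L: "0 \<le> L" and C: "cubic_Lipschitz L C" and Cm[measurable]: "C \<in> borel_measurable borel" for k L C h
  proof -
    have C0: "C 0 = 0" and CL: "\<And>a b. \<bar>C a - C b\<bar> \<le> L * ((norm a + norm b)^2 * norm (a - b))"
      using C by (auto simp: cubic_Lipschitz_def)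
    have Cb: "\<bar>C a\<bar> \<le> L * norm a ^ 3" for a using CL[of a 0] C0 by (simp add: power2_eq_square power3_eq_cube mult.assoc)
    note pv = L2D(1)[OF v] and mv = L2D(2)[OF v]
    have md: "(\<lambda>x. \<Phi> k x - v x) \<in> borel_measurable torus" and pd: "periodic (\<lambda>x. \<Phi> k x - v x)"
      using L2D(1,2)[OF L2_diff[OF D(5) v]] by auto
    have iPhi: "integrable torus (\<lambda>x. norm (\<Phi> k x) ^ 3)"
      by (intro integrable_torus_continuous continuous_intros smooth_continuous D)
    note i\<Phi> = increment_L3(1)[OF D(2) L2D(2)[OF D(5)] iPhi, of h]
    note iv = increment_L3[OF pv mv conv(1), of h]
    note id = increment_L3[OF pd md conv(2), of h]
    have inc: "increment h (\<lambda>x. \<Phi> k x - v x) x = increment h (\<Phi> k) x - increment h v x" for x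
      by (simp add: increment_def)
    have mi: "(\<lambda>x. increment h w x) \<in> borel_measurable torus" if "periodic w" "w \<in> borel_measurable torus" for w
      unfolding increment_def using torus_measurable_shift[OF that] that(2) by (rule borel_measurable_diff)
    note m1 = mi[OF D(2) L2D(2)[OF D(5)], of k] and m2 = mi[OF pv mv]
    have ic1: "integrable torus (\<lambda>x. C (increment h (\<Phi> k) x))"
      by (rule integrable_bound[OF integrable_mult_right[OF i\<Phi>, of L]])
         (use measurable_compose[OF m1 Cm] Cb L in \<open>auto intro!: AE_I2 simp: abs_mult power_abs\<close>)
    have ic2: "integrable torus (\<lambda>x. C (increment h v x))"
      by (rule integrable_bound[OF integrable_mult_right[OF iv(1), of L]])
         (use measurable_compose[OF m2 Cm] Cb L in \<open>auto intro!: AE_I2 simp: abs_mult power_abs\<close>)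
    have ib: "integrable torus (\<lambda>x. L * (8 * \<eta> * norm (increment h v x) ^ 3 + (8 / \<eta>^2 + 2) * norm (increment h (\<lambda>x. \<Phi> k x - v x) x) ^ 3))"
      using iv(1) id(1) by simp
    have "\<bar>(LINT x|torus. C (increment h (\<Phi> k) x)) - (LINT x|torus. C (increment h v x))\<bar>
      = \<bar>LINT x|torus. C (increment h (\<Phi> k) x) - C (increment h v x)\<bar>"
      by (simp add: integral_diff[OF ic1 ic2])
    also have "\<dots> \<le> (LINT x|torus. \<bar>C (increment h (\<Phi> k) x) - C (increment h v x)\<bar>)" by (rule integral_abs_bound)
    also have "\<dots> \<le> (LINT x|torus. L * (8 * \<eta> * norm (increment h v x) ^ 3 + (8 / \<eta>^2 + 2) * norm (increment h (\<lambda>x. \<Phi> k x - v x) x) ^ 3))"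
    proof (rule integral_mono[OF _ ib])
      show "integrable torus (\<lambda>x. \<bar>C (increment h (\<Phi> k) x) - C (increment h v x)\<bar>)" using ic1 ic2 by simp
      show "\<bar>C (increment h (\<Phi> k) x) - C (increment h v x)\<bar> \<le> L * (8 * \<eta> * norm (increment h v x) ^ 3 + (8 / \<eta>^2 + 2) * norm (increment h (\<lambda>x. \<Phi> k x - v x) x) ^ 3)" for x
        unfolding inc by (rule order_trans[OF CL mult_left_mono[OF cubic_young[OF \<eta>] L]])
    qed
    also have "\<dots> = L * (8 * \<eta> * (LINT x|torus. norm (increment h v x) ^ 3) + (8 / \<eta>^2 + 2) * (LINT x|torus. norm (increment h (\<lambda>x. \<Phi> k x - v x) x) ^ 3))"
      using iv(1) id(1) by simp
    also have "\<dots> \<le> L * (8 * \<eta> * (8 * M) + (8 / \<eta>^2 + 2) * (8 * d k))"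
      using iv(2) id(2) \<eta> L unfolding M_def d_def by (intro mult_left_mono add_mono) (auto intro!: add_nonneg_nonneg)
    also have "\<dots> \<le> L * e"
    proof (rule mult_left_mono[OF _ L])
      have "K * d k \<le> K * (e / (2 * K))" using N[OF k] K by (intro mult_left_mono) auto
      also have "\<dots> = e / 2" using K by simp
      finally have 1: "(8 / \<eta>^2 + 2) * (8 * d k) \<le> e / 2" by (simp add: K_def mult.commute mult.left_commute)
      have "8 * \<eta> * (8 * M) \<le> \<eta> * Q" using \<eta> by (simp add: Q_def algebra_simps)
      also have "\<dots> = e / 2" using Q by (simp add: \<eta>_def)
      finally show "8 * \<eta> * (8 * M) + (8 / \<eta>^2 + 2) * (8 * d k) \<le> e" using 1 by linarith
    qed
    finally show ?thesis .
  qed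
  then show ?thesis by blast
qed

lemma sphere_cubic_convergence:
  assumes A: "H1_approx v G \<Phi>"
    and C: "\<And>n. cubic_Lipschitz (norm n ^ q) (C n)" "\<And>n. C n \<in> borel_measurable borel"
    and cC: "continuous_on UNIV (\<lambda>z. C (snd z) (fst z))"
  shows "(\<lambda>k. LINT n|sphere_measure. LINT x|torus. C n (increment (l *\<^sub>R n) (\<Phi> k) x)) \<longlonglongrightarrow>
    (LINT n|sphere_measure. LINT x|torus. C n (increment (l *\<^sub>R n) v x))"
proof -
  note D = C_inf_divD[OF H1_approxD(3)[OF A]]
  let ?Q = "\<lambda>w n. LINT x|torus. C n (increment (l *\<^sub>R n) w x)"
  have conv: "\<exists>N. \<forall>k\<ge>N. \<forall>n. \<bar>?Q (\<Phi> k) n - ?Q v n\<bar> \<le> norm n ^ q * e" if "e > 0" for e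
    using cubic_convergence[OF A that] C by (meson norm_ge_zero zero_le_power)
  have cont: "continuous_on UNIV (\<lambda>z. C (snd z) (increment (l *\<^sub>R snd z) (\<Phi> k) (fst z)))" for k
  proof -
    have c: "continuous_on UNIV (\<lambda>z::(real^3)\<times>(real^3). \<Phi> k (fst z + l *\<^sub>R snd z) - \<Phi> k (fst z))"
      by (intro continuous_on_diff continuous_on_compose2[OF smooth_continuous[OF D(1), of UNIV k]]) (auto intro!: continuous_intros)
    have "continuous_on UNIV (\<lambda>z. (\<Phi> k (fst z + l *\<^sub>R snd z) - \<Phi> k (fst z), snd z))"
      by (intro continuous_on_Pair c continuous_intros)
    from continuous_on_compose2[OF cC this] show ?thesis by (simp add: increment_def)
  qed
  have Qi: "integrable sphere_measure (?Q (\<Phi> k))" and Qm: "?Q (\<Phi> k) \<in> borel_measurable borel" for k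
    using fubini_sphere(2,3)[OF cont[of k]] by simp_all
  have ptw: "(\<lambda>k. ?Q (\<Phi> k) n) \<longlonglongrightarrow> ?Q v n" for n
  proof (rule LIMSEQ_I)
    fix r :: real assume r: "r > 0"
    define e where "e = r / (2 * (norm n ^ q + 1))"
    have e: "e > 0" using r by (simp add: e_def add_nonneg_pos)
    obtain N where "\<forall>k\<ge>N. \<forall>n. \<bar>?Q (\<Phi> k) n - ?Q v n\<bar> \<le> norm n ^ q * e" using conv[OF e] by blast
    moreover have "norm n ^ q * e < r"
    proof -
      have "norm n ^ q * e \<le> (norm n ^ q + 1) * e" using e by (simp add: distrib_right)
      also have "\<dots> = r / 2" unfolding e_def by (simp add: add_nonneg_eq_0_iff field_simps)
      also have "\<dots> < r" using r by simp
      finally show ?thesis .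
    qed
    ultimately show "\<exists>N. \<forall>k\<ge>N. norm (?Q (\<Phi> k) n - ?Q v n) < r" unfolding real_norm_def by (meson le_less_trans)
  qed
  have Qv: "?Q v \<in> borel_measurable borel" by (rule borel_measurable_LIMSEQ_real[OF ptw Qm])
  obtain N where N: "\<And>k n. k \<ge> N \<Longrightarrow> \<bar>?Q (\<Phi> k) n - ?Q v n\<bar> \<le> norm n ^ q * 1" using conv[of 1] by auto
  have "(\<lambda>k. LINT n|sphere_measure. ?Q (\<Phi> (k + N)) n) \<longlonglongrightarrow> (LINT n|sphere_measure. ?Q v n)"
  \<comment> \<open>On the unit sphere the fluxes of the members from N on are within 1 of the
    limit, hence within 2 of the flux of member N, which is integrable.\<close>
  proof (rule integral_dominated_convergence[where w="\<lambda>n. \<bar>?Q (\<Phi> N) n\<bar> + 2"])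
    show "integrable sphere_measure (\<lambda>n. \<bar>?Q (\<Phi> N) n\<bar> + 2)" using Qi by simp
    show "AE n in sphere_measure. (\<lambda>k. ?Q (\<Phi> (k + N)) n) \<longlonglongrightarrow> ?Q v n"
      by (intro AE_I2 LIMSEQ_ignore_initial_segment ptw)
    show "AE n in sphere_measure. norm (?Q (\<Phi> (k + N)) n) \<le> \<bar>?Q (\<Phi> N) n\<bar> + 2" for k
      using AE_sphere_measure
    proof eventually_elim
      fix n :: "real^3" assume "norm n = 1"
      then show "norm (?Q (\<Phi> (k + N)) n) \<le> \<bar>?Q (\<Phi> N) n\<bar> + 2" using N[of "k + N" n] N[of N n] by simp
    qed
  qed (use Qv Qm in auto)
  then show ?thesis by (rule LIMSEQ_offset)
qed

section \<open>The advection term of an H1 field\<close>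

lemma advect_measurable:
  fixes G :: "real^3 \<Rightarrow> real^3^3" and v :: "real^3 \<Rightarrow> real^3"
  assumes "G \<in> borel_measurable torus" "v \<in> borel_measurable torus"
  shows "(\<lambda>x. G x *v v x) \<in> borel_measurable torus"
proof (rule borel_measurable_continuous_Pair[OF assms])
  show "continuous_on UNIV (\<lambda>x::(real^3^3) \<times> (real^3). fst x *v snd x)"
    unfolding matrix_vector_mult_def by (intro continuous_intros)
qed

lemma integrable_advect:
  fixes G :: "real^3 \<Rightarrow> real^3^3" and v :: "real^3 \<Rightarrow> real^3"
  assumes "G \<in> L2" "v \<in> L2"
  shows "integrable torus (\<lambda>x. G x *v v x)" "(LINT x|torus. norm (G x *v v x)) \<le> L2_norm G * L2_norm v"
proof -
  note i = L2_cs_norm(1)[OF assms]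
  note m = advect_measurable[OF L2D(2)[OF assms(1)] L2D(2)[OF assms(2)]]
  show ii: "integrable torus (\<lambda>x. G x *v v x)"
    by (rule integrable_bound[OF i m]) (auto intro!: AE_I2 norm_matrix_vector_le)
  have "(LINT x|torus. norm (G x *v v x)) \<le> (LINT x|torus. norm (G x) * norm (v x))"
    by (rule integral_mono[OF integrable_norm[OF ii] i norm_matrix_vector_le])
  also have "\<dots> \<le> L2_norm G * L2_norm v" by (rule L2_cs_norm(2)[OF assms])
  finally show "(LINT x|torus. norm (G x *v v x)) \<le> L2_norm G * L2_norm v" .
qed

text \<open>Writing the difference as (grad \<Phi> - G) \<Phi> + G (\<Phi> - v), each summand is a
  product of an L2 factor tending to zero and a bounded L2 factor, so the advection converges in
  L1.\<close>

lemma flux_convergence: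
  assumes A: "H1_approx v G \<Phi>" and K: "bounded_kernel K"
  shows "(\<lambda>k. conv_form K (\<lambda>x. grad (\<Phi> k) x *v \<Phi> k x) (\<Phi> k)) \<longlonglongrightarrow> conv_form K (\<lambda>x. G x *v v x) v"
proof -
  note H = H1_approxD[OF A]
  note v = H(1) and G = H(2) and lv = H(4) and lG = H(5) and D = C_inf_divD[OF H(3)]
  show ?thesis
  proof (rule conv_form_convergence[OF K integrable_advect(1)[OF D(6) D(5)] integrable_advect(1)[OF G v] L2_integrable[OF D(5)] L2_integrable[OF v]])
    show "(\<lambda>n. LINT x|torus. norm (\<Phi> n x - v x)) \<longlonglongrightarrow> 0" by (rule L1_tendsto_L2[OF D(5) v lv])
    show "(\<lambda>n. LINT x|torus. norm (grad (\<Phi> n) x *v \<Phi> n x - G x *v v x)) \<longlonglongrightarrow> 0"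
    proof (rule LIMSEQ_0_le)
      let ?a = "\<lambda>n. L2_norm (\<lambda>x. grad (\<Phi> n) x - G x)" and ?b = "\<lambda>n. L2_norm (\<lambda>x. \<Phi> n x - v x)"
      show "(LINT x|torus. norm (grad (\<Phi> n) x *v \<Phi> n x - G x *v v x)) \<le> ?a n * (L2_norm v + ?b n) + L2_norm G * ?b n" for n
      proof -
        note i1 = integrable_advect[OF L2_diff[OF D(6) G] D(5), of n n] and i2 = integrable_advect[OF G L2_diff[OF D(5) v], of n]
        have "grad (\<Phi> n) x *v \<Phi> n x - G x *v v x = (grad (\<Phi> n) x - G x) *v \<Phi> n x + G x *v (\<Phi> n x - v x)" for x
          by (simp add: matrix_vector_mult_diff_rdistrib matrix_vector_mult_diff_distrib)
        then have "(LINT x|torus. norm (grad (\<Phi> n) x *v \<Phi> n x - G x *v v x))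
          \<le> (LINT x|torus. norm ((grad (\<Phi> n) x - G x) *v \<Phi> n x) + norm (G x *v (\<Phi> n x - v x)))"
          using i1(1) i2(1) by (intro integral_mono) (auto intro: norm_triangle_ineq)
        also have "\<dots> = (LINT x|torus. norm ((grad (\<Phi> n) x - G x) *v \<Phi> n x)) + (LINT x|torus. norm (G x *v (\<Phi> n x - v x)))"
          using i1(1) i2(1) by simp
        also have "\<dots> \<le> ?a n * L2_norm (\<Phi> n) + L2_norm G * ?b n" by (intro add_mono i1 i2)
        also have "\<dots> \<le> ?a n * (L2_norm v + ?b n) + L2_norm G * ?b n"
          using L2_norm_diff_abs[OF D(5) v, of n] by (intro add_right_mono mult_left_mono) auto
        finally show ?thesis .
      qed
      have "(\<lambda>n. ?a n * (L2_norm v + ?b n) + L2_norm G * ?b n) \<longlonglongrightarrow> 0 * (L2_norm v + 0) + L2_norm G * 0"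
        by (intro tendsto_intros lv lG)
      then show "(\<lambda>n. ?a n * (L2_norm v + ?b n) + L2_norm G * ?b n) \<longlonglongrightarrow> 0" by simp
    qed simp
  qed
qed

lemma bounded_kernel_kball: "bounded_kernel (kball l)"
proof (rule bounded_kernelI[of _ 1])
  have "(\<lambda>h. if tnorm h < l then 1 else 0 :: real) \<in> borel_measurable borel" by measurable
  then show "kball l \<in> borel_measurable borel" by (simp add: kball_def[abs_def])
qed (simp add: kball_def)

lemma bounded_kernel_kpar: "bounded_kernel (kpar l)"
proof (rule bounded_kernelI[of _ "l^2"])
  have "(\<lambda>h. max 0 (l^2 - (tnorm h)^2)) \<in> borel_measurable borel" by measurable
  then show "kpar l \<in> borel_measurable borel" by (simp add: kpar_def[abs_def])
qed (simp add: kpar_def)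

theorem H1_flux_ball:
  assumes A: "H1_approx v G \<Phi>" and l: "0 < l" "l \<le> pi"
  shows "conv_form (kball l) (\<lambda>x. G x *v v x) v = - (l^2 / 4) * flux_ball l v"
proof -
  note D = C_inf_divD[OF H1_approxD(3)[OF A]]
  have "(\<lambda>k. - (l^2 / 4) * flux_ball l (\<Phi> k))
    \<longlonglongrightarrow> - (l^2 / 4) * flux_ball l v"
    by (intro tendsto_mult_left sphere_cubic_convergence[OF A, where q=1 and C="\<lambda>n a. (norm a)^2 * (a \<bullet> n)"])
       (use cubic_Lipschitz_ball in \<open>auto intro!: continuous_intros\<close>)
  then have "(\<lambda>k. conv_form (kball l) (\<lambda>x. grad (\<Phi> k) x *v \<Phi> k x) (\<Phi> k))
    \<longlonglongrightarrow> - (l^2 / 4) * flux_ball l v"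
    by (simp only: smooth_flux_ball[OF D(1-3) l])
  from LIMSEQ_unique[OF flux_convergence[OF A bounded_kernel_kball] this] show ?thesis .
qed

theorem H1_flux_par:
  assumes A: "H1_approx v G \<Phi>" and l: "0 < l" "l \<le> pi"
  shows "conv_form (kpar l) (\<lambda>x. G x *v v x) v = - (l ^ 4 / 6) * flux_par l v"
proof -
  note D = C_inf_divD[OF H1_approxD(3)[OF A]]
  have "(\<lambda>k. - (l ^ 4 / 6) * flux_par l (\<Phi> k))
    \<longlonglongrightarrow> - (l ^ 4 / 6) * flux_par l v"
    by (intro tendsto_mult_left sphere_cubic_convergence[OF A, where q=3 and C="\<lambda>n a. (a \<bullet> n) ^ 3"])
       (use cubic_Lipschitz_par in \<open>auto intro!: continuous_intros\<close>)
  then have "(\<lambda>k. conv_form (kpar l) (\<lambda>x. grad (\<Phi> k) x *v \<Phi> k x) (\<Phi> k))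
    \<longlonglongrightarrow> - (l ^ 4 / 6) * flux_par l v"
    by (simp only: smooth_flux_par[OF D(1-3) l])
  from LIMSEQ_unique[OF flux_convergence[OF A bounded_kernel_kpar] this] show ?thesis .
qed

section \<open>Weak gradients\<close>

lemma L2_norm_scaleR: "L2_norm (\<lambda>x. c *\<^sub>R f x) = \<bar>c\<bar> * L2_norm f"
  by (simp add: L2_norm_def power_mult_distrib real_sqrt_mult)

lemma L2_inner_diff_left:
  assumes "f \<in> L2" "f' \<in> L2" "g \<in> L2"
  shows "L2_inner (\<lambda>x. f x - f' x) g = L2_inner f g - L2_inner f' g"
  using L2_cs(1)[OF assms(1,3)] L2_cs(1)[OF assms(2,3)] by (simp add: L2_inner_def inner_diff_left)

lemma L2_inner_commute: "L2_inner f g = L2_inner g f"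
  by (simp add: L2_inner_def inner_commute)

lemma L2_inner_tendsto:
  assumes "\<And>n. f' n \<in> L2" "f \<in> L2" "\<And>n. g' n \<in> L2" "g \<in> L2"
    and f: "(\<lambda>n. L2_norm (\<lambda>x. f' n x - f x)) \<longlonglongrightarrow> 0" and g: "(\<lambda>n. L2_norm (\<lambda>x. g' n x - g x)) \<longlonglongrightarrow> 0"
  shows "(\<lambda>n. L2_inner (f' n) (g' n)) \<longlonglongrightarrow> L2_inner f g"
proof -
  have "norm (L2_inner (f' n) (g' n) - L2_inner f g)
      \<le> L2_norm (\<lambda>x. f' n x - f x) * (L2_norm g + L2_norm (\<lambda>x. g' n x - g x)) + L2_norm f * L2_norm (\<lambda>x. g' n x - g x)" for n
  proof -
    have "L2_inner (f' n) (g' n) - L2_inner f g = L2_inner (\<lambda>x. f' n x - f x) (g' n) + L2_inner f (\<lambda>x. g' n x - g x)"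
      using L2_inner_diff_left[OF assms(1,2,3)] L2_inner_diff_left[OF assms(3,4,2)] by (simp add: L2_inner_commute[of f])
    moreover have "\<bar>L2_inner (\<lambda>x. f' n x - f x) (g' n)\<bar> \<le> L2_norm (\<lambda>x. f' n x - f x) * (L2_norm g + L2_norm (\<lambda>x. g' n x - g x))"
    proof -
      have "\<bar>L2_inner (\<lambda>x. f' n x - f x) (g' n)\<bar> \<le> L2_norm (\<lambda>x. f' n x - f x) * L2_norm (g' n)"
        by (rule L2_cs(2)[OF L2_diff[OF assms(1,2)] assms(3)])
      also have "\<dots> \<le> L2_norm (\<lambda>x. f' n x - f x) * (L2_norm g + L2_norm (\<lambda>x. g' n x - g x))"
        using L2_norm_diff_abs[OF assms(3,4), of n] by (intro mult_left_mono) auto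
      finally show ?thesis .
    qed
    moreover have "\<bar>L2_inner f (\<lambda>x. g' n x - g x)\<bar> \<le> L2_norm f * L2_norm (\<lambda>x. g' n x - g x)"
      by (rule L2_cs(2)[OF assms(2) L2_diff[OF assms(3,4)]])
    ultimately show ?thesis by simp
  qed
  note le = this
  have "(\<lambda>n. L2_norm (\<lambda>x. f' n x - f x) * (L2_norm g + L2_norm (\<lambda>x. g' n x - g x)) + L2_norm f * L2_norm (\<lambda>x. g' n x - g x))
      \<longlonglongrightarrow> 0 * (L2_norm g + 0) + L2_norm f * 0"
    by (intro tendsto_intros f g)
  then have "(\<lambda>n. L2_inner (f' n) (g' n) - L2_inner f g) \<longlonglongrightarrow> 0"
    by (intro Lim_null_comparison[OF always_eventually[OF allI[OF le]]]) simp
  then show ?thesis by (rule LIM_zero_cancel)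
qed

lemma L2_norm_const_seq: "(\<lambda>n. L2_norm (\<lambda>x. f x - f x)) \<longlonglongrightarrow> 0"
  by (simp add: L2_norm_def)

lemma L2_norm_tendsto:
  assumes "\<And>n. f' n \<in> L2" "f \<in> L2" and f: "(\<lambda>n. L2_norm (\<lambda>x. f' n x - f x)) \<longlonglongrightarrow> 0"
  shows "(\<lambda>n. L2_norm (f' n)) \<longlonglongrightarrow> L2_norm f"
proof -
  have "(\<lambda>n. L2_norm (f' n) - L2_norm f) \<longlonglongrightarrow> 0"
    by (rule Lim_null_comparison[OF always_eventually[OF allI] f]) (use L2_norm_diff_abs[OF assms(1,2)] in simp)
  then show ?thesis by (rule LIM_zero_cancel)
qed

lemma L2_norm_nth_le:
  fixes f :: "real^3 \<Rightarrow> ('b::euclidean_space)^3" assumes "f \<in> L2" shows "L2_norm (\<lambda>x. f x $ i) \<le> L2_norm f"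
  unfolding L2_norm_def
  by (intro real_sqrt_le_mono integral_mono L2D(3)[OF L2_nth[OF assms]] L2D(3)[OF assms] power_mono Finite_Cartesian_Product.norm_nth_le norm_ge_zero)

lemma L2_norm_nth_tendsto:
  fixes f :: "real^3 \<Rightarrow> ('b::euclidean_space)^3"
  assumes "\<And>n. f' n \<in> L2" "f \<in> L2" "(\<lambda>n. L2_norm (\<lambda>x. f' n x - f x)) \<longlonglongrightarrow> 0"
  shows "(\<lambda>n. L2_norm (\<lambda>x. f' n x $ i - f x $ i)) \<longlonglongrightarrow> 0"
  by (rule LIMSEQ_0_le[OF assms(3)]) (use L2_norm_nth_le[OF L2_diff[OF assms(1,2)], of _ i] in simp_all)

lemma L2_divD: "f \<in> L2_div \<Longrightarrow> f \<in> L2" by (simp add: L2_div_def)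

lemma smooth_weak_grad:
  fixes \<psi> :: "real^3 \<Rightarrow> real"
  assumes "f \<in> C_inf_div" "smooth \<psi>" "periodic \<psi>"
  shows "(LINT x|torus. f x $ i * pd j \<psi> x) = - (LINT x|torus. grad f x $ i $ j * \<psi> x)"
proof -
  note D = C_inf_divD[OF assms(1)]
  show ?thesis
    using integration_by_parts[OF smooth_vec_nth[OF D(1), of i] periodic_compose[OF D(2)] assms(2,3), of j]
    by (simp add: grad_eq[OF D(1)] smooth_nth_pd[OF D(1)])
qed

lemma H1_approx_weak_grad:
  assumes A: "H1_approx v G \<Phi>" shows "has_weak_grad v G"
  unfolding has_weak_grad_def
proof (intro conjI allI impI)
  note H = H1_approxD[OF A]
  note D = C_inf_divD[OF H(3)]
  show "G \<in> L2" by (rule H)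
  fix \<psi> :: "real^3 \<Rightarrow> real" and i j
  assume \<psi>: "smooth \<psi> \<and> periodic \<psi>"
  have p1: "pd j \<psi> \<in> L2" and p2: "\<psi> \<in> L2" using \<psi> by (auto intro: L2_smooth smooth_pd periodic_pd)
  have "(\<lambda>n. L2_inner (\<lambda>x. \<Phi> n x $ i) (pd j \<psi>)) \<longlonglongrightarrow> L2_inner (\<lambda>x. v x $ i) (pd j \<psi>)"
    by (rule L2_inner_tendsto[OF L2_nth[OF D(5)] L2_nth[OF H(1)] p1 p1 L2_norm_nth_tendsto[OF D(5) H(1,4)] L2_norm_const_seq])
  moreover have "(\<lambda>n. - L2_inner (\<lambda>x. grad (\<Phi> n) x $ i $ j) \<psi>) \<longlonglongrightarrow> - L2_inner (\<lambda>x. G x $ i $ j) \<psi>"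
    by (intro tendsto_minus L2_inner_tendsto[OF L2_nth[OF L2_nth[OF D(6)]] L2_nth[OF L2_nth[OF H(2)]] p2 p2 _ L2_norm_const_seq]
      L2_norm_nth_tendsto[OF L2_nth[OF D(6)] L2_nth[OF H(2)] L2_norm_nth_tendsto[OF D(6) H(2,5)]])
  moreover have "L2_inner (\<lambda>x. \<Phi> n x $ i) (pd j \<psi>) = - L2_inner (\<lambda>x. grad (\<Phi> n) x $ i $ j) \<psi>" for n
    using smooth_weak_grad[OF H(3), of \<psi> n i j] \<psi> by (simp add: L2_inner_def)
  ultimately show "(LINT x|torus. v x $ i * pd j \<psi> x) = - (LINT x|torus. G x $ i $ j * \<psi> x)"
    using LIMSEQ_unique by (simp add: L2_inner_def)
qed

lemma H1_div_iff: "f \<in> H1_div \<longleftrightarrow> (\<exists>G \<Phi>. H1_approx f G \<Phi>)"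
proof
  assume "f \<in> H1_div"
  then show "\<exists>G \<Phi>. H1_approx f G \<Phi>" by (auto simp: H1_div_def H1_approx_def has_weak_grad_def)
next
  assume "\<exists>G \<Phi>. H1_approx f G \<Phi>"
  then obtain G \<Phi> where A: "H1_approx f G \<Phi>" by blast
  show "f \<in> H1_div" using H1_approx_weak_grad[OF A] A by (auto simp: H1_div_def H1_approx_def)
qed

lemma H1_weak_grad: assumes "f \<in> H1_div" shows "has_weak_grad f (weak_grad f)"
  unfolding weak_grad_def using assms by (intro someI_ex[of "has_weak_grad f"]) (auto simp: H1_div_def)

lemma has_weak_gradD:
  fixes \<psi> :: "real^3 \<Rightarrow> real"
  assumes "has_weak_grad f G" shows "G \<in> L2"
    "smooth \<psi> \<Longrightarrow> periodic \<psi> \<Longrightarrow> (LINT x|torus. f x $ i * pd j \<psi> x) = - (LINT x|torus. G x $ i $ j * \<psi> x)"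
  using assms by (auto simp: has_weak_grad_def)

lemma integrable_nth_mult:
  fixes f :: "real^3 \<Rightarrow> real^3" and \<psi> :: "real^3 \<Rightarrow> real"
  assumes "f \<in> L2" "\<psi> \<in> L2" shows "integrable torus (\<lambda>x. f x $ i * \<psi> x)"
  using L2_cs(1)[OF L2_nth[OF assms(1)] assms(2)] by simp

lemma L2_inner_matrix:
  fixes F G :: "real^3 \<Rightarrow> real^3^3"
  assumes "F \<in> L2" "G \<in> L2"
  shows "L2_inner F G = (\<Sum>i\<in>UNIV. \<Sum>j\<in>UNIV. (LINT x|torus. F x $ i $ j * G x $ i $ j))"
proof -
  have "integrable torus (\<lambda>x. F x $ i $ j * G x $ i $ j)" for i j
    by (rule integrable_nth_mult[OF L2_nth[OF assms(1)] L2_nth[OF L2_nth[OF assms(2)]]])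
  then show ?thesis by (simp add: L2_inner_def inner_vec_def integral_sum)
qed

lemma weak_grad_inner_smooth:
  assumes W: "has_weak_grad f W" and "smooth \<phi>" "periodic \<phi>" and that: "f \<in> L2"
  shows "L2_inner W (grad \<phi>) = - (LINT x|torus. f x \<bullet> laplacian \<phi> x)"
proof -
  have s: "smooth (\<lambda>x. pd j \<phi> x $ i)" and p: "periodic (\<lambda>x. pd j \<phi> x $ i)" for i j
    using assms(2,3) by (auto intro: smooth_vec_nth smooth_pd periodic_compose periodic_pd)
  have e: "pd j (\<lambda>x. pd j \<phi> x $ i) x = pd j (pd j \<phi>) x $ i" for i j x by (rule smooth_nth_pd[OF smooth_pd[OF assms(2)]])
  have i: "integrable torus (\<lambda>x. f x $ i * pd j (pd j \<phi>) x $ i)" for i j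
    using assms(2,3) by (intro integrable_nth_mult[OF that] L2_nth L2_smooth smooth_pd periodic_pd)
  have "L2_inner W (grad \<phi>) = (\<Sum>i\<in>UNIV. \<Sum>j\<in>UNIV. (LINT x|torus. W x $ i $ j * pd j \<phi> x $ i))"
    using L2_inner_matrix[OF has_weak_gradD(1)[OF W] L2_continuous[OF continuous_grad[OF assms(2)] periodic_grad[OF assms(2,3)]]]
    by (simp add: grad_eq[OF assms(2)])
  also have "\<dots> = (\<Sum>i\<in>UNIV. \<Sum>j\<in>UNIV. - (LINT x|torus. f x $ i * pd j (pd j \<phi>) x $ i))"
  proof (intro sum.cong refl)
    fix i j
    show "(LINT x|torus. W x $ i $ j * pd j \<phi> x $ i) = - (LINT x|torus. f x $ i * pd j (pd j \<phi>) x $ i)"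
      using has_weak_gradD(2)[OF W s[where i=i and j=j] p[where i=i and j=j], of i j] unfolding e by simp
  qed
  also have "\<dots> = - (LINT x|torus. (\<Sum>i\<in>UNIV. \<Sum>j\<in>UNIV. f x $ i * pd j (pd j \<phi>) x $ i))"
    using i by (simp add: integral_sum sum_negf)
  also have "(\<lambda>x. \<Sum>i\<in>UNIV. \<Sum>j\<in>UNIV. f x $ i * pd j (pd j \<phi>) x $ i) = (\<lambda>x. f x \<bullet> laplacian \<phi> x)"
    by (simp add: fun_eq_iff inner_vec_def laplacian_def sum_distrib_left)
  finally show ?thesis .
qed

text \<open>Both gradients pair alike with smooth gradients, so (G, G) = (W, G), and Cauchy-Schwarz
  concludes. It carries the energy inequality, stated for \<open>weak_grad\<close>, over to the
  gradient obtained by approximation.\<close>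

lemma H1_grad_minimal:
  assumes A: "H1_approx v G \<Phi>" and W: "has_weak_grad v W"
  shows "L2_norm G \<le> L2_norm W"
proof -
  note H = H1_approxD[OF A]
  note D = C_inf_divD[OF H(3)]
  note WL = has_weak_gradD(1)[OF W]
  have eq: "L2_inner G (grad (\<Phi> n)) = L2_inner W (grad (\<Phi> n))" for n
    using weak_grad_inner_smooth[OF H1_approx_weak_grad[OF A] D(1,2) H(1)] weak_grad_inner_smooth[OF W D(1,2) H(1)] by simp
  have "(\<lambda>n. L2_inner G (grad (\<Phi> n))) \<longlonglongrightarrow> L2_inner G G"
    by (rule L2_inner_tendsto[OF H(2) H(2) D(6) H(2) L2_norm_const_seq H(5)])
  moreover have "(\<lambda>n. L2_inner W (grad (\<Phi> n))) \<longlonglongrightarrow> L2_inner W G"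
    by (rule L2_inner_tendsto[OF WL WL D(6) H(2) L2_norm_const_seq H(5)])
  ultimately have "L2_inner G G = L2_inner W G" using LIMSEQ_unique by (simp add: eq)
  moreover have "L2_inner G G = (L2_norm G)^2" by (simp add: L2_norm_sq L2_inner_def power2_norm_eq_inner)
  ultimately have sq: "L2_norm G * L2_norm G \<le> L2_norm W * L2_norm G"
    using L2_cs(2)[OF WL H(2)] by (simp add: power2_eq_square)
  show ?thesis
  proof (cases "L2_norm G > 0")
    case True then show ?thesis using sq by simp
  next
    case False then show ?thesis by (meson not_less order_trans L2_norm_nonneg)
  qed
qed

lemma L2_bilinear:
  fixes B :: "'a::euclidean_space \<Rightarrow> 'b::euclidean_space \<Rightarrow> 'c::euclidean_space"
  assumes B: "bounded_bilinear B" and g: "continuous_on UNIV g" "periodic g"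
  obtains C where "0 \<le> C" "\<And>f. f \<in> L2 \<Longrightarrow> (\<lambda>x. B (f x) (g x)) \<in> L2"
    "\<And>f. f \<in> L2 \<Longrightarrow> L2_norm (\<lambda>x. B (f x) (g x)) \<le> C * L2_norm f"
proof -
  obtain K where K: "0 \<le> K" "\<And>a b. norm (B a b) \<le> norm a * norm b * K" using bounded_bilinear.nonneg_bounded[OF B] by blast
  obtain c where c: "\<And>x. norm (g x) \<le> c" using periodic_continuous_bounded[OF g] by metis
  have c0: "0 \<le> c" using c[of 0] norm_ge_zero order_trans by blast
  let ?C = "c * K"
  have main: "(\<lambda>x. B (f x) (g x)) \<in> L2 \<and> L2_norm (\<lambda>x. B (f x) (g x)) \<le> ?C * L2_norm f" if f: "f \<in> L2" for f
  proof -
    have b: "norm (B (f x) (g x)) \<le> ?C * norm (f x)" for x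
      using order_trans[OF K(2) mult_right_mono[OF mult_left_mono[OF c norm_ge_zero] K(1)]] by (simp add: mult_ac)
    have le: "(norm (B (f x) (g x)))^2 \<le> ?C^2 * (norm (f x))^2" for x
      using power_mono[OF b[of x], of 2] by (simp add: power_mult_distrib)
    have "continuous_on UNIV (\<lambda>z. B (fst z) (snd z))" by (intro bounded_bilinear.continuous_on[OF B] continuous_intros)
    then have m: "(\<lambda>x. B (f x) (g x)) \<in> borel_measurable torus"
      by (rule borel_measurable_continuous_Pair[OF L2D(2)[OF f] borel_imp_torus[OF continuous_borel[OF g(1)]]])
    have i: "integrable torus (\<lambda>x. (norm (B (f x) (g x)))^2)"
      by (rule integrable_bound[OF integrable_mult_right[OF L2D(3)[OF f], of "?C^2"]]) (use m le in auto)
    have "(L2_norm (\<lambda>x. B (f x) (g x)))^2 \<le> (LINT x|torus. ?C^2 * (norm (f x))^2)"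
      unfolding L2_norm_sq by (rule integral_mono[OF i integrable_mult_right[OF L2D(3)[OF f]]]) (rule le)
    then have "(L2_norm (\<lambda>x. B (f x) (g x)))^2 \<le> (?C * L2_norm f)^2" by (simp add: L2_norm_sq power_mult_distrib)
    then have "L2_norm (\<lambda>x. B (f x) (g x)) \<le> ?C * L2_norm f" by (rule power2_le_imp_le) (use K c0 in simp)
    then show ?thesis using m i periodic_compose2[OF L2D(1)[OF f] g(2), of B] by (simp add: L2_def)
  qed
  show thesis by (rule that[of ?C]) (use main K c0 in auto)
qed

lemma bounded_bilinear_matrix_vector: "bounded_bilinear (\<lambda>(A :: real^3^3) x. A *v x)"
  by (rule bounded_bilinear.intro)
    (auto simp: matrix_vector_mult_add_rdistrib matrix_vector_right_distrib scaleR_matrix_vector_assoc matrix_vector_mult_scaleR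
      intro!: exI[of _ 1] norm_matrix_vector_le)

lemma bounded_bilinear_transpose: "bounded_bilinear (\<lambda>(A :: real^3^3) x. transpose A *v x)"
proof (rule bounded_bilinear.comp1[OF bounded_bilinear_matrix_vector])
  show "bounded_linear (transpose :: real^3^3 \<Rightarrow> real^3^3)"
    by (simp add: linear_conv_bounded_linear[symmetric] linear_iff transpose_def vec_eq_iff)
qed

lemma inner_transpose: "(transpose A *v x) \<bullet> y = x \<bullet> (A *v (y :: real^3))"
  by (simp add: dot_lmul_matrix)

text \<open>Only the advecting factor is replaced by smooth \<Phi> n. Then \<Phi>_j \<phi>_i is an
  admissible test function for the weak gradient, and both sides are L2 pairings of \<Phi> n with
  the fixed fields X and Y, hence continuous in \<Phi> n.\<close>

lemma weak_grad_advect: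
  assumes f: "f \<in> L2_div" and W: "has_weak_grad f W" and \<phi>: "smooth \<phi>" "periodic \<phi>"
  shows "L2_inner (\<lambda>x. W x *v f x) \<phi> = - (LINT x|torus. f x \<bullet> (grad \<phi> x *v f x))"
proof -
  obtain \<Phi> where \<Phi>: "\<And>n. \<Phi> n \<in> C_inf_div" and lim: "(\<lambda>n. L2_norm (\<lambda>x. \<Phi> n x - f x)) \<longlonglongrightarrow> 0"
    using f by (auto simp: L2_div_def)
  note fL = L2_divD[OF f]
  note WL = has_weak_gradD(1)[OF W]
  note D = C_inf_divD[OF \<Phi>]
  define X where "X x = transpose (W x) *v \<phi> x" for x
  define Y where "Y x = transpose (grad \<phi> x) *v f x" for x
  have inX: "X x \<bullet> y = (W x *v y) \<bullet> \<phi> x" and inY: "Y x \<bullet> y = f x \<bullet> (grad \<phi> x *v y)" for x y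
    by (simp_all only: X_def Y_def inner_transpose inner_commute[of "\<phi> x"])
  have XL: "X \<in> L2"
    using L2_bilinear[OF bounded_bilinear_transpose smooth_continuous[OF \<phi>(1)] \<phi>(2)] WL unfolding X_def[abs_def] by blast
  have YL: "Y \<in> L2"
    using L2_bilinear[OF bounded_bilinear.flip[OF bounded_bilinear_transpose] continuous_grad[OF \<phi>(1)] periodic_grad[OF \<phi>]] fL
    unfolding Y_def[abs_def] by blast
  have step: "L2_inner X (\<Phi> n) = - L2_inner Y (\<Phi> n)" for n
  proof -
    have \<psi>: "smooth (\<lambda>x. \<Phi> n x $ j * \<phi> x $ i)" "periodic (\<lambda>x. \<Phi> n x $ j * \<phi> x $ i)" for i j
      by (intro smooth_mult smooth_vec_nth D \<phi>) (rule periodic_compose2[OF D(2) \<phi>(2)])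
    have pd\<psi>: "pd j (\<lambda>x. \<Phi> n x $ j * \<phi> x $ i) x = \<Phi> n x $ j * pd j \<phi> x $ i + pd j (\<Phi> n) x $ j * \<phi> x $ i" for i j x
    proof -
      have "pd j (\<lambda>x. \<Phi> n x $ j * \<phi> x $ i) x = \<Phi> n x $ j * pd j (\<lambda>x. \<phi> x $ i) x + pd j (\<lambda>x. \<Phi> n x $ j) x * \<phi> x $ i"
        by (rule pd_bounded_bilinear[OF bounded_bilinear_mult]) (intro smooth_differentiable smooth_vec_nth D \<phi>)+
      then show ?thesis by (simp only: smooth_nth_pd[OF D(1)] smooth_nth_pd[OF \<phi>(1)])
    qed
    have i1: "integrable torus (\<lambda>x. W x $ i $ j * (\<Phi> n x $ j * \<phi> x $ i))" for i j
      by (rule integrable_nth_mult[OF L2_nth[OF WL] L2_smooth[OF \<psi>]])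
    have i2: "integrable torus (\<lambda>x. f x $ i * pd j (\<lambda>x. \<Phi> n x $ j * \<phi> x $ i) x)" for i j
      by (rule integrable_nth_mult[OF fL L2_smooth[OF smooth_pd[OF \<psi>(1)] periodic_pd[OF \<psi>(2)]]])
    have "L2_inner X (\<Phi> n) = (LINT x|torus. (\<Sum>i\<in>UNIV. \<Sum>j\<in>UNIV. W x $ i $ j * (\<Phi> n x $ j * \<phi> x $ i)))"
      unfolding L2_inner_def inX
      by (simp add: inner_vec_def matrix_vector_mult_def sum_distrib_right sum_distrib_left ac_simps)
    also have "\<dots> = (\<Sum>i\<in>UNIV. \<Sum>j\<in>UNIV. (LINT x|torus. W x $ i $ j * (\<Phi> n x $ j * \<phi> x $ i)))"
      using i1 by (simp add: integral_sum)
    also have "\<dots> = (\<Sum>i\<in>UNIV. \<Sum>j\<in>UNIV. - (LINT x|torus. f x $ i * pd j (\<lambda>x. \<Phi> n x $ j * \<phi> x $ i) x))"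
      using has_weak_gradD(2)[OF W \<psi>] by simp
    also have "\<dots> = - (LINT x|torus. (\<Sum>i\<in>UNIV. \<Sum>j\<in>UNIV. f x $ i * pd j (\<lambda>x. \<Phi> n x $ j * \<phi> x $ i) x))"
      using i2 by (simp add: integral_sum sum_negf)
    also have "(\<lambda>x. \<Sum>i\<in>UNIV. \<Sum>j\<in>UNIV. f x $ i * pd j (\<lambda>x. \<Phi> n x $ j * \<phi> x $ i) x) = (\<lambda>x. Y x \<bullet> \<Phi> n x)"
    proof
      fix x
      have "(\<Sum>i\<in>UNIV. \<Sum>j\<in>UNIV. f x $ i * pd j (\<lambda>x. \<Phi> n x $ j * \<phi> x $ i) x)
        = (\<Sum>i\<in>UNIV. \<Sum>j\<in>UNIV. f x $ i * (\<Phi> n x $ j * pd j \<phi> x $ i)) + (\<Sum>i\<in>UNIV. f x $ i * \<phi> x $ i * (\<Sum>j\<in>UNIV. pd j (\<Phi> n) x $ j))"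
        unfolding pd\<psi> by (simp add: distrib_left sum.distrib sum_distrib_left ac_simps)
      also have "(\<Sum>j\<in>UNIV. pd j (\<Phi> n) x $ j) = 0" using D(3)[of n x] by (simp add: divergence_def)
      finally show "(\<Sum>i\<in>UNIV. \<Sum>j\<in>UNIV. f x $ i * pd j (\<lambda>x. \<Phi> n x $ j * \<phi> x $ i) x) = Y x \<bullet> \<Phi> n x"
        unfolding inY by (simp add: inner_vec_def matrix_vector_mult_def grad_eq[OF \<phi>(1)] sum_distrib_left ac_simps)
    qed
    finally show ?thesis by (simp add: L2_inner_def)
  qed
  have "(\<lambda>n. L2_inner X (\<Phi> n)) \<longlonglongrightarrow> L2_inner X f"
    by (rule L2_inner_tendsto[OF XL XL D(5) fL L2_norm_const_seq lim])
  moreover have "(\<lambda>n. - L2_inner Y (\<Phi> n)) \<longlonglongrightarrow> - L2_inner Y f"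
    by (intro tendsto_minus L2_inner_tendsto[OF YL YL D(5) fL L2_norm_const_seq lim])
  ultimately have "L2_inner X f = - L2_inner Y f" unfolding step using LIMSEQ_unique by blast
  then show ?thesis by (simp add: L2_inner_def inX inY)
qed

section \<open>Completeness and the closed sublevel sets of the gradient norm\<close>

text \<open>Riesz-Fischer for the seminorm on representatives.\<close>

lemma L2_complete:
  fixes F :: "nat \<Rightarrow> real^3 \<Rightarrow> 'b::euclidean_space"
  assumes F: "\<And>n. F n \<in> L2" and Cauchy: "\<And>e. e > 0 \<Longrightarrow> \<exists>N. \<forall>m\<ge>N. \<forall>n\<ge>N. L2_norm (\<lambda>x. F m x - F n x) < e"
  obtains G where "G \<in> L2" "(\<lambda>n. L2_norm (\<lambda>x. F n x - G x)) \<longlonglongrightarrow> 0"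
proof -
  note [measurable] = L2D(2)[OF F]
  obtain s where sm: "strict_mono s" and ae: "AE x in torus. Cauchy (\<lambda>k. F (s k) x)"
  proof (rule cauchy_L1_AE_cauchy_subseq[of torus F])
    show "integrable torus (F n)" for n by (rule L2_integrable[OF F])
    fix e :: real assume "e > 0"
    then obtain N where N: "\<forall>m\<ge>N. \<forall>n\<ge>N. L2_norm (\<lambda>x. F m x - F n x) < e / sqrt tvol"
      using Cauchy[of "e / sqrt tvol"] tvol_pos by auto
    have "(LINT x|torus. norm (F m x - F n x)) < e" if "N \<le> m" "N \<le> n" for m n
      using le_less_trans[OF L1_le_L2[OF L2_diff[OF F F]]] N that tvol_pos by (simp add: pos_less_divide_eq mult.commute)
    then show "\<exists>N. \<forall>i\<ge>N. \<forall>j\<ge>N. (LINT x|torus. norm (F i x - F j x)) < e" by blast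
  qed
  \<comment> \<open>Taken as \<open>lim\<close> at every point, also where the sequence diverges, so
    that G is periodic everywhere and not merely up to a null set.\<close>
  define G where "G x = lim (\<lambda>k. F (s k) x)" for x
  have Gm[measurable]: "G \<in> borel_measurable torus" unfolding G_def by (rule borel_measurable_lim_metric) measurable
  have Gp: "periodic G" using L2D(1)[OF F] by (simp add: periodic_def G_def)
  have lim: "AE x in torus. (\<lambda>k. F (s k) x) \<longlonglongrightarrow> G x"
    using ae by eventually_elim (simp add: G_def Cauchy_convergent_iff convergent_LIMSEQ_iff)
  have fat: "(\<integral>\<^sup>+x. ennreal ((norm (F n x - G x))^2) \<partial>torus) \<le> ennreal (e^2)"
    if e: "e > 0" and N: "\<forall>m\<ge>N. \<forall>n\<ge>N. L2_norm (\<lambda>x. F m x - F n x) < e" and n: "n \<ge> N" for e N n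
  proof (rule nn_integral_limit_le[where h="\<lambda>k x. (norm (F n x - F (s k) x))^2"])
    show "AE x in torus. (\<lambda>k. (norm (F n x - F (s k) x))^2) \<longlonglongrightarrow> (norm (F n x - G x))^2"
      using lim by eventually_elim (intro tendsto_intros)
    show "\<forall>\<^sub>F k in sequentially. (\<integral>\<^sup>+x. ennreal ((norm (F n x - F (s k) x))^2) \<partial>torus) \<le> ennreal (e^2)"
    proof (rule eventually_sequentiallyI[of N])
      fix k assume "k \<ge> N"
      then have "s k \<ge> N" using seq_suble[OF sm, of k] by simp
      then have "L2_norm (\<lambda>x. F n x - F (s k) x) < e" using N n by blast
      then have "(L2_norm (\<lambda>x. F n x - F (s k) x))^2 \<le> e^2" by (intro power_mono) auto
      then show "(\<integral>\<^sup>+x. ennreal ((norm (F n x - F (s k) x))^2) \<partial>torus) \<le> ennreal (e^2)"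
        using nn_integral_eq_integral[OF L2D(3)[OF L2_diff[OF F F]], of n "s k"] by (simp add: L2_norm_sq ennreal_leI)
    qed
  qed measurable
  have diffL: "(\<lambda>x. F n x - G x) \<in> L2 \<and> L2_norm (\<lambda>x. F n x - G x) \<le> e"
    if e: "e > 0" and N: "\<forall>m\<ge>N. \<forall>n\<ge>N. L2_norm (\<lambda>x. F m x - F n x) < e" and n: "n \<ge> N" for e N n
  proof -
    have i: "integrable torus (\<lambda>x. (norm (F n x - G x))^2)"
      by (rule integrableI_bounded) (use le_less_trans[OF fat[OF that] ennreal_less_top] in auto)
    have "ennreal (LINT x|torus. (norm (F n x - G x))^2) \<le> ennreal (e^2)"
      using fat[OF that] nn_integral_eq_integral[OF i] by simp
    then have "(L2_norm (\<lambda>x. F n x - G x))^2 \<le> e^2" by (simp add: L2_norm_sq ennreal_le_iff)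
    then have "L2_norm (\<lambda>x. F n x - G x) \<le> e" by (rule power2_le_imp_le) (use e in simp)
    moreover have "(\<lambda>x. F n x - G x) \<in> L2"
      using i L2D(1)[OF F] Gp by (auto simp: L2_def intro: periodic_compose2)
    ultimately show ?thesis by simp
  qed
  obtain N0 where N0: "\<forall>m\<ge>N0. \<forall>n\<ge>N0. L2_norm (\<lambda>x. F m x - F n x) < 1" using Cauchy[of 1] by auto
  have GL: "G \<in> L2"
    using L2_diff[OF F conjunct1[OF diffL[OF zero_less_one N0 order_refl]], of N0] by simp
  have "(\<lambda>n. L2_norm (\<lambda>x. F n x - G x)) \<longlonglongrightarrow> 0"
  proof (rule LIMSEQ_I)
    fix r :: real assume "r > 0"
    then obtain N where N: "\<forall>m\<ge>N. \<forall>n\<ge>N. L2_norm (\<lambda>x. F m x - F n x) < r / 2" using Cauchy[of "r / 2"] by auto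
    show "\<exists>N. \<forall>n\<ge>N. norm (L2_norm (\<lambda>x. F n x - G x) - 0) < r"
      using conjunct2[OF diffL[OF _ N]] \<open>r > 0\<close> by (intro exI[of _ N]) fastforce
  qed
  with GL show thesis by (rule that)
qed

text \<open>Describes the condition on the gradient norm without any gradient of f, by smooth fields
  near f. In this form closedness in L2 is a matter of the triangle inequality, and the
  measurability of \<open>H1_div\<close> and of the gradient norm rests on it.\<close>

definition H1_sublevel :: "real \<Rightarrow> (real^3 \<Rightarrow> real^3) set" where
  "H1_sublevel R = {f \<in> L2_div. \<forall>e>0. \<exists>\<Phi>\<in>C_inf_div. L2_norm (\<lambda>x. \<Phi> x - f x) < e \<and> L2_norm (grad \<Phi>) \<le> R + e}"

text \<open>Unlike \<open>weak_grad\<close> it is chosen among L2 limits of smooth gradients, so an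
  approximating sequence comes along with it.\<close>

definition hgrad :: "(real^3 \<Rightarrow> real^3) \<Rightarrow> real^3 \<Rightarrow> real^3^3" where
  "hgrad f = (SOME G. \<exists>\<Phi>. H1_approx f G \<Phi>)"

lemma hgrad_approx: assumes "f \<in> H1_div" obtains \<Phi> where "H1_approx f (hgrad f) \<Phi>"
  using assms someI_ex[of "\<lambda>G. \<exists>\<Phi>. H1_approx f G \<Phi>"] unfolding H1_div_iff hgrad_def by blast

lemma C_inf_div_linear:
  assumes "f \<in> C_inf_div" "g \<in> C_inf_div"
  shows "(\<lambda>x. a *\<^sub>R f x + b *\<^sub>R g x) \<in> C_inf_div"
    and "grad (\<lambda>x. a *\<^sub>R f x + b *\<^sub>R g x) = (\<lambda>x. a *\<^sub>R grad f x + b *\<^sub>R grad g x)"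
proof -
  note F = C_inf_divD[OF assms(1)] note G = C_inf_divD[OF assms(2)]
  have sf: "smooth (\<lambda>x. a *\<^sub>R f x)" and sg: "smooth (\<lambda>x. b *\<^sub>R g x)"
    using smooth_bounded_linear[OF bounded_linear_scaleR_right] F(1) G(1) by auto
  have pd: "pd i (\<lambda>x. a *\<^sub>R f x + b *\<^sub>R g x) x = a *\<^sub>R pd i f x + b *\<^sub>R pd i g x" for i x
    using pd_add[OF smooth_differentiable[OF sf] smooth_differentiable[OF sg]]
      pd_bounded_linear[OF bounded_linear_scaleR_right smooth_differentiable[OF F(1)]]
      pd_bounded_linear[OF bounded_linear_scaleR_right smooth_differentiable[OF G(1)]] by simp
  have "divergence (\<lambda>x. a *\<^sub>R f x + b *\<^sub>R g x) x = a * divergence f x + b * divergence g x" for x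
    by (simp add: divergence_def pd sum.distrib sum_distrib_left)
  moreover have "(LINT x|torus. a *\<^sub>R f x + b *\<^sub>R g x) = 0"
    using L2_integrable[OF F(5)] L2_integrable[OF G(5)] F(4) G(4) by simp
  ultimately show "(\<lambda>x. a *\<^sub>R f x + b *\<^sub>R g x) \<in> C_inf_div"
    using smooth_add[OF sf sg] F G periodic_compose2[OF F(2) G(2), of "\<lambda>y z. a *\<^sub>R y + b *\<^sub>R z"] by (simp add: C_inf_div_def)
  show "grad (\<lambda>x. a *\<^sub>R f x + b *\<^sub>R g x) = (\<lambda>x. a *\<^sub>R grad f x + b *\<^sub>R grad g x)"
    by (simp add: fun_eq_iff vec_eq_iff grad_eq[OF smooth_add[OF sf sg]] grad_eq[OF F(1)] grad_eq[OF G(1)] pd)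
qed

lemma L2_parallelogram:
  assumes "f \<in> L2" "g \<in> L2"
  shows "(L2_norm (\<lambda>x. f x - g x))^2 = 2 * (L2_norm f)^2 + 2 * (L2_norm g)^2 - (L2_norm (\<lambda>x. f x + g x))^2"
proof -
  note i = L2D(3)[OF assms(1)] L2D(3)[OF assms(2)] L2D(3)[OF L2_add[OF assms]] L2D(3)[OF L2_diff[OF assms]]
  have "(norm (f x - g x))^2 = 2 * (norm (f x))^2 + 2 * (norm (g x))^2 - (norm (f x + g x))^2" for x
    unfolding power2_norm_eq_inner by (simp add: inner_diff_left inner_diff_right inner_add_left inner_add_right inner_commute)
  then show ?thesis unfolding L2_norm_sq using i by simp
qed

text \<open>Weak lower semicontinuity of the norm, tested against the smooth gradients of \<Psi>:
  moved onto the Laplacian of \<Psi> k, the pairing of grad (\<Phi> n) converges under mere L2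
  convergence of \<Phi> n.\<close>

lemma H1_sublevel_grad_le:
  assumes f: "f \<in> H1_sublevel R" and A: "H1_approx f G \<Psi>"
  shows "L2_norm G \<le> R"
proof -
  note H = H1_approxD[OF A]
  note D = C_inf_divD[OF H(3)]
  have "\<exists>\<Phi>\<in>C_inf_div. L2_norm (\<lambda>x. \<Phi> x - f x) < 1 / real (Suc n) \<and> L2_norm (grad \<Phi>) \<le> R + 1 / real (Suc n)" for n
    using f by (simp add: H1_sublevel_def)
  then obtain \<Phi> where \<Phi>: "\<And>n. \<Phi> n \<in> C_inf_div" "\<And>n. L2_norm (\<lambda>x. \<Phi> n x - f x) < 1 / real (Suc n)"
    "\<And>n. L2_norm (grad (\<Phi> n)) \<le> R + 1 / real (Suc n)" by metis
  note E = C_inf_divD[OF \<Phi>(1)]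
  have \<Phi>lim: "(\<lambda>n. L2_norm (\<lambda>x. \<Phi> n x - f x)) \<longlonglongrightarrow> 0"
    by (rule LIMSEQ_0_le[OF LIMSEQ_inverse_Suc L2_norm_nonneg less_imp_le[OF \<Phi>(2)]])
  have le: "L2_inner G (grad (\<Psi> k)) \<le> R * L2_norm (grad (\<Psi> k))" for k
  proof -
    have lap: "laplacian (\<Psi> k) \<in> L2"
      unfolding laplacian_def[abs_def]
      by (intro L2_smooth smooth_sum smooth_pd D periodic_sum periodic_pd)
    have Gk: "L2_inner G (grad (\<Psi> k)) = - L2_inner f (laplacian (\<Psi> k))"
      using weak_grad_inner_smooth[OF H1_approx_weak_grad[OF A] D(1,2) H(1)] by (simp add: L2_inner_def)
    have "has_weak_grad (\<Phi> n) (grad (\<Phi> n))" for n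
      using smooth_weak_grad[OF \<Phi>(1)] E(6) by (simp add: has_weak_grad_def)
    then have Gn: "L2_inner (grad (\<Phi> n)) (grad (\<Psi> k)) = - L2_inner (\<Phi> n) (laplacian (\<Psi> k))" for n
      using weak_grad_inner_smooth[OF _ D(1,2) E(5)] by (simp add: L2_inner_def)
    have "(\<lambda>n. - L2_inner (\<Phi> n) (laplacian (\<Psi> k))) \<longlonglongrightarrow> - L2_inner f (laplacian (\<Psi> k))"
      by (intro tendsto_minus L2_inner_tendsto[OF E(5) H(1) lap lap \<Phi>lim L2_norm_const_seq])
    then have l1: "(\<lambda>n. L2_inner (grad (\<Phi> n)) (grad (\<Psi> k))) \<longlonglongrightarrow> L2_inner G (grad (\<Psi> k))"
      by (simp only: Gn Gk)
    have l2: "(\<lambda>n. (R + 1 / real (Suc n)) * L2_norm (grad (\<Psi> k))) \<longlonglongrightarrow> (R + 0) * L2_norm (grad (\<Psi> k))"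
      by (intro tendsto_intros LIMSEQ_inverse_Suc)
    have "L2_inner (grad (\<Phi> n)) (grad (\<Psi> k)) \<le> (R + 1 / real (Suc n)) * L2_norm (grad (\<Psi> k))" for n
      using L2_cs(2)[OF E(6) D(6), of n k] mult_right_mono[OF \<Phi>(3)[of n] L2_norm_nonneg[of "grad (\<Psi> k)"]] by linarith
    then show ?thesis using LIMSEQ_le[OF l1 l2] by auto
  qed
  have "(\<lambda>k. L2_inner G (grad (\<Psi> k))) \<longlonglongrightarrow> L2_inner G G"
    by (rule L2_inner_tendsto[OF H(2) H(2) D(6) H(2) L2_norm_const_seq H(5)])
  moreover have "(\<lambda>k. R * L2_norm (grad (\<Psi> k))) \<longlonglongrightarrow> R * L2_norm G"
    by (intro tendsto_mult_left L2_norm_tendsto[OF D(6) H(2,5)])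
  ultimately have "L2_inner G G \<le> R * L2_norm G" using le by (intro LIMSEQ_le) auto
  moreover have "L2_inner G G = L2_norm G * L2_norm G"
    unfolding power2_eq_square[symmetric] by (simp add: L2_norm_sq L2_inner_def power2_norm_eq_inner)
  moreover have "0 \<le> R"
  proof (rule field_le_epsilon)
    fix e :: real assume "e > 0"
    then obtain \<Phi> where "L2_norm (grad \<Phi>) \<le> R + e" using f unfolding H1_sublevel_def by blast
    then show "0 \<le> R + e" using L2_norm_nonneg order_trans by blast
  qed
  ultimately show ?thesis by (cases "L2_norm G = 0") (simp_all add: mult_le_cancel_right)
qed

text \<open>A bounded sequence of gradients need not converge strongly, so the approximants are
  chosen nearly minimal: \<rho> n is the least gradient norm among smooth fields within 1/(n + 1) of
  f. It increases to a finite r, and midpoints of near minimisers are competitors again, so the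
  parallelogram identity makes the gradients Cauchy.\<close>

theorem H1_sublevel_subset:
  assumes f: "f \<in> H1_sublevel R" shows "f \<in> H1_div"
proof -
  define A where "A n = {\<Phi> \<in> C_inf_div. L2_norm (\<lambda>x. \<Phi> x - f x) < 1 / real (Suc n)}" for n
  define \<rho> where "\<rho> n = (INF \<Phi>\<in>A n. L2_norm (grad \<Phi>))" for n
  have fL: "f \<in> L2" using f by (simp add: H1_sublevel_def L2_divD)
  have dle: "1 / real (Suc m) \<le> 1 / real (Suc n)" if "n \<le> m" for n m using that by (simp add: field_simps)
  have bdd: "bdd_below ((\<lambda>\<Phi>. L2_norm (grad \<Phi>)) ` A n)" for n by (rule bdd_belowI[of _ 0]) auto
  have ne: "\<exists>\<Phi>\<in>A n. L2_norm (grad \<Phi>) \<le> R + 1" for n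
  proof -
    have "1 / real (Suc n) > 0" by simp
    then obtain \<Phi> where c: "\<Phi> \<in> C_inf_div" "L2_norm (\<lambda>x. \<Phi> x - f x) < 1 / real (Suc n)" "L2_norm (grad \<Phi>) \<le> R + 1 / real (Suc n)"
      using f unfolding H1_sublevel_def by blast
    have "1 / real (Suc n) \<le> 1" by simp
    then have "L2_norm (grad \<Phi>) \<le> R + 1" using c(3) by linarith
    moreover have "\<Phi> \<in> A n" using c(1,2) by (simp add: A_def)
    ultimately show ?thesis by blast
  qed
  then have ne': "A n \<noteq> {}" for n by blast
  have \<rho>0: "0 \<le> \<rho> n" for n unfolding \<rho>_def by (rule cINF_greatest[OF ne']) simp
  have \<rho>b: "\<rho> n \<le> R + 1" for n
    using ne[of n] cINF_lower[OF bdd] unfolding \<rho>_def by (meson order_trans)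
  have "incseq \<rho>"
  proof (rule incseq_SucI)
    fix n
    have "A (Suc n) \<subseteq> A n" using dle[of n "Suc n"] by (auto simp: A_def)
    then show "\<rho> n \<le> \<rho> (Suc n)" unfolding \<rho>_def by (rule cINF_superset_mono[OF ne' bdd]) simp
  qed
  then obtain r where r: "\<rho> \<longlonglongrightarrow> r" "\<And>n. \<rho> n \<le> r" using incseq_convergent[of \<rho> "R + 1"] \<rho>b by blast
  have "\<exists>\<Phi>\<in>A n. L2_norm (grad \<Phi>) < \<rho> n + 1 / real (Suc n)" for n
    using cInf_lessD[of "(\<lambda>\<Phi>. L2_norm (grad \<Phi>)) ` A n" "\<rho> n + 1 / real (Suc n)"] ne'[of n]
    by (auto simp: \<rho>_def[symmetric])
  then obtain \<Phi> where \<Phi>: "\<And>n. \<Phi> n \<in> A n" "\<And>n. L2_norm (grad (\<Phi> n)) < \<rho> n + 1 / real (Suc n)" by metis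
  have \<Phi>C: "\<And>n. \<Phi> n \<in> C_inf_div" and \<Phi>d: "\<And>n. L2_norm (\<lambda>x. \<Phi> n x - f x) < 1 / real (Suc n)" using \<Phi>(1) by (auto simp: A_def)
  note D = C_inf_divD[OF \<Phi>C]
  have \<Phi>lim: "(\<lambda>n. L2_norm (\<lambda>x. \<Phi> n x - f x)) \<longlonglongrightarrow> 0"
    by (rule LIMSEQ_0_le[OF LIMSEQ_inverse_Suc L2_norm_nonneg less_imp_le[OF \<Phi>d]])
  \<comment> \<open>The midpoint belongs to \<open>A N\<close>, so the sum of the two gradients has
    norm at least 2 \<rho>(N), while each of them has norm at most r + 1/(N + 1).\<close>
  have key: "(L2_norm (\<lambda>x. grad (\<Phi> m) x - grad (\<Phi> n) x))^2 \<le> 4 * (r + 1 / real (Suc N))^2 - 4 * (\<rho> N)^2" if "N \<le> m" "N \<le> n" for N m n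
  proof -
    let ?a = "\<lambda>x. (1/2) *\<^sub>R \<Phi> m x + (1/2) *\<^sub>R \<Phi> n x"
    have aC: "?a \<in> C_inf_div" by (rule C_inf_div_linear[OF \<Phi>C \<Phi>C])
    have "L2_norm (\<lambda>x. ?a x - f x) = L2_norm (\<lambda>x. (1/2) *\<^sub>R (\<Phi> m x - f x) + (1/2) *\<^sub>R (\<Phi> n x - f x))"
    proof -
      have "?a x - f x = (1/2) *\<^sub>R (\<Phi> m x - f x) + (1/2) *\<^sub>R (\<Phi> n x - f x)" for x
        by (simp add: vec_eq_iff field_simps)
      then show ?thesis by simp
    qed
    also have "\<dots> \<le> (1/2) * L2_norm (\<lambda>x. \<Phi> m x - f x) + (1/2) * L2_norm (\<lambda>x. \<Phi> n x - f x)"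
      using L2_norm_triangle[OF L2_scaleR[OF L2_diff[OF D(5) fL]] L2_scaleR[OF L2_diff[OF D(5) fL]], of "1/2" m "1/2" n]
      by (simp add: L2_norm_scaleR)
    also have "\<dots> < 1 / real (Suc N)" using \<Phi>d[of m] \<Phi>d[of n] dle[OF that(1)] dle[OF that(2)] by linarith
    finally have "?a \<in> A N" using aC by (simp add: A_def)
    then have "\<rho> N \<le> L2_norm (grad ?a)" unfolding \<rho>_def by (rule cINF_lower[OF bdd])
    also have "grad ?a = (\<lambda>x. (1/2) *\<^sub>R (grad (\<Phi> m) x + grad (\<Phi> n) x))"
      by (simp add: C_inf_div_linear(2)[OF \<Phi>C \<Phi>C] scaleR_add_right)
    also have "L2_norm \<dots> = (1/2) * L2_norm (\<lambda>x. grad (\<Phi> m) x + grad (\<Phi> n) x)" by (simp add: L2_norm_scaleR)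
    finally have "(2 * \<rho> N)^2 \<le> (L2_norm (\<lambda>x. grad (\<Phi> m) x + grad (\<Phi> n) x))^2" using \<rho>0[of N] by (intro power_mono) auto
    moreover have "(L2_norm (grad (\<Phi> k)))^2 \<le> (r + 1 / real (Suc N))^2" if "N \<le> k" for k
      using \<Phi>(2)[of k] r(2)[of k] dle[OF that] by (intro power_mono) auto
    ultimately show ?thesis
      using L2_parallelogram[OF D(6) D(6), of m n] that by (simp add: power_mult_distrib) (smt (verit))
  qed
  have "\<exists>N. \<forall>m\<ge>N. \<forall>n\<ge>N. L2_norm (\<lambda>x. grad (\<Phi> m) x - grad (\<Phi> n) x) < e" if e: "e > 0" for e
  proof -
    have "(\<lambda>N. 4 * (r + 1 / real (Suc N))^2 - 4 * (\<rho> N)^2) \<longlonglongrightarrow> 4 * (r + 0)^2 - 4 * r^2"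
      by (intro tendsto_intros LIMSEQ_inverse_Suc r)
    then have "\<forall>\<^sub>F N in sequentially. 4 * (r + 1 / real (Suc N))^2 - 4 * (\<rho> N)^2 < e^2"
      by (rule order_tendstoD(2)) (use e in simp)
    then obtain N where N: "4 * (r + 1 / real (Suc N))^2 - 4 * (\<rho> N)^2 < e^2"
      unfolding eventually_sequentially by blast
    have "L2_norm (\<lambda>x. grad (\<Phi> m) x - grad (\<Phi> n) x) < e" if "m \<ge> N" "n \<ge> N" for m n
      by (rule power2_less_imp_less) (use key[OF that] N e in auto)
    then show ?thesis by blast
  qed
  then obtain G where "G \<in> L2" "(\<lambda>n. L2_norm (\<lambda>x. grad (\<Phi> n) x - G x)) \<longlonglongrightarrow> 0"
    using L2_complete[of "\<lambda>n. grad (\<Phi> n)", OF D(6)] by blast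
  then have "H1_approx f G \<Phi>" using fL \<Phi>C \<Phi>lim by (simp add: H1_approx_def)
  then show ?thesis unfolding H1_div_iff by blast
qed

theorem H1_sublevel_iff: "f \<in> H1_sublevel R \<longleftrightarrow> f \<in> H1_div \<and> L2_norm (hgrad f) \<le> R"
proof
  assume f: "f \<in> H1_sublevel R"
  then have h: "f \<in> H1_div" by (rule H1_sublevel_subset)
  obtain \<Phi> where "H1_approx f (hgrad f) \<Phi>" using hgrad_approx[OF h] .
  then show "f \<in> H1_div \<and> L2_norm (hgrad f) \<le> R" using H1_sublevel_grad_le[OF f] h by blast
next
  assume h: "f \<in> H1_div \<and> L2_norm (hgrad f) \<le> R"
  then obtain \<Phi> where A: "H1_approx f (hgrad f) \<Phi>" using hgrad_approx by blast
  note H = H1_approxD[OF A]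
  note D = C_inf_divD[OF H(3)]
  show "f \<in> H1_sublevel R"
    unfolding H1_sublevel_def
  proof (intro CollectI conjI allI impI H(6))
    fix e :: real assume e: "e > 0"
    have "\<forall>\<^sub>F n in sequentially. L2_norm (\<lambda>x. \<Phi> n x - f x) < e"
      by (rule order_tendstoD(2)[OF H(4) e])
    moreover have "\<forall>\<^sub>F n in sequentially. L2_norm (grad (\<Phi> n)) < R + e"
      by (rule order_tendstoD(2)[OF L2_norm_tendsto[OF D(6) H(2,5)]]) (use h e in linarith)
    ultimately have "\<forall>\<^sub>F n in sequentially. L2_norm (\<lambda>x. \<Phi> n x - f x) < e \<and> L2_norm (grad (\<Phi> n)) < R + e"
      by (rule eventually_conj)
    then obtain n where "L2_norm (\<lambda>x. \<Phi> n x - f x) < e \<and> L2_norm (grad (\<Phi> n)) < R + e"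
      unfolding eventually_sequentially by blast
    then show "\<exists>\<Phi>\<in>C_inf_div. L2_norm (\<lambda>x. \<Phi> x - f x) < e \<and> L2_norm (grad \<Phi>) \<le> R + e"
      using H(3) by (intro bexI[of _ "\<Phi> n"]) auto
  qed
qed

section \<open>Measurability on the space of square integrable fields\<close>

lemma space_L2_div_borel [simp]: "space L2_div_borel = L2_div"
  by (auto simp: L2_div_borel_def L2_div_open_def intro!: space_measure_of)

lemma L2_div_open_sets: "L2_div_open U \<Longrightarrow> U \<in> sets L2_div_borel"
  unfolding L2_div_borel_def by (subst sets_measure_of) (auto simp: L2_div_open_def)

text \<open>Sequential continuity for the seminorm makes preimages of open sets
  \<open>L2_div_open\<close>, and these generate the \<sigma>-algebra.\<close>

lemma L2_div_borel_measurableI: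
  fixes \<Psi> :: "(real^3 \<Rightarrow> real^3) \<Rightarrow> real"
  assumes "\<And>F f. (\<And>n. F n \<in> L2_div) \<Longrightarrow> f \<in> L2_div \<Longrightarrow> (\<lambda>n. L2_norm (\<lambda>x. F n x - f x)) \<longlonglongrightarrow> 0 \<Longrightarrow> (\<lambda>n. \<Psi> (F n)) \<longlonglongrightarrow> \<Psi> f"
  shows "\<Psi> \<in> borel_measurable L2_div_borel"
proof (rule borel_measurableI)
  fix S :: "real set" assume S: "open S"
  have "L2_div_open (\<Psi> -` S \<inter> L2_div)"
    unfolding L2_div_open_def
  proof (intro conjI ballI)
    fix f assume f: "f \<in> \<Psi> -` S \<inter> L2_div"
    show "\<exists>r>0. \<forall>g\<in>L2_div. L2_norm (\<lambda>x. g x - f x) < r \<longrightarrow> g \<in> \<Psi> -` S \<inter> L2_div"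
    proof (rule ccontr)
      assume c: "\<not> ?thesis"
      have "\<exists>g\<in>L2_div. L2_norm (\<lambda>x. g x - f x) < 1 / real (Suc n) \<and> \<Psi> g \<notin> S" for n
      proof -
        have "1 / real (Suc n) > 0" by simp
        then show ?thesis using c by blast
      qed
      then obtain g where g: "\<And>n. g n \<in> L2_div" "\<And>n. L2_norm (\<lambda>x. g n x - f x) < 1 / real (Suc n)" "\<And>n. \<Psi> (g n) \<notin> S"
        by metis
          have "(\<lambda>n. L2_norm (\<lambda>x. g n x - f x)) \<longlonglongrightarrow> 0"
        by (rule LIMSEQ_0_le[OF LIMSEQ_inverse_Suc L2_norm_nonneg less_imp_le[OF g(2)]])
      then have "(\<lambda>n. \<Psi> (g n)) \<longlonglongrightarrow> \<Psi> f" using f by (intro assms g(1)) auto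
      then have "\<forall>\<^sub>F n in sequentially. \<Psi> (g n) \<in> S" by (rule topological_tendstoD) (use S f in auto)
      then show False using g(3) by (auto simp: eventually_sequentially)
    qed
  qed auto
  then show "\<Psi> -` S \<inter> space L2_div_borel \<in> sets L2_div_borel" by (simp add: L2_div_open_sets)
qed

lemma measurable_L2_norm [measurable]: "L2_norm \<in> borel_measurable L2_div_borel"
  by (rule L2_div_borel_measurableI) (auto intro: L2_norm_tendsto L2_divD)

lemma measurable_L2_inner [measurable]:
  assumes "\<phi> \<in> L2" shows "(\<lambda>f. L2_inner f \<phi>) \<in> borel_measurable L2_div_borel"
  by (rule L2_div_borel_measurableI) (auto intro!: L2_inner_tendsto assms L2_norm_const_seq L2_divD)

lemma L2_grad_vector:
  assumes "smooth \<phi>" "periodic \<phi>"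
  obtains C where "C \<ge> 0" "\<And>f. f \<in> L2 \<Longrightarrow> (\<lambda>x. grad \<phi> x *v f x) \<in> L2"
    "\<And>f. f \<in> L2 \<Longrightarrow> L2_norm (\<lambda>x. grad \<phi> x *v f x) \<le> C * L2_norm f"
  by (rule L2_bilinear[OF bounded_bilinear.flip[OF bounded_bilinear_matrix_vector] continuous_grad[OF assms(1)] periodic_grad[OF assms]]) (rule that)

text \<open>The rate of change of (u, \<phi>) apart from the noise, with all derivatives moved onto
  \<phi>. In this form it is defined on all of L2, continuous there and of quadratic growth.\<close>

definition drift :: "real \<Rightarrow> (real^3 \<Rightarrow> real^3) \<Rightarrow> (real^3 \<Rightarrow> real^3) \<Rightarrow> real" where
  "drift \<nu> \<phi> f = \<nu> * L2_inner f (laplacian \<phi>) + L2_inner f (\<lambda>x. grad \<phi> x *v f x)"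

lemma L2_laplacian: "smooth \<phi> \<Longrightarrow> periodic \<phi> \<Longrightarrow> laplacian \<phi> \<in> L2"
  unfolding laplacian_def[abs_def] by (intro L2_smooth smooth_sum smooth_pd periodic_sum periodic_pd)

lemma measurable_drift:
  assumes "smooth \<phi>" "periodic \<phi>" shows "drift \<nu> \<phi> \<in> borel_measurable L2_div_borel"
proof (rule L2_div_borel_measurableI)
  fix F f assume F: "\<And>n::nat. F n \<in> L2_div" and f: "f \<in> L2_div" and lim: "(\<lambda>n. L2_norm (\<lambda>x. F n x - f x)) \<longlonglongrightarrow> 0"
  note FL = L2_divD[OF F] and fL = L2_divD[OF f]
  obtain C where C: "C \<ge> 0" "\<And>f. f \<in> L2 \<Longrightarrow> (\<lambda>x. grad \<phi> x *v f x) \<in> L2"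
    "\<And>f. f \<in> L2 \<Longrightarrow> L2_norm (\<lambda>x. grad \<phi> x *v f x) \<le> C * L2_norm f"
    using L2_grad_vector[OF assms] by blast
  have "(\<lambda>n. L2_norm (\<lambda>x. grad \<phi> x *v F n x - grad \<phi> x *v f x)) \<longlonglongrightarrow> 0"
    by (rule LIMSEQ_0_le[of "\<lambda>n. C * L2_norm (\<lambda>x. F n x - f x)"])
      (use tendsto_mult_left[OF lim, of C] C(3)[OF L2_diff[OF FL fL]] in \<open>simp_all add: matrix_vector_mult_diff_distrib\<close>)
  then show "(\<lambda>n. drift \<nu> \<phi> (F n)) \<longlonglongrightarrow> drift \<nu> \<phi> f"
    unfolding drift_def
    by (intro tendsto_add tendsto_mult_left L2_inner_tendsto[OF FL fL L2_laplacian[OF assms] L2_laplacian[OF assms] lim L2_norm_const_seq]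
      L2_inner_tendsto[OF FL fL C(2)[OF FL] C(2)[OF fL] lim])
qed

lemma drift_bound:
  assumes "smooth \<phi>" "periodic \<phi>" shows "\<exists>C\<ge>0. \<forall>f\<in>L2. \<bar>drift \<nu> \<phi> f\<bar> \<le> C * (1 + (L2_norm f)^2)"
proof -
  obtain C where C: "C \<ge> 0" "\<And>f. f \<in> L2 \<Longrightarrow> (\<lambda>x. grad \<phi> x *v f x) \<in> L2"
    "\<And>f. f \<in> L2 \<Longrightarrow> L2_norm (\<lambda>x. grad \<phi> x *v f x) \<le> C * L2_norm f"
    using L2_grad_vector[OF assms] by blast
  let ?l = "L2_norm (laplacian \<phi>)"
  have "\<bar>drift \<nu> \<phi> f\<bar> \<le> (\<bar>\<nu>\<bar> * ?l + C) * (1 + (L2_norm f)^2)" if f: "f \<in> L2" for f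
  proof -
    have "\<bar>drift \<nu> \<phi> f\<bar> \<le> \<bar>\<nu>\<bar> * (L2_norm f * ?l) + L2_norm f * (C * L2_norm f)"
      unfolding drift_def
      using mult_left_mono[OF L2_cs(2)[OF f L2_laplacian[OF assms]], of "\<bar>\<nu>\<bar>"]
        order_trans[OF L2_cs(2)[OF f C(2)[OF f]] mult_left_mono[OF C(3)[OF f] L2_norm_nonneg]]
      using abs_triangle_ineq[of "\<nu> * L2_inner f (laplacian \<phi>)" "L2_inner f (\<lambda>x. grad \<phi> x *v f x)"]
      unfolding abs_mult by linarith
    also have "\<dots> = (\<bar>\<nu>\<bar> * ?l) * L2_norm f + C * (L2_norm f)^2" by (simp add: power2_eq_square)
    also have "\<dots> \<le> (\<bar>\<nu>\<bar> * ?l) * (1 + (L2_norm f)^2) + C * (1 + (L2_norm f)^2)"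
      using le_one_add_sq[of "L2_norm f"] C(1) by (intro add_mono mult_left_mono) auto
    finally show ?thesis by (simp add: distrib_right)
  qed
  moreover have "\<bar>\<nu>\<bar> * ?l + C \<ge> 0" using C(1) by simp
  ultimately show ?thesis by blast
qed

text \<open>The complement is open: if the defining condition fails at f with margin e, it fails
  with margin e/2 throughout the ball of radius e/2.\<close>

lemma H1_sublevel_sets: "H1_sublevel R \<in> sets L2_div_borel"
proof -
  have "L2_div_open (L2_div - H1_sublevel R)"
    unfolding L2_div_open_def
  proof (intro conjI ballI)
    fix f assume f: "f \<in> L2_div - H1_sublevel R"
    then obtain e where e: "e > 0" and far: "\<And>\<Phi>. \<Phi> \<in> C_inf_div \<Longrightarrow> L2_norm (\<lambda>x. \<Phi> x - f x) < e \<Longrightarrow> L2_norm (grad \<Phi>) > R + e"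
      unfolding H1_sublevel_def by force
    show "\<exists>r>0. \<forall>g\<in>L2_div. L2_norm (\<lambda>x. g x - f x) < r \<longrightarrow> g \<in> L2_div - H1_sublevel R"
    proof (intro exI[of _ "e/2"] conjI ballI impI)
      fix g assume g: "g \<in> L2_div" "L2_norm (\<lambda>x. g x - f x) < e/2"
      have "L2_norm (grad \<Phi>) > R + e/2" if \<Phi>: "\<Phi> \<in> C_inf_div" "L2_norm (\<lambda>x. \<Phi> x - g x) < e/2" for \<Phi>
      proof -
        have "L2_norm (\<lambda>x. \<Phi> x - f x) < e"
          using L2_norm_triangle_diff[OF C_inf_divD(5)[OF \<Phi>(1)] L2_divD[OF g(1)] L2_divD, of f] f \<Phi>(2) g(2) by simp
        then show ?thesis using far[OF \<Phi>(1)] e by simp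
      qed
      moreover have "e/2 > 0" using e by simp
      ultimately have "g \<notin> H1_sublevel R" unfolding H1_sublevel_def by (auto simp: not_le intro!: exI[of _ "e/2"])
      then show "g \<in> L2_div - H1_sublevel R" using g by simp
    qed (use e in simp)
  qed auto
  then have "space L2_div_borel - (L2_div - H1_sublevel R) \<in> sets L2_div_borel" by (intro sets.compl_sets L2_div_open_sets)
  moreover have "space L2_div_borel - (L2_div - H1_sublevel R) = H1_sublevel R" by (auto simp: H1_sublevel_def)
  ultimately show ?thesis by simp
qed

lemma H1_div_sets [measurable]: "H1_div \<in> sets L2_div_borel"
proof -
  have "H1_div = (\<Union>n::nat. H1_sublevel (real n))"
    using real_arch_simple H1_sublevel_iff by blast
  moreover have "(\<Union>n::nat. H1_sublevel (real n)) \<in> sets L2_div_borel"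
    by (rule sets.countable_nat_UN) (use H1_sublevel_sets in blast)
  ultimately show ?thesis by simp
qed

text \<open>\<open>hgrad\<close> is a choice, and nothing is claimed about its own measurability;
  the sublevel sets of its norm are the measurable sets \<open>H1_sublevel\<close>, up to the
  complement of \<open>H1_div\<close>.\<close>

lemma measurable_L2_norm_hgrad:
  "(\<lambda>f. if f \<in> H1_div then L2_norm (hgrad f) else 0) \<in> borel_measurable L2_div_borel"
proof (rule borel_measurable_iff_le[THEN iffD2], rule allI)
  fix R :: real
  have L2: "f \<in> H1_div \<Longrightarrow> f \<in> L2_div" for f using H1_approxD(6) unfolding H1_div_iff by blast
  have "{f \<in> space L2_div_borel. (if f \<in> H1_div then L2_norm (hgrad f) else 0) \<le> R}
      = H1_sublevel R \<union> (if 0 \<le> R then space L2_div_borel - H1_div else {})"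
  proof (intro set_eqI)
    fix f
    show "f \<in> {f \<in> space L2_div_borel. (if f \<in> H1_div then L2_norm (hgrad f) else 0) \<le> R}
      \<longleftrightarrow> f \<in> H1_sublevel R \<union> (if 0 \<le> R then space L2_div_borel - H1_div else {})"
      using L2[of f] by (cases "f \<in> H1_div") (simp_all add: H1_sublevel_iff)
  qed
  then show "{f \<in> space L2_div_borel. (if f \<in> H1_div then L2_norm (hgrad f) else 0) \<le> R} \<in> sets L2_div_borel"
    using H1_sublevel_sets sets.compl_sets[OF H1_div_sets] by auto
qed

section \<open>Increments of stationary processes\<close>

lemma integrable_square_add:
  fixes f g :: "'a \<Rightarrow> real"
  assumes "f \<in> borel_measurable M" "g \<in> borel_measurable M" "integrable M (\<lambda>x. (f x)^2)" "integrable M (\<lambda>x. (g x)^2)"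
  shows "integrable M (\<lambda>x. (f x + g x)^2)"
    and "(LINT x|M. (f x + g x)^2) = (LINT x|M. (f x)^2) + 2 * (LINT x|M. f x * g x) + (LINT x|M. (g x)^2)"
    and "(LINT x|M. (f x + g x)^2) \<le> 2 * (LINT x|M. (f x)^2) + 2 * (LINT x|M. (g x)^2)"
proof -
  note i = assms(3,4) cauchy_schwarz_integral(1)[OF assms]
  have eq: "(\<lambda>x. (f x + g x)^2) = (\<lambda>x. (f x)^2 + 2 * (f x * g x) + (g x)^2)"
    by (simp add: fun_eq_iff power2_sum)
  show int: "integrable M (\<lambda>x. (f x + g x)^2)" unfolding eq using i by auto
  show "(LINT x|M. (f x + g x)^2) = (LINT x|M. (f x)^2) + 2 * (LINT x|M. f x * g x) + (LINT x|M. (g x)^2)"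
    unfolding eq using i by simp
  have "(LINT x|M. (f x + g x)^2) \<le> (LINT x|M. 2 * (f x)^2 + 2 * (g x)^2)"
  proof (rule integral_mono[OF int])
    show "integrable M (\<lambda>x. 2 * (f x)^2 + 2 * (g x)^2)" using i by auto
    show "(f x + g x)^2 \<le> 2 * (f x)^2 + 2 * (g x)^2" for x
      using zero_le_power2[of "f x - g x"] by (simp add: power2_sum power2_diff)
  qed
  then show "(LINT x|M. (f x + g x)^2) \<le> 2 * (LINT x|M. (f x)^2) + 2 * (LINT x|M. (g x)^2)" using i by simp
qed

context prob_space
begin

text \<open>Cauchy-Schwarz in time bounds the squared time integral by t times the time integral of
  the square, whence t^2 B: one order smaller in t than the variance of the noise.\<close>

lemma time_average:
  fixes t :: real and b :: "real \<Rightarrow> 'a \<Rightarrow> real"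
  defines "\<Lambda> \<equiv> restrict_space lborel {0..t}"
  assumes t: "0 \<le> t"
    and b: "(\<lambda>(s, w). b s w) \<in> borel_measurable (restrict_space borel {0..t} \<Otimes>\<^sub>M M)"
    and b2: "\<forall>s\<in>{0..t}. integrable M (\<lambda>w. (b s w)^2) \<and> expectation (\<lambda>w. (b s w)^2) = B"
  shows "(\<lambda>z. b (fst z) (snd z)) \<in> borel_measurable (\<Lambda> \<Otimes>\<^sub>M M)"
    and "integrable (\<Lambda> \<Otimes>\<^sub>M M) (\<lambda>z. (b (fst z) (snd z))^2)"
    and "(LINT z|(\<Lambda> \<Otimes>\<^sub>M M). (b (fst z) (snd z))^2) = t * B"
    and "(\<lambda>w. LINT s|\<Lambda>. b s w) \<in> borel_measurable M"
    and "integrable M (\<lambda>w. (LINT s|\<Lambda>. b s w)^2)"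
    and "expectation (\<lambda>w. (LINT s|\<Lambda>. b s w)^2) \<le> t^2 * B"
    and "AE w in M. integrable \<Lambda> (\<lambda>s. b s w)"
proof -
  have sL: "sets \<Lambda> = sets (restrict_space borel {0..t})" unfolding \<Lambda>_def by (rule sets_restrict_space_cong) simp
  have spL: "space \<Lambda> = {0..t}" by (simp add: \<Lambda>_def space_restrict_space)
  have mL: "measure \<Lambda> {0..t} = t" using t by (simp add: \<Lambda>_def measure_restrict_space)
  interpret L: finite_measure \<Lambda>
    by (rule finite_measureI) (use t in \<open>simp add: \<Lambda>_def emeasure_restrict_space space_restrict_space\<close>)
  interpret P: pair_sigma_finite \<Lambda> M ..
  have one: "(\<lambda>s. 1::real) \<in> borel_measurable \<Lambda>" "integrable \<Lambda> (\<lambda>s. 1^2::real)" "(LINT s|\<Lambda>. 1^2::real) = t"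
    using mL spL by (auto simp: L.integrable_const)
  show bm: "(\<lambda>z. b (fst z) (snd z)) \<in> borel_measurable (\<Lambda> \<Otimes>\<^sub>M M)"
    using b unfolding measurable_cong_sets[OF sets_pair_measure_cong[OF sL refl, of M] refl, of borel] by (simp add: case_prod_beta')
  have bs: "(\<lambda>s. b s w) \<in> borel_measurable \<Lambda>" if "w \<in> space M" for w
    using measurable_compose[OF measurable_Pair2'[OF that] bm] by simp
  show int: "integrable (\<Lambda> \<Otimes>\<^sub>M M) (\<lambda>z. (b (fst z) (snd z))^2)"
  proof (rule P.Fubini_integrable)
    show "integrable \<Lambda> (\<lambda>s. LINT w|M. norm ((b (fst (s, w)) (snd (s, w)))^2))"
      by (rule integrable_cong[THEN iffD2, OF refl _ L.integrable_const[of B]]) (simp add: spL b2)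
    show "AE s in \<Lambda>. integrable M (\<lambda>w. (b (fst (s, w)) (snd (s, w)))^2)"
      by (intro AE_I2) (simp add: spL b2)
  qed (use bm in measurable)
  have "(LINT z|(\<Lambda> \<Otimes>\<^sub>M M). (b (fst z) (snd z))^2) = (LINT s|\<Lambda>. LINT w|M. (b s w)^2)"
    using P.integral_fst'[OF int] by simp
  also have "\<dots> = (LINT s|\<Lambda>. B)" by (rule integral_cong) (auto simp: spL b2)
  also have "\<dots> = t * B" by (simp add: spL mL)
  finally show tB: "(LINT z|(\<Lambda> \<Otimes>\<^sub>M M). (b (fst z) (snd z))^2) = t * B" .
  show D: "(\<lambda>w. LINT s|\<Lambda>. b s w) \<in> borel_measurable M"
    using L.borel_measurable_lebesgue_integral[of "\<lambda>w s. b s w" M]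
      measurable_compose[OF measurable_pair_swap' bm] by (simp add: case_prod_beta')
  have intM: "integrable M (\<lambda>w. LINT s|\<Lambda>. (b s w)^2)" using P.integrable_snd[of "\<lambda>s w. (b s w)^2"] int by (simp add: case_prod_beta')
  have swap: "(LINT w|M. LINT s|\<Lambda>. (b s w)^2) = t * B"
    using P.integral_snd[of "\<lambda>s w. (b s w)^2"] int tB by (simp add: case_prod_beta')
  have AEi: "AE w in M. integrable \<Lambda> (\<lambda>s. (b s w)^2)"
    using P.AE_integrable_snd[of "\<lambda>s w. (b s w)^2"] int by (simp add: case_prod_beta')
  have AEd: "AE w in M. integrable \<Lambda> (\<lambda>s. b s w) \<and> (LINT s|\<Lambda>. b s w)^2 \<le> t * (LINT s|\<Lambda>. (b s w)^2)"
    using AEi AE_space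
  proof eventually_elim
    fix w assume i: "integrable \<Lambda> (\<lambda>s. (b s w)^2)" and w: "w \<in> space M"
    note cs = cauchy_schwarz_integral[OF one(1) bs[OF w] one(2) i]
    have "(LINT s|\<Lambda>. b s w)^2 = \<bar>LINT s|\<Lambda>. 1 * b s w\<bar>^2" by simp
    also have "\<dots> \<le> (sqrt t * sqrt (LINT s|\<Lambda>. (b s w)^2))^2"
      by (rule power_mono) (use cs(3) one(3) in simp_all)
    also have "\<dots> = t * (LINT s|\<Lambda>. (b s w)^2)" using t by (simp add: power_mult_distrib)
    finally show "integrable \<Lambda> (\<lambda>s. b s w) \<and> (LINT s|\<Lambda>. b s w)^2 \<le> t * (LINT s|\<Lambda>. (b s w)^2)" using cs(1) by simp
  qed
  then show "AE w in M. integrable \<Lambda> (\<lambda>s. b s w)" by eventually_elim simp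
  show D2: "integrable M (\<lambda>w. (LINT s|\<Lambda>. b s w)^2)"
  proof (rule integrable_bound[OF integrable_mult_right[OF intM, of t]])
    show "AE w in M. norm ((LINT s|\<Lambda>. b s w)^2) \<le> norm (t * (LINT s|\<Lambda>. (b s w)^2))"
      using AEd by eventually_elim (use t in \<open>simp add: abs_mult\<close>)
  qed (use D in measurable)
  have "expectation (\<lambda>w. (LINT s|\<Lambda>. b s w)^2) \<le> expectation (\<lambda>w. t * (LINT s|\<Lambda>. (b s w)^2))"
    by (rule integral_mono_AE[OF D2 integrable_mult_right[OF intM]]) (use AEd in eventually_elim, simp)
  then show "expectation (\<lambda>w. (LINT s|\<Lambda>. b s w)^2) \<le> t^2 * B"
    unfolding integral_mult_right_zero swap by (simp add: power2_eq_square mult.assoc)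
qed

text \<open>Stands in for the Ito formula. With D the time integral of b, expand A = E (X_0 + D +
  N)^2, where A is also E X_0^2: E X_0 N = 0, E N^2 = t \<gamma>, E D^2 = O(t^2), E D N = O(t^(3/2))
  and E X_0 D = t R + O(t^(3/2)). Dividing by t and letting t tend to 0 leaves 2 R + \<gamma> =
  0.\<close>

theorem stationary_balance:
  fixes X b N :: "real \<Rightarrow> 'a \<Rightarrow> real"
  assumes Xm: "(\<lambda>(s, w). X s w) \<in> borel_measurable (restrict_space borel {0..1} \<Otimes>\<^sub>M M)"
    and bm: "(\<lambda>(s, w). b s w) \<in> borel_measurable (restrict_space borel {0..1} \<Otimes>\<^sub>M M)"
    and X2: "\<And>s. s \<in> {0..1} \<Longrightarrow> integrable M (\<lambda>w. (X s w)^2)" "\<And>s. s \<in> {0..1} \<Longrightarrow> expectation (\<lambda>w. (X s w)^2) = A"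
    and b2: "\<And>s. s \<in> {0..1} \<Longrightarrow> integrable M (\<lambda>w. (b s w)^2)" "\<And>s. s \<in> {0..1} \<Longrightarrow> expectation (\<lambda>w. (b s w)^2) = B"
    and Xb: "\<And>s. s \<in> {0..1} \<Longrightarrow> expectation (\<lambda>w. X s w * b s w) = R"
    and N: "\<And>t. 0 < t \<Longrightarrow> t \<le> 1 \<Longrightarrow> N t \<in> borel_measurable M"
      "\<And>t. 0 < t \<Longrightarrow> t \<le> 1 \<Longrightarrow> integrable M (\<lambda>w. (N t w)^2)"
      "\<And>t. 0 < t \<Longrightarrow> t \<le> 1 \<Longrightarrow> expectation (\<lambda>w. (N t w)^2) = t * \<gamma>"
      "\<And>t. 0 < t \<Longrightarrow> t \<le> 1 \<Longrightarrow> expectation (\<lambda>w. X 0 w * N t w) = 0"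
    and eq: "\<And>t. 0 < t \<Longrightarrow> t \<le> 1 \<Longrightarrow> AE w in M. X t w = X 0 w + (LINT s|restrict_space lborel {0..t}. b s w) + N t w"
  shows "2 * R + \<gamma> = 0"
proof -
  let ?\<Lambda> = "\<lambda>t. restrict_space (lborel :: real measure) {0..t}"
  let ?D = "\<lambda>t w. LINT s|?\<Lambda> t. b s w"
  have restr: "(\<lambda>(s, w). f s w) \<in> borel_measurable (restrict_space borel {0..t} \<Otimes>\<^sub>M M)"
    if f: "(\<lambda>(s, w). f s w) \<in> borel_measurable (restrict_space borel {0..1} \<Otimes>\<^sub>M M)" and t: "t \<le> 1" for f :: "real \<Rightarrow> 'a \<Rightarrow> real" and t
  proof -
    have "(\<lambda>s. s) \<in> measurable (restrict_space borel {0..t}) (restrict_space (borel :: real measure) {0..1})"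
      by (rule measurable_restrict_mono[OF measurable_ident_sets]) (use t in auto)
    then have "(\<lambda>z. (fst z, snd z)) \<in> measurable (restrict_space borel {0..t} \<Otimes>\<^sub>M M) (restrict_space (borel :: real measure) {0..1} \<Otimes>\<^sub>M M)"
      by (intro measurable_Pair measurable_compose[OF measurable_fst] measurable_snd)
    from measurable_compose[OF this f] show ?thesis by (simp add: case_prod_beta')
  qed
  have Xms: "X s \<in> borel_measurable M" if "s \<in> {0..1}" for s
    using measurable_compose[OF measurable_Pair1'[of s] Xm] that by (simp add: space_restrict_space)
  have bms: "b s \<in> borel_measurable M" if "s \<in> {0..1}" for s
    using measurable_compose[OF measurable_Pair1'[of s] bm] that by (simp add: space_restrict_space)
  have X0m: "X 0 \<in> borel_measurable M" by (rule Xms) simp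
  have X0c: "(\<lambda>(s, w). X 0 w) \<in> borel_measurable (restrict_space borel {0..t} \<Otimes>\<^sub>M M)" for t :: real
    using measurable_compose[OF measurable_snd X0m] by (simp add: case_prod_beta')
  have \<gamma>0: "0 \<le> \<gamma>" using N(3)[of 1] integral_nonneg_AE[of "\<lambda>w. (N 1 w)^2" M] by simp
  have B0: "0 \<le> B" using b2(2)[of 0] integral_nonneg_AE[of "\<lambda>w. (b 0 w)^2" M] by simp
  have D: "?D t \<in> borel_measurable M" "integrable M (\<lambda>w. (?D t w)^2)" "expectation (\<lambda>w. (?D t w)^2) \<le> t^2 * B"
    if "0 < t" "t \<le> 1" for t
    by (rule time_average[OF less_imp_le[OF that(1)] restr[OF bm that(2)]], use b2 that in auto)+
  \<comment> \<open>Mean square continuity at 0, with the rate t of the noise; it allows X_s to be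
    replaced by X_0 below.\<close>
  have inc: "expectation (\<lambda>w. (X s w - X 0 w)^2) \<le> 2 * t * (B + \<gamma>)" if s: "0 \<le> s" "s \<le> t" "t \<le> 1" for s t
  proof (cases "s = 0")
    case True then show ?thesis using B0 \<gamma>0 s by simp
  next
    case False
    then have s': "0 < s" "s \<le> 1" using s by auto
    have [measurable]: "X s \<in> borel_measurable M" "X 0 \<in> borel_measurable M" "?D s \<in> borel_measurable M" "N s \<in> borel_measurable M"
      using Xms[of s] X0m D(1)[OF s'] N(1)[OF s'] s' by auto
    have "expectation (\<lambda>w. (X s w - X 0 w)^2) = expectation (\<lambda>w. (?D s w + N s w)^2)"
    proof (rule integral_cong_AE)
      show "AE w in M. (X s w - X 0 w)^2 = (?D s w + N s w)^2" using eq[OF s'] by eventually_elim simp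
    qed measurable
    also have "\<dots> \<le> 2 * expectation (\<lambda>w. (?D s w)^2) + 2 * expectation (\<lambda>w. (N s w)^2)"
      by (rule integrable_square_add(3)[OF D(1)[OF s'] N(1)[OF s'] D(2)[OF s'] N(2)[OF s']])
    also have "\<dots> \<le> 2 * (s * 1 * B) + 2 * (s * \<gamma>)"
      using D(3)[OF s'] N(3)[OF s'] mult_right_mono[OF mult_left_mono[OF s'(2) less_imp_le[OF s'(1)]] B0]
      unfolding power2_eq_square by linarith
    also have "\<dots> \<le> 2 * t * (B + \<gamma>)"
      using mult_right_mono[OF s(2) B0] mult_right_mono[OF s(2) \<gamma>0] by (simp add: distrib_left)
    finally show ?thesis .
  qed
  \<comment> \<open>Collects the two errors of order t^(3/2), from E X_0 D and from E D N, after
    division by t; B t is what remains of E D^2.\<close>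
  define K where "K = 2 * (sqrt (2 * (B + \<gamma>)) * sqrt B) + 2 * (sqrt B * sqrt \<gamma>)"
  have main: "\<bar>2 * R + \<gamma>\<bar> \<le> K * sqrt t + B * t" if t: "0 < t" "t \<le> 1" for t
  proof -
    note t0 = less_imp_le[OF t(1)]
    have sp: "s \<in> {0..1}" if "s \<in> {0..t}" for s using that t by auto
    have spL: "space (?\<Lambda> t) = {0..t}" by (simp add: space_restrict_space)
    have mL: "measure (?\<Lambda> t) {0..t} = t" using t by (simp add: measure_restrict_space)
    interpret L: finite_measure "?\<Lambda> t"
      by (rule finite_measureI) (use t in \<open>simp add: emeasure_restrict_space space_restrict_space\<close>)
    interpret P: pair_sigma_finite "?\<Lambda> t" M ..
    let ?P = "?\<Lambda> t \<Otimes>\<^sub>M M"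
    have "\<forall>s\<in>{0..t}. integrable M (\<lambda>w. (b s w)^2) \<and> expectation (\<lambda>w. (b s w)^2) = B" using b2 sp by blast
    note bP = time_average(1-3)[OF t0 restr[OF bm t(2)] this]
    have "\<forall>s\<in>{0..t}. integrable M (\<lambda>w. (X s w)^2) \<and> expectation (\<lambda>w. (X s w)^2) = A" using X2 sp by blast
    note XP = time_average(1-3)[OF t0 restr[OF Xm t(2)] this]
    have "\<forall>s\<in>{0..t}. integrable M (\<lambda>w. (X 0 w)^2) \<and> expectation (\<lambda>w. (X 0 w)^2) = A" using X2[of 0] by simp
    note YP = time_average(1-3)[OF t0 X0c this]
    have YP': "(\<lambda>z. X 0 (snd z)) \<in> borel_measurable ?P" "integrable ?P (\<lambda>z. (X 0 (snd z))^2)" using YP(1,2) by auto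
    note cb = cauchy_schwarz_integral[OF _ bP(1) _ bP(2)]
    note Yb = cb(1)[OF YP'] and Xb' = cb(1)[OF XP(1,2)]
    have dm: "(\<lambda>z. X (fst z) (snd z) - X 0 (snd z)) \<in> borel_measurable ?P" using XP(1) YP'(1) by measurable
    have d2: "integrable ?P (\<lambda>z. (X (fst z) (snd z) - X 0 (snd z))^2)"
      using integrable_square_add(1)[OF XP(1) borel_measurable_uminus[OF YP'(1)] XP(2)] YP'(2) by simp
    have "(LINT z|?P. (X (fst z) (snd z) - X 0 (snd z))^2) = (LINT s|?\<Lambda> t. LINT w|M. (X s w - X 0 w)^2)"
      using P.integral_fst'[OF d2] by simp
    also have "\<dots> \<le> (LINT s|?\<Lambda> t. 2 * t * (B + \<gamma>))"
      using P.integrable_fst'[OF d2] inc t by (intro integral_mono) (auto simp: spL)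
    also have "\<dots> = t^2 * (2 * (B + \<gamma>))" by (simp add: spL mL power2_eq_square)
    finally have dle: "(LINT z|?P. (X (fst z) (snd z) - X 0 (snd z))^2) \<le> t^2 * (2 * (B + \<gamma>))" .
    have "(LINT z|?P. X (fst z) (snd z) * b (fst z) (snd z)) = (LINT s|?\<Lambda> t. LINT w|M. X s w * b s w)"
      using P.integral_fst'[OF Xb'] by simp
    also have "\<dots> = (LINT s|?\<Lambda> t. R)" using t by (intro integral_cong) (auto simp: spL Xb)
    also have "\<dots> = t * R" by (simp add: spL mL)
    finally have tR: "(LINT z|?P. X (fst z) (snd z) * b (fst z) (snd z)) = t * R" .
    have X0D: "(LINT z|?P. X 0 (snd z) * b (fst z) (snd z)) = expectation (\<lambda>w. X 0 w * ?D t w)"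
      using P.integral_snd[of "\<lambda>s w. X 0 w * b s w"] Yb by (simp add: case_prod_beta')
    \<comment> \<open>The error is the integral of (X_s - X_0) b_s over time and probability space:
      by \<open>inc\<close> its first factor has L2 norm of order t, the second of order sqrt
      t.\<close>
    have "t * R - expectation (\<lambda>w. X 0 w * ?D t w) = (LINT z|?P. (X (fst z) (snd z) - X 0 (snd z)) * b (fst z) (snd z))"
      unfolding X0D[symmetric] tR[symmetric] using Yb Xb' by (simp add: left_diff_distrib)
    then have "\<bar>t * R - expectation (\<lambda>w. X 0 w * ?D t w)\<bar> \<le> sqrt (t^2 * (2 * (B + \<gamma>))) * sqrt (t * B)"
      using order_trans[OF cb(3)[OF dm d2] mult_mono[OF real_sqrt_le_mono[OF dle]]] t B0 \<gamma>0 by (simp add: bP(3))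
    then have c1: "\<bar>t * R - expectation (\<lambda>w. X 0 w * ?D t w)\<bar> \<le> t * (sqrt (2 * (B + \<gamma>)) * sqrt B * sqrt t)"
      using t by (simp add: real_sqrt_mult mult_ac)
    note Dt = D[OF t] and Nt = N[OF t]
    have DN: "\<bar>expectation (\<lambda>w. ?D t w * N t w)\<bar> \<le> t * (sqrt B * sqrt \<gamma> * sqrt t)"
    proof -
      have "\<bar>expectation (\<lambda>w. ?D t w * N t w)\<bar> \<le> sqrt (t^2 * B) * sqrt (t * \<gamma>)"
        using order_trans[OF cauchy_schwarz_integral(3)[OF Dt(1) Nt(1) Dt(2) Nt(2)] mult_mono[OF real_sqrt_le_mono[OF Dt(3)]]]
          t B0 \<gamma>0 by (simp add: Nt(3))
      then show ?thesis using t by (simp add: real_sqrt_mult mult_ac)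
    qed
    note DNs = integrable_square_add[OF Dt(1) Nt(1) Dt(2) Nt(2)]
    have DNm: "(\<lambda>w. ?D t w + N t w) \<in> borel_measurable M" using Dt(1) Nt(1) by measurable
    have X02: "integrable M (\<lambda>w. (X 0 w)^2)" by (rule X2) simp
    have [measurable]: "X t \<in> borel_measurable M" "X 0 \<in> borel_measurable M" "?D t \<in> borel_measurable M" "N t \<in> borel_measurable M"
      using Xms[of t] X0m Dt(1) Nt(1) t by auto
    have D0: "0 \<le> expectation (\<lambda>w. (?D t w)^2)" by (rule integral_nonneg_AE) simp
    have arith: "\<bar>x\<bar> \<le> 2 * a + d + 2 * b" if "x = 2 * p - q - 2 * r" "0 \<le> q" "q \<le> d" "\<bar>p\<bar> \<le> a" "\<bar>r\<bar> \<le> b" for x p q r a b d :: real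
      using that by linarith
    have "A = expectation (\<lambda>w. (X 0 w + (?D t w + N t w))^2)"
    proof -
      have "expectation (\<lambda>w. (X t w)^2) = expectation (\<lambda>w. (X 0 w + (?D t w + N t w))^2)"
      proof (rule integral_cong_AE)
        show "AE w in M. (X t w)^2 = (X 0 w + (?D t w + N t w))^2" using eq[OF t] by eventually_elim (simp add: add.assoc)
      qed measurable
      then show ?thesis using X2(2)[of t] t by simp
    qed
    also have "\<dots> = A + 2 * expectation (\<lambda>w. X 0 w * (?D t w + N t w)) + expectation (\<lambda>w. (?D t w + N t w)^2)"
      using integrable_square_add(2)[OF X0m DNm X02 DNs(1)] X2(2)[of 0] by simp
    also have "expectation (\<lambda>w. X 0 w * (?D t w + N t w)) = expectation (\<lambda>w. X 0 w * ?D t w) + expectation (\<lambda>w. X 0 w * N t w)"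
      using cauchy_schwarz_integral(1)[OF X0m Dt(1) X02 Dt(2)] cauchy_schwarz_integral(1)[OF X0m Nt(1) X02 Nt(2)]
      by (simp add: distrib_left)
    finally have "t * (2 * R + \<gamma>) = 2 * (t * R - expectation (\<lambda>w. X 0 w * ?D t w)) - expectation (\<lambda>w. (?D t w)^2)
        - 2 * expectation (\<lambda>w. ?D t w * N t w)"
      unfolding DNs(2) Nt(3) Nt(4) by (simp add: algebra_simps)
    then have "\<bar>t * (2 * R + \<gamma>)\<bar> \<le> 2 * (t * (sqrt (2 * (B + \<gamma>)) * sqrt B * sqrt t)) + t^2 * B + 2 * (t * (sqrt B * sqrt \<gamma> * sqrt t))"
      by (rule arith[OF _ D0 Dt(3) c1 DN])
    also have "\<dots> = t * (K * sqrt t + B * t)" by (simp add: K_def algebra_simps power2_eq_square)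
    finally show ?thesis using t by (simp add: abs_mult)
  qed
  have "(\<lambda>n. K * sqrt (1 / real (Suc n)) + B * (1 / real (Suc n))) \<longlonglongrightarrow> K * sqrt 0 + B * 0"
    by (intro tendsto_intros LIMSEQ_inverse_Suc)
  then have "\<bar>2 * R + \<gamma>\<bar> \<le> K * sqrt 0 + B * 0"
    by (rule LIMSEQ_le_const) (intro exI[of _ 0] allI impI main; simp)
  then show ?thesis by simp
qed

end

section \<open>The noise\<close>

text \<open>The limit is given only almost everywhere; Fatou's lemma turns the Cauchy rate r into a
  bound for its L2 distance to the approximants.\<close>

lemma L2_limit:
  fixes S :: "nat \<Rightarrow> 'a \<Rightarrow> real"
  assumes Sm: "\<And>n. S n \<in> borel_measurable M" and S2: "\<And>n. integrable M (\<lambda>x. (S n x)^2)"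
    and Nm: "N \<in> borel_measurable M" and lim: "AE x in M. (\<lambda>n. S n x) \<longlonglongrightarrow> N x"
    and cauchy: "\<forall>n. \<forall>m\<ge>n. (LINT x|M. (S m x - S n x)^2) \<le> r n" and r: "r \<longlonglongrightarrow> 0"
  shows "integrable M (\<lambda>x. (N x)^2)"
    and "(\<lambda>n. LINT x|M. (S n x)^2) \<longlonglongrightarrow> (LINT x|M. (N x)^2)"
    and "Y \<in> borel_measurable M \<Longrightarrow> integrable M (\<lambda>x. (Y x)^2) \<Longrightarrow> (\<lambda>n. LINT x|M. Y x * S n x) \<longlonglongrightarrow> (LINT x|M. Y x * N x)"
proof -
  note [measurable] = Sm Nm
  have d: "integrable M (\<lambda>x. (S m x - S n x)^2)" for m n
    using integrable_square_add(1)[OF Sm borel_measurable_uminus[OF Sm] S2, of n m] S2 by simp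
  have r0: "0 \<le> r n" for n using spec[OF cauchy, of n] by auto
  have nn: "(\<integral>\<^sup>+x. ennreal ((N x - S n x)^2) \<partial>M) \<le> ennreal (r n)" for n
  proof (rule nn_integral_limit_le[where h="\<lambda>m x. (S m x - S n x)^2"])
    show "AE x in M. (\<lambda>m. (S m x - S n x)^2) \<longlonglongrightarrow> (N x - S n x)^2"
      using lim by eventually_elim (intro tendsto_intros)
    show "\<forall>\<^sub>F m in sequentially. (\<integral>\<^sup>+x. ennreal ((S m x - S n x)^2) \<partial>M) \<le> ennreal (r n)"
      using cauchy nn_integral_eq_integral[OF d]
      by (auto simp: eventually_sequentially intro!: exI[of _ n] ennreal_leI)
  qed measurable
  have di: "integrable M (\<lambda>x. (N x - S n x)^2)" for n
    using nn[of n] by (intro integrableI_bounded) (auto simp: order_le_less_trans[OF _ ennreal_less_top])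
  have dle: "(LINT x|M. (N x - S n x)^2) \<le> r n" for n
    using nn[of n] nn_integral_eq_integral[OF di] r0 by (simp add: ennreal_le_iff)
  have dm: "(\<lambda>x. N x - S n x) \<in> borel_measurable M" for n by measurable
  show N2: "integrable M (\<lambda>x. (N x)^2)" using integrable_square_add(1)[OF dm Sm di S2, of 0 0] by simp
  show Y: "(\<lambda>n. LINT x|M. Y x * S n x) \<longlonglongrightarrow> (LINT x|M. Y x * N x)"
    if Y: "Y \<in> borel_measurable M" "integrable M (\<lambda>x. (Y x)^2)" for Y
  proof -
    have "norm ((LINT x|M. Y x * N x) - (LINT x|M. Y x * S n x)) \<le> sqrt (LINT x|M. (Y x)^2) * sqrt (r n)" for n
    proof -
      have "(LINT x|M. Y x * N x) - (LINT x|M. Y x * S n x) = (LINT x|M. Y x * (N x - S n x))"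
        using cauchy_schwarz_integral(1)[OF Y(1) Nm Y(2) N2] cauchy_schwarz_integral(1)[OF Y(1) Sm Y(2) S2]
        by (simp add: right_diff_distrib)
      then show ?thesis
        using order_trans[OF cauchy_schwarz_integral(3)[OF Y(1) dm Y(2) di] mult_left_mono[OF real_sqrt_le_mono[OF dle]]] by simp
    qed
    moreover have "(\<lambda>n. sqrt (LINT x|M. (Y x)^2) * sqrt (r n)) \<longlonglongrightarrow> sqrt (LINT x|M. (Y x)^2) * sqrt 0" by (intro tendsto_intros r)
    ultimately have "(\<lambda>n. (LINT x|M. Y x * N x) - (LINT x|M. Y x * S n x)) \<longlonglongrightarrow> 0"
      by (rule_tac Lim_null_comparison[OF always_eventually[OF allI]]) simp_all
    from tendsto_diff[OF tendsto_const this, of "LINT x|M. Y x * N x"] show ?thesis by simp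
  qed
  have "(\<lambda>n. LINT x|M. (N x - S n x)^2) \<longlonglongrightarrow> 0"
    by (rule LIMSEQ_0_le[OF r _ dle]) simp
  then have "(\<lambda>n. (LINT x|M. (N x - S n x)^2) + 2 * (LINT x|M. N x * S n x) - (LINT x|M. (N x)^2))
      \<longlonglongrightarrow> 0 + 2 * (LINT x|M. N x * N x) - (LINT x|M. (N x)^2)"
    by (intro tendsto_intros Y[OF Nm N2])
  moreover have "(LINT x|M. (N x - S n x)^2) + 2 * (LINT x|M. N x * S n x) - (LINT x|M. (N x)^2) = (LINT x|M. (S n x)^2)" for n
    using integrable_square_add(2)[OF Nm borel_measurable_uminus[OF Sm] N2, of n] S2 by simp
  ultimately show "(\<lambda>n. LINT x|M. (S n x)^2) \<longlonglongrightarrow> (LINT x|M. (N x)^2)" by (simp add: power2_eq_square)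
qed

context stochastic_basis
begin

lemma increment_moments:
  assumes "0 < t"
  shows "(\<lambda>w. \<beta> k t w - \<beta> k 0 w) \<in> borel_measurable M" "integrable M (\<lambda>w. \<beta> k t w - \<beta> k 0 w)"
    "expectation (\<lambda>w. \<beta> k t w - \<beta> k 0 w) = 0" "integrable M (\<lambda>w. (\<beta> k t w - \<beta> k 0 w)^2)"
    "expectation (\<lambda>w. (\<beta> k t w - \<beta> k 0 w)^2) = t"
proof -
  interpret B: brownian_motion M F "\<beta> k" by (rule brownian)
  have D: "distributed M lborel (\<lambda>w. \<beta> k t w - \<beta> k 0 w) (normal_density 0 (sqrt t))" using B.gaussian[of 0 t] assms by simp
  have s: "sqrt t > 0" using assms by simp
  show m: "(\<lambda>w. \<beta> k t w - \<beta> k 0 w) \<in> borel_measurable M" using distributed_measurable[OF D] by simp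
  show e: "expectation (\<lambda>w. \<beta> k t w - \<beta> k 0 w) = 0" by (rule normal_distributed_expectation[OF s D])
  show i2: "integrable M (\<lambda>w. (\<beta> k t w - \<beta> k 0 w)^2)"
    using distributed_integrable[OF D, of "\<lambda>x. x^2"] integrable.intros[OF normal_moment_even[OF s, of 0 1]] by simp
  show "expectation (\<lambda>w. (\<beta> k t w - \<beta> k 0 w)^2) = t" using normal_distributed_variance[OF s D] e assms by simp
  show "integrable M (\<lambda>w. \<beta> k t w - \<beta> k 0 w)" by (rule square_integrable_imp_integrable[OF m i2])
qed

lemma increment_uncorrelated:
  assumes t: "0 < t" and "j \<noteq> k"
  shows "expectation (\<lambda>w. (\<beta> j t w - \<beta> j 0 w) * (\<beta> k t w - \<beta> k 0 w)) = 0"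
proof -
  have "indep_vars (\<lambda>_. borel) (\<lambda>k w. (\<lambda>f. f t - f 0) (\<lambda>s\<in>{0..}. \<beta> k s w)) UNIV"
    using t by (intro indep_vars_compose2[OF independent] borel_measurable_diff measurable_component_singleton) auto
  then have "indep_vars (\<lambda>_. borel) (\<lambda>k w. \<beta> k t w - \<beta> k 0 w) UNIV" using t by simp
  then have "indep_vars (\<lambda>_. borel) (\<lambda>k w. \<beta> k t w - \<beta> k 0 w) {j, k}" by (rule indep_vars_subset) simp
  from indep_vars_lebesgue_integral[OF _ this] show ?thesis
    using increment_moments(2,3)[OF t] \<open>j \<noteq> k\<close> by simp
qed

lemma increment_independent_past:
  assumes t: "0 < t" and Y: "Y \<in> borel_measurable (F 0)" "integrable M Y"
  shows "expectation (\<lambda>w. Y w * (\<beta> k t w - \<beta> k 0 w)) = 0"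
proof -
  interpret B: brownian_motion M F "\<beta> k" by (rule brownian)
  have sa: "subalgebra M (F 0)" by (rule sub) simp
  have YM: "Y \<in> borel_measurable M" by (rule measurable_from_subalg[OF sa Y(1)])
  let ?\<Delta> = "\<lambda>w. \<beta> k t w - \<beta> k 0 w"
  have st: "Int_stable {f -` A \<inter> space M | A. A \<in> sets (borel :: real measure)}" for f :: "'w \<Rightarrow> real"
  proof (rule Int_stableI)
    fix a b assume "a \<in> {f -` A \<inter> space M | A. A \<in> sets borel}" "b \<in> {f -` A \<inter> space M | A. A \<in> sets borel}"
    then obtain A B where "A \<in> sets borel" "B \<in> sets borel" "a = f -` A \<inter> space M" "b = f -` B \<inter> space M" by blast
    then show "a \<inter> b \<in> {f -` A \<inter> space M | A. A \<in> sets borel}" by (intro CollectI exI[of _ "A \<inter> B"]) auto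
  qed
  have YF: "{Y -` A \<inter> space M | A. A \<in> sets borel} \<subseteq> sets (F 0)"
    using measurable_sets[OF Y(1)] sa by (auto simp: subalgebra_def)
  have "indep_set (sets (F 0)) {?\<Delta> -` A \<inter> space M | A. A \<in> sets borel}" using B.independent_increments[of 0 t] t by simp
  then have "indep_set {Y -` A \<inter> space M | A. A \<in> sets borel} {?\<Delta> -` A \<inter> space M | A. A \<in> sets borel}"
    unfolding indep_sets2_eq using YF by (meson subset_trans subsetD)
  then have "indep_var borel Y borel ?\<Delta>"
    unfolding indep_var_eq using YM increment_moments(1)[OF t]
    by (intro conjI indep_set_sigma_sets st)
  from indep_var_lebesgue_integral[OF this Y(2) increment_moments(2)[OF t]] show ?thesis
    using increment_moments(3)[OF t] by simp
qed

text \<open>N is given as an almost sure sum of a series. Uncorrelated increments make the partial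
  sums Cauchy in L2, with rate t times the tail of the series of (c k)^2, so second moments and
  correlations with the past pass to the limit.\<close>

lemma noise_moments:
  assumes t: "0 < t" and c: "summable (\<lambda>k. (c k)^2)" and Nm: "N \<in> borel_measurable M"
    and sums: "AE w in M. (\<lambda>k. c k * (\<beta> k t w - \<beta> k 0 w)) sums N w"
  shows "integrable M (\<lambda>w. (N w)^2)" "expectation (\<lambda>w. (N w)^2) = t * (\<Sum>k. (c k)^2)"
    "Y \<in> borel_measurable (F 0) \<Longrightarrow> integrable M (\<lambda>w. (Y w)^2) \<Longrightarrow> expectation (\<lambda>w. Y w * N w) = 0"
proof -
  let ?\<Delta> = "\<lambda>k w. \<beta> k t w - \<beta> k 0 w"
  define S where "S J w = (\<Sum>k\<in>J. c k * ?\<Delta> k w)" for J w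
  note \<Delta> = increment_moments[OF t]
  have Sm: "S J \<in> borel_measurable M" for J
    unfolding S_def[abs_def] by (intro borel_measurable_sum borel_measurable_times borel_measurable_const \<Delta>)
  have \<Delta>\<Delta>: "integrable M (\<lambda>w. ?\<Delta> j w * ?\<Delta> k w)" for j k
    by (rule cauchy_schwarz_integral(1)[OF \<Delta>(1) \<Delta>(1) \<Delta>(4) \<Delta>(4)])
  have corr: "expectation (\<lambda>w. ?\<Delta> j w * ?\<Delta> k w) = (if j = k then t else 0)" for j k
    using increment_uncorrelated[OF t, of j k] \<Delta>(5)[of k] by (simp add: power2_eq_square)
  have sq: "(S J w)^2 = (\<Sum>j\<in>J. \<Sum>k\<in>J. (c j * c k) * (?\<Delta> j w * ?\<Delta> k w))" for J w
    unfolding power2_eq_square S_def sum_product by (intro sum.cong refl) (simp only: mult_ac)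
  have S2: "integrable M (\<lambda>w. (S J w)^2)" for J
    unfolding sq by (intro integrable_sum integrable_mult_right \<Delta>\<Delta>)
  have ES2: "expectation (\<lambda>w. (S J w)^2) = t * (\<Sum>k\<in>J. (c k)^2)" if "finite J" for J
  proof -
    have "expectation (\<lambda>w. (S J w)^2) = (\<Sum>j\<in>J. \<Sum>k\<in>J. (c j * c k) * (if j = k then t else 0))"
      unfolding sq using \<Delta>\<Delta> by (simp add: integral_sum corr)
    also have "\<dots> = (\<Sum>j\<in>J. t * (c j)^2)" using that by (intro sum.cong refl) (simp add: power2_eq_square if_distrib sum.delta cong: if_cong)
    finally show ?thesis by (simp add: sum_distrib_left)
  qed
  let ?r = "\<lambda>n. t * ((\<Sum>k. (c k)^2) - (\<Sum>k<n. (c k)^2))"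
  have lim: "AE w in M. (\<lambda>n. S {..<n} w) \<longlonglongrightarrow> N w" using sums unfolding S_def sums_def .
  have cl: "(\<lambda>n. \<Sum>k<n. (c k)^2) \<longlonglongrightarrow> (\<Sum>k. (c k)^2)" by (rule summable_LIMSEQ[OF c])
  have "?r \<longlonglongrightarrow> t * ((\<Sum>k. (c k)^2) - (\<Sum>k. (c k)^2))" by (intro tendsto_intros cl)
  then have r: "?r \<longlonglongrightarrow> 0" by simp
  have "expectation (\<lambda>w. (S {..<m} w - S {..<n} w)^2) \<le> ?r n" if "n \<le> m" for m n
  proof -
    have split: "{..<m} = {..<n} \<union> {n..<m}" "{..<n} \<inter> {n..<m} = {}" using that by auto
    have diff: "(\<Sum>k<m. f k) - (\<Sum>k<n. f k) = (\<Sum>k\<in>{n..<m}. f k)" for f :: "nat \<Rightarrow> real"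
      unfolding split(1) by (subst sum.union_disjoint) (use split(2) in auto)
    have "expectation (\<lambda>w. (S {..<m} w - S {..<n} w)^2) = t * ((\<Sum>k<m. (c k)^2) - (\<Sum>k<n. (c k)^2))"
      using ES2[of "{n..<m}"] unfolding diff S_def by simp
    also have "\<dots> \<le> ?r n" using sum_le_suminf[OF c, of "{..<m}"] t by (intro mult_left_mono) auto
    finally show ?thesis .
  qed
  then have cauchy: "\<forall>n. \<forall>m\<ge>n. expectation (\<lambda>w. (S {..<m} w - S {..<n} w)^2) \<le> ?r n" by blast
  note L = L2_limit[OF Sm S2 Nm lim cauchy r]
  show "integrable M (\<lambda>w. (N w)^2)" by (rule L(1))
  have "(\<lambda>n. t * (\<Sum>k<n. (c k)^2)) \<longlonglongrightarrow> expectation (\<lambda>w. (N w)^2)" using L(2) by (simp add: ES2)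
  with tendsto_mult_left[OF cl, of t] show "expectation (\<lambda>w. (N w)^2) = t * (\<Sum>k. (c k)^2)" using LIMSEQ_unique by blast
  assume Y: "Y \<in> borel_measurable (F 0)" "integrable M (\<lambda>w. (Y w)^2)"
  have YM: "Y \<in> borel_measurable M" by (rule measurable_from_subalg[OF sub Y(1)]) simp
  have Y1: "integrable M Y" by (rule square_integrable_imp_integrable[OF YM Y(2)])
  have "expectation (\<lambda>w. Y w * S {..<n} w) = 0" for n
  proof -
    have i: "integrable M (\<lambda>w. c k * (Y w * ?\<Delta> k w))" for k
      by (intro integrable_mult_right cauchy_schwarz_integral(1)[OF YM \<Delta>(1) Y(2) \<Delta>(4)])
    have "(\<lambda>w. Y w * S {..<n} w) = (\<lambda>w. \<Sum>k<n. c k * (Y w * ?\<Delta> k w))"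
      unfolding S_def by (simp add: sum_distrib_left mult_ac)
    then show ?thesis using i by (simp add: integral_sum increment_independent_past[OF t Y(1) Y1])
  qed
  then show "expectation (\<lambda>w. Y w * N w) = 0" using L(3)[OF YM Y(2)] LIMSEQ_unique[OF tendsto_const] by fastforce
qed

end

section \<open>Energy balance for a single test function\<close>

lemma (in complete_measure) borel_measurable_AE_eq:
  fixes f g :: "'a \<Rightarrow> 'b::topological_space"
  assumes "f \<in> borel_measurable M" "AE x in M. f x = g x" shows "g \<in> borel_measurable M"
proof (rule measurableI)
  fix A :: "'b set" assume "A \<in> sets borel"
  then have f: "f -` A \<inter> space M \<in> sets M" using assms(1) by (rule measurable_sets[rotated])
  have "AE x in M. x \<in> f -` A \<inter> space M \<longleftrightarrow> x \<in> g -` A \<inter> space M" using assms(2) by eventually_elim auto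
  from in_sets_AE[OF this f] show "g -` A \<inter> space M \<in> sets M" by simp
qed simp

text \<open>The weak formulation integrates over time with respect to \<open>lebesgue_on\<close>,
  while joint measurability and Fubini are used over \<open>lborel\<close>; this mediates between
  the two.\<close>

lemma lebesgue_on_eq_lborel:
  fixes f :: "'a::euclidean_space \<Rightarrow> real"
  assumes S: "S \<in> sets borel" and f: "f \<in> borel_measurable (restrict_space lborel S)"
  shows "f \<in> borel_measurable (lebesgue_on S)" "(LINT x|lebesgue_on S. f x) = (LINT x|restrict_space lborel S. f x)"
    "integrable (restrict_space lborel S) f \<Longrightarrow> integrable (lebesgue_on S) f"
proof -
  have f': "(\<lambda>x. indicator S x *\<^sub>R f x) \<in> borel_measurable lborel"
    using f S by (subst (asm) borel_measurable_restrict_space_iff) auto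
  show "f \<in> borel_measurable (lebesgue_on S)"
    using measurable_completion[OF f'] S by (subst borel_measurable_restrict_space_iff) auto
  show "(LINT x|lebesgue_on S. f x) = (LINT x|restrict_space lborel S. f x)"
    using integral_completion[OF f'] S by (simp add: integral_restrict_space)
  assume "integrable (restrict_space lborel S) f"
  then show "integrable (lebesgue_on S) f"
    using integrable_completion[OF f'] S by (simp add: integrable_restrict_space set_integrable_def)
qed

lemma AE_lebesgue_on_lborel:
  fixes S :: "'a::euclidean_space set"
  assumes S: "S \<in> sets borel" and P: "AE x in lebesgue_on S. P x" shows "AE x in restrict_space lborel S. P x"
  using P S by (simp add: AE_restrict_space_iff AE_completion_iff)

lemma (in usual_filtration) complete_M: "complete_measure M"
proof
  fix A B assume "B \<subseteq> A" "A \<in> null_sets M"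
  then have "B \<in> sets (F 0)" using complete by blast
  moreover have "subalgebra M (F 0)" by (rule sub) simp
  ultimately show "B \<in> sets M" by (auto simp: subalgebra_def)
qed

locale stationary_nse = stationary_martingale_solution M F \<beta> \<nu> \<sigma> e u
  for M :: "'w measure" and F \<beta> \<nu> \<sigma> e u +
  assumes \<nu>: "\<nu> > 0"
    and forcing: "stokes_forcing \<sigma> e"
    and energy: "energy_inequality M \<nu> \<sigma> u"
    and moments: "finite_moments M u"
begin

section \<open>One-time laws and moments of the solution\<close>

lemma u_measurable_F: assumes "0 \<le> t" shows "u t \<in> measurable (F t) L2_div_borel"
  using measurable_compose[OF measurable_Pair1'[of t] progressive[OF assms]] assms by (simp add: space_restrict_space)

lemma u_measurable: assumes "0 \<le> t" shows "u t \<in> measurable M L2_div_borel"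
  by (rule measurable_from_subalg[OF sub[OF assms] u_measurable_F[OF assms]])

lemma u_L2_div: assumes "0 \<le> t" "w \<in> space M" shows "u t w \<in> L2_div"
  using measurable_space[OF u_measurable[OF assms(1)] assms(2)] by simp

lemma u_joint:
  assumes "0 \<le> T"
  shows "(\<lambda>(t, w). u t w) \<in> measurable (restrict_space borel {0..T} \<Otimes>\<^sub>M M) L2_div_borel"
proof -
  have "(\<lambda>x. x) \<in> measurable M (F T)" by (rule measurable_from_subalg[OF sub[OF assms]]) simp
  then have "(\<lambda>z. (fst z, snd z)) \<in> measurable (restrict_space (borel :: real measure) {0..T} \<Otimes>\<^sub>M M) (restrict_space borel {0..T} \<Otimes>\<^sub>M F T)"
    by (intro measurable_Pair measurable_fst measurable_compose[OF measurable_snd])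
  from measurable_compose[OF this progressive[OF assms]] show ?thesis by (simp add: case_prod_beta')
qed

lemma u_distr: assumes t: "0 \<le> t" shows "distr M L2_div_borel (u t) = distr M L2_div_borel (u 0)"
proof -
  let ?P = "PiM {0::real..} (\<lambda>_. L2_div_borel)"
  have c: "(\<lambda>p. p 0) \<in> measurable ?P L2_div_borel" by (rule measurable_component_singleton) simp
  have m: "(\<lambda>w. \<lambda>s\<in>{0..}. u (s + \<tau>) w) \<in> measurable M ?P" if "0 \<le> \<tau>" for \<tau>
    by (rule measurable_restrict) (use that in \<open>auto intro: u_measurable\<close>)
  have "distr M L2_div_borel (u \<tau>) = distr (distr M ?P (\<lambda>w. \<lambda>s\<in>{0..}. u (s + \<tau>) w)) L2_div_borel (\<lambda>p. p 0)" if "0 \<le> \<tau>" for \<tau>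
    by (subst distr_distr[OF c m[OF that]]) (simp add: comp_def)
  from this[OF t] this[of 0] stationary[OF t] stationary[of 0] show ?thesis by simp
qed

lemma u_integral:
  fixes \<Psi> :: "(real^3 \<Rightarrow> real^3) \<Rightarrow> real"
  assumes "0 \<le> t" "\<Psi> \<in> borel_measurable L2_div_borel"
  shows "expectation (\<lambda>w. \<Psi> (u t w)) = expectation (\<lambda>w. \<Psi> (u 0 w))"
    "integrable M (\<lambda>w. \<Psi> (u t w)) \<longleftrightarrow> integrable M (\<lambda>w. \<Psi> (u 0 w))"
  using integral_distr[OF u_measurable[OF assms(1)] assms(2)] integral_distr[OF u_measurable[of 0] assms(2)]
    integrable_distr_eq[OF u_measurable[OF assms(1)] assms(2)] integrable_distr_eq[OF u_measurable[of 0] assms(2)]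
    u_distr[OF assms(1)] by simp_all

lemma u_nn_integral:
  assumes "0 \<le> t" "\<Psi> \<in> borel_measurable L2_div_borel"
  shows "(\<integral>\<^sup>+w. \<Psi> (u t w) \<partial>M) = (\<integral>\<^sup>+w. \<Psi> (u 0 w) \<partial>M)"
  using nn_integral_distr[OF u_measurable[OF assms(1)], of \<Psi>] nn_integral_distr[OF u_measurable[of 0], of \<Psi>] assms(2)
    u_distr[OF assms(1)] by simp

lemma unit_interval: "prob_space (restrict_space lborel {0..1::real})"
  by (rule prob_spaceI) (simp add: emeasure_restrict_space space_restrict_space)

lemma u_joint_lborel: "(\<lambda>z. u (fst z) (snd z)) \<in> measurable (restrict_space lborel {0..1} \<Otimes>\<^sub>M M) L2_div_borel"
proof -
  have "sets (restrict_space lborel {0..1::real}) = sets (restrict_space borel {0..1})" by (rule sets_restrict_space_cong) simp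
  from measurable_cong_sets[OF sets_pair_measure_cong[OF this refl, of M] refl, of L2_div_borel]
  show ?thesis using u_joint[of 1] by (simp add: case_prod_beta')
qed

lemma u_paths: assumes "0 \<le> T" shows "AE w in M. in_Linf_L2 T (\<lambda>t. u t w) \<and> in_L2_H1 T (\<lambda>t. u t w)"
  using paths[OF assms] by auto

text \<open>Paths are in L2(0,1; H1), so at almost every time the field is in H1 almost surely. One
  such time is enough: all one-time laws agree and \<open>H1_div\<close> is measurable.\<close>

lemma u_H1: assumes t: "0 \<le> t" shows "AE w in M. u t w \<in> H1_div"
proof -
  let ?\<Lambda> = "restrict_space lborel {0..1::real}"
  interpret L: prob_space ?\<Lambda> by (rule unit_interval)
  interpret P: pair_sigma_finite ?\<Lambda> M ..
  have "AE w in M. AE s in ?\<Lambda>. u s w \<in> H1_div"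
    using u_paths[OF zero_le_one] by eventually_elim (auto simp: in_L2_H1_def intro: AE_lebesgue_on_lborel)
  moreover have "{z \<in> space (?\<Lambda> \<Otimes>\<^sub>M M). u (fst z) (snd z) \<in> H1_div} \<in> sets (?\<Lambda> \<Otimes>\<^sub>M M)"
    using measurable_sets[OF u_joint_lborel H1_div_sets] by (simp add: vimage_def Int_def conj_commute)
  ultimately have "AE s in ?\<Lambda>. AE w in M. u s w \<in> H1_div" by (subst P.AE_commute) auto
  then have "AE s in ?\<Lambda>. s \<in> space ?\<Lambda> \<and> (AE w in M. u s w \<in> H1_div)" using AE_space by eventually_elim simp
  then obtain s where s: "0 \<le> s" "AE w in M. u s w \<in> H1_div"
    using eventually_happens'[OF L.ae_filter_bot] by (fastforce simp: space_restrict_space)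
  have ev: "(AE w in M. u r w \<in> H1_div) \<longleftrightarrow> (AE f in distr M L2_div_borel (u r). f \<in> H1_div)" if "0 \<le> r" for r
    using sets.Int[OF sets.top H1_div_sets] by (subst AE_distr_iff[OF u_measurable[OF that]]) (auto simp: Collect_conj_eq)
  show ?thesis using s(2) unfolding ev[OF t] ev[OF s(1)] u_distr[OF t] u_distr[OF s(1)] .
qed

text \<open>The essential supremum controls almost every time only. Averaging over [0, 1] and using
  that the law does not depend on time gives the bound at each time.\<close>

lemma u_fourth_moment: assumes t: "0 \<le> t" shows "integrable M (\<lambda>w. L2_norm (u t w) ^ 4)"
proof -
  let ?\<Lambda> = "restrict_space lborel {0..1::real}"
  interpret L: prob_space ?\<Lambda> by (rule unit_interval)
  interpret P: pair_sigma_finite ?\<Lambda> M ..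
  have spL: "space ?\<Lambda> = {0..1}" by (simp add: space_restrict_space)
  let ?E = "\<lambda>w. real_of_ereal (esssup_L2 1 (\<lambda>t. u t w))"
  have AE: "AE w in M. (\<integral>\<^sup>+s. ennreal (L2_norm (u s w) ^ 4) \<partial>?\<Lambda>) \<le> ennreal (?E w powr 4)"
    using u_paths[OF zero_le_one]
  proof eventually_elim
    fix w assume "in_Linf_L2 1 (\<lambda>t. u t w) \<and> in_L2_H1 1 (\<lambda>t. u t w)"
    then have fin: "esssup_L2 1 (\<lambda>t. u t w) < \<infinity>" by (simp add: in_Linf_L2_def)
    have "AE s in lebesgue_on {0..1}. ereal (L2_norm (u s w)) \<le> esssup_L2 1 (\<lambda>t. u t w)"
      unfolding esssup_L2_def by (rule esssup_AE)
    then have "AE s in ?\<Lambda>. ereal (L2_norm (u s w)) \<le> esssup_L2 1 (\<lambda>t. u t w)" by (intro AE_lebesgue_on_lborel) auto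
    then have "AE s in ?\<Lambda>. ennreal (L2_norm (u s w) ^ 4) \<le> ennreal (?E w powr 4)"
    proof eventually_elim
      fix s assume le: "ereal (L2_norm (u s w)) \<le> esssup_L2 1 (\<lambda>t. u t w)"
      then have "L2_norm (u s w) \<le> ?E w" using fin by (cases "esssup_L2 1 (\<lambda>t. u t w)") auto
      then have "L2_norm (u s w) ^ 4 \<le> ?E w ^ 4" and "0 \<le> ?E w"
        using L2_norm_nonneg[of "u s w"] order_trans by (auto intro: power_mono simp del: L2_norm_nonneg)
      then show "ennreal (L2_norm (u s w) ^ 4) \<le> ennreal (?E w powr 4)" by (intro ennreal_leI) simp
    qed
    then have "(\<integral>\<^sup>+s. ennreal (L2_norm (u s w) ^ 4) \<partial>?\<Lambda>) \<le> (\<integral>\<^sup>+s. ennreal (?E w powr 4) \<partial>?\<Lambda>)"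
      by (rule nn_integral_mono_AE)
    then show "(\<integral>\<^sup>+s. ennreal (L2_norm (u s w) ^ 4) \<partial>?\<Lambda>) \<le> ennreal (?E w powr 4)" using L.emeasure_space_1 by (simp add: spL)
  qed
  have m4: "(\<lambda>f. ennreal (L2_norm f ^ 4)) \<in> borel_measurable L2_div_borel" by measurable
  have "(\<integral>\<^sup>+w. ennreal (L2_norm (u 0 w) ^ 4) \<partial>M) = (\<integral>\<^sup>+s. \<integral>\<^sup>+w. ennreal (L2_norm (u 0 w) ^ 4) \<partial>M \<partial>?\<Lambda>)"
    using L.emeasure_space_1 by (simp add: spL)
  also have "\<dots> = (\<integral>\<^sup>+s. \<integral>\<^sup>+w. ennreal (L2_norm (u s w) ^ 4) \<partial>M \<partial>?\<Lambda>)"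
    by (rule nn_integral_cong, rule u_nn_integral[OF _ m4, symmetric]) (simp add: spL)
  also have "\<dots> = (\<integral>\<^sup>+w. \<integral>\<^sup>+s. ennreal (L2_norm (u s w) ^ 4) \<partial>?\<Lambda> \<partial>M)"
    using P.Fubini'[of "\<lambda>s w. ennreal (L2_norm (u s w) ^ 4)"] measurable_compose[OF u_joint_lborel m4] by (simp add: case_prod_beta')
  also have "\<dots> \<le> (\<integral>\<^sup>+w. ennreal (?E w powr 4) \<partial>M)" by (rule nn_integral_mono_AE[OF AE])
  also have "\<dots> < \<infinity>" using moments by (auto simp: finite_moments_def)
  finally have fin: "(\<integral>\<^sup>+w. ennreal (L2_norm (u t w) ^ 4) \<partial>M) < \<infinity>" by (simp add: u_nn_integral[OF t m4])
  have "(\<lambda>w. L2_norm (u t w) ^ 4) \<in> borel_measurable M"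
    using measurable_compose[OF u_measurable[OF t] measurable_L2_norm] by measurable
  then show ?thesis using fin by (intro integrableI_bounded) auto
qed

end

text \<open>The observables of the solution whose squares are integrable thanks to the fourth moment
  of the L2 norm; pairings with L2 fields and the drift are both of this kind.\<close>

definition quadratic_growth :: "((real^3 \<Rightarrow> real^3) \<Rightarrow> real) \<Rightarrow> bool" where
  "quadratic_growth \<Psi> \<longleftrightarrow> \<Psi> \<in> borel_measurable L2_div_borel \<and> (\<exists>C. \<forall>f\<in>L2_div. \<bar>\<Psi> f\<bar> \<le> C * (1 + (L2_norm f)^2))"

lemma quadratic_growth_measurable: "quadratic_growth \<Psi> \<Longrightarrow> \<Psi> \<in> borel_measurable L2_div_borel"
  by (simp add: quadratic_growth_def)

lemma quadratic_growth_inner: assumes "\<psi> \<in> L2" shows "quadratic_growth (\<lambda>f. L2_inner f \<psi>)"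
  unfolding quadratic_growth_def
proof (intro conjI exI ballI measurable_L2_inner assms)
  fix f assume "f \<in> L2_div"
  then have "\<bar>L2_inner f \<psi>\<bar> \<le> L2_norm f * L2_norm \<psi>" by (intro L2_cs(2) assms L2_divD)
  also have "\<dots> \<le> (1 + (L2_norm f)^2) * L2_norm \<psi>"
    by (intro mult_right_mono L2_norm_nonneg le_one_add_sq)
  finally show "\<bar>L2_inner f \<psi>\<bar> \<le> L2_norm \<psi> * (1 + (L2_norm f)^2)" by (simp add: mult.commute)
qed

lemma quadratic_growth_drift: assumes "smooth \<phi>" "periodic \<phi>" shows "quadratic_growth (drift \<nu> \<phi>)"
  using measurable_drift[OF assms] drift_bound[OF assms] L2_divD unfolding quadratic_growth_def by blast

context stationary_nse
begin

lemma quadratic_growth_square_integrable: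
  assumes \<Psi>: "quadratic_growth \<Psi>" and s: "0 \<le> s" shows "integrable M (\<lambda>w. (\<Psi> (u s w))^2)"
proof -
  obtain C where C: "\<And>f. f \<in> L2_div \<Longrightarrow> \<bar>\<Psi> f\<bar> \<le> C * (1 + (L2_norm f)^2)" using \<Psi> by (auto simp: quadratic_growth_def)
  have i: "integrable M (\<lambda>w. 2 * C^2 * (1 + L2_norm (u s w) ^ 4))" using u_fourth_moment[OF s] by simp
  show ?thesis
  proof (rule integrable_bound[OF i])
    show "(\<lambda>w. (\<Psi> (u s w))^2) \<in> borel_measurable M"
      using measurable_compose[OF u_measurable[OF s] quadratic_growth_measurable[OF \<Psi>]] by measurable
    have "norm ((\<Psi> (u s w))^2) \<le> norm (2 * C^2 * (1 + L2_norm (u s w) ^ 4))" if w: "w \<in> space M" for w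
    proof -
      let ?n = "L2_norm (u s w)"
      have "(\<Psi> (u s w))^2 \<le> (C * (1 + ?n^2))^2" using power_mono[OF C[OF u_L2_div[OF s w]], of 2] by simp
      also have "\<dots> = C^2 * (1 + ?n^2)^2" by (simp add: power_mult_distrib)
      also have "\<dots> \<le> C^2 * (2 * (1 + ?n ^ 4))"
        using zero_le_power2[of "?n^2 - 1"] by (intro mult_left_mono) (simp_all add: power2_sum power2_diff flip: power_mult)
      finally show ?thesis by (simp add: algebra_simps)
    qed
    then show "AE w in M. norm ((\<Psi> (u s w))^2) \<le> norm (2 * C^2 * (1 + L2_norm (u s w) ^ 4))" by (rule AE_I2)
  qed
qed

lemma quadratic_growth_joint:
  assumes \<Psi>: "quadratic_growth \<Psi>" and T: "0 \<le> T"
  shows "(\<lambda>(s, w). \<Psi> (u s w)) \<in> borel_measurable (restrict_space borel {0..T} \<Otimes>\<^sub>M M)"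
  using measurable_compose[OF u_joint[OF T] quadratic_growth_measurable[OF \<Psi>]] by (simp add: case_prod_beta')

lemma quadratic_growth_time:
  assumes \<Psi>: "quadratic_growth \<Psi>" and T: "0 \<le> T"
  shows "AE w in M. integrable (restrict_space lborel {0..T}) (\<lambda>s. \<Psi> (u s w))"
    "(\<lambda>w. LINT s|restrict_space lborel {0..T}. \<Psi> (u s w)) \<in> borel_measurable M"
proof -
  have m: "(\<lambda>f. (\<Psi> f)^2) \<in> borel_measurable L2_div_borel" using quadratic_growth_measurable[OF \<Psi>] by measurable
  have "\<forall>s\<in>{0..T}. integrable M (\<lambda>w. (\<Psi> (u s w))^2) \<and> expectation (\<lambda>w. (\<Psi> (u s w))^2) = expectation (\<lambda>w. (\<Psi> (u 0 w))^2)"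
    by (intro ballI conjI quadratic_growth_square_integrable[OF \<Psi>] u_integral(1)[OF _ m]) auto
  from time_average(7,4)[OF T quadratic_growth_joint[OF \<Psi> T] this]
  show "AE w in M. integrable (restrict_space lborel {0..T}) (\<lambda>s. \<Psi> (u s w))"
    "(\<lambda>w. LINT s|restrict_space lborel {0..T}. \<Psi> (u s w)) \<in> borel_measurable M" by auto
qed

text \<open>Rewrites the weak formulation with \<open>drift\<close>, which is a measurable function
  of the field, in place of the chosen \<open>weak_grad\<close>.\<close>

lemma weak_balance:
  assumes t: "0 \<le> t" and \<phi>: "\<phi> \<in> C_inf_div"
  shows "AE w in M. (\<lambda>k. L2_inner (\<lambda>x. \<sigma> k *\<^sub>R e k x) \<phi> * (\<beta> k t w - \<beta> k 0 w)) sums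
    (L2_inner (u t w) \<phi> - L2_inner (u 0 w) \<phi> - (LINT s|restrict_space lborel {0..t}. drift \<nu> \<phi> (u s w)))"
proof -
  note D = C_inf_divD[OF \<phi>]
  have qa: "quadratic_growth (\<lambda>f. L2_inner f (laplacian \<phi>))" by (rule quadratic_growth_inner[OF L2_laplacian[OF D(1,2)]])
  have qd: "quadratic_growth (drift 0 \<phi>)" by (rule quadratic_growth_drift[OF D(1,2)])
  let ?\<Lambda> = "restrict_space lborel {0..t}"
  have S: "{0..t} \<in> sets borel" by simp
  interpret C: complete_measure "lebesgue_on {0..t}" by (rule complete_lebesgue_on) simp
  show ?thesis
    using u_paths[OF t] weak_form[OF t \<phi>] quadratic_growth_time(1)[OF qa t] quadratic_growth_time(1)[OF qd t] AE_space
  proof eventually_elim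
    fix w
    assume "in_Linf_L2 t (\<lambda>t. u t w) \<and> in_L2_H1 t (\<lambda>t. u t w)"
    then have H1: "AE s in lebesgue_on {0..t}. u s w \<in> H1_div" by (simp add: in_L2_H1_def)
    assume "\<exists>N. (\<lambda>k. L2_inner (\<lambda>x. \<sigma> k *\<^sub>R e k x) \<phi> * (\<beta> k t w - \<beta> k 0 w)) sums N \<and>
        L2_inner (u t w) \<phi>
          + \<nu> * (LINT s|lebesgue_on {0..t}. L2_inner (weak_grad (u s w)) (grad \<phi>))
          + (LINT s|lebesgue_on {0..t}. L2_inner (\<lambda>x. weak_grad (u s w) x *v u s w x) \<phi>)
        = L2_inner (u 0 w) \<phi> + N" (is "\<exists>N. ?S N \<and> ?E N")
    then obtain N where N: "?S N" "?E N" by blast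
    assume ia: "integrable ?\<Lambda> (\<lambda>s. L2_inner (u s w) (laplacian \<phi>))" and id: "integrable ?\<Lambda> (\<lambda>s. drift 0 \<phi> (u s w))"
      and w: "w \<in> space M"
    \<comment> \<open>The integrand g contains the choice \<open>weak_grad\<close>; its
      measurability in time comes from agreeing almost everywhere with the measurable -f, by
      completeness of \<open>lebesgue_on\<close>.\<close>
    have swap: "(LINT s|lebesgue_on {0..t}. g s) = - (LINT s|?\<Lambda>. f s)"
      if f: "integrable ?\<Lambda> f" and fg: "AE s in lebesgue_on {0..t}. g s = - f s" for f g :: "real \<Rightarrow> real"
    proof -
      note m = lebesgue_on_eq_lborel[OF S borel_measurable_integrable[OF f]]
      have "(LINT s|lebesgue_on {0..t}. g s) = (LINT s|lebesgue_on {0..t}. - f s)"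
      proof (rule integral_cong_AE[OF _ _ fg])
        show "(\<lambda>s. - f s) \<in> borel_measurable (lebesgue_on {0..t})" using m(1) by measurable
        then show "g \<in> borel_measurable (lebesgue_on {0..t})"
          by (rule C.borel_measurable_AE_eq) (use fg in \<open>eventually_elim, simp\<close>)
      qed
      then show ?thesis using m(2) by simp
    qed
    have a: "(LINT s|lebesgue_on {0..t}. L2_inner (weak_grad (u s w)) (grad \<phi>)) = - (LINT s|?\<Lambda>. L2_inner (u s w) (laplacian \<phi>))"
    proof (rule swap[OF ia])
      show "AE s in lebesgue_on {0..t}. L2_inner (weak_grad (u s w)) (grad \<phi>) = - L2_inner (u s w) (laplacian \<phi>)"
        using H1
      proof eventually_elim
        fix s assume h: "u s w \<in> H1_div"
        then have "u s w \<in> L2" by (simp add: H1_div_def)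
        then show "L2_inner (weak_grad (u s w)) (grad \<phi>) = - L2_inner (u s w) (laplacian \<phi>)"
          using weak_grad_inner_smooth[OF H1_weak_grad[OF h] D(1,2)] by (simp add: L2_inner_def)
      qed
    qed
    have d: "(LINT s|lebesgue_on {0..t}. L2_inner (\<lambda>x. weak_grad (u s w) x *v u s w x) \<phi>) = - (LINT s|?\<Lambda>. drift 0 \<phi> (u s w))"
    proof (rule swap[OF id])
      show "AE s in lebesgue_on {0..t}. L2_inner (\<lambda>x. weak_grad (u s w) x *v u s w x) \<phi> = - drift 0 \<phi> (u s w)"
        using H1
      proof eventually_elim
        fix s assume h: "u s w \<in> H1_div"
        then have "u s w \<in> L2_div" using H1_approxD(6) unfolding H1_div_iff by blast
        then show "L2_inner (\<lambda>x. weak_grad (u s w) x *v u s w x) \<phi> = - drift 0 \<phi> (u s w)"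
          using weak_grad_advect[OF _ H1_weak_grad[OF h] D(1,2)] by (simp add: L2_inner_def drift_def)
      qed
    qed
    have "(LINT s|?\<Lambda>. drift \<nu> \<phi> (u s w)) = \<nu> * (LINT s|?\<Lambda>. L2_inner (u s w) (laplacian \<phi>)) + (LINT s|?\<Lambda>. drift 0 \<phi> (u s w))"
    proof -
      have "drift \<nu> \<phi> f = \<nu> * L2_inner f (laplacian \<phi>) + drift 0 \<phi> f" for f by (simp add: drift_def)
      then show ?thesis using ia id by simp
    qed
    with N a d have "N = L2_inner (u t w) \<phi> - L2_inner (u 0 w) \<phi> - (LINT s|?\<Lambda>. drift \<nu> \<phi> (u s w))"
      by (simp add: algebra_simps)
    then show "(\<lambda>k. L2_inner (\<lambda>x. \<sigma> k *\<^sub>R e k x) \<phi> * (\<beta> k t w - \<beta> k 0 w)) sums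
      (L2_inner (u t w) \<phi> - L2_inner (u 0 w) \<phi> - (LINT s|?\<Lambda>. drift \<nu> \<phi> (u s w)))" using N(1) by simp
  qed
qed

lemma e_props: "e k \<in> C_inf_div" "e k \<in> L2" "L2_norm (e k) = 1" "summable (\<lambda>k. (\<sigma> k)^2)"
proof -
  show c: "e k \<in> C_inf_div" and "summable (\<lambda>k. (\<sigma> k)^2)"
    using forcing by (auto simp: stokes_forcing_def stokes_eigenfunction_def)
  show "e k \<in> L2" by (rule C_inf_divD[OF c])
  have "L2_inner (e k) (e k) = 1" using forcing by (simp add: stokes_forcing_def)
  then show "L2_norm (e k) = 1" by (simp add: L2_norm_def L2_inner_def power2_norm_eq_inner)
qed

lemma L2_inner_scaleR_left: "L2_inner (\<lambda>x. c *\<^sub>R f x) g = c * L2_inner f g"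
  by (simp add: L2_inner_def)

lemma summable_forcing_inner: assumes "\<phi> \<in> L2" shows "summable (\<lambda>k. (\<sigma> k * L2_inner (e k) \<phi>)^2)"
proof (rule summable_comparison_test'[OF summable_mult2[OF e_props(4), of "(L2_norm \<phi>)^2"]])
  fix k
  have "(L2_inner (e k) \<phi>)^2 \<le> (L2_norm \<phi>)^2"
    using power_mono[OF L2_cs(2)[OF e_props(2)[of k] assms], of 2] by (simp add: e_props(3))
  then show "norm ((\<sigma> k * L2_inner (e k) \<phi>)^2) \<le> (\<sigma> k)^2 * (L2_norm \<phi>)^2"
    by (simp add: power_mult_distrib mult_left_mono)
qed

text \<open>\<open>stationary_balance\<close> for X = (u, \<phi>), with b the drift and \<gamma> the
  variance of the noise per unit time.\<close>

theorem test_function_balance: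
  assumes \<phi>: "\<phi> \<in> C_inf_div" and t: "0 \<le> t"
  shows "2 * expectation (\<lambda>w. L2_inner (u t w) \<phi> * drift \<nu> \<phi> (u t w)) + (\<Sum>k. (\<sigma> k * L2_inner (e k) \<phi>)^2) = 0"
proof -
  note D = C_inf_divD[OF \<phi>]
  have qX: "quadratic_growth (\<lambda>f. L2_inner f \<phi>)" by (rule quadratic_growth_inner[OF D(5)])
  have qb: "quadratic_growth (drift \<nu> \<phi>)" by (rule quadratic_growth_drift[OF D(1,2)])
  note mX = quadratic_growth_measurable[OF qX] and mb = quadratic_growth_measurable[OF qb]
  have mX2: "(\<lambda>f. (L2_inner f \<phi>)^2) \<in> borel_measurable L2_div_borel" and mb2: "(\<lambda>f. (drift \<nu> \<phi> f)^2) \<in> borel_measurable L2_div_borel"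
    and mXb: "(\<lambda>f. L2_inner f \<phi> * drift \<nu> \<phi> f) \<in> borel_measurable L2_div_borel" using mX mb by measurable
  \<comment> \<open>Defined by the equation rather than by the series, so that it is measurable and
    the increment identity holds everywhere; that it is the sum of the series holds almost
    surely.\<close>
  define N where "N s w = L2_inner (u s w) \<phi> - L2_inner (u 0 w) \<phi> - (LINT r|restrict_space lborel {0..s}. drift \<nu> \<phi> (u r w))" for s w
  have Nm: "N s \<in> borel_measurable M" if "0 \<le> s" for s
    unfolding N_def[abs_def] using that
    by (intro borel_measurable_diff quadratic_growth_time(2)[OF qb] measurable_compose[OF u_measurable mX]) auto
  have sums: "AE w in M. (\<lambda>k. (\<sigma> k * L2_inner (e k) \<phi>) * (\<beta> k s w - \<beta> k 0 w)) sums N s w" if "0 \<le> s" for s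
    using weak_balance[OF that \<phi>] by (simp add: N_def L2_inner_scaleR_left)
  have Y: "(\<lambda>w. L2_inner (u 0 w) \<phi>) \<in> borel_measurable (F 0)" by (rule measurable_compose[OF u_measurable_F mX]) simp
  have "2 * expectation (\<lambda>w. L2_inner (u 0 w) \<phi> * drift \<nu> \<phi> (u 0 w)) + (\<Sum>k. (\<sigma> k * L2_inner (e k) \<phi>)^2) = 0"
  proof (rule stationary_balance[where X="\<lambda>s w. L2_inner (u s w) \<phi>" and b="\<lambda>s w. drift \<nu> \<phi> (u s w)" and N=N
        and A="expectation (\<lambda>w. (L2_inner (u 0 w) \<phi>)^2)" and B="expectation (\<lambda>w. (drift \<nu> \<phi> (u 0 w))^2)"])
    show "(\<lambda>(s, w). L2_inner (u s w) \<phi>) \<in> borel_measurable (restrict_space borel {0..1} \<Otimes>\<^sub>M M)"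
      "(\<lambda>(s, w). drift \<nu> \<phi> (u s w)) \<in> borel_measurable (restrict_space borel {0..1} \<Otimes>\<^sub>M M)"
      by (rule quadratic_growth_joint[OF qX] quadratic_growth_joint[OF qb]; simp)+
    fix s :: real
    show "AE w in M. L2_inner (u s w) \<phi> = L2_inner (u 0 w) \<phi> + (LINT r|restrict_space lborel {0..s}. drift \<nu> \<phi> (u r w)) + N s w"
      by (simp add: N_def)
    {
      assume "s \<in> {0..1}" then have s: "0 \<le> s" by simp
      show "integrable M (\<lambda>w. (L2_inner (u s w) \<phi>)^2)" "integrable M (\<lambda>w. (drift \<nu> \<phi> (u s w))^2)"
        by (rule quadratic_growth_square_integrable[OF qX s] quadratic_growth_square_integrable[OF qb s])+
      show "expectation (\<lambda>w. (L2_inner (u s w) \<phi>)^2) = expectation (\<lambda>w. (L2_inner (u 0 w) \<phi>)^2)"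
        "expectation (\<lambda>w. (drift \<nu> \<phi> (u s w))^2) = expectation (\<lambda>w. (drift \<nu> \<phi> (u 0 w))^2)"
        "expectation (\<lambda>w. L2_inner (u s w) \<phi> * drift \<nu> \<phi> (u s w)) = expectation (\<lambda>w. L2_inner (u 0 w) \<phi> * drift \<nu> \<phi> (u 0 w))"
        by (rule u_integral(1)[OF s mX2] u_integral(1)[OF s mb2] u_integral(1)[OF s mXb])+
    next
      assume s: "0 < s"
      note s' = less_imp_le[OF s]
      note noise = noise_moments[OF s summable_forcing_inner[OF D(5)] Nm[OF s'] sums[OF s']]
      show "N s \<in> borel_measurable M" by (rule Nm[OF s'])
      show "integrable M (\<lambda>w. (N s w)^2)" "expectation (\<lambda>w. (N s w)^2) = s * (\<Sum>k. (\<sigma> k * L2_inner (e k) \<phi>)^2)" by (rule noise)+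
      show "expectation (\<lambda>w. L2_inner (u 0 w) \<phi> * N s w) = 0"
        by (rule noise(3)[OF Y quadratic_growth_square_integrable[OF qX]]) simp
    }
  qed
  then show ?thesis using u_integral(1)[OF t mXb] by simp
qed

end

section \<open>The Karman--Howarth--Monin balance\<close>

definition wave :: "real^3 \<Rightarrow> 'b::real_normed_vector \<Rightarrow> 'b \<Rightarrow> real^3 \<Rightarrow> 'b" where
  "wave k a b x = cos (k \<bullet> x) *\<^sub>R a + sin (k \<bullet> x) *\<^sub>R b"

lemma wave_smooth: "smooth (wave k a b)"
  using smooth_wave[of k a b] by (simp add: wave_def[abs_def])

lemma pd_wave': "pd i (wave k a b) = wave k (k $ i *\<^sub>R b) (- (k $ i) *\<^sub>R a)"
  using pd_wave[of i k a b] by (simp add: wave_def[abs_def])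

lemma wave_periodic: assumes k: "int_vec k" shows "periodic (wave k a b)"
proof -
  have "cos (k \<bullet> x + k $ i * (2 * pi)) = cos (k \<bullet> x) \<and> sin (k \<bullet> x + k $ i * (2 * pi)) = sin (k \<bullet> x)" for x i
  proof -
    obtain n :: int where "k $ i = n" using k unfolding int_vec_def by (metis Ints_cases)
    then show ?thesis
      using cos_int_2pin[of n] sin_int_2pin[of n] by (simp add: cos_add sin_add mult.commute mult.left_commute)
  qed
  then show ?thesis by (simp add: periodic_def wave_def inner_add_right inner_axis)
qed

lemma laplacian_wave:
  fixes a b :: "'b::real_normed_vector"
  shows "laplacian (wave k a b) = (\<lambda>x. - (k \<bullet> k) *\<^sub>R wave k a b x)"
proof
  fix x
  have "laplacian (wave k a b) x = (\<Sum>i\<in>UNIV. - (k $ i * k $ i) *\<^sub>R wave k a b x)"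
    unfolding laplacian_def pd_wave' by (simp add: wave_def algebra_simps)
  also have "\<dots> = - (k \<bullet> k) *\<^sub>R wave k a b x"
    by (simp add: inner_vec_def sum_negf flip: scaleR_left.sum)
  finally show "laplacian (wave k a b) x = - (k \<bullet> k) *\<^sub>R wave k a b x" .
qed

lemma integral_nth:
  fixes f :: "'a \<Rightarrow> ('b::euclidean_space)^'n" assumes "integrable N f"
  shows "integral\<^sup>L N f $ i = (LINT x|N. f x $ i)"
  using integral_bounded_linear[OF bounded_linear_vec_nth assms] by simp

lemma wave_C_inf_div:
  fixes a b :: "real^3"
  assumes k: "int_vec k" "k \<noteq> 0" and ab: "k \<bullet> a = 0" "k \<bullet> b = 0"
  shows "wave k a b \<in> C_inf_div"
proof -
  obtain j where j: "k $ j \<noteq> 0" using k(2) by (metis vec_eq_iff zero_index)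
  have int: "integrable torus (wave k a b)"
    by (rule L2_integrable[OF L2_smooth[OF wave_smooth wave_periodic[OF k(1)]]])
  have "(LINT x|torus. wave k a b x) $ i = 0" for i
  proof -
    \<comment> \<open>An explicit antiderivative in a direction j with k_j different from 0, so that
      each component has mean zero.\<close>
    have "pd j (wave k (- (b $ i) / k $ j) (a $ i / k $ j)) = (\<lambda>x. wave k a b x $ i)"
      using j by (simp add: pd_wave' fun_eq_iff wave_def)
    then show ?thesis
      using integral_pd_eq_0[OF wave_smooth wave_periodic[OF k(1)], of j "- (b $ i) / k $ j" "a $ i / k $ j"]
      by (simp add: integral_nth[OF int])
  qed
  moreover have "divergence (wave k a b) x = 0" for x
  proof -
    have "divergence (wave k a b) x = cos (k \<bullet> x) * (k \<bullet> b) - sin (k \<bullet> x) * (k \<bullet> a)"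
      unfolding divergence_def pd_wave'
      by (simp add: wave_def inner_vec_def sum.distrib sum_distrib_left sum_subtractf mult.assoc)
    then show ?thesis by (simp add: ab)
  qed
  ultimately show ?thesis
    by (simp add: C_inf_div_def wave_smooth wave_periodic[OF k(1)] vec_eq_iff)
qed

lemma L2_inner_wave:
  assumes f: "integrable torus f" shows "L2_inner f (wave k a b) = cosc f k \<bullet> a + sinc' f k \<bullet> b"
proof -
  note w = integrable_wave[OF f, of k]
  have "L2_inner f (wave k a b) = (LINT x|torus. (cos (k \<bullet> x) *\<^sub>R f x) \<bullet> a + (sin (k \<bullet> x) *\<^sub>R f x) \<bullet> b)"
    by (simp add: L2_inner_def wave_def inner_add_right)
  also have "\<dots> = (LINT x|torus. (cos (k \<bullet> x) *\<^sub>R f x) \<bullet> a) + (LINT x|torus. (sin (k \<bullet> x) *\<^sub>R f x) \<bullet> b)"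
    by (intro integral_add integrable_inner_left w)
  finally show ?thesis using w by (simp only: cosc_def sinc'_def integral_inner_left)
qed

lemma L2_wave: "int_vec k \<Longrightarrow> wave k a (b :: 'b::euclidean_space) \<in> L2"
  by (intro L2_smooth wave_smooth wave_periodic)

lemma L2_div_orthogonal:
  assumes f: "f \<in> L2_div" and g: "g \<in> L2" and smooth: "\<And>\<phi>. \<phi> \<in> C_inf_div \<Longrightarrow> L2_inner \<phi> g = 0"
  shows "L2_inner f g = 0"
proof -
  obtain \<Phi> where \<Phi>: "\<And>n. \<Phi> n \<in> C_inf_div" "(\<lambda>n. L2_norm (\<lambda>x. \<Phi> n x - f x)) \<longlonglongrightarrow> 0"
    using f by (auto simp: L2_div_def)
  have "(\<lambda>n. L2_inner (\<Phi> n) g) \<longlonglongrightarrow> L2_inner f g"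
    by (rule L2_inner_tendsto[OF C_inf_divD(5)[OF \<Phi>(1)] L2_divD[OF f] g g \<Phi>(2) L2_norm_const_seq])
  then show ?thesis using smooth[OF \<Phi>(1)] LIMSEQ_unique[OF tendsto_const] by fastforce
qed

text \<open>A wave with amplitudes along k is the gradient of a scalar wave, hence orthogonal to
  smooth solenoidal fields and to their L2 limits.\<close>

lemma div_free_fourier:
  assumes f: "f \<in> L2_div" and k: "int_vec k"
  shows "k \<bullet> cosc f k = 0" "k \<bullet> sinc' f k = 0"
proof -
  have "L2_inner f (wave k (c *\<^sub>R k) (d *\<^sub>R k)) = 0" for c d
  proof (rule L2_div_orthogonal[OF f L2_wave[OF k]])
    fix \<phi> assume \<phi>: "\<phi> \<in> C_inf_div"
    note D = C_inf_divD[OF \<phi>]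
    let ?\<psi> = "wave k (- d) c :: real^3 \<Rightarrow> real"
    note \<psi> = wave_smooth[of k "- d" c] wave_periodic[OF k, of "- d" c]
    have \<psi>i: "pd i ?\<psi> = (\<lambda>x. wave k (c *\<^sub>R k) (d *\<^sub>R k) x $ i)" for i
      by (simp add: pd_wave' fun_eq_iff wave_def mult_ac)
    have i1: "integrable torus (\<lambda>x. \<phi> x $ i * pd i ?\<psi> x)" for i
      by (intro integrable_nth_mult[OF D(5)] L2_smooth smooth_pd periodic_pd \<psi>)
    have i2: "integrable torus (\<lambda>x. pd i \<phi> x $ i * ?\<psi> x)" for i
      by (intro integrable_nth_mult[OF L2_smooth] L2_smooth smooth_pd periodic_pd \<psi> D)
    have "L2_inner \<phi> (wave k (c *\<^sub>R k) (d *\<^sub>R k)) = (\<Sum>i\<in>UNIV. (LINT x|torus. \<phi> x $ i * pd i ?\<psi> x))"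
      using i1 unfolding \<psi>i L2_inner_def inner_vec_def by (simp add: integral_sum)
    also have "\<dots> = (\<Sum>i\<in>UNIV. - (LINT x|torus. pd i \<phi> x $ i * ?\<psi> x))"
    proof (rule sum.cong[OF refl])
      fix i
      show "(LINT x|torus. \<phi> x $ i * pd i ?\<psi> x) = - (LINT x|torus. pd i \<phi> x $ i * ?\<psi> x)"
        using integration_by_parts[OF smooth_vec_nth[OF D(1), of i] periodic_compose[OF D(2)] \<psi>, of i]
        by (simp add: smooth_nth_pd[OF D(1)])
    qed
    also have "\<dots> = - (LINT x|torus. divergence \<phi> x * ?\<psi> x)"
      using i2 by (simp add: divergence_def sum_distrib_right integral_sum sum_negf)
    finally show "L2_inner \<phi> (wave k (c *\<^sub>R k) (d *\<^sub>R k)) = 0" by (simp add: D(3))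
  qed
  from this[of 1 0] this[of 0 1] show "k \<bullet> cosc f k = 0" "k \<bullet> sinc' f k = 0"
    using L2_inner_wave[OF L2_integrable[OF L2_divD[OF f]]] by (simp_all add: inner_commute)
qed

lemma L2_div_mean_zero: assumes f: "f \<in> L2_div" shows "(LINT x|torus. f x) = 0"
proof -
  have "L2_inner f (\<lambda>x. a) = 0" for a
  proof (rule L2_div_orthogonal[OF f])
    show "(\<lambda>x. a) \<in> L2" by (rule L2_continuous) (auto intro: periodic_const)
    fix \<phi> assume "\<phi> \<in> C_inf_div"
    then show "L2_inner \<phi> (\<lambda>x. a) = 0"
      using C_inf_divD(4)[of \<phi>] L2_integrable[OF C_inf_divD(5)[of \<phi>]] by (simp add: L2_inner_def)
  qed
  from this[of "LINT x|torus. f x"] show ?thesis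
    using L2_integrable[OF L2_divD[OF f]] by (simp add: L2_inner_def)
qed

lemma weak_grad_fourier:
  assumes G: "has_weak_grad f G" and k: "int_vec k" and f: "f \<in> L2"
  shows "cosc G k $ i $ j = k $ j * sinc' f k $ i" "sinc' G k $ i $ j = - (k $ j) * cosc f k $ i"
proof -
  note Gi = L2_integrable[OF has_weak_gradD(1)[OF G]] and fi = L2_integrable[OF f]
  have nth2: "integral\<^sup>L torus g $ i $ j = (LINT x|torus. g x $ i $ j)" if "integrable torus g" for g :: "real^3 \<Rightarrow> real^3^3"
    using integral_nth[OF that, of i] integral_nth[of torus "\<lambda>x. g x $ i" j]
      integrable_bounded_linear[OF bounded_linear_vec_nth that, of i] by simp
  have *: "c * (LINT x|torus. cos (k \<bullet> x) * G x $ i $ j) + d * (LINT x|torus. sin (k \<bullet> x) * G x $ i $ j)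
      = k $ j * (c * sinc' f k $ i - d * cosc f k $ i)" for c d
  proof -
    let ?\<psi> = "wave k c d :: real^3 \<Rightarrow> real"
    have g: "integrable torus (\<lambda>x. cos (k \<bullet> x) * G x $ i $ j)" "integrable torus (\<lambda>x. sin (k \<bullet> x) * G x $ i $ j)"
      using integrable_bounded_linear[OF bounded_linear_vec_nth integrable_bounded_linear[OF bounded_linear_vec_nth integrable_wave(1)[OF Gi, of k]], of i j]
        integrable_bounded_linear[OF bounded_linear_vec_nth integrable_bounded_linear[OF bounded_linear_vec_nth integrable_wave(2)[OF Gi, of k]], of i j]
      by simp_all
    have h: "integrable torus (\<lambda>x. cos (k \<bullet> x) * f x $ i)" "integrable torus (\<lambda>x. sin (k \<bullet> x) * f x $ i)"
      using integrable_bounded_linear[OF bounded_linear_vec_nth integrable_wave(1)[OF fi, of k], of i]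
        integrable_bounded_linear[OF bounded_linear_vec_nth integrable_wave(2)[OF fi, of k], of i] by simp_all
    have "(LINT x|torus. f x $ i * pd j ?\<psi> x) = - (LINT x|torus. G x $ i $ j * ?\<psi> x)"
      by (rule has_weak_gradD(2)[OF G wave_smooth wave_periodic[OF k]])
    moreover have "(LINT x|torus. G x $ i $ j * ?\<psi> x) = (LINT x|torus. c * (cos (k \<bullet> x) * G x $ i $ j) + d * (sin (k \<bullet> x) * G x $ i $ j))"
      by (simp add: wave_def algebra_simps)
    moreover have "(LINT x|torus. f x $ i * pd j ?\<psi> x) = (LINT x|torus. (k $ j * d) * (cos (k \<bullet> x) * f x $ i) - (k $ j * c) * (sin (k \<bullet> x) * f x $ i))"
      by (simp add: pd_wave' wave_def algebra_simps)
    ultimately show ?thesis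
      using g h integrable_wave[OF fi, of k] by (simp add: cosc_def sinc'_def integral_nth algebra_simps)
  qed
  from *[of 1 0] *[of 0 1]
  show "cosc G k $ i $ j = k $ j * sinc' f k $ i" "sinc' G k $ i $ j = - (k $ j) * cosc f k $ i"
    using integrable_wave[OF Gi, of k] by (simp_all add: cosc_def[of G] sinc'_def[of G] nth2)
qed

lemma conv_form_grad_cos:
  assumes G: "has_weak_grad f G" and k: "int_vec k" and f: "f \<in> L2"
  shows "conv_form (\<lambda>h. cos (k \<bullet> h)) G G = (k \<bullet> k) * conv_form (\<lambda>h. cos (k \<bullet> h)) f f"
proof -
  have s: "(\<Sum>i\<in>UNIV. \<Sum>j\<in>UNIV. (k $ j * p $ i) * (k $ j * p $ i)) = (k \<bullet> k) * (p \<bullet> p)" for p :: "real^3"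
    unfolding inner_vec_def sum_product by (subst sum.swap) (simp add: mult_ac)
  have "cosc G k \<bullet> cosc G k = (k \<bullet> k) * (sinc' f k \<bullet> sinc' f k)" "sinc' G k \<bullet> sinc' G k = (k \<bullet> k) * (cosc f k \<bullet> cosc f k)"
    using s[of "sinc' f k"] s[of "cosc f k"]
    by (simp_all add: inner_vec_def[where 'a="real^3"] inner_vec_def[of "cosc G k $ _"] inner_vec_def[of "sinc' G k $ _"] weak_grad_fourier[OF assms])
  then show ?thesis
    using L2_integrable[OF has_weak_gradD(1)[OF G]] L2_integrable[OF f] by (simp add: conv_form_cos algebra_simps)
qed

text \<open>The columns of the projection onto the plane orthogonal to \<open>k\<close>.\<close>

definition polarization :: "real^3 \<Rightarrow> 3 \<Rightarrow> real^3" where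
  "polarization k i = axis i 1 - (k $ i / (k \<bullet> k)) *\<^sub>R k"

lemma polarization_orthogonal: "k \<noteq> 0 \<Longrightarrow> k \<bullet> polarization k i = 0"
  by (simp add: polarization_def inner_diff_right inner_axis)

text \<open>For p orthogonal to k the pairing with the i-th column is p_i. The three columns are a
  tight frame of the plane, which avoids choosing an orthonormal basis depending on k.\<close>

lemma sum_polarization:
  assumes "k \<bullet> p = 0" shows "(\<Sum>i\<in>UNIV. (p \<bullet> polarization k i) * (q \<bullet> polarization k i)) = p \<bullet> q"
proof -
  have "p \<bullet> polarization k i = p $ i" for i
    using assms by (simp add: polarization_def inner_diff_right inner_axis inner_commute[of p k])
  then have "(\<Sum>i\<in>UNIV. (p \<bullet> polarization k i) * (q \<bullet> polarization k i)) = q \<bullet> (\<Sum>i\<in>UNIV. p $ i *\<^sub>R polarization k i)"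
    by (simp add: inner_sum_right)
  also have "(\<Sum>i\<in>UNIV. p $ i *\<^sub>R polarization k i) = p - ((k \<bullet> p) / (k \<bullet> k)) *\<^sub>R k"
  proof -
    have "(\<Sum>i\<in>UNIV. p $ i *\<^sub>R axis i (1::real)) = p" by (simp add: vec_eq_iff axis_def if_distrib cong: if_cong)
    moreover have "(\<Sum>i\<in>UNIV. p $ i *\<^sub>R (k $ i / (k \<bullet> k)) *\<^sub>R k) = ((k \<bullet> p) / (k \<bullet> k)) *\<^sub>R k"
      by (simp add: inner_vec_def[of k p] sum_divide_distrib mult.commute flip: scaleR_left.sum)
    ultimately show ?thesis by (simp add: polarization_def scaleR_diff_right sum_subtractf)
  qed
  finally show ?thesis by (simp add: assms inner_commute)
qed

text \<open>The index \<open>True\<close> stands for the cosine and \<open>False\<close> for the sine modes.\<close>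

definition mode :: "real^3 \<Rightarrow> bool \<Rightarrow> 3 \<Rightarrow> real^3 \<Rightarrow> real^3" where
  "mode k c i = wave k (if c then polarization k i else 0) (if c then 0 else polarization k i)"

lemma mode_C_inf_div: "int_vec k \<Longrightarrow> k \<noteq> 0 \<Longrightarrow> mode k c i \<in> C_inf_div"
  unfolding mode_def by (intro wave_C_inf_div) (auto simp: polarization_orthogonal)

text \<open>A solenoidal f has no Fourier component along k, so the projection onto the plane
  orthogonal to k may be dropped for both factors. Thus g may be the advection term, although it is
  not solenoidal: no pressure appears.\<close>

lemma sum_mode:
  assumes f: "f \<in> L2_div" and g: "integrable torus g" and k: "int_vec k"
  shows "(\<Sum>i\<in>UNIV. \<Sum>c\<in>UNIV. L2_inner f (mode k c i) * L2_inner g (mode k c i)) = conv_form (\<lambda>h. cos (k \<bullet> h)) f g"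
proof -
  note fi = L2_integrable[OF L2_divD[OF f]]
  show ?thesis
    using sum_polarization[OF div_free_fourier(1)[OF f k], of "cosc g k"] sum_polarization[OF div_free_fourier(2)[OF f k], of "sinc' g k"]
    by (simp add: UNIV_bool mode_def L2_inner_wave[OF fi] L2_inner_wave[OF g] conv_form_cos[OF fi g] sum.distrib)
qed

text \<open>The Laplacian contributes the factor -|k|^2, which \<open>conv_form_grad_cos\<close>
  absorbs by passing from f to its gradient.\<close>

lemma sum_mode_drift:
  assumes f: "f \<in> L2_div" and G: "has_weak_grad f G" and k: "int_vec k"
  shows "(\<Sum>i\<in>UNIV. \<Sum>c\<in>UNIV. L2_inner f (mode k c i) * drift \<nu> (mode k c i) f)
    = - (\<nu> * conv_form (\<lambda>h. cos (k \<bullet> h)) G G + conv_form (\<lambda>h. cos (k \<bullet> h)) (\<lambda>x. G x *v f x) f)"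
proof -
  note fL = L2_divD[OF f]
  note fi = L2_integrable[OF fL] and gi = integrable_advect(1)[OF has_weak_gradD(1)[OF G] fL]
  have sym: "conv_form (\<lambda>h. cos (k \<bullet> h)) f (\<lambda>x. G x *v f x) = conv_form (\<lambda>h. cos (k \<bullet> h)) (\<lambda>x. G x *v f x) f"
    unfolding conv_form_cos[OF fi gi] conv_form_cos[OF gi fi] by (simp only: inner_commute)
  have drift_eq: "drift \<nu> (mode k c i) f = - \<nu> * (k \<bullet> k) * L2_inner f (mode k c i) - L2_inner (\<lambda>x. G x *v f x) (mode k c i)" for c i
  proof -
    have "L2_inner f (laplacian (mode k c i)) = - (k \<bullet> k) * L2_inner f (mode k c i)"
      by (simp add: mode_def laplacian_wave L2_inner_def)
    moreover have "smooth (mode k c i)" "periodic (mode k c i)" unfolding mode_def by (rule wave_smooth wave_periodic[OF k])+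
    note weak_grad_advect[OF f G this]
    ultimately show ?thesis by (simp add: drift_def L2_inner_def)
  qed
  have "(\<Sum>i\<in>UNIV. \<Sum>c\<in>UNIV. L2_inner f (mode k c i) * drift \<nu> (mode k c i) f)
    = (\<Sum>i\<in>UNIV. \<Sum>c\<in>UNIV. - \<nu> * (k \<bullet> k) * (L2_inner f (mode k c i) * L2_inner f (mode k c i))
        - L2_inner f (mode k c i) * L2_inner (\<lambda>x. G x *v f x) (mode k c i))"
    unfolding drift_eq by (simp add: algebra_simps)
  also have "\<dots> = - \<nu> * (k \<bullet> k) * conv_form (\<lambda>h. cos (k \<bullet> h)) f f - conv_form (\<lambda>h. cos (k \<bullet> h)) f (\<lambda>x. G x *v f x)"
    unfolding sum_mode[OF f fi k, symmetric] sum_mode[OF f gi k, symmetric]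
    by (simp add: sum_subtractf sum_distrib_left)
  finally show ?thesis
    unfolding conv_form_grad_cos[OF G k fL] sym by simp
qed

text \<open>The random variable under the expectation in the balance, dissipation plus transfer. By
  \<open>u_H1\<close> the value 0 off \<open>H1_div\<close> concerns a null event.\<close>

definition flux_form :: "real \<Rightarrow> (real^3 \<Rightarrow> real) \<Rightarrow> (real^3 \<Rightarrow> real^3) \<Rightarrow> real" where
  "flux_form \<nu> K f = (if f \<in> H1_div
    then \<nu> * conv_form K (hgrad f) (hgrad f) + conv_form K (\<lambda>x. hgrad f x *v f x) f else 0)"

definition enstrophy :: "(real^3 \<Rightarrow> real^3) \<Rightarrow> real" where
  "enstrophy f = (if f \<in> H1_div then (L2_norm (hgrad f))^2 else 0)"

lemma H1_divD:
  assumes "f \<in> H1_div"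
  shows "f \<in> L2_div" "f \<in> L2" "has_weak_grad f (hgrad f)" "hgrad f \<in> L2"
    "integrable torus f" "integrable torus (hgrad f)" "integrable torus (\<lambda>x. hgrad f x *v f x)"
proof -
  obtain \<Phi> where A: "H1_approx f (hgrad f) \<Phi>" using hgrad_approx[OF assms] .
  note H = H1_approxD[OF A]
  show "f \<in> L2_div" "f \<in> L2" "has_weak_grad f (hgrad f)" "hgrad f \<in> L2"
    "integrable torus f" "integrable torus (hgrad f)" "integrable torus (\<lambda>x. hgrad f x *v f x)"
    by (rule H H1_approx_weak_grad[OF A] L2_integrable integrable_advect)+
qed

lemma flux_form_add:
  assumes "bounded_kernel K" "bounded_kernel L"
  shows "flux_form \<nu> (\<lambda>x. K x + L x) f = flux_form \<nu> K f + flux_form \<nu> L f"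
  using H1_divD[of f] by (auto simp: flux_form_def conv_form_add[OF assms] algebra_simps)

lemma flux_form_cmult: "flux_form \<nu> (\<lambda>x. a * K x) f = a * flux_form \<nu> K f"
  by (simp add: flux_form_def conv_form_cmult algebra_simps)

lemma flux_form_limit:
  assumes "\<And>n. bounded_kernel (K n)" "\<And>n x. \<bar>K n x\<bar> \<le> C" "\<And>x. (\<lambda>n. K n x) \<longlonglongrightarrow> L x"
  shows "(\<lambda>n. flux_form \<nu> (K n) f) \<longlonglongrightarrow> flux_form \<nu> L f"
proof (cases "f \<in> H1_div")
  case True
  then show ?thesis
    using H1_divD[OF True] by (simp add: flux_form_def) (intro tendsto_intros conv_form_limit[OF assms]; simp)
qed (simp add: flux_form_def)

lemma conv_form_L2_bound:
  assumes K: "bounded_kernel K" "\<And>x. \<bar>K x\<bar> \<le> C" and f: "f \<in> L2"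
  shows "\<bar>conv_form K f f\<bar> \<le> C * tvol * (L2_norm f)^2"
proof -
  note fi = L2_integrable[OF f]
  have C: "0 \<le> C" using K(2)[of 0] by linarith
  have "\<bar>conv_form K f f\<bar> \<le> C * ((LINT x|torus. norm (f x)) * (LINT x|torus. norm (f x)))" by (rule conv_form_bound[OF K fi fi])
  also have "\<dots> \<le> C * ((sqrt tvol * L2_norm f) * (sqrt tvol * L2_norm f))"
    by (intro mult_left_mono[OF _ C] mult_mono L1_le_L2[OF f]) (auto simp: less_imp_le[OF tvol_pos])
  also have "\<dots> = C * tvol * (L2_norm f)^2"
    using tvol_pos by (simp add: power2_eq_square mult_ac)
  finally show ?thesis .
qed

text \<open>The cubic term is at most a multiple of the gradient norm times the square of the L2
  norm, which splits into enstrophy plus fourth power: both have finite expectation. This majorant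
  serves every limit of kernels.\<close>

lemma flux_form_bound:
  assumes K: "bounded_kernel K" "\<And>x. \<bar>K x\<bar> \<le> C" and \<nu>: "0 \<le> \<nu>"
  shows "\<bar>flux_form \<nu> K f\<bar> \<le> C * (\<nu> * tvol + sqrt tvol) * (enstrophy f + L2_norm f ^ 4)"
proof (cases "f \<in> H1_div")
  case True
  note H = H1_divD[OF True]
  let ?g = "L2_norm (hgrad f)" and ?n = "L2_norm f"
  have C: "0 \<le> C" using K(2)[of 0] by linarith
  have "\<bar>conv_form K (\<lambda>x. hgrad f x *v f x) f\<bar> \<le> C * ((LINT x|torus. norm (hgrad f x *v f x)) * (LINT x|torus. norm (f x)))"
    by (rule conv_form_bound[OF K H(7,5)])
  also have "\<dots> \<le> C * ((?g * ?n) * (sqrt tvol * ?n))"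
    by (intro mult_left_mono[OF _ C] mult_mono L1_le_L2[OF H(2)] integrable_advect(2)[OF H(4,2)]) auto
  also have "\<dots> = C * sqrt tvol * (?g * ?n^2)" by (simp add: power2_eq_square mult_ac)
  also have "\<dots> \<le> C * sqrt tvol * (?g^2 + ?n ^ 4)"
  proof (rule mult_left_mono)
    have "?n ^ 4 = (?n^2)^2" by simp
    moreover have "0 \<le> ?g * ?n^2" by simp
    ultimately show "?g * ?n^2 \<le> ?g^2 + ?n ^ 4"
      using zero_le_power2[of "?g - ?n^2"] unfolding power2_diff by linarith
  qed (use C tvol_pos in simp)
  finally have a: "\<bar>conv_form K (\<lambda>x. hgrad f x *v f x) f\<bar> \<le> C * sqrt tvol * (?g^2 + ?n ^ 4)" .
  have "\<nu> * \<bar>conv_form K (hgrad f) (hgrad f)\<bar> \<le> \<nu> * (C * tvol * ?g^2)"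
    by (rule mult_left_mono[OF conv_form_L2_bound[OF K H(4)] \<nu>])
  also have "\<dots> \<le> \<nu> * (C * tvol * (?g^2 + ?n ^ 4))"
    using C tvol_pos \<nu> by (intro mult_left_mono) auto
  finally have "\<bar>\<nu> * conv_form K (hgrad f) (hgrad f)\<bar> \<le> \<nu> * (C * tvol * (?g^2 + ?n ^ 4))"
    using \<nu> by (simp add: abs_mult)
  then have "\<bar>flux_form \<nu> K f\<bar> \<le> \<nu> * (C * tvol * (?g^2 + ?n ^ 4)) + C * sqrt tvol * (?g^2 + ?n ^ 4)"
    using a True unfolding flux_form_def by (simp only: if_True)
  then show ?thesis using True by (simp add: enstrophy_def algebra_simps)
next
  case False
  have "0 \<le> C" using K(2)[of 0] by linarith
  then show ?thesis using False \<nu> tvol_pos by (simp add: flux_form_def enstrophy_def)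
qed

section \<open>The balance for general kernels\<close>

context stationary_nse
begin

lemma enstrophy_measurable: assumes "0 \<le> t" shows "(\<lambda>w. enstrophy (u t w)) \<in> borel_measurable M"
proof -
  have eq: "enstrophy f = (if f \<in> H1_div then L2_norm (hgrad f) else 0)^2" for f by (simp add: enstrophy_def)
  show ?thesis unfolding eq
    by (rule measurable_compose[OF u_measurable[OF assms] borel_measurable_power[OF measurable_L2_norm_hgrad]])
qed

lemma enstrophy_energy:
  assumes t: "0 \<le> t"
  shows "integrable M (\<lambda>w. enstrophy (u t w))" "\<nu> * expectation (\<lambda>w. enstrophy (u t w)) \<le> energy_input \<sigma>"
proof -
  have nn: "ennreal \<nu> * (\<integral>\<^sup>+w. ennreal (enstrophy (u t w)) \<partial>M) \<le> ennreal (energy_input \<sigma>)"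
  proof -
    have "(\<integral>\<^sup>+w. ennreal (enstrophy (u t w)) \<partial>M) \<le> (\<integral>\<^sup>+w. ennreal ((L2_norm (weak_grad (u t w)))^2) \<partial>M)"
    proof (rule nn_integral_mono_AE)
      show "AE w in M. ennreal (enstrophy (u t w)) \<le> ennreal ((L2_norm (weak_grad (u t w)))^2)"
        using u_H1[OF t]
      proof eventually_elim
        fix w assume h: "u t w \<in> H1_div"
        obtain \<Phi> where A: "H1_approx (u t w) (hgrad (u t w)) \<Phi>" using hgrad_approx[OF h] .
        show "ennreal (enstrophy (u t w)) \<le> ennreal ((L2_norm (weak_grad (u t w)))^2)"
          using power_mono[OF H1_grad_minimal[OF A H1_weak_grad[OF h]], of 2] h by (intro ennreal_leI) (simp add: enstrophy_def)
      qed
    qed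
    then have "ennreal \<nu> * (\<integral>\<^sup>+w. ennreal (enstrophy (u t w)) \<partial>M) \<le> ennreal \<nu> * (\<integral>\<^sup>+w. ennreal ((L2_norm (weak_grad (u t w)))^2) \<partial>M)"
      by (rule mult_left_mono) simp
    also have "\<dots> \<le> ennreal (energy_input \<sigma>)" using energy t by (simp add: energy_inequality_def)
    finally show ?thesis .
  qed
  have e0: "0 \<le> enstrophy f" for f by (simp add: enstrophy_def)
  have "(\<integral>\<^sup>+w. ennreal (enstrophy (u t w)) \<partial>M) < \<infinity>"
  proof (rule ccontr)
    assume "\<not> ?thesis"
    then have "(\<integral>\<^sup>+w. ennreal (enstrophy (u t w)) \<partial>M) = \<infinity>" by (simp add: not_less top.extremum_unique)
    then show False using nn \<nu> by (simp add: ennreal_mult_top top.extremum_unique)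
  qed
  then show i: "integrable M (\<lambda>w. enstrophy (u t w))"
    using enstrophy_measurable[OF t] e0 by (intro integrableI_bounded) auto
  have E0: "0 \<le> energy_input \<sigma>" using suminf_nonneg[OF e_props(4)] by (simp add: energy_input_def)
  have "ennreal (\<nu> * expectation (\<lambda>w. enstrophy (u t w))) \<le> ennreal (energy_input \<sigma>)"
    using nn nn_integral_eq_integral[OF i] e0 \<nu> by (simp add: ennreal_mult)
  then show "\<nu> * expectation (\<lambda>w. enstrophy (u t w)) \<le> energy_input \<sigma>" using E0 by (simp add: ennreal_le_iff)
qed

text \<open>Measurability is recorded for every \<mu> because the difference between \<mu> = 1 and
  \<mu> = 0 isolates the gradient form, whose expectation has to be estimated separately in
  \<open>structure_bounds\<close>.\<close>

definition khm :: "real \<Rightarrow> (real^3 \<Rightarrow> real) \<Rightarrow> bool" where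
  "khm t K \<longleftrightarrow> (\<forall>\<mu>. (\<lambda>w. flux_form \<mu> K (u t w)) \<in> borel_measurable M) \<and> integrable M (\<lambda>w. flux_form \<nu> K (u t w)) \<and>
    2 * expectation (\<lambda>w. flux_form \<nu> K (u t w)) = (\<Sum>j. (\<sigma> j)^2 * conv_form K (e j) (e j))"

lemma forcing_conv_bound:
  assumes "bounded_kernel K" "\<And>x. \<bar>K x\<bar> \<le> C"
  shows "\<bar>(\<sigma> j)^2 * conv_form K (e j) (e j)\<bar> \<le> (\<sigma> j)^2 * (C * tvol)"
  using conv_form_L2_bound[OF assms e_props(2), of j] by (simp add: abs_mult e_props(3) mult_left_mono)

lemma summable_forcing_conv:
  assumes "bounded_kernel K" shows "summable (\<lambda>j. (\<sigma> j)^2 * conv_form K (e j) (e j))"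
proof -
  obtain C where C: "\<And>x. \<bar>K x\<bar> \<le> C" using assms by (auto simp: bounded_kernel_def)
  show ?thesis
    by (rule summable_comparison_test'[OF summable_mult2[OF e_props(4), of "C * tvol"]])
      (use forcing_conv_bound[OF assms C] in simp)
qed

text \<open>For k different from 0 it is the sum of \<open>test_function_balance\<close> over the
  modes of k.\<close>

lemma khm_cos:
  assumes k: "int_vec k" and t: "0 \<le> t" shows "khm t (\<lambda>h. cos (k \<bullet> h))"
proof (cases "k = 0")
  case True
  \<comment> \<open>For k = 0 the modes are not admissible test functions, but all forms vanish
    since solenoidal fields have mean zero.\<close>
  have z: "conv_form (\<lambda>h. cos (k \<bullet> h)) f g = 0" if "integrable torus f" "g \<in> L2_div" for f g
    unfolding conv_form_cos[OF that(1) L2_integrable[OF L2_divD[OF that(2)]]]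
    using L2_div_mean_zero[OF that(2)] by (simp add: True cosc_def sinc'_def)
  have "flux_form \<mu> (\<lambda>h. cos (k \<bullet> h)) f = 0" for f \<mu>
  proof (cases "f \<in> H1_div")
    case H: True
    note H = H1_divD[OF H]
    show ?thesis using z[OF H(7,1)] conv_form_grad_cos[OF H(3) k H(2)] by (simp add: flux_form_def True)
  qed (simp add: flux_form_def)
  moreover have "e j \<in> L2_div" for j
    using e_props(1,2)[of j] L2_norm_const_seq[of "e j"] by (auto simp: L2_div_def intro!: exI[of _ "\<lambda>n. e j"])
  ultimately show ?thesis using z[OF L2_integrable[OF e_props(2)]] by (simp add: khm_def)
next
  case False
  interpret C: complete_measure M by (rule complete_M)
  let ?\<phi> = "mode k"
  note \<phi> = mode_C_inf_div[OF k False]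
  note D = C_inf_divD[OF \<phi>]
  define Z where "Z \<mu> w = (\<Sum>i\<in>UNIV. \<Sum>c\<in>UNIV. L2_inner (u t w) (?\<phi> c i) * drift \<mu> (?\<phi> c i) (u t w))" for \<mu> w
  have iz: "integrable M (\<lambda>w. L2_inner (u t w) (?\<phi> c i) * drift \<mu> (?\<phi> c i) (u t w))" for c i \<mu>
  proof -
    have q: "quadratic_growth (\<lambda>f. L2_inner f (?\<phi> c i))" "quadratic_growth (drift \<mu> (?\<phi> c i))"
      by (rule quadratic_growth_inner[OF D(5)] quadratic_growth_drift[OF D(1,2)])+
    note m = measurable_compose[OF u_measurable[OF t] quadratic_growth_measurable]
    show ?thesis
      by (rule cauchy_schwarz_integral(1)[OF m[OF q(1)] m[OF q(2)] quadratic_growth_square_integrable[OF q(1) t] quadratic_growth_square_integrable[OF q(2) t]])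
  qed
  then have Zi: "integrable M (Z \<mu>)" for \<mu> unfolding Z_def[abs_def] by (intro integrable_sum)
  have AE: "AE w in M. - Z \<mu> w = flux_form \<mu> (\<lambda>h. cos (k \<bullet> h)) (u t w)" for \<mu>
    using u_H1[OF t]
  proof eventually_elim
    fix w assume h: "u t w \<in> H1_div"
    show "- Z \<mu> w = flux_form \<mu> (\<lambda>h. cos (k \<bullet> h)) (u t w)"
      unfolding Z_def sum_mode_drift[OF H1_divD(1)[OF h] H1_divD(3)[OF h] k] using h by (simp add: flux_form_def)
  qed
  have Zm: "(\<lambda>w. - Z \<mu> w) \<in> borel_measurable M" for \<mu> using borel_measurable_integrable[OF Zi] by measurable
  have fm: "(\<lambda>w. flux_form \<mu> (\<lambda>h. cos (k \<bullet> h)) (u t w)) \<in> borel_measurable M" for \<mu>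
    by (rule C.borel_measurable_AE_eq[OF Zm AE])
  have i: "integrable M (\<lambda>w. flux_form \<nu> (\<lambda>h. cos (k \<bullet> h)) (u t w))"
    using integrable_cong_AE[OF Zm fm AE] Zi by simp
  have "2 * expectation (\<lambda>w. flux_form \<nu> (\<lambda>h. cos (k \<bullet> h)) (u t w)) = - 2 * expectation (Z \<nu>)"
    using integral_cong_AE[OF Zm fm AE] by simp
  also have "\<dots> = (\<Sum>i\<in>UNIV. \<Sum>c\<in>UNIV. - (2 * expectation (\<lambda>w. L2_inner (u t w) (?\<phi> c i) * drift \<nu> (?\<phi> c i) (u t w))))"
    unfolding Z_def using iz by (simp add: integral_sum sum_distrib_left sum_negf)
  also have "\<dots> = (\<Sum>i\<in>UNIV. \<Sum>c\<in>UNIV. (\<Sum>j. (\<sigma> j * L2_inner (e j) (?\<phi> c i))^2))"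
    using test_function_balance[OF \<phi> t] by (intro sum.cong refl) (simp add: eq_neg_iff_add_eq_0 add.commute minus_equation_iff[symmetric] neg_eq_iff_add_eq_0)
  also have "\<dots> = (\<Sum>j. \<Sum>i\<in>UNIV. \<Sum>c\<in>UNIV. (\<sigma> j * L2_inner (e j) (?\<phi> c i))^2)"
    using summable_forcing_inner[OF D(5)] by (simp add: suminf_sum summable_sum)
  also have "\<dots> = (\<Sum>j. (\<sigma> j)^2 * conv_form (\<lambda>h. cos (k \<bullet> h)) (e j) (e j))"
  proof (rule suminf_cong)
    fix j
    have ej: "e j \<in> L2_div"
      using e_props(1,2)[of j] L2_norm_const_seq[of "e j"] by (auto simp: L2_div_def intro!: exI[of _ "\<lambda>n. e j"])
    show "(\<Sum>i\<in>UNIV. \<Sum>c\<in>UNIV. (\<sigma> j * L2_inner (e j) (?\<phi> c i))^2) = (\<sigma> j)^2 * conv_form (\<lambda>h. cos (k \<bullet> h)) (e j) (e j)"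
      unfolding sum_mode[OF ej L2_integrable[OF e_props(2)] k, symmetric]
      by (simp add: power_mult_distrib sum_distrib_left power2_eq_square mult_ac)
  qed
  finally show ?thesis using i fm by (simp add: khm_def)
qed

lemma khm_cmult: "khm t K \<Longrightarrow> bounded_kernel K \<Longrightarrow> khm t (\<lambda>x. a * K x)"
  using suminf_mult[OF summable_forcing_conv, of K a]
  by (auto simp: khm_def flux_form_cmult conv_form_cmult mult.left_commute[of _ a] intro!: borel_measurable_times)

lemma khm_add:
  assumes "khm t K" "khm t L" "bounded_kernel K" "bounded_kernel L" shows "khm t (\<lambda>x. K x + L x)"
  using assms suminf_add[OF summable_forcing_conv[OF assms(3)] summable_forcing_conv[OF assms(4)]]
  by (auto simp: khm_def flux_form_add conv_form_add L2_integrable[OF e_props(2)] distrib_left intro!: borel_measurable_add)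

lemma khm_cos_poly: "cos_poly p \<Longrightarrow> 0 \<le> t \<Longrightarrow> khm t p"
proof (induct rule: cos_poly.induct)
  case (cos k a)
  have "cos_poly (\<lambda>x. 1 * cos (k \<bullet> x))" by (rule cos_poly.cos[OF cos(1)])
  then have "bounded_kernel (\<lambda>x. cos (k \<bullet> x))" using cos_poly_kernel by fastforce
  then show ?case by (rule khm_cmult[OF khm_cos[OF cos]])
next
  case (add p q)
  then show ?case using cos_poly_kernel by (intro khm_add) auto
qed

text \<open>Dominated convergence with the majorant of \<open>flux_form_bound\<close>, and Tannery's
  theorem for the series of the forcing. Bounded pointwise convergence is enough, so discontinuous
  kernels are reached.\<close>

lemma khm_limit:
  assumes t: "0 \<le> t" and K: "\<And>n. bounded_kernel (K n)" "\<And>n x. \<bar>K n x\<bar> \<le> C" "\<And>x. (\<lambda>n. K n x) \<longlonglongrightarrow> L x"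
    and khm: "\<And>n. khm t (K n)"
  shows "khm t L"
proof -
  let ?w = "\<lambda>w. C * (\<nu> * tvol + sqrt tvol) * (enstrophy (u t w) + L2_norm (u t w) ^ 4)"
  have m: "(\<lambda>w. flux_form \<mu> (K n) (u t w)) \<in> borel_measurable M" for \<mu> n using khm by (auto simp: khm_def)
  note lim = flux_form_limit[OF K]
  have Lm: "(\<lambda>w. flux_form \<mu> L (u t w)) \<in> borel_measurable M" for \<mu> by (rule borel_measurable_LIMSEQ_real[OF lim m])
  have w: "integrable M ?w" using enstrophy_energy(1)[OF t] u_fourth_moment[OF t] by simp
  have b: "AE w in M. norm (flux_form \<nu> (K n) (u t w)) \<le> ?w w" for n
    using flux_form_bound[OF K(1,2)] \<nu> by simp
  have AEl: "AE w in M. (\<lambda>n. flux_form \<nu> (K n) (u t w)) \<longlonglongrightarrow> flux_form \<nu> L (u t w)" using lim by simp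
  have i: "integrable M (\<lambda>w. flux_form \<nu> L (u t w))"
    by (rule integrable_dominated_convergence[OF Lm m w AEl b])
  have l1: "(\<lambda>n. 2 * expectation (\<lambda>w. flux_form \<nu> (K n) (u t w))) \<longlonglongrightarrow> 2 * expectation (\<lambda>w. flux_form \<nu> L (u t w))"
    by (intro tendsto_mult_left integral_dominated_convergence[OF Lm m w AEl b])
  have l2: "(\<lambda>n. \<Sum>j. (\<sigma> j)^2 * conv_form (K n) (e j) (e j)) \<longlonglongrightarrow> (\<Sum>j. (\<sigma> j)^2 * conv_form L (e j) (e j))"
  proof (rule tannerys_theorem[THEN conjunct2, THEN conjunct2])
    show "(\<lambda>n. (\<sigma> j)^2 * conv_form (K n) (e j) (e j)) \<longlonglongrightarrow> (\<sigma> j)^2 * conv_form L (e j) (e j)" for j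
      by (intro tendsto_mult_left conv_form_limit[OF K] L2_integrable e_props)
    show "\<forall>\<^sub>F (j, n) in sequentially \<times>\<^sub>F sequentially. norm ((\<sigma> j)^2 * conv_form (K n) (e j) (e j)) \<le> (\<sigma> j)^2 * (C * tvol)"
      using forcing_conv_bound[OF K(1,2)] by (intro always_eventually) auto
    show "summable (\<lambda>j. (\<sigma> j)^2 * (C * tvol))" by (rule summable_mult2[OF e_props(4)])
  qed simp
  have "2 * expectation (\<lambda>w. flux_form \<nu> L (u t w)) = (\<Sum>j. (\<sigma> j)^2 * conv_form L (e j) (e j))"
    using l1 l2 khm by (intro LIMSEQ_unique[OF l1]) (simp add: khm_def)
  then show ?thesis using i Lm by (simp add: khm_def)
qed

lemma khm_continuous:
  assumes K: "continuous_on UNIV K" "periodic K" "\<And>x. K (- x) = K x" and t: "0 \<le> t" shows "khm t K"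
proof -
  obtain P where P: "\<And>n. cos_poly (P n)" "\<And>n x. \<bar>P n x - K x\<bar> < 1 / real (Suc n)"
    using kernel_approximation[OF K] by metis
  obtain C where C: "\<And>x. norm (K x) \<le> C" using periodic_continuous_bounded[OF K(1,2)] by metis
  show ?thesis
  proof (rule khm_limit[OF t, where K=P and C="C + 1"])
    show "bounded_kernel (P n)" "khm t (P n)" for n using cos_poly_kernel[OF P(1)] khm_cos_poly[OF P(1) t] by auto
    show "\<bar>P n x\<bar> \<le> C + 1" for n x
    proof -
      have "1 / real (Suc n) \<le> 1" by simp
      then show ?thesis using P(2)[of n x] C[of x] unfolding real_norm_def by linarith
    qed
    show "(\<lambda>n. P n x) \<longlonglongrightarrow> K x" for x
    proof -
      have "(\<lambda>n. P n x - K x) \<longlonglongrightarrow> 0"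
        by (rule Lim_null_comparison[OF always_eventually[OF allI] LIMSEQ_inverse_Suc]) (use P(2) less_imp_le in auto)
      then show ?thesis by (rule LIM_zero_cancel)
    qed
  qed
qed

lemma khm_kpar: assumes "0 \<le> t" shows "khm t (kpar l)"
proof (rule khm_continuous[OF _ _ _ assms])
  show "continuous_on UNIV (kpar l)" unfolding kpar_def[abs_def] by (intro continuous_intros continuous_tnorm)
  show "periodic (kpar l)" unfolding kpar_def[abs_def] by (rule periodic_compose[OF periodic_tnorm])
  show "kpar l (- x) = kpar l x" for x by (simp add: kpar_def tnorm_minus)
qed

text \<open>The indicator of the open ball is the pointwise limit of ever steeper continuous ramps;
  at distance l all ramps vanish, matching the strict inequality in \<open>kball\<close>.\<close>

lemma khm_kball: assumes t: "0 \<le> t" shows "khm t (kball l)"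
proof (rule khm_limit[OF t, where K="\<lambda>n x. min 1 (real n * max 0 (l - tnorm x))" and C=1])
  fix n :: nat
  let ?K = "\<lambda>x. min 1 (real n * max 0 (l - tnorm x))"
  have c: "continuous_on UNIV ?K" by (intro continuous_intros continuous_tnorm)
  show b: "\<bar>?K x\<bar> \<le> 1" for x by auto
  show "bounded_kernel ?K" by (rule bounded_kernelI[OF continuous_borel[OF c] b])
  show "khm t ?K"
    by (rule khm_continuous[OF c _ _ t]) (auto simp: tnorm_minus intro: periodic_compose[OF periodic_tnorm])
next
  fix x
  show "(\<lambda>n. min 1 (real n * max 0 (l - tnorm x))) \<longlonglongrightarrow> kball l x"
  proof (cases "tnorm x < l")
    case True
    then obtain N :: nat where N: "1 < real N * (l - tnorm x)" using reals_Archimedean3[of "l - tnorm x"] by auto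
    have "min 1 (real n * max 0 (l - tnorm x)) = 1" if "n \<ge> N" for n
    proof -
      have "real N * (l - tnorm x) \<le> real n * (l - tnorm x)" using that True by (intro mult_right_mono) auto
      then have "1 \<le> real n * (l - tnorm x)" using N by linarith
      then show ?thesis using True by (simp add: min_absorb1)
    qed
    then have "\<forall>\<^sub>F n in sequentially. min 1 (real n * max 0 (l - tnorm x)) = kball l x"
      using True unfolding eventually_sequentially by (auto simp: kball_def)
    then show ?thesis by (rule tendsto_eventually)
  qed (simp add: kball_def)
qed

end

section \<open>Small scales\<close>

definition radial_kernel :: "real \<Rightarrow> (real \<Rightarrow> real) \<Rightarrow> bool" where
  "radial_kernel l k \<longleftrightarrow> k \<in> borel_measurable borel \<and> (\<forall>r\<ge>l. k r = 0) \<and> (\<forall>r. 0 \<le> k r) \<and> (\<exists>C. \<forall>r. k r \<le> C)"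

definition mass :: "real \<Rightarrow> (real \<Rightarrow> real) \<Rightarrow> real" where
  "mass l k = (LINT h|lborel. indicator (ball (0::real^3) l) h * k (norm h))"

lemma radial_kernelD:
  assumes "radial_kernel l k"
  shows "k \<in> borel_measurable borel" "l \<le> r \<Longrightarrow> k r = 0" "0 \<le> k r"
    "bounded_kernel (\<lambda>h. k (tnorm h))" "periodic (\<lambda>h. k (tnorm h))" "k (tnorm (- h)) = k (tnorm h)"
proof -
  show k: "k \<in> borel_measurable borel" and "l \<le> r \<Longrightarrow> k r = 0" and n: "0 \<le> k r" for r
    using assms by (auto simp: radial_kernel_def)
  obtain C where C: "\<And>r. k r \<le> C" using assms by (auto simp: radial_kernel_def)
  show "bounded_kernel (\<lambda>h. k (tnorm h))"
    by (rule bounded_kernelI[where C=C]) (use k n C in \<open>auto simp: abs_of_nonneg\<close>)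
  show "periodic (\<lambda>h. k (tnorm h))" by (rule periodic_compose[OF periodic_tnorm])
  show "k (tnorm (- h)) = k (tnorm h)" by (simp add: tnorm_minus)
qed

lemma integral_radial_kernel:
  assumes k: "radial_kernel l k" and l: "l \<le> pi" shows "(LINT y|torus. k (tnorm y)) = mass l k"
  using torus_radial_convolution[of "\<lambda>_. 1" k l 0, OF _ periodic_const radial_kernelD(1,2)[OF k] l]
  by (simp add: tnorm_minus mass_def)

text \<open>On the support of the kernel e(x + h) differs from e(x) by at most L l, so the form is
  mass times squared norm up to a relative error of order l.\<close>

lemma radial_kernel_mollify:
  fixes e :: "real^3 \<Rightarrow> real^3"
  assumes k: "radial_kernel l k" and l: "0 < l" "l \<le> pi" and e: "smooth e" "periodic e"
    and L: "0 \<le> L" "\<And>x y. norm (e x - e y) \<le> L * norm (x - y)"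
  shows "\<bar>conv_form (\<lambda>h. k (tnorm h)) e e - mass l k * (L2_norm e)^2\<bar> \<le> mass l k * (L * l) * (LINT x|torus. norm (e x))"
proof -
  note R = radial_kernelD[OF k]
  note eL = L2_smooth[OF e] note ei = L2_integrable[OF eL]
  have ec: "continuous_on UNIV e" by (rule smooth_continuous[OF e(1)])
  obtain C where C: "\<And>r. k r \<le> C" using k by (auto simp: radial_kernel_def)
  obtain E where E: "\<And>x. norm (e x) \<le> E" using periodic_continuous_bounded[OF ec e(2)] by metis
  have E0: "0 \<le> E" using E[of 0] norm_ge_zero order_trans by blast
  let ?J = "\<lambda>x. LINT y|torus. k (tnorm (x - y)) * (e x \<bullet> e y)"
  have em [measurable]: "e \<in> borel_measurable borel" by (rule continuous_borel[OF ec])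
  note [measurable] = R(1)
  have bi: "integrable lborel (\<lambda>h. indicator (ball (0::real^3) l) h * g h)"
    if "g \<in> borel_measurable borel" "\<And>h. \<bar>g h\<bar> \<le> B" for g :: "real^3 \<Rightarrow> real" and B
    using that by (rule integrable_ball)
  have k1: "integrable lborel (\<lambda>h. indicator (ball (0::real^3) l) h * k (norm h))"
    by (rule bi[where B=C]) (use R(3) C in \<open>auto simp: abs_of_nonneg\<close>)
  have J: "\<bar>?J x - mass l k * (norm (e x))^2\<bar> \<le> mass l k * (L * l) * norm (e x)" for x
  proof -
    have k2: "integrable lborel (\<lambda>h. indicator (ball (0::real^3) l) h * (k (norm h) * (e x \<bullet> e (x + h))))"
    proof (rule bi[where B="C * (E * E)"])
      fix h
      have "\<bar>e x \<bullet> e (x + h)\<bar> \<le> E * E"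
        using order_trans[OF Cauchy_Schwarz_ineq2 mult_mono[OF E E E0 norm_ge_zero]] .
      then show "\<bar>k (norm h) * (e x \<bullet> e (x + h))\<bar> \<le> C * (E * E)"
        using mult_mono[OF C[of "norm h"] _ order_trans[OF R(3) C]] R(3)[of "norm h"] by (simp add: abs_mult)
    qed measurable
    have "?J x = (LINT h|lborel. indicator (ball 0 l) h * (k (norm h) * (e x \<bullet> e (x + h))))"
      by (rule torus_radial_convolution[of "\<lambda>y. e x \<bullet> e y" k l x, OF _ periodic_compose[OF e(2)] R(1,2) l(2)]) measurable
    then have "?J x - mass l k * (norm (e x))^2
        = (LINT h|lborel. indicator (ball 0 l) h * (k (norm h) * (e x \<bullet> e (x + h))) - indicator (ball 0 l) h * k (norm h) * (norm (e x))^2)"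
      unfolding mass_def using k1 k2 by simp
    also have "\<bar>\<dots>\<bar> \<le> (LINT h|lborel. indicator (ball (0::real^3) l) h * k (norm h) * (L * l * norm (e x)))"
    proof (rule integral_abs_bound_integral)
      show "integrable lborel (\<lambda>h. indicator (ball 0 l) h * (k (norm h) * (e x \<bullet> e (x + h))) - indicator (ball 0 l) h * k (norm h) * (norm (e x))^2)"
        using k1 k2 by simp
      show "integrable lborel (\<lambda>h. indicator (ball (0::real^3) l) h * k (norm h) * (L * l * norm (e x)))" using k1 by simp
      fix h :: "real^3"
      show "\<bar>indicator (ball 0 l) h * (k (norm h) * (e x \<bullet> e (x + h))) - indicator (ball 0 l) h * k (norm h) * (norm (e x))^2\<bar>
          \<le> indicator (ball 0 l) h * k (norm h) * (L * l * norm (e x))"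
      proof (cases "h \<in> ball 0 l")
        case True
        have "\<bar>e x \<bullet> (e (x + h) - e x)\<bar> \<le> norm (e x) * (L * l)"
          using order_trans[OF Cauchy_Schwarz_ineq2 mult_left_mono[OF order_trans[OF L(2) mult_left_mono]]] L(1) True by simp
        then have "k (norm h) * \<bar>e x \<bullet> (e (x + h) - e x)\<bar> \<le> k (norm h) * (L * l * norm (e x))"
          by (intro mult_left_mono R(3)) (simp add: mult.commute)
        moreover have "k (norm h) * (e x \<bullet> e (x + h)) - k (norm h) * (norm (e x))^2 = k (norm h) * (e x \<bullet> (e (x + h) - e x))"
          by (simp add: inner_diff_right power2_norm_eq_inner right_diff_distrib)
        ultimately show ?thesis using True R(3)[of "norm h"] by (simp add: abs_mult)
      qed simp
    qed
    also have "\<dots> = mass l k * (L * l * norm (e x))" unfolding mass_def using k1 by simp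
    finally show ?thesis by (simp add: mult.assoc)
  qed
  have Ji: "integrable torus ?J" using torus2.integrable_fst'[OF conv_form_integrable[OF R(4) ei ei]] by simp
  have n2: "integrable torus (\<lambda>x. (norm (e x))^2)" by (rule L2D(3)[OF eL])
  have eq: "conv_form (\<lambda>h. k (tnorm h)) e e - mass l k * (L2_norm e)^2 = (LINT x|torus. ?J x - mass l k * (norm (e x))^2)"
    unfolding conv_form_def L2_norm_sq using Ji n2 by simp
  have "\<bar>LINT x|torus. ?J x - mass l k * (norm (e x))^2\<bar> \<le> (LINT x|torus. mass l k * (L * l) * norm (e x))"
    by (intro integral_abs_bound_integral integrable_diff Ji integrable_mult_right n2 integrable_norm ei J)
  then show ?thesis unfolding eq integral_mult_right_zero .
qed

context stationary_nse
begin

text \<open>The balance gives E I = (\<nu> E g - Q/2) / a, where g is the gradient form and Q the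
  series of the forcing. Schur's test bounds |\<nu> E g| through the energy inequality, and Q/2
  through |e_j| = 1, by mass times \<epsilon> each; the lower bound uses both, the upper one keeps
  Q.\<close>

lemma structure_bounds:
  assumes t: "0 \<le> t" and k: "radial_kernel l k" and l: "0 < l" "l \<le> pi" and a: "0 < a"
    and khm: "khm t (\<lambda>h. k (tnorm h))"
    and flux: "\<And>v G \<Phi>. H1_approx v G \<Phi> \<Longrightarrow> conv_form (\<lambda>h. k (tnorm h)) (\<lambda>x. G x *v v x) v = - a * I v"
  shows "- (2 * mass l k * energy_input \<sigma>) / a \<le> expectation (\<lambda>w. I (u t w))"
    and "expectation (\<lambda>w. I (u t w))
      \<le> (mass l k * energy_input \<sigma> - (\<Sum>j. (\<sigma> j)^2 * conv_form (\<lambda>h. k (tnorm h)) (e j) (e j)) / 2) / a"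
proof -
  note R = radial_kernelD[OF k]
  interpret C: complete_measure M by (rule complete_M)
  let ?K = "\<lambda>h. k (tnorm h)" and ?m = "mass l k"
  let ?Q = "\<Sum>j. (\<sigma> j)^2 * conv_form ?K (e j) (e j)"
  \<comment> \<open>The transfer term does not depend on the viscosity and cancels; what remains is
    the gradient form, and \<open>khm\<close> makes it measurable.\<close>
  define g where "g w = flux_form 1 ?K (u t w) - flux_form 0 ?K (u t w)" for w
  have schur: "\<bar>conv_form ?K f f\<bar> \<le> ?m * (L2_norm f)^2" if "f \<in> L2" for f :: "real^3 \<Rightarrow> 'b::euclidean_space"
    using conv_form_schur[OF R(4,5) R(6) R(3) that] integral_radial_kernel[OF k l(2)] by simp
  have m0: "0 \<le> ?m" unfolding mass_def by (rule integral_nonneg_AE) (use R(3) in auto)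
  have fm: "(\<lambda>w. flux_form \<mu> ?K (u t w)) \<in> borel_measurable M" for \<mu> using khm by (simp add: khm_def)
  have fi: "integrable M (\<lambda>w. flux_form \<nu> ?K (u t w))" using khm by (simp add: khm_def)
  have gm: "g \<in> borel_measurable M" unfolding g_def[abs_def] using fm by measurable
  have ge: "g w = (if u t w \<in> H1_div then conv_form ?K (hgrad (u t w)) (hgrad (u t w)) else 0)" for w
    by (simp add: g_def flux_form_def)
  have gb: "\<bar>g w\<bar> \<le> ?m * enstrophy (u t w)" for w
    using schur[OF H1_divD(4)] by (simp add: ge enstrophy_def)
  have ei: "integrable M (\<lambda>w. ?m * enstrophy (u t w))" using enstrophy_energy(1)[OF t] by simp
  have gi: "integrable M g"
    by (rule integrable_bound[OF ei gm]) (use gb in \<open>auto intro!: AE_I2 order_trans[OF _ abs_ge_self]\<close>)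
  have "\<bar>expectation g\<bar> \<le> ?m * expectation (\<lambda>w. enstrophy (u t w))"
    using order_trans[OF integral_abs_bound integral_mono[OF integrable_abs[OF gi] ei gb]] by simp
  from mult_left_mono[OF this less_imp_le[OF \<nu>]]
  have "\<nu> * \<bar>expectation g\<bar> \<le> ?m * (\<nu> * expectation (\<lambda>w. enstrophy (u t w)))" by (simp add: mult_ac)
  also have "\<dots> \<le> ?m * energy_input \<sigma>" by (rule mult_left_mono[OF enstrophy_energy(2)[OF t] m0])
  finally have gE: "\<bar>\<nu> * expectation g\<bar> \<le> ?m * energy_input \<sigma>" using \<nu> by (simp add: abs_mult)
  have AE: "AE w in M. (\<nu> * g w - flux_form \<nu> ?K (u t w)) / a = I (u t w)"
    using u_H1[OF t]
  proof eventually_elim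
    fix w assume h: "u t w \<in> H1_div"
    obtain \<Phi> where A: "H1_approx (u t w) (hgrad (u t w)) \<Phi>" using hgrad_approx[OF h] .
    show "(\<nu> * g w - flux_form \<nu> ?K (u t w)) / a = I (u t w)"
      using h a by (simp add: ge flux_form_def flux[OF A])
  qed
  have Im: "(\<lambda>w. (\<nu> * g w - flux_form \<nu> ?K (u t w)) / a) \<in> borel_measurable M" using gm fm by measurable
  have "expectation (\<lambda>w. I (u t w)) = expectation (\<lambda>w. (\<nu> * g w - flux_form \<nu> ?K (u t w)) / a)"
    by (rule integral_cong_AE[OF C.borel_measurable_AE_eq[OF Im AE] Im]) (use AE in \<open>eventually_elim, simp\<close>)
  also have "\<dots> = (\<nu> * expectation g - ?Q / 2) / a"
    using gi fi khm by (simp add: khm_def)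
  finally have eq: "expectation (\<lambda>w. I (u t w)) = (\<nu> * expectation g - ?Q / 2) / a" .
  show "expectation (\<lambda>w. I (u t w)) \<le> (?m * energy_input \<sigma> - ?Q / 2) / a"
    unfolding eq using gE a by (intro divide_right_mono) auto
  have "?Q \<le> (\<Sum>j. (\<sigma> j)^2 * ?m)"
    using schur[OF e_props(2)] e_props(3)
    by (intro suminf_le summable_forcing_conv R(4) summable_mult2 e_props(4) mult_left_mono) (auto simp: abs_le_iff)
  also have "\<dots> = 2 * ?m * energy_input \<sigma>"
    unfolding suminf_mult2[OF e_props(4), symmetric] by (simp add: energy_input_def)
  finally have "?Q / 2 \<le> ?m * energy_input \<sigma>" by simp
  then show "- (2 * ?m * energy_input \<sigma>) / a \<le> expectation (\<lambda>w. I (u t w))"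
    unfolding eq using gE a by (intro divide_right_mono) auto
qed

text \<open>For each j the quotient of form and mass tends to 1, as e_j is smooth with unit norm.
  The rate depends on j through the Lipschitz constant, so the sum is handled by Tannery's theorem,
  with the majorant (\<sigma> j)^2 from Schur's test.\<close>

lemma forcing_average_tendsto:
  assumes k: "\<And>l. 0 < l \<Longrightarrow> radial_kernel l (k l)" and m: "\<And>l. 0 < l \<Longrightarrow> 0 < mass l (k l)"
  shows "((\<lambda>l. (\<Sum>j. (\<sigma> j)^2 * conv_form (\<lambda>h. k l (tnorm h)) (e j) (e j)) / (2 * mass l (k l))) \<longlongrightarrow> energy_input \<sigma>) (at_right 0)"
proof -
  let ?Q = "\<lambda>l j. conv_form (\<lambda>h. k l (tnorm h)) (e j) (e j)"
  have small: "\<forall>\<^sub>F l in at_right (0::real). 0 < l \<and> l < pi"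
    using eventually_at_right_real[OF pi_gt_zero] by simp
  have bnd: "\<bar>(\<sigma> j)^2 * (?Q l j / mass l (k l))\<bar> \<le> (\<sigma> j)^2" if l: "0 < l" "l < pi" for j l
  proof -
    note R = radial_kernelD[OF k[OF l(1)]]
    have "\<bar>?Q l j\<bar> \<le> mass l (k l)"
      using conv_form_schur[OF R(4,5) R(6) R(3) e_props(2), of j] integral_radial_kernel[OF k[OF l(1)]] l by (simp add: e_props(3))
    then have "\<bar>?Q l j / mass l (k l)\<bar> \<le> 1" using m[OF l(1)] by (simp add: abs_divide)
    from mult_left_mono[OF this zero_le_power2[of "\<sigma> j"]] show ?thesis unfolding abs_mult abs_power2 by simp
  qed
  have lim: "((\<lambda>l. (\<sigma> j)^2 * (?Q l j / mass l (k l))) \<longlongrightarrow> (\<sigma> j)^2 * 1) (at_right 0)" for j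
  proof (rule tendsto_mult_left)
    note D = C_inf_divD[OF e_props(1)[of j]]
    obtain L where L: "L > 0" "\<And>x y. norm (e j x - e j y) \<le> L * norm (x - y)" using smooth_Lipschitz[OF D(1,2)] by metis
    let ?c = "LINT x|torus. norm (e j x)"
    have "\<forall>\<^sub>F l in at_right 0. norm (?Q l j / mass l (k l) - 1) \<le> L * l * ?c"
      using small
    proof eventually_elim
      fix l :: real assume l: "0 < l \<and> l < pi"
      then have "\<bar>?Q l j - mass l (k l)\<bar> \<le> mass l (k l) * (L * l * ?c)"
        using radial_kernel_mollify[OF k _ _ D(1,2) _ L(2), of l] L(1) by (simp add: e_props(3) mult.assoc)
      moreover have "?Q l j / mass l (k l) - 1 = (?Q l j - mass l (k l)) / mass l (k l)" using m[of l] l by (simp add: field_simps)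
      ultimately show "norm (?Q l j / mass l (k l) - 1) \<le> L * l * ?c" using m[of l] l by (simp add: abs_divide field_simps)
    qed
    moreover have "((\<lambda>l. L * l * ?c) \<longlongrightarrow> L * 0 * ?c) (at_right 0)" by (intro tendsto_intros)
    then have "((\<lambda>l. L * l * ?c) \<longlongrightarrow> 0) (at_right 0)" by simp
    ultimately have "((\<lambda>l. ?Q l j / mass l (k l) - 1) \<longlongrightarrow> 0) (at_right 0)" by (rule Lim_null_comparison)
    then show "((\<lambda>l. ?Q l j / mass l (k l)) \<longlongrightarrow> 1) (at_right 0)" by (rule LIM_zero_cancel)
  qed
  have "((\<lambda>l. \<Sum>j. (\<sigma> j)^2 * (?Q l j / mass l (k l))) \<longlongrightarrow> (\<Sum>j. (\<sigma> j)^2 * 1)) (at_right 0)"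
  proof (rule tannerys_theorem[THEN conjunct2, THEN conjunct2, OF lim _ e_props(4)])
    have "\<forall>\<^sub>F (j, l) in sequentially \<times>\<^sub>F at_right (0::real). 0 < l \<and> l < pi"
      using small eventually_prod2[OF sequentially_bot] by blast
    then show "\<forall>\<^sub>F (j, l) in sequentially \<times>\<^sub>F at_right 0. norm ((\<sigma> j)^2 * (?Q l j / mass l (k l))) \<le> (\<sigma> j)^2"
      by (rule eventually_mono) (use bnd in \<open>simp only: split_paired_all prod.case real_norm_def\<close>)
  qed simp
  then have "((\<lambda>l. (\<Sum>j. (\<sigma> j)^2 * (?Q l j / mass l (k l))) / 2) \<longlongrightarrow> energy_input \<sigma>) (at_right 0)"
    by (auto simp: energy_input_def intro: tendsto_eq_intros)
  then show ?thesis
  proof (rule Lim_transform_eventually)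
    show "\<forall>\<^sub>F l in at_right 0. (\<Sum>j. (\<sigma> j)^2 * (?Q l j / mass l (k l))) / 2 = (\<Sum>j. (\<sigma> j)^2 * ?Q l j) / (2 * mass l (k l))"
      using small
    proof eventually_elim
      fix l :: real assume "0 < l \<and> l < pi"
      then have "(\<Sum>j. (\<sigma> j)^2 * ?Q l j / mass l (k l)) = (\<Sum>j. (\<sigma> j)^2 * ?Q l j) / mass l (k l)"
        by (intro suminf_divide summable_forcing_conv radial_kernelD(4)[OF k]) simp
      then show "(\<Sum>j. (\<sigma> j)^2 * (?Q l j / mass l (k l))) / 2 = (\<Sum>j. (\<sigma> j)^2 * ?Q l j) / (2 * mass l (k l))" by simp
    qed
  qed
qed

text \<open>One argument for both structure functions; only c depends on the kernel. It is 4/3 =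
  (4/3 pi l^3) / (pi l^2 l) for the ball and 4/5 = (8/15 pi l^5) / (2/3 pi l^4 l) for the
  parabola.\<close>

theorem structure_function_limits:
  fixes S :: "real \<Rightarrow> real" and I :: "real \<Rightarrow> (real^3 \<Rightarrow> real^3) \<Rightarrow> real"
  assumes t: "0 \<le> t" and k: "\<And>l. 0 < l \<Longrightarrow> radial_kernel l (k l)" and m: "\<And>l. 0 < l \<Longrightarrow> 0 < mass l (k l)"
    and khm: "\<And>l. 0 < l \<Longrightarrow> khm t (\<lambda>h. k l (tnorm h))"
    and a: "\<And>l. 0 < l \<Longrightarrow> mass l (k l) / (4 * pi * a l) = c * l" "\<And>l. 0 < l \<Longrightarrow> 0 < a l"
    and flux: "\<And>l v G \<Phi>. 0 < l \<Longrightarrow> l \<le> pi \<Longrightarrow> H1_approx v G \<Phi> \<Longrightarrow>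
      conv_form (\<lambda>h. k l (tnorm h)) (\<lambda>x. G x *v v x) v = - a l * I l v"
    and S: "\<And>l. S l = 1 / (4 * pi) * expectation (\<lambda>w. I l (u t w))"
  shows "ereal (- (2 * c) * energy_input \<sigma>) \<le> Liminf (at_right 0) (\<lambda>l. ereal (S l / l)) \<and>
      Liminf (at_right 0) (\<lambda>l. ereal (S l / l)) \<le> Limsup (at_right 0) (\<lambda>l. ereal (S l / l)) \<and>
      Limsup (at_right 0) (\<lambda>l. ereal (S l / l)) \<le> 0"
proof (intro conjI)
  let ?q = "\<lambda>l. (\<Sum>j. (\<sigma> j)^2 * conv_form (\<lambda>h. k l (tnorm h)) (e j) (e j)) / (2 * mass l (k l))"
  have small: "\<forall>\<^sub>F l in at_right (0::real). 0 < l \<and> l < pi"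
    using eventually_at_right_real[OF pi_gt_zero] by simp
  have b: "- (2 * c) * energy_input \<sigma> \<le> S l / l \<and> S l / l \<le> c * (energy_input \<sigma> - ?q l)" if l: "0 < l" "l < pi" for l
  proof -
    note B = structure_bounds[OF t k[OF l(1)] l(1) less_imp_le[OF l(2)] a(2)[OF l(1)] khm[OF l(1)] flux[OF l(1) less_imp_le[OF l(2)]]]
    have pos: "0 < 4 * pi * l" using l by simp
    have c: "mass l (k l) / a l = 4 * pi * l * c" using a(1)[OF l(1)] a(2)[OF l(1)] by (simp add: field_simps)
    have SE: "S l / l = expectation (\<lambda>w. I l (u t w)) / (4 * pi * l)" by (simp add: S)
    have "- (2 * mass l (k l) * energy_input \<sigma>) / a l = - 2 * energy_input \<sigma> * (mass l (k l) / a l)" by simp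
    also have "\<dots> = (- (2 * c) * energy_input \<sigma>) * (4 * pi * l)" unfolding c by simp
    finally have "- (2 * mass l (k l) * energy_input \<sigma>) / a l = (- (2 * c) * energy_input \<sigma>) * (4 * pi * l)" .
    then have lo: "- (2 * c) * energy_input \<sigma> \<le> S l / l"
      unfolding SE using B(1) pos by (simp only: pos_le_divide_eq)
    have "(mass l (k l) * energy_input \<sigma> - (\<Sum>j. (\<sigma> j)^2 * conv_form (\<lambda>h. k l (tnorm h)) (e j) (e j)) / 2) / a l
        = (mass l (k l) / a l) * (energy_input \<sigma> - ?q l)"
      using m[OF l(1)] a(2)[OF l(1)] by (simp add: field_simps)
    also have "\<dots> = (c * (energy_input \<sigma> - ?q l)) * (4 * pi * l)" unfolding c by simp
    finally have "S l / l \<le> c * (energy_input \<sigma> - ?q l)"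
      unfolding SE using B(2) pos by (simp only: pos_divide_le_eq)
    with lo show ?thesis by blast
  qed
  show "ereal (- (2 * c) * energy_input \<sigma>) \<le> Liminf (at_right 0) (\<lambda>l. ereal (S l / l))"
    by (rule Liminf_bounded, rule eventually_mono[OF small]) (use b in simp)
  show "Liminf (at_right 0) (\<lambda>l. ereal (S l / l)) \<le> Limsup (at_right 0) (\<lambda>l. ereal (S l / l))"
    by (rule Liminf_le_Limsup) simp
  have "((\<lambda>l. ereal (c * (energy_input \<sigma> - ?q l))) \<longlongrightarrow> ereal (c * (energy_input \<sigma> - energy_input \<sigma>))) (at_right 0)"
    by (intro tendsto_ereal tendsto_intros forcing_average_tendsto k m)
  from lim_imp_Limsup[OF _ this] have "Limsup (at_right 0) (\<lambda>l. ereal (c * (energy_input \<sigma> - ?q l))) = 0" by simp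
  moreover have "Limsup (at_right 0) (\<lambda>l. ereal (S l / l)) \<le> Limsup (at_right 0) (\<lambda>l. ereal (c * (energy_input \<sigma> - ?q l)))"
    by (rule Limsup_mono, rule eventually_mono[OF small]) (use b in simp)
  ultimately show "Limsup (at_right 0) (\<lambda>l. ereal (S l / l)) \<le> 0" by simp
qed

end

section \<open>The two kernels and the conclusion\<close>

lemma radial_kernel_ball: "radial_kernel l (\<lambda>r. if r < l then 1 else 0)"
  unfolding radial_kernel_def by (auto intro!: exI[of _ 1])

lemma mass_ball: assumes "0 < l" shows "mass l (\<lambda>r. if r < l then 1 else 0) = 4 / 3 * pi * l ^ 3"
proof -
  have "mass l (\<lambda>r. if r < l then 1 else 0) = (LINT h|lborel. indicator (ball (0::real^3) l) h)"
    unfolding mass_def by (rule integral_cong) (auto simp: indicator_def)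
  then show ?thesis using measure_ball3[of l] assms by simp
qed

lemma radial_kernel_par: assumes "0 < l" shows "radial_kernel l (\<lambda>r. max 0 (l^2 - r^2))"
  unfolding radial_kernel_def
proof (intro conjI allI impI exI[of _ "l^2"])
  show "max 0 (l^2 - r^2) = 0" if "l \<le> r" for r using power_mono[OF that, of 2] assms by simp
qed auto

lemma mass_par: assumes "0 < l" shows "mass l (\<lambda>r. max 0 (l^2 - r^2)) = 8 / 15 * pi * l ^ 5"
proof -
  have "mass l (\<lambda>r. max 0 (l^2 - r^2)) = (LINT h|lborel. indicator (ball (0::real^3) l) h * (l^2 - (norm h)^2))"
    unfolding mass_def
  proof (rule integral_cong[OF refl])
    fix h :: "real^3"
    show "indicator (ball 0 l) h * max 0 (l^2 - (norm h)^2) = indicator (ball 0 l) h * (l^2 - (norm h)^2)"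
      using power_mono[of "norm h" l 2] by (cases "h \<in> ball 0 l") auto
  qed
  then show ?thesis using integral_ball_parabola[OF assms] by simp
qed

text \<open>The statement for \<open>S_par\<close> is made precise with the constant 8/5 = 2 * 4/5.
  The field is taken at an arbitrary time t, which stationarity makes immaterial.\<close>

theorem proposition1p7:
  fixes M :: "'w measure" and F :: "real \<Rightarrow> 'w measure" and \<beta> :: "nat \<Rightarrow> real \<Rightarrow> 'w \<Rightarrow> real"
    and \<nu> :: real and \<sigma> :: "nat \<Rightarrow> real" and e :: "nat \<Rightarrow> real^3 \<Rightarrow> real^3"
    and u :: "real \<Rightarrow> 'w \<Rightarrow> real^3 \<Rightarrow> real^3" and t :: real
  assumes "\<nu> > 0"
    and "stokes_forcing \<sigma> e"
    and "stationary_martingale_solution M F \<beta> \<nu> \<sigma> e u"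
    and "energy_inequality M \<nu> \<sigma> u"
    and "finite_moments M u"
    and "t \<ge> 0"
  shows "ereal (- (8 / 3) * energy_input \<sigma>) \<le> Liminf (at_right 0) (\<lambda>l. ereal (S0 M (u t) l / l)) \<and>
      Liminf (at_right 0) (\<lambda>l. ereal (S0 M (u t) l / l))
        \<le> Limsup (at_right 0) (\<lambda>l. ereal (S0 M (u t) l / l)) \<and>
      Limsup (at_right 0) (\<lambda>l. ereal (S0 M (u t) l / l)) \<le> 0 \<and>
      ereal (- (8 / 5) * energy_input \<sigma>) \<le> Liminf (at_right 0) (\<lambda>l. ereal (S_par M (u t) l / l)) \<and>
      Liminf (at_right 0) (\<lambda>l. ereal (S_par M (u t) l / l))
        \<le> Limsup (at_right 0) (\<lambda>l. ereal (S_par M (u t) l / l)) \<and>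
      Limsup (at_right 0) (\<lambda>l. ereal (S_par M (u t) l / l)) \<le> 0"
proof -
  interpret stationary_nse M F \<beta> \<nu> \<sigma> e u
    using assms by (simp add: stationary_nse_def stationary_nse_axioms_def)
  note t = assms(6)
  have "ereal (- (2 * (4/3)) * energy_input \<sigma>) \<le> Liminf (at_right 0) (\<lambda>l. ereal (S0 M (u t) l / l)) \<and>
      Liminf (at_right 0) (\<lambda>l. ereal (S0 M (u t) l / l)) \<le> Limsup (at_right 0) (\<lambda>l. ereal (S0 M (u t) l / l)) \<and>
      Limsup (at_right 0) (\<lambda>l. ereal (S0 M (u t) l / l)) \<le> 0"
  proof (rule structure_function_limits[OF t, where k="\<lambda>l r. if r < l then 1 else 0" and a="\<lambda>l. l^2 / 4"
        and I=flux_ball])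
    have kb: "(\<lambda>h. if tnorm h < l then 1 else 0) = kball l" for l by (simp add: fun_eq_iff kball_def)
    fix l :: real assume l: "0 < l"
    show "radial_kernel l (\<lambda>r. if r < l then 1 else 0)" by (rule radial_kernel_ball)
    show "0 < mass l (\<lambda>r. if r < l then 1 else 0)" using l by (simp add: mass_ball)
    show "khm t (\<lambda>h. if tnorm h < l then 1 else 0)" unfolding kb by (rule khm_kball[OF t])
    show "mass l (\<lambda>r. if r < l then 1 else 0) / (4 * pi * (l^2 / 4)) = 4 / 3 * l"
      using l by (simp add: mass_ball power2_eq_square power3_eq_cube)
    show "0 < l^2 / 4" using l by simp
    show "conv_form (\<lambda>h. if tnorm h < l then 1 else 0) (\<lambda>x. G x *v v x) v = - (l^2 / 4) * flux_ball l v"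
      if "l \<le> pi" "H1_approx v G \<Phi>" for v G \<Phi>
      unfolding kb by (rule H1_flux_ball[OF that(2) l that(1)])
  qed (simp add: S0_def)
  moreover have "ereal (- (2 * (4/5)) * energy_input \<sigma>) \<le> Liminf (at_right 0) (\<lambda>l. ereal (S_par M (u t) l / l)) \<and>
      Liminf (at_right 0) (\<lambda>l. ereal (S_par M (u t) l / l)) \<le> Limsup (at_right 0) (\<lambda>l. ereal (S_par M (u t) l / l)) \<and>
      Limsup (at_right 0) (\<lambda>l. ereal (S_par M (u t) l / l)) \<le> 0"
  proof (rule structure_function_limits[OF t, where k="\<lambda>l r. max 0 (l^2 - r^2)" and a="\<lambda>l. l ^ 4 / 6"
        and I=flux_par])
    have kp: "(\<lambda>h. max 0 (l^2 - (tnorm h)^2)) = kpar l" for l by (simp add: fun_eq_iff kpar_def)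
    fix l :: real assume l: "0 < l"
    show "radial_kernel l (\<lambda>r. max 0 (l^2 - r^2))" by (rule radial_kernel_par[OF l])
    show "0 < mass l (\<lambda>r. max 0 (l^2 - r^2))" using l by (simp add: mass_par)
    show "khm t (\<lambda>h. max 0 (l^2 - (tnorm h)^2))" unfolding kp by (rule khm_kpar[OF t])
    show "mass l (\<lambda>r. max 0 (l^2 - r^2)) / (4 * pi * (l ^ 4 / 6)) = 4 / 5 * l"
      unfolding mass_par[OF l] using l by (simp add: eval_nat_numeral)
    show "0 < l ^ 4 / 6" using l by simp
    show "conv_form (\<lambda>h. max 0 (l^2 - (tnorm h)^2)) (\<lambda>x. G x *v v x) v = - (l ^ 4 / 6) * flux_par l v"
      if "l \<le> pi" "H1_approx v G \<Phi>" for v G \<Phi>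
      unfolding kp by (rule H1_flux_par[OF that(2) l that(1)])
  qed (simp add: S_par_def)
  ultimately show ?thesis by simp
qed

end
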